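(* Let $c\ge0$ and $\theta\in[0,\infty)^2$, and let $\mathcal{G}^{c,\theta}$ be the operator on $C_l(E)$ with domain $C_l^2(E)$ defined in the context. (i) For every $f\in C_l^2(E)$ we have, pointwise for all $x\in E$, $$\mathcal{G}^{c,\theta}f(x)=\lim_{\varepsilon\downarrow0}\varepsilon^{-1}\Big(\int_E f\,dQ_{x+\varepsilon c(\theta-x)}-f(x)\Big)=\lim_{t\downarrow0}\frac{\mathcal{S}_tf(x)-f(x)}{t}.$$ (ii) The operator $\mathcal{G}^{c,\theta}$ on $C_l(E)$ is closable and its closure generates the contraction semigroup $\mathcal{S}=(\mathcal{S}_t)_{t\ge0}$ of the infinite rate mutually catalytic branching process $X^{c,\theta}$.
   Context: Let $E:=[0,\infty)^2\setminus(0,\infty)^2$. For $x\in[0,\infty)^2$, let $B$ be a standard planar Brownian motion started at $x$, $\tau=\inf\{t>0: B_t\notin(0,\infty)^2\}$, and let $Q_x$ be the law of $B_\tau$ (a probability measure on $E$; $Q_x=\delta_x$ if $x\in E$). $C_l(E)$ is the space of continuous $f:E\to\mathbb{C}$ such that $\lim_{u\to\infty}f(u,0)=\lim_{v\to\infty}f(0,v)$ exists and is finite, with the supremum norm. The semigroup of the process $X^{c,\theta}$ (the $E$-valued càdlàg Markov process with transition kernels $p_t(x,\cdot)=Q_{e^{-ct}x+(1-e^{-ct})\theta}$) is $\mathcal{S}_tf(x)=\int_E f(y)\,Q_{e^{-ct}x+(1-e^{-ct})\theta}(dy)$. Write $\partial_1f(u,v)=\frac{\partial}{\partial u}f(u,v)$,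 $\partial_2f(u,v)=\frac{\partial}{\partial v}f(u,v)$. $C_l^2(E)$ is the subspace of all $f\in C_l(E)$ such that: (1) $\partial_1f$ exists and is continuous on $(0,\infty)\times\{0\}$ and extends continuously to $[0,\infty)\times\{0\}$, $\partial_2f$ exists and is continuous on $\{0\}\times(0,\infty)$ and extends continuously to $\{0\}\times[0,\infty)$, and $\lim_{u\to\infty}u\,\partial_1f(u,0)=\lim_{v\to\infty}v\,\partial_2f(0,v)=0$; (2) the second derivatives $\partial_1^2f$ and $\partial_2^2f$ exist on $(0,\infty)\times\{0\}$ and $\{0\}\times(0,\infty)$, respectively, and $\sup_{r\in(0,\infty)}r\big(|\partial_1^2f(r,0)|+|\partial_2^2f(0,r)|\big)<\infty$. Let $\nu$ be the $\sigma$-finite measure on $E$ with one-dimensional Lebesgue density $$\nu(d(u,v))=\begin{cases}\frac4\pi\frac{u}{(1-u)^2(1+u)^2}\,du,&v=0,\\ \frac4\pi\frac{v}{(1+v^2)^2}\,dv,&u=0.\end{cases}$$ For $f\in C_l^2(E)$ and $x\in E$ define $$\mathcal{G}_2f(x)=\begin{cases}\partial_2f(x),&x_1=0,\\ \frac1{x_1}\int_E\big[f(x_1y)-f(x)-x_1(y_1-1)\,\partial_1f(x)\big]\,\nu(dy),&x_1>0,\end{cases}$$ and $\mathcal{G}_1f=(\mathcal{G}_2f^\dagger)^\dagger$, where $f^\dagger((x_1,x_2)):=f((x_2,x_1))$. Finally, with domain $C_l^2(E)$, $$\mathcal{G}^{c,\theta}f(x)=\sum_{i=1}^2c(\theta_i-x_i)\,\mathcal{G}_if(x).$$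 *)

theory Defs
  imports "HOL-Probability.Probability"
begin

section \<open>Harmonic measure of the quadrant\<close>

definition quadrant :: "(real \<times> real) set"
  where "quadrant = {0..} \<times> {0..}"

definition open_quadrant :: "(real \<times> real) set"
  where "open_quadrant = {0<..} \<times> {0<..}"

definition E :: "(real \<times> real) set"
  where "E = quadrant - open_quadrant"

definition planar_brownian_motion ::
    "'w measure \<Rightarrow> real \<times> real \<Rightarrow> (real \<Rightarrow> 'w \<Rightarrow> real \<times> real) \<Rightarrow> bool"
  where "planar_brownian_motion M x B \<longleftrightarrow>
    prob_space M \<and>
    (\<forall>t\<ge>0. B t \<in> borel_measurable M) \<and>
    (AE \<omega> in M. B 0 \<omega> = x) \<and>
    (\<forall>\<omega>\<in>space M. continuous_on {0..} (\<lambda>t. B t \<omega>)) \<and>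
    (\<forall>s t. 0 \<le> s \<and> s < t \<longrightarrow>
      distributed M lborel (\<lambda>\<omega>. B t \<omega> - B s \<omega>)
        (\<lambda>(a, b). ennreal (normal_density 0 (sqrt (t - s)) a * normal_density 0 (sqrt (t - s)) b))) \<and>
    (\<forall>(n::nat) (s::nat \<Rightarrow> real). 0 \<le> s 0 \<and> (\<forall>i<n. s i < s (Suc i)) \<longrightarrow>
      prob_space.indep_vars M (\<lambda>_. borel) (\<lambda>i \<omega>. B (s (Suc i)) \<omega> - B (s i) \<omega>) {..<n})"

definition exit_time :: "(real \<Rightarrow> real \<times> real) \<Rightarrow> real"
  where "exit_time w = Inf {t. 0 < t \<and> w t \<notin> open_quadrant}"

text \<open>A path that never leaves the open quadrant (a null event) has no exit time;
  it is sent to the origin, which keeps the exit point measurable.\<close>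

definition exit_point :: "(real \<Rightarrow> real \<times> real) \<Rightarrow> real \<times> real"
  where "exit_point w =
    (if \<exists>t>0. w t \<notin> open_quadrant then w (exit_time w) else (0, 0))"

definition exit_law :: "'w measure \<Rightarrow> (real \<Rightarrow> 'w \<Rightarrow> real \<times> real) \<Rightarrow> (real \<times> real) measure"
  where "exit_law M B = distr M borel (\<lambda>\<omega>. exit_point (\<lambda>t. B t \<omega>))"


section \<open>Function spaces\<close>

text \<open>Functions on \<open>E\<close> are represented by the total functions that are \<open>undefined\<close> off \<open>E\<close>,
  so that equality of functions is equality on \<open>E\<close>.\<close>

definition Cl :: "(real \<times> real \<Rightarrow> complex) set"
  where "Cl = {f \<in> extensional E. continuous_on E f \<and>
    (\<exists>L. ((\<lambda>u. f (u, 0)) \<longlongrightarrow> L) at_top \<and> ((\<lambda>v. f (0, v)) \<longlongrightarrow> L) at_top)}"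

definition sup_norm :: "(real \<times> real \<Rightarrow> complex) \<Rightarrow> real"
  where "sup_norm f = (SUP x\<in>E. norm (f x))"

text \<open>Derivative along a half-axis; at \<open>0\<close> it is the continuous extension.\<close>

definition axis_deriv :: "(real \<Rightarrow> complex) \<Rightarrow> real \<Rightarrow> complex"
  where "axis_deriv g r =
    (if 0 < r then vector_derivative g (at r)
     else Lim (at_right 0) (\<lambda>s. vector_derivative g (at s)))"

text \<open>The partial derivative \<open>pd1 f\<close> is meaningful on the first axis only,
  \<open>pd2 f\<close> on the second axis only.\<close>

definition pd1 :: "(real \<times> real \<Rightarrow> complex) \<Rightarrow> real \<times> real \<Rightarrow> complex"
  where "pd1 f x = axis_deriv (\<lambda>u. f (u, 0)) (fst x)"

definition pd2 :: "(real \<times> real \<Rightarrow> complex) \<Rightarrow> real \<times> real \<Rightarrow> complex"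
  where "pd2 f x = axis_deriv (\<lambda>v. f (0, v)) (snd x)"

definition Cl2 :: "(real \<times> real \<Rightarrow> complex) set"
  where "Cl2 = {f \<in> Cl.
    (\<forall>u>0. (\<lambda>u. f (u, 0)) differentiable (at u)) \<and>
    continuous_on {0<..} (\<lambda>u. pd1 f (u, 0)) \<and>
    (\<exists>L. ((\<lambda>u. pd1 f (u, 0)) \<longlongrightarrow> L) (at_right 0)) \<and>
    (\<forall>v>0. (\<lambda>v. f (0, v)) differentiable (at v)) \<and>
    continuous_on {0<..} (\<lambda>v. pd2 f (0, v)) \<and>
    (\<exists>L. ((\<lambda>v. pd2 f (0, v)) \<longlongrightarrow> L) (at_right 0)) \<and>
    ((\<lambda>u. u *\<^sub>R pd1 f (u, 0)) \<longlongrightarrow> 0) at_top \<and>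
    ((\<lambda>v. v *\<^sub>R pd2 f (0, v)) \<longlongrightarrow> 0) at_top \<and>
    (\<forall>u>0. (\<lambda>u. pd1 f (u, 0)) differentiable (at u)) \<and>
    (\<forall>v>0. (\<lambda>v. pd2 f (0, v)) differentiable (at v)) \<and>
    bdd_above ((\<lambda>r. r * (norm (vector_derivative (\<lambda>u. pd1 f (u, 0)) (at r)) +
                         norm (vector_derivative (\<lambda>v. pd2 f (0, v)) (at r)))) ` {0<..})}"


section \<open>The operator and the semigroup\<close>

definition nu_density1 :: "real \<Rightarrow> real"
  where "nu_density1 u = 4 / pi * (u / ((1 - u)\<^sup>2 * (1 + u)\<^sup>2))"

definition nu_density2 :: "real \<Rightarrow> real"
  where "nu_density2 v = 4 / pi * (v / (1 + v\<^sup>2)\<^sup>2)"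

definition nu :: "(real \<times> real) measure"
  where "nu = measure_of UNIV (sets borel) (\<lambda>A.
    (\<integral>\<^sup>+u\<in>{0<..}. ennreal (nu_density1 u) * indicator A (u, 0) \<partial>lborel) +
    (\<integral>\<^sup>+v\<in>{0<..}. ennreal (nu_density2 v) * indicator A (0, v) \<partial>lborel))"

lemma sets_nu [simp]: "sets nu = sets borel"
  unfolding nu_def by (simp add: sets.sigma_sets_eq[of borel, simplified])

text \<open>The set function above is countably additive, so it is the measure \<open>nu\<close>.\<close>

lemma emeasure_nu:
  assumes "A \<in> sets borel"
  shows "emeasure nu A =
    (\<integral>\<^sup>+u\<in>{0<..}. ennreal (nu_density1 u) * indicator A (u, 0) \<partial>lborel) +
    (\<integral>\<^sup>+v\<in>{0<..}. ennreal (nu_density2 v) * indicator A (0, v) \<partial>lborel)"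
proof -
  define m1 where "m1 = distr (density lborel (\<lambda>u. ennreal (nu_density1 u) * indicator {0<..} u))
    (borel :: (real \<times> real) measure) (\<lambda>u. (u, 0))"
  define m2 where "m2 = distr (density lborel (\<lambda>v. ennreal (nu_density2 v) * indicator {0<..} v))
    (borel :: (real \<times> real) measure) (\<lambda>v. (0, v))"
  have [measurable]: "nu_density1 \<in> borel_measurable borel" "nu_density2 \<in> borel_measurable borel"
    unfolding nu_density1_def[abs_def] nu_density2_def[abs_def] by measurable
  have [measurable]: "(\<lambda>u. (u, 0)) \<in> borel \<rightarrow>\<^sub>M (borel :: (real \<times> real) measure)"
    "(\<lambda>v. (0, v)) \<in> borel \<rightarrow>\<^sub>M (borel :: (real \<times> real) measure)"
    by (intro borel_measurable_continuous_onI continuous_intros)+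
  have m1: "emeasure m1 B =
      (\<integral>\<^sup>+u\<in>{0<..}. ennreal (nu_density1 u) * indicator B (u, 0) \<partial>lborel)"
    if [measurable]: "B \<in> sets borel" for B
  proof -
    have [measurable]: "(\<lambda>u::real. (u, 0::real)) -` B \<in> sets borel"
      using measurable_sets[of "\<lambda>u. (u, 0)" borel borel B] by simp
    show ?thesis
      unfolding m1_def
      by (auto simp: emeasure_distr emeasure_density space_borel indicator_def
          intro!: nn_integral_cong)
  qed
  have m2: "emeasure m2 B =
      (\<integral>\<^sup>+v\<in>{0<..}. ennreal (nu_density2 v) * indicator B (0, v) \<partial>lborel)"
    if [measurable]: "B \<in> sets borel" for B
  proof -
    have [measurable]: "(\<lambda>v::real. (0::real, v)) -` B \<in> sets borel"
      using measurable_sets[of "\<lambda>v. (0, v)" borel borel B] by simp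
    show ?thesis
      unfolding m2_def
      by (auto simp: emeasure_distr emeasure_density space_borel indicator_def
          intro!: nn_integral_cong)
  qed
  have s: "sets m1 = sets borel" "sets m2 = sets borel" by (simp_all add: m1_def m2_def)
  have ca: "countably_additive (sets borel) (\<lambda>A. emeasure m1 A + emeasure m2 A)"
  proof (rule countably_additiveI)
    fix F :: "nat \<Rightarrow> (real \<times> real) set"
    assume F: "range F \<subseteq> sets borel" "disjoint_family F"
    show "(\<Sum>i. emeasure m1 (F i) + emeasure m2 (F i)) =
        emeasure m1 (\<Union>i. F i) + emeasure m2 (\<Union>i. F i)"
      using F s by (simp add: suminf_add[symmetric] suminf_emeasure)
  qed
  have nu: "nu = measure_of UNIV (sets borel) (\<lambda>A. emeasure m1 A + emeasure m2 A)"
    unfolding nu_def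
    by (rule measure_of_eq) (auto simp: m1 m2 sets.sigma_sets_eq[of borel, simplified])
  have "emeasure nu A = emeasure m1 A + emeasure m2 A"
    by (rule emeasure_measure_of[OF nu]) (use assms ca in \<open>auto simp: positive_def\<close>)
  then show ?thesis using assms by (simp add: m1 m2)
qed

definition dagger :: "(real \<times> real \<Rightarrow> complex) \<Rightarrow> real \<times> real \<Rightarrow> complex"
  where "dagger f = (\<lambda>(x1, x2). f (x2, x1))"

definition G2 :: "(real \<times> real \<Rightarrow> complex) \<Rightarrow> real \<times> real \<Rightarrow> complex"
  where "G2 f x =
    (if fst x = 0 then pd2 f x
     else (1 / fst x) *\<^sub>R
       (LINT y:E|nu. f (fst x *\<^sub>R y) - f x - (fst x * (fst y - 1)) *\<^sub>R pd1 f x))"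

definition G1 :: "(real \<times> real \<Rightarrow> complex) \<Rightarrow> real \<times> real \<Rightarrow> complex"
  where "G1 f = dagger (G2 (dagger f))"

definition G :: "real \<Rightarrow> real \<times> real \<Rightarrow> (real \<times> real \<Rightarrow> complex) \<Rightarrow> real \<times> real \<Rightarrow> complex"
  where "G c \<theta> f = (\<lambda>x\<in>E.
    (c * (fst \<theta> - fst x)) *\<^sub>R G1 f x + (c * (snd \<theta> - snd x)) *\<^sub>R G2 f x)"

text \<open>The operator with domain \<open>Cl2\<close>, as a graph.\<close>

definition G_graph ::
    "real \<Rightarrow> real \<times> real \<Rightarrow> ((real \<times> real \<Rightarrow> complex) \<times> (real \<times> real \<Rightarrow> complex)) set"
  where "G_graph c \<theta> = (\<lambda>f. (f, G c \<theta> f)) ` Cl2"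

text \<open>In the following, \<open>Q x\<close> is the law of the exit point for the starting point \<open>x\<close>.\<close>

definition trans_kernel ::
    "(real \<times> real \<Rightarrow> (real \<times> real) measure) \<Rightarrow> real \<Rightarrow> real \<times> real \<Rightarrow>
      real \<Rightarrow> real \<times> real \<Rightarrow> (real \<times> real) measure"
  where "trans_kernel Q c \<theta> t x = Q (exp (- c * t) *\<^sub>R x + (1 - exp (- c * t)) *\<^sub>R \<theta>)"

definition S ::
    "(real \<times> real \<Rightarrow> (real \<times> real) measure) \<Rightarrow> real \<Rightarrow> real \<times> real \<Rightarrow>
      real \<Rightarrow> (real \<times> real \<Rightarrow> complex) \<Rightarrow> real \<times> real \<Rightarrow> complex"
  where "S Q c \<theta> t f = (\<lambda>x\<in>E. LINT y:E|trans_kernel Q c \<theta> t x. f y)"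


section \<open>Operators and semigroups on \<open>Cl\<close>\<close>

text \<open>Convergence in supremum norm is \<open>uniform_limit E\<close>.\<close>

definition graph_closure ::
    "((real \<times> real \<Rightarrow> complex) \<times> (real \<times> real \<Rightarrow> complex)) set \<Rightarrow>
     ((real \<times> real \<Rightarrow> complex) \<times> (real \<times> real \<Rightarrow> complex)) set"
  where "graph_closure T = {(f, g). f \<in> Cl \<and> g \<in> Cl \<and>
    (\<exists>F H. (\<forall>n::nat. (F n, H n) \<in> T) \<and>
      uniform_limit E F f sequentially \<and> uniform_limit E H g sequentially)}"

definition closable ::
    "((real \<times> real \<Rightarrow> complex) \<times> (real \<times> real \<Rightarrow> complex)) set \<Rightarrow> bool"
  where "closable T \<longleftrightarrow> single_valued (graph_closure T)"

definition contraction_semigroup ::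
    "(real \<Rightarrow> (real \<times> real \<Rightarrow> complex) \<Rightarrow> real \<times> real \<Rightarrow> complex) \<Rightarrow> bool"
  where "contraction_semigroup T \<longleftrightarrow>
    (\<forall>t\<ge>0. \<forall>f\<in>Cl. T t f \<in> Cl \<and> sup_norm (T t f) \<le> sup_norm f) \<and>
    (\<forall>t\<ge>0. \<forall>f\<in>Cl. \<forall>g\<in>Cl. \<forall>a b.
      T t (\<lambda>x\<in>E. a * f x + b * g x) = (\<lambda>x\<in>E. a * T t f x + b * T t g x)) \<and>
    (\<forall>f\<in>Cl. T 0 f = f) \<and>
    (\<forall>s\<ge>0. \<forall>t\<ge>0. \<forall>f\<in>Cl. T (s + t) f = T s (T t f)) \<and>
    (\<forall>f\<in>Cl. uniform_limit E (\<lambda>t. T t f) f (at_right 0))"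

definition generator ::
    "(real \<Rightarrow> (real \<times> real \<Rightarrow> complex) \<Rightarrow> real \<times> real \<Rightarrow> complex) \<Rightarrow>
     ((real \<times> real \<Rightarrow> complex) \<times> (real \<times> real \<Rightarrow> complex)) set"
  where "generator T = {(f, g). f \<in> Cl \<and> g \<in> Cl \<and>
    uniform_limit E (\<lambda>t x. (1 / t) *\<^sub>R (T t f x - f x)) g (at_right 0)}"

end

theory Submission
  imports Defs "HOL-Complex_Analysis.Complex_Analysis"
begin

text \<open>For \<open>z\<close> in the fourth quadrant, \<open>x \<mapsto> exp (- z (x\<^sub>1 + \<i> x\<^sub>2))\<close> is bounded and harmonic on the quadrant, so
  optional stopping gives its integral against every exit law. Linear combinations of these
  functions and their conjugates are dense in \<open>Cl\<close>, so exit laws act on \<open>Cl\<close> as harmonic extension, which the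
  Poisson kernel makes explicit; differentiating the Poisson integral at the boundary yields \<open>G\<close>.

  On the same exponentials the semigroup is composition with the deterministic flow towards \<open>\<theta>\<close>. Hence
  their span is invariant, lies in the domain of the generator, and \<open>u - G u\<close> for \<open>u\<close> in the span is dense
  in \<open>Cl\<close>. The maximum principle for pointwise derivatives of the semigroup then identifies every \<open>f\<close> in \<open>Cl2\<close>,
  and every \<open>f\<close> in the domain of the generator, as a limit of elements of the span.\<close>

section \<open>The exit law of planar Brownian motion\<close>

text \<open>The span of the exponentials and their conjugates is not an algebra: the product of a
  holomorphic and an antiholomorphic exponential is not harmonic, so Stone-Weierstrass does not
  apply to it directly. The holomorphic exponentials alone do form an algebra, and on
  \<open>E\<close> the square of \<open>cx x\<close> is real. Hence the uniform closure of that
  algebra contains a unimodular function, on which conjugation is inversion; mixed products of its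
  powers collapse to pure powers, and these lie in the closure of the span. In the optional
  stopping, the exponential is bounded only inside the quadrant, while a discretised exit
  overshoots. Truncation, with a second-moment error that does not depend on the mesh, allows the
  passage to the limit. At the boundary the rescaled Poisson kernel tends to a density with a
  non-integrable singularity of order two. Subtracting the first-order Taylor polynomial compensates
  it, and costs nothing because the mass and the first moment of the kernel are known exactly; for
  this the Poisson formula is proved for entire functions of linear growth.\<close>

lemma normal_density_exp_shift:
  assumes "0 < s"
  shows "normal_density 0 s x * exp (p * x) = exp (p\<^sup>2 * s\<^sup>2 / 2) * normal_density (p * s\<^sup>2) s x"
proof -
  have "-(x\<^sup>2) / (2 * s\<^sup>2) + p * x = p\<^sup>2 * s\<^sup>2 / 2 + -((x - p * s\<^sup>2)\<^sup>2) / (2 * s\<^sup>2)"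
    using assms by (simp add: field_simps power2_eq_square)
  then have "exp (-(x\<^sup>2) / (2 * s\<^sup>2)) * exp (p * x) = exp (p\<^sup>2 * s\<^sup>2 / 2) * exp (-((x - p * s\<^sup>2)\<^sup>2) / (2 * s\<^sup>2))"
    by (metis exp_add)
  then show ?thesis
    by (simp add: normal_density_def)
qed

text \<open>The real part of \<open>a\<close> tilts the Gaussian into one with shifted mean; the
  imaginary part then leaves a characteristic function, which is known.\<close>

lemma normal_density_exp:
  fixes a :: complex
  assumes s: "0 < s"
  shows "integrable lborel (\<lambda>x. normal_density 0 s x *\<^sub>R exp (a * of_real x))" (is ?int)
    and "(LINT x|lborel. normal_density 0 s x *\<^sub>R exp (a * of_real x)) = exp (a\<^sup>2 * of_real (s\<^sup>2) / 2)" (is ?eq)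
proof -
  define p q where "p = Re a" and "q = Im a"
  have a: "a = Complex p q" by (simp add: p_def q_def)
  define \<mu> where "\<mu> = p * s\<^sup>2"
  have split: "normal_density 0 s x *\<^sub>R exp (a * of_real x)
      = of_real (exp (p\<^sup>2 * s\<^sup>2 / 2)) * (normal_density \<mu> s x *\<^sub>R iexp (q * x))" for x
  proof -
    have "exp (a * of_real x) = of_real (exp (p * x)) * iexp (q * x)"
      by (simp add: a Complex_eq exp_of_real[symmetric] exp_add[symmetric] algebra_simps)
    then show ?thesis
      using normal_density_exp_shift[OF s, of x p]
      by (simp add: scaleR_conv_of_real \<mu>_def flip: of_real_mult mult.assoc)
  qed
  have int: "integrable lborel (\<lambda>x. normal_density \<mu> s x *\<^sub>R iexp (q * x))"
    by (rule Bochner_Integration.integrable_bound[OF integrable_normal_density[OF s, of \<mu>]])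
      (auto simp: norm_mult)
  show ?int unfolding split by (rule integrable_mult_right, rule int)
  have "(LINT x|lborel. normal_density \<mu> s x *\<^sub>R iexp (q * x))
      = s *\<^sub>R (LINT x|lborel. normal_density \<mu> s (\<mu> + s * x) *\<^sub>R iexp (q * (\<mu> + s * x)))"
    using lborel_integral_real_affine[of s "\<lambda>x. normal_density \<mu> s x *\<^sub>R iexp (q * x)" \<mu>] s by simp
  also have "\<dots> = (LINT x|lborel. s *\<^sub>R (normal_density \<mu> s (\<mu> + s * x) *\<^sub>R iexp (q * (\<mu> + s * x))))"
    by (simp only: integral_scaleR_right)
  also have "\<dots> = (LINT x|lborel. iexp (q * \<mu>) * (std_normal_density x *\<^sub>R iexp (q * s * x)))"
  proof (intro Bochner_Integration.integral_cong refl)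
    fix x
    have "s * normal_density \<mu> s (\<mu> + s * x) = std_normal_density x"
      using s by (simp add: normal_density_def real_sqrt_mult power_mult_distrib field_simps)
    moreover have "iexp (q * (\<mu> + s * x)) = iexp (q * \<mu>) * iexp (q * s * x)"
      by (simp add: exp_add[symmetric] algebra_simps)
    ultimately show "s *\<^sub>R (normal_density \<mu> s (\<mu> + s * x) *\<^sub>R iexp (q * (\<mu> + s * x)))
        = iexp (q * \<mu>) * (std_normal_density x *\<^sub>R iexp (q * s * x))"
      by simp
  qed
  also have "\<dots> = iexp (q * \<mu>) * (LINT x|lborel. (std_normal_density x *\<^sub>R iexp (q * s * x)))"
    by (simp only: integral_mult_right_zero)
  also have "(LINT x|lborel. (std_normal_density x *\<^sub>R iexp (q * s * x))) = char std_normal_distribution (q * s)"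
    unfolding char_def by (subst integral_density) auto
  also have "\<dots> = of_real (exp (- (q * s)\<^sup>2 / 2))"
    by (simp add: char_std_normal_distribution)
  finally have "(LINT x|lborel. normal_density \<mu> s x *\<^sub>R iexp (q * x))
      = iexp (q * \<mu>) * of_real (exp (- (q * s)\<^sup>2 / 2))" .
  then have "(LINT x|lborel. normal_density 0 s x *\<^sub>R exp (a * of_real x))
      = of_real (exp (p\<^sup>2 * s\<^sup>2 / 2)) * (iexp (q * \<mu>) * of_real (exp (- (q * s)\<^sup>2 / 2)))"
    unfolding split by (simp only: integral_mult_right_zero)
  also have "\<dots> = exp (of_real (p\<^sup>2 * s\<^sup>2 / 2) + (\<i> * of_real (q * \<mu>) + of_real (- (q * s)\<^sup>2 / 2)))"
    by (simp only: exp_add exp_of_real)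
  also have "of_real (p\<^sup>2 * s\<^sup>2 / 2) + (\<i> * of_real (q * \<mu>) + of_real (- (q * s)\<^sup>2 / 2))
      = a\<^sup>2 * of_real (s\<^sup>2) / 2"
    by (simp add: a Complex_eq \<mu>_def power2_eq_square algebra_simps add_divide_distrib diff_divide_distrib)
  finally show ?eq .
qed

lemma gaussian_pair_exp:
  fixes a b :: complex
  assumes M: "prob_space M" and s: "0 < s"
    and D: "distributed M lborel D (\<lambda>(u, v). ennreal (normal_density 0 s u * normal_density 0 s v))"
  shows "integrable M (\<lambda>\<omega>. exp (a * of_real (fst (D \<omega>)) + b * of_real (snd (D \<omega>))))" (is ?int)
    and "(LINT \<omega>|M. exp (a * of_real (fst (D \<omega>)) + b * of_real (snd (D \<omega>))))
      = exp ((a\<^sup>2 + b\<^sup>2) * of_real (s\<^sup>2) / 2)" (is ?eq)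
proof -
  let ?n = "normal_density 0 s"
  define f1 f2 where "f1 u = ?n u *\<^sub>R exp (a * of_real u)" and "f2 u = ?n u *\<^sub>R exp (b * of_real u)" for u
  define f where "f = (\<lambda>(u, v). f1 u * f2 v)"
  have i1: "integrable lborel f1" "integral\<^sup>L lborel f1 = exp (a\<^sup>2 * of_real (s\<^sup>2) / 2)"
    unfolding f1_def by (rule normal_density_exp[OF s])+
  have i2: "integrable lborel f2" "integral\<^sup>L lborel f2 = exp (b\<^sup>2 * of_real (s\<^sup>2) / 2)"
    unfolding f2_def by (rule normal_density_exp[OF s])+
  define g :: "real \<times> real \<Rightarrow> complex" where "g = (\<lambda>y. exp (a * of_real (fst y) + b * of_real (snd y)))"
  define d where "d = (\<lambda>y::real \<times> real. ?n (fst y) * ?n (snd y))"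
  have dens: "(\<lambda>(u, v). ennreal (?n u * ?n v)) = (\<lambda>y. ennreal (d y))"
    by (auto simp: d_def)
  have gm[measurable]: "g \<in> borel_measurable borel"
    unfolding g_def by (intro borel_measurable_continuous_onI continuous_intros)
  have dm[measurable]: "d \<in> borel_measurable borel"
    unfolding d_def borel_prod[symmetric] by measurable
  have fm: "f \<in> borel_measurable (lborel \<Otimes>\<^sub>M lborel)"
    unfolding f_def f1_def f2_def by measurable
  have fd: "d y *\<^sub>R g y = f y" for y
    by (cases y) (simp add: f_def f1_def f2_def g_def d_def exp_add scaleR_conv_of_real)
  interpret lborel_pair: pair_sigma_finite "lborel :: real measure" "lborel :: real measure" ..
  have intf: "integrable (lborel \<Otimes>\<^sub>M lborel) f"
  proof (rule lborel_pair.Fubini_integrable[OF fm])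
    have "(\<lambda>x. LINT y|lborel. norm (f (x, y))) = (\<lambda>x. norm (f1 x) * (LINT y|lborel. norm (f2 y)))"
      by (simp add: f_def norm_mult)
    moreover have "integrable lborel (\<lambda>x. norm (f1 x))"
      using i1(1) by (rule integrable_norm)
    ultimately show "integrable lborel (\<lambda>x. LINT y|lborel. norm (f (x, y)))"
      by simp
    show "AE x in lborel. integrable lborel (\<lambda>y. f (x, y))"
      using i2(1) by (simp add: f_def)
  qed
  have "(LINT x|lborel. LINT y|lborel. f (x, y)) = integral\<^sup>L (lborel \<Otimes>\<^sub>M lborel) f"
    by (rule lborel_pair.integral_fst'[OF intf])
  then have eqf: "integral\<^sup>L (lborel \<Otimes>\<^sub>M lborel) f = exp (a\<^sup>2 * of_real (s\<^sup>2) / 2) * exp (b\<^sup>2 * of_real (s\<^sup>2) / 2)"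
    by (simp add: f_def i1 i2)
  have distr: "distr M lborel D = density lborel (\<lambda>y. ennreal (d y))"
    using D unfolding distributed_def dens by simp
  have Dm[measurable]: "D \<in> borel_measurable M"
    using D unfolding distributed_def by simp
  have d0: "0 \<le> d y" for y by (simp add: d_def)
  have "integrable (distr M lborel D) g"
    unfolding distr using intf d0 by (subst integrable_density) (auto simp: fd lborel_prod)
  then have "integrable M (\<lambda>\<omega>. g (D \<omega>))"
    by (subst (asm) integrable_distr_eq) auto
  then show ?int by (simp add: g_def)
  have "(LINT \<omega>|M. g (D \<omega>)) = integral\<^sup>L (distr M lborel D) g"
    by (subst integral_distr) auto
  also have "\<dots> = integral\<^sup>L lborel f"
    unfolding distr using d0 by (subst integral_density) (auto simp: fd)
  also have "\<dots> = exp ((a\<^sup>2 + b\<^sup>2) * of_real (s\<^sup>2) / 2)"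
    using eqf by (simp add: lborel_prod exp_add[symmetric] algebra_simps add_divide_distrib)
  finally show ?eq by (simp add: g_def)
qed

section \<open>Exponential martingales and optional stopping at grid times\<close>

text \<open>Along a planar Brownian motion \<open>B\<close>, the process \<open>bexp a b t (B t)\<close> is a martingale.\<close>

definition bexp :: "complex \<Rightarrow> complex \<Rightarrow> real \<Rightarrow> real \<times> real \<Rightarrow> complex"
  where "bexp a b t y = exp (a * of_real (fst y) + b * of_real (snd y) - (a\<^sup>2 + b\<^sup>2) / 2 * of_real t)"

lemma continuous_on_bexp [continuous_intros]:
  "continuous_on A f \<Longrightarrow> continuous_on A g \<Longrightarrow> continuous_on A (\<lambda>x. bexp a b (f x) (g x))"
  unfolding bexp_def by (intro continuous_intros)

lemma bexp_measurable [measurable]: "bexp a b t \<in> borel_measurable borel"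
  by (intro borel_measurable_continuous_onI continuous_intros)

lemma bexp_add: "bexp a b (s + t) (x + y) = bexp a b s x * bexp a b t y"
  by (simp add: bexp_def exp_add[symmetric] algebra_simps add_divide_distrib)

text \<open>The stopped value as a sum of increments over the steps before the stop. The condition
  on the summand \<open>j\<close> involves only the indices up to \<open>j\<close>, so that each
  summand becomes a martingale increment times an event of the past. The cap \<open>N\<close> keeps
  \<open>LEAST\<close> well defined.\<close>

lemma Least_telescope:
  fixes h :: "nat \<Rightarrow> 'a::ab_group_add"
  shows "h (LEAST i. N \<le> i \<or> \<not> P i) = h 0 + (\<Sum>j<N. if \<forall>i\<le>j. P i then h (Suc j) - h j else 0)"
proof -
  define J where "J = (LEAST i. N \<le> i \<or> \<not> P i)"
  have J: "N \<le> J \<or> \<not> P J" unfolding J_def by (rule LeastI[of _ N]) simp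
  have J_le: "J \<le> i" if "N \<le> i \<or> \<not> P i" for i unfolding J_def by (rule Least_le) (rule that)
  have "{j\<in>{..<N}. \<forall>i\<le>j. P i} = {..<J}"
    using J J_le by (fastforce simp: not_le[symmetric])
  then have "(\<Sum>j<N. if \<forall>i\<le>j. P i then h (Suc j) - h j else 0) = (\<Sum>j<J. h (Suc j) - h j)"
    by (simp add: sum.inter_filter[symmetric])
  then show ?thesis by (simp add: sum_lessThan_telescope J_def)
qed

context
  fixes M :: "'w measure" and x :: "real \<times> real" and B :: "real \<Rightarrow> 'w \<Rightarrow> real \<times> real"
  assumes pbm: "planar_brownian_motion M x B"
begin

lemma pbm_prob_space: "prob_space M" using pbm by (simp add: planar_brownian_motion_def)

lemma pbm_measurable: "0 \<le> t \<Longrightarrow> B t \<in> borel_measurable M"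
  using pbm by (simp add: planar_brownian_motion_def)

lemma pbm_start: "AE \<omega> in M. B 0 \<omega> = x"
  using pbm by (simp add: planar_brownian_motion_def)

lemma pbm_continuous: "\<omega> \<in> space M \<Longrightarrow> continuous_on {0..} (\<lambda>t. B t \<omega>)"
  using pbm by (simp add: planar_brownian_motion_def)

lemma pbm_increment:
  assumes "0 \<le> s" "s < t"
  shows "integrable M (\<lambda>\<omega>. bexp a b (t - s) (B t \<omega> - B s \<omega>))"
    and "(LINT \<omega>|M. bexp a b (t - s) (B t \<omega> - B s \<omega>)) = 1"
proof -
  have D: "distributed M lborel (\<lambda>\<omega>. B t \<omega> - B s \<omega>)
      (\<lambda>(u, v). ennreal (normal_density 0 (sqrt (t - s)) u * normal_density 0 (sqrt (t - s)) v))"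
    using pbm assms by (simp add: planar_brownian_motion_def)
  have *: "bexp a b (t - s) y = exp (- (a\<^sup>2 + b\<^sup>2) / 2 * of_real (t - s)) *
      exp (a * of_real (fst y) + b * of_real (snd y))" for y
    by (simp add: bexp_def exp_add[symmetric] algebra_simps add_divide_distrib diff_divide_distrib)
  have pos: "0 < sqrt (t - s)" using assms by simp
  show "integrable M (\<lambda>\<omega>. bexp a b (t - s) (B t \<omega> - B s \<omega>))"
    unfolding * using gaussian_pair_exp(1)[OF pbm_prob_space pos D, of a b] by simp
  show "(LINT \<omega>|M. bexp a b (t - s) (B t \<omega> - B s \<omega>)) = 1"
    unfolding * integral_mult_right_zero gaussian_pair_exp(2)[OF pbm_prob_space pos D, of a b]
    using assms by (simp add: exp_add[symmetric] flip: of_real_diff add_divide_distrib distrib_right)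
qed

text \<open>Time 0 is treated apart, because the law of an increment is prescribed only for
  intervals of positive length.\<close>

lemma bexp_integrable:
  assumes "0 \<le> t"
  shows "integrable M (\<lambda>\<omega>. bexp a b t (B t \<omega>))"
proof (cases "t = 0")
  case True
  interpret prob_space M by (rule pbm_prob_space)
  have [measurable]: "B 0 \<in> borel_measurable M" by (rule pbm_measurable) simp
  have "integrable M (\<lambda>\<omega>. bexp a b 0 (B 0 \<omega>)) \<longleftrightarrow> integrable M (\<lambda>\<omega>. bexp a b 0 x)"
    by (rule integrable_cong_AE) (use pbm_start in auto)
  then show ?thesis using True by simp
next
  case False
  have [measurable]: "B 0 \<in> borel_measurable M" "B t \<in> borel_measurable M"
    using assms by (auto intro: pbm_measurable)
  have "integrable M (\<lambda>\<omega>. bexp a b 0 x * bexp a b (t - 0) (B t \<omega> - B 0 \<omega>))"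
    using False assms by (intro integrable_mult_right pbm_increment) auto
  also have "?this \<longleftrightarrow> integrable M (\<lambda>\<omega>. bexp a b t (B t \<omega>))"
  proof (rule integrable_cong_AE)
    show "AE \<omega> in M. bexp a b 0 x * bexp a b (t - 0) (B t \<omega> - B 0 \<omega>) = bexp a b t (B t \<omega>)"
      using pbm_start by eventually_elim (simp add: bexp_add[symmetric])
  qed measurable
  finally show ?thesis .
qed

text \<open>Brownian motion is given here by independent increments, without a filtration. The event
  and the value at \<open>s j\<close> are therefore written as functions of the increments before
  \<open>s j\<close>, while the quotient of consecutive exponentials is a function of the next
  increment alone and has mean 1; independence factorises the expectation.\<close>

lemma bexp_martingale_step:
  fixes R :: "nat \<Rightarrow> real \<times> real \<Rightarrow> bool" and s :: "nat \<Rightarrow> real"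
  assumes s0: "s 0 = 0" and s: "\<And>i. s i < s (Suc i)" and R: "\<And>i. Measurable.pred borel (R i)"
  shows "integrable M (\<lambda>\<omega>. if \<forall>i\<le>j. R i (B (s i) \<omega>)
            then bexp a b (s (Suc j)) (B (s (Suc j)) \<omega>) - bexp a b (s j) (B (s j) \<omega>) else 0)" (is ?int)
    and "(LINT \<omega>|M. (if \<forall>i\<le>j. R i (B (s i) \<omega>)
            then bexp a b (s (Suc j)) (B (s (Suc j)) \<omega>) - bexp a b (s j) (B (s j) \<omega>) else 0)) = 0" (is ?eq)
proof -
  interpret prob_space M by (rule pbm_prob_space)
  have sp: "0 \<le> s i" for i
    using s0 s by (induction i) (auto intro: order.trans less_imp_le)
  have [measurable]: "B (s i) \<in> borel_measurable M" for i by (rule pbm_measurable[OF sp])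
  note R[measurable]
  let ?h = "\<lambda>i \<omega>. bexp a b (s i) (B (s i) \<omega>)"
  let ?P = "\<lambda>\<omega>. \<forall>i\<le>j. R i (B (s i) \<omega>)"
  have Pm[measurable]: "Measurable.pred M ?P" by measurable
  have ih: "integrable M (\<lambda>\<omega>. if ?P \<omega> then ?h i \<omega> else 0)" for i
  proof (rule Bochner_Integration.integrable_bound[OF bexp_integrable[OF sp[of i], of a b]])
    show "(\<lambda>\<omega>. if ?P \<omega> then ?h i \<omega> else 0) \<in> borel_measurable M" by measurable
  qed auto
  have gen: "(if P then u - v else 0) = (if P then u else 0) - (if P then v else (0::complex))" for P u v
    by simp
  have d: "(\<lambda>\<omega>. if ?P \<omega> then ?h (Suc j) \<omega> - ?h j \<omega> else 0) =
      (\<lambda>\<omega>. (if ?P \<omega> then ?h (Suc j) \<omega> else 0) - (if ?P \<omega> then ?h j \<omega> else 0))"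
    by (rule ext, rule gen)
  show ?int unfolding d by (intro Bochner_Integration.integrable_diff ih)
  define D where "D = (\<lambda>i \<omega>. B (s (Suc i)) \<omega> - B (s i) \<omega>)"
  have iv: "indep_vars (\<lambda>_. borel) D {..<Suc j}"
    using pbm s s0 unfolding planar_brownian_motion_def D_def by simp
  \<comment> \<open>The positions rebuilt from the increments; they agree with
    \<open>B (s i)\<close> almost surely, because \<open>B 0\<close> equals \<open>x\<close> only
    almost surely.\<close>
  define pos where "pos = (\<lambda>(v :: nat \<Rightarrow> real \<times> real) i. x + (\<Sum>l<i. v l))"
  define Y1 where "Y1 = (\<lambda>v. if \<forall>i\<le>j. R i (pos v i) then bexp a b (s j) (pos v j) else 0)"
  define Y2 where "Y2 = (\<lambda>v :: nat \<Rightarrow> real \<times> real. bexp a b (s (Suc j) - s j) (v j))"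
  have pm: "(\<lambda>v. pos v i) \<in> borel_measurable (Pi\<^sub>M {..<j} (\<lambda>_. borel))" if "i \<le> j" for i
    unfolding pos_def using that by (intro borel_measurable_add borel_measurable_const borel_measurable_sum measurable_component_singleton) auto
  have predR: "Measurable.pred (Pi\<^sub>M {..<j} (\<lambda>_. borel)) (\<lambda>v. \<forall>i\<le>j. R i (pos v i))"
  proof -
    have "Measurable.pred (Pi\<^sub>M {..<j} (\<lambda>_. borel)) (\<lambda>v. \<forall>i\<in>{..j}. R i (pos v i))"
      by (rule pred_intros_finite(3)) (auto intro: measurable_compose[OF pm R])
    then show ?thesis by (simp only: Ball_def atMost_iff)
  qed
  have Y1m: "Y1 \<in> borel_measurable (Pi\<^sub>M {..<j} (\<lambda>_. borel))"
    unfolding Y1_def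
    by (rule measurable_If[OF measurable_compose[OF pm[OF order_refl] bexp_measurable] borel_measurable_const predR[unfolded pred_def]])
  have Y2m: "Y2 \<in> borel_measurable (Pi\<^sub>M {j} (\<lambda>_. borel))"
    unfolding Y2_def by (rule measurable_compose[where N = borel, OF _ bexp_measurable], rule measurable_component_singleton, simp)
  have "indep_var borel (Y1 \<circ> (\<lambda>\<omega>. restrict (\<lambda>i. D i \<omega>) {..<j})) borel (Y2 \<circ> (\<lambda>\<omega>. restrict (\<lambda>i. D i \<omega>) {j}))"
    by (rule indep_var_compose[OF indep_var_restrict[OF iv] Y1m Y2m]) auto
  moreover have "Y1 (restrict v {..<j}) = Y1 v" for v
  proof -
    have "pos (restrict v {..<j}) i = pos v i" if "i \<le> j" for i
      using that by (auto simp: pos_def intro!: sum.cong)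
    then show ?thesis by (auto simp: Y1_def)
  qed
  moreover have "Y2 (restrict v {j}) = Y2 v" for v by (simp add: Y2_def)
  ultimately have ind: "indep_var borel (\<lambda>\<omega>. Y1 (\<lambda>i. D i \<omega>)) borel (\<lambda>\<omega>. Y2 (\<lambda>i. D i \<omega>))"
    by (simp add: comp_def)
  have posB: "AE \<omega> in M. \<forall>i. pos (\<lambda>i. D i \<omega>) i = B (s i) \<omega>"
    using pbm_start
  proof eventually_elim
    case (elim \<omega>)
    have "(\<Sum>l<i. D l \<omega>) = B (s i) \<omega> - B (s 0) \<omega>" for i
      unfolding D_def by (rule sum_lessThan_telescope)
    then show ?case using elim s0 by (simp add: pos_def)
  qed
  have ae1: "AE \<omega> in M. Y1 (\<lambda>i. D i \<omega>) = (if ?P \<omega> then ?h j \<omega> else 0)"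
    using posB by eventually_elim (auto simp: Y1_def)
  have ae2: "AE \<omega> in M. Y1 (\<lambda>i. D i \<omega>) * Y2 (\<lambda>i. D i \<omega>) = (if ?P \<omega> then ?h (Suc j) \<omega> else 0)"
    using posB
  proof eventually_elim
    case (elim \<omega>)
    have "bexp a b (s j) (B (s j) \<omega>) * bexp a b (s (Suc j) - s j) (D j \<omega>) = ?h (Suc j) \<omega>"
      by (simp add: bexp_add[symmetric] D_def)
    then show ?case using elim by (auto simp: Y1_def Y2_def)
  qed
  have m1: "(\<lambda>\<omega>. Y1 (\<lambda>i. D i \<omega>)) \<in> borel_measurable M" and m2[measurable]: "(\<lambda>\<omega>. Y2 (\<lambda>i. D i \<omega>)) \<in> borel_measurable M"
    using indep_var_rv1[OF ind] indep_var_rv2[OF ind] by auto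
  note m1[measurable]
  have i1: "integrable M (\<lambda>\<omega>. Y1 (\<lambda>i. D i \<omega>))"
    using ih[of j] by (subst integrable_cong_AE[OF _ _ ae1]) auto
  have i2: "integrable M (\<lambda>\<omega>. Y2 (\<lambda>i. D i \<omega>))" "(LINT \<omega>|M. Y2 (\<lambda>i. D i \<omega>)) = 1"
    unfolding Y2_def D_def by (rule pbm_increment[OF sp s])+
  have "(LINT \<omega>|M. (if ?P \<omega> then ?h (Suc j) \<omega> else 0)) = (LINT \<omega>|M. Y1 (\<lambda>i. D i \<omega>) * Y2 (\<lambda>i. D i \<omega>))"
    by (rule integral_cong_AE[symmetric, OF _ _ ae2]) auto
  also have "\<dots> = (LINT \<omega>|M. Y1 (\<lambda>i. D i \<omega>)) * (LINT \<omega>|M. Y2 (\<lambda>i. D i \<omega>))"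
    by (rule indep_var_lebesgue_integral[OF ind i1 i2(1)])
  also have "\<dots> = (LINT \<omega>|M. (if ?P \<omega> then ?h j \<omega> else 0))"
    using integral_cong_AE[OF _ _ ae1] by (simp add: i2(2))
  finally show ?eq unfolding d by (subst Bochner_Integration.integral_diff[OF ih ih]) simp
qed

text \<open>The index is bounded by \<open>N\<close>, so after telescoping only finitely many
  increments occur, each of mean zero.\<close>

lemma bexp_optional_stopping:
  fixes R :: "nat \<Rightarrow> real \<times> real \<Rightarrow> bool" and s :: "nat \<Rightarrow> real" and N :: nat
  assumes s0: "s 0 = 0" and s: "\<And>i. s i < s (Suc i)" and R: "\<And>i. Measurable.pred borel (R i)"
  defines "J \<equiv> \<lambda>\<omega>. LEAST i. N \<le> i \<or> \<not> R i (B (s i) \<omega>)"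
  shows "integrable M (\<lambda>\<omega>. bexp a b (s (J \<omega>)) (B (s (J \<omega>)) \<omega>))" (is ?int)
    and "(LINT \<omega>|M. bexp a b (s (J \<omega>)) (B (s (J \<omega>)) \<omega>)) = bexp a b 0 x" (is ?eq)
proof -
  interpret prob_space M by (rule pbm_prob_space)
  let ?d = "\<lambda>j \<omega>. if \<forall>i\<le>j. R i (B (s i) \<omega>)
            then bexp a b (s (Suc j)) (B (s (Suc j)) \<omega>) - bexp a b (s j) (B (s j) \<omega>) else 0"
  note step = bexp_martingale_step[where R = R and s = s, OF s0 s R]
  have tel: "bexp a b (s (J \<omega>)) (B (s (J \<omega>)) \<omega>) = bexp a b 0 (B 0 \<omega>) + (\<Sum>j<N. ?d j \<omega>)" for \<omega>
    unfolding J_def Least_telescope[of "\<lambda>i. bexp a b (s i) (B (s i) \<omega>)"] by (simp add: s0)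
  have i0: "integrable M (\<lambda>\<omega>. bexp a b 0 (B 0 \<omega>))" by (rule bexp_integrable) simp
  show ?int unfolding tel by (intro Bochner_Integration.integrable_add i0 Bochner_Integration.integrable_sum step)
  have "(LINT \<omega>|M. bexp a b 0 (B 0 \<omega>)) = (LINT \<omega>|M. bexp a b 0 x)"
    using pbm_start pbm_measurable[of 0] by (intro integral_cong_AE) auto
  then show ?eq unfolding tel
    by (subst Bochner_Integration.integral_add[OF i0 Bochner_Integration.integrable_sum[OF step(1)]])
      (simp add: Bochner_Integration.integral_sum[OF step(1)] step(2) prob_space)
qed

end

section \<open>The exit time as a limit of grid times\<close>

text \<open>Exit times capped at a horizon \<open>T\<close>, so that the infimum is over a nonempty set.\<close>

definition hit :: "(real \<Rightarrow> real \<times> real) \<Rightarrow> (real \<times> real) set \<Rightarrow> real \<Rightarrow> real \<Rightarrow> real"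
  where "hit w A d T = Inf (insert T {t. d \<le> t \<and> t \<le> T \<and> w t \<notin> A})"

definition hit0 :: "(real \<Rightarrow> real \<times> real) \<Rightarrow> real \<Rightarrow> real"
  where "hit0 w T = Inf (insert T {t. 0 < t \<and> t \<le> T \<and> w t \<notin> open_quadrant})"

lemma hit_bdd: "bdd_below (insert (T::real) {t. d \<le> t \<and> t \<le> T \<and> P t})"
  by (rule bdd_belowI[of _ "min d T"]) auto

lemma hit0_bdd: "bdd_below (insert (T::real) {t. 0 < t \<and> t \<le> T \<and> P t})"
  by (rule bdd_belowI[of _ "min 0 T"]) auto

lemma hit_le: "hit w A d T \<le> T"
  unfolding hit_def by (rule cInf_lower[OF _ hit_bdd]) simp

lemma hit_ge: "d \<le> T \<Longrightarrow> d \<le> hit w A d T"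
  unfolding hit_def by (rule cInf_greatest) auto

lemma hit0_le: "hit0 w T \<le> T"
  unfolding hit0_def by (rule cInf_lower[OF _ hit0_bdd]) simp

lemma hit0_ge: "0 \<le> T \<Longrightarrow> 0 \<le> hit0 w T"
  unfolding hit0_def by (rule cInf_greatest) auto

text \<open>A grid exit is an exit, so the grid times never undershoot. Conversely the complement of
  the closed set \<open>A\<close> is open: after an exit the path stays outside for a while, and a
  fine grid has a point there. For the open quadrant itself this last step would fail, which is why
  closed sets come first.\<close>

lemma grid_hit_tendsto:
  fixes w :: "real \<Rightarrow> real \<times> real"
  assumes w: "continuous_on {0..} w" and d: "0 \<le> d" "d \<le> T" and T: "0 < T" and A: "closed A"
  defines "J \<equiv> \<lambda>n. LEAST i. 2 ^ n \<le> i \<or> \<not> (real i * (T / 2 ^ n) < d \<or> w (real i * (T / 2 ^ n)) \<in> A)"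
  shows "(\<lambda>n. real (J n) * (T / 2 ^ n)) \<longlonglongrightarrow> hit w A d T"
proof -
  let ?\<sigma> = "\<lambda>n. real (J n) * (T / 2 ^ n)"
  have J: "2 ^ n \<le> J n \<or> \<not> (?\<sigma> n < d \<or> w (?\<sigma> n) \<in> A)" for n
    unfolding J_def by (rule LeastI[of _ "2 ^ n"]) simp
  have J_le: "J n \<le> i" if "2 ^ n \<le> i \<or> \<not> (real i * (T / 2 ^ n) < d \<or> w (real i * (T / 2 ^ n)) \<in> A)" for i n
    unfolding J_def by (rule Least_le) (rule that)
  have le: "?\<sigma> n \<le> T" for n
  proof -
    have "real (J n) \<le> real (2 ^ n)" using J_le[of n "2 ^ n"] by (simp only: of_nat_le_iff) simp
    then show ?thesis using T by (simp add: field_simps)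
  qed
  have ge: "hit w A d T \<le> ?\<sigma> n" for n
  proof (cases "2 ^ n \<le> J n")
    case True
    then have "J n = 2 ^ n" using J_le[of n "2 ^ n"] by simp
    then show ?thesis using hit_le[of w A d T] by simp
  next
    case False
    then show ?thesis
      using J[of n] le[of n] unfolding hit_def by (intro cInf_lower[OF _ hit_bdd]) auto
  qed
  show ?thesis
  proof (rule order_tendstoI)
    fix a assume "a < hit w A d T"
    then show "eventually (\<lambda>n. a < ?\<sigma> n) sequentially"
      using ge by (auto intro!: always_eventually dest: less_le_trans)
  next
    fix a assume a: "hit w A d T < a"
    show "eventually (\<lambda>n. ?\<sigma> n < a) sequentially"
    proof (cases "hit w A d T = T")
      case True
      then show ?thesis using le a by (auto intro!: always_eventually dest: le_less_trans)
    next
      case False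
      then have "hit w A d T < min a T" using a hit_le[of w A d T] by auto
      then obtain t where t: "t \<in> insert T {t. d \<le> t \<and> t \<le> T \<and> w t \<notin> A}" "t < min a T"
        unfolding hit_def using cInf_lessD[of "insert T {t. d \<le> t \<and> t \<le> T \<and> w t \<notin> A}"] by blast
      then have t: "d \<le> t" "t < T" "t < a" "w t \<notin> A" by auto
      have "(w \<longlongrightarrow> w t) (at t within {0..})"
        using w t d by (auto simp: continuous_on_def)
      then have "eventually (\<lambda>t'. w t' \<in> - A) (at t within {0..})"
        by (rule topological_tendstoD) (use A t in auto)
      then obtain r where r: "0 < r" "\<And>t'. t' \<ge> 0 \<Longrightarrow> t' \<noteq> t \<Longrightarrow> dist t' t < r \<Longrightarrow> w t' \<notin> A"
        by (auto simp: eventually_at)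
      have "(\<lambda>n. T / 2 ^ n) \<longlonglongrightarrow> 0" by (rule LIMSEQ_divide_realpow_zero) simp
      then have "eventually (\<lambda>n. T / 2 ^ n < min r (a - t)) sequentially"
        by (rule order_tendstoD) (use r t in auto)
      then show ?thesis
      proof eventually_elim
        case (elim n)
        define h where "h = T / 2 ^ n"
        have h: "0 < h" "h < r" "h < a - t" using elim T by (auto simp: h_def)
        \<comment> \<open>The first grid index at or after the exit time \<open>t\<close>. Its grid
          time is less than one mesh width later, hence the path is still outside
          \<open>A\<close>.\<close>
        define i where "i = nat \<lceil>t / h\<rceil>"
        have "real i \<ge> t / h" "real i < t / h + 1"
          unfolding i_def using t d h by (auto simp: of_nat_nat) linarith+
        then have i: "t \<le> real i * h" "real i * h < t + h" using h by (auto simp: field_simps)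
        have "w (real i * h) \<notin> A"
        proof (cases "real i * h = t")
          case False
          then show ?thesis using i h t d by (intro r(2)) (auto simp: dist_real_def)
        qed (use t in simp)
        then have "J n \<le> i" using i t by (intro J_le) (auto simp: h_def)
        then have "real (J n) * h \<le> real i * h" using h by simp
        then show ?case using i h by (simp add: h_def)
      qed
    qed
  qed
qed

text \<open>On a compact time interval before the exit the smaller coordinate has a positive
  minimum, so the path stays in one of the closed quadrants exhausting the open one. A start time
  \<open>d\<close> keeps the interval closed on the left.\<close>

lemma hit_shrink_tendsto:
  assumes w: "continuous_on {0..} w" and d: "0 \<le> d" "d \<le> T"
  shows "(\<lambda>k. hit w ({1 / real (Suc k)..} \<times> {1 / real (Suc k)..}) d T) \<longlonglongrightarrow> hit w open_quadrant d T"
proof (rule order_tendstoI)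
  let ?K = "\<lambda>k. {1 / real (Suc k)..} \<times> {1 / real (Suc k)..}"
  have sub: "?K k \<subseteq> open_quadrant" for k
  proof -
    have "0 < a" if "1 / real (Suc k) \<le> a" for a
      using that by (rule less_le_trans[rotated]) simp
    then show ?thesis unfolding open_quadrant_def by (auto simp del: of_nat_Suc)
  qed
  have le: "hit w (?K k) d T \<le> hit w open_quadrant d T" for k
    unfolding hit_def by (rule cInf_superset_mono[OF _ hit_bdd]) (use sub[of k] in auto)
  {
    fix a assume "hit w open_quadrant d T < a"
    then show "eventually (\<lambda>k. hit w (?K k) d T < a) sequentially"
      using le by (auto intro!: always_eventually dest: le_less_trans)
  next
    fix a assume a: "a < hit w open_quadrant d T"
    define u where "u = (a + hit w open_quadrant d T) / 2"
    have u: "a < u" "u < hit w open_quadrant d T" using a by (auto simp: u_def)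
    show "eventually (\<lambda>k. a < hit w (?K k) d T) sequentially"
    proof (cases "u < d")
      case True
      then show ?thesis using hit_ge[OF d(2)] u
        by (auto intro!: always_eventually) (meson less_trans less_le_trans)
    next
      case False
      have O: "w t \<in> open_quadrant" if "d \<le> t" "t \<le> u" for t
      proof (rule ccontr)
        assume "w t \<notin> open_quadrant"
        then have "hit w open_quadrant d T \<le> t"
          unfolding hit_def using that u hit_le[of w open_quadrant d T]
          by (intro cInf_lower[OF _ hit_bdd]) auto
        then show False using that u by simp
      qed
      have "continuous_on {d..u} (\<lambda>t. min (fst (w t)) (snd (w t)))"
        using d by (intro continuous_intros continuous_on_subset[OF w]) auto
      then obtain t0 where t0: "t0 \<in> {d..u}"
          "\<And>t. t \<in> {d..u} \<Longrightarrow> min (fst (w t0)) (snd (w t0)) \<le> min (fst (w t)) (snd (w t))"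
        using continuous_attains_inf[of "{d..u}" "\<lambda>t. min (fst (w t)) (snd (w t))"] False by auto
      define c where "c = min (fst (w t0)) (snd (w t0))"
      have c: "0 < c" using O[of t0] t0 by (auto simp: c_def open_quadrant_def)
      have "(\<lambda>k. 1 / real (Suc k)) \<longlonglongrightarrow> 0"
        using LIMSEQ_inverse_real_of_nat by (simp add: inverse_eq_divide)
      then have "eventually (\<lambda>k. 1 / real (Suc k) < c) sequentially"
        by (rule order_tendstoD) (rule c)
      then show ?thesis
      proof eventually_elim
        case (elim k)
        have "u \<le> hit w (?K k) d T"
          unfolding hit_def
        proof (rule cInf_greatest)
          fix t assume t: "t \<in> insert T {t. d \<le> t \<and> t \<le> T \<and> w t \<notin> ?K k}"
          show "u \<le> t"
          proof (rule ccontr)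
            assume "\<not> u \<le> t"
            moreover from this have "t \<noteq> T" using u hit_le[of w open_quadrant d T] by auto
            ultimately have "d \<le> t" "t \<le> u" "w t \<notin> ?K k" using t by auto
            moreover have "c \<le> min (fst (w t)) (snd (w t))"
              using t0(2)[of t] calculation by (auto simp: c_def)
            ultimately show False using elim by (cases "w t") auto
          qed
        qed simp
        then show ?case using u by simp
      qed
    qed
  }
qed

text \<open>Only strictly positive times count as exits in \<open>hit0\<close>; each of them lies
  beyond the start times \<open>T / real (k + 2)\<close> from some \<open>k\<close> on.\<close>

lemma hit_start_tendsto:
  assumes T: "0 < T"
  shows "(\<lambda>k. hit w open_quadrant (T / real (k + 2)) T) \<longlonglongrightarrow> hit0 w T"
proof (rule order_tendstoI)
  let ?d = "\<lambda>k. T / real (k + 2)"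
  have dp: "0 < ?d k" for k using T by simp
  have le: "hit0 w T \<le> hit w open_quadrant (?d k) T" for k
    unfolding hit_def hit0_def
    by (rule cInf_superset_mono[OF _ hit0_bdd]) (use dp[of k] in auto)
  fix a
  show "eventually (\<lambda>k. a < hit w open_quadrant (?d k) T) sequentially" if "a < hit0 w T"
    using le that by (auto intro!: always_eventually dest: less_le_trans)
  show "eventually (\<lambda>k. hit w open_quadrant (?d k) T < a) sequentially" if a: "hit0 w T < a"
  proof -
    obtain t where t: "t \<in> insert T {t. 0 < t \<and> t \<le> T \<and> w t \<notin> open_quadrant}" "t < a"
      using cInf_lessD[OF _ a[unfolded hit0_def]] by blast
    have "?d \<longlonglongrightarrow> 0" by real_asymp
    then have "eventually (\<lambda>k. ?d k < t) sequentially"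
      by (rule order_tendstoD) (use t T in auto)
    then show ?thesis
    proof eventually_elim
      case (elim k)
      have "hit w open_quadrant (?d k) T \<le> t"
        unfolding hit_def using t elim by (intro cInf_lower[OF _ hit_bdd]) auto
      then show ?case using t by simp
    qed
  qed
qed

lemma closed_quadrant: "closed quadrant"
  unfolding quadrant_def by (intro closed_Times closed_atLeast)

lemma open_open_quadrant: "open open_quadrant"
  unfolding open_quadrant_def by (intro open_Times open_greaterThan)

text \<open>Between 0 and the capped exit time the path is in the open quadrant, and the closed
  quadrant contains its limit. If that time is 0, the starting point answers.\<close>

lemma hit0_in_quadrant:
  assumes w: "continuous_on {0..} w" "w 0 \<in> quadrant" and T: "0 < T"
  shows "w (hit0 w T) \<in> quadrant"
proof (cases "hit0 w T = 0")
  case False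
  then have pos: "0 < hit0 w T" using hit0_ge[of T w] T by simp
  have cl: "closed ({0..} \<inter> w -` quadrant)"
    using continuous_closed_preimage[OF w(1) _ closed_quadrant] by simp
  have "{0<..<hit0 w T} \<subseteq> {0..} \<inter> w -` quadrant"
  proof (rule subsetI)
    fix t assume t: "t \<in> {0<..<hit0 w T}"
    have "w t \<in> open_quadrant"
    proof (rule ccontr)
      assume "w t \<notin> open_quadrant"
      then have "hit0 w T \<le> t" unfolding hit0_def
        using t hit0_le[of w T] by (intro cInf_lower[OF _ hit0_bdd]) auto
      then show False using t by simp
    qed
    then show "t \<in> {0..} \<inter> w -` quadrant" using t by (auto simp: open_quadrant_def quadrant_def)
  qed
  then have "closure {0<..<hit0 w T} \<subseteq> {0..} \<inter> w -` quadrant"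
    by (rule closure_minimal[OF _ cl])
  moreover have "hit0 w T \<in> closure {0<..<hit0 w T}" using pos by (simp add: closure_greaterThanLessThan)
  ultimately show ?thesis by auto
qed (use w in simp)

text \<open>Any exit bounds the exit time, and a horizon beyond that bound no longer caps
  it.\<close>

lemma exit_hit0:
  assumes "\<exists>t>0. w t \<notin> open_quadrant"
  shows "eventually (\<lambda>n. hit0 w (real n) = exit_time w \<and> exit_time w < real n) sequentially"
proof -
  obtain t0 where t0: "0 < t0" "w t0 \<notin> open_quadrant" using assms by auto
  have bdd: "bdd_below {t. 0 < t \<and> w t \<notin> open_quadrant}" by (rule bdd_belowI[of _ 0]) auto
  have "eventually (\<lambda>n. t0 < real n) sequentially" by real_asymp
  then show ?thesis
  proof eventually_elim
    case (elim n)
    have le: "exit_time w \<le> t0" unfolding exit_time_def using t0 by (intro cInf_lower[OF _ bdd]) auto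
    have "exit_time w \<le> hit0 w (real n)"
      unfolding hit0_def
    proof (rule cInf_greatest)
      fix t assume "t \<in> insert (real n) {t. 0 < t \<and> t \<le> real n \<and> w t \<notin> open_quadrant}"
      then consider "t = real n" | "t \<in> {t. 0 < t \<and> w t \<notin> open_quadrant}" by auto
      then show "exit_time w \<le> t"
      proof cases
        case 2
        then show ?thesis unfolding exit_time_def by (rule cInf_lower[OF _ bdd])
      qed (use le elim in simp)
    qed simp
    moreover have "hit0 w (real n) \<le> exit_time w"
      unfolding exit_time_def
    proof (rule cInf_greatest)
      fix t assume t: "t \<in> {t. 0 < t \<and> w t \<notin> open_quadrant}"
      show "hit0 w (real n) \<le> t"
      proof (cases "t \<le> real n")
        case True
        then show ?thesis unfolding hit0_def using t by (intro cInf_lower[OF _ hit0_bdd]) auto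
      qed (use hit0_le[of w "real n"] in simp)
    qed (use t0 in auto)
    ultimately show ?case using le elim by simp
  qed
qed

lemma hit0_no_exit:
  assumes "\<not> (\<exists>t>0. w t \<notin> open_quadrant)"
  shows "hit0 w T = T"
proof -
  have "{t. 0 < t \<and> t \<le> T \<and> w t \<notin> open_quadrant} = {}" using assms by auto
  then show ?thesis unfolding hit0_def by (simp only: cInf_singleton)
qed

text \<open>The complement of the open quadrant is closed, so it contains the position at the
  infimum of the exit times; the closed quadrant contains it as well. Paths without an exit are sent
  to the origin, a point of \<open>E\<close>.\<close>

lemma exit_point_in_E:
  assumes w: "continuous_on {0..} w" "w 0 \<in> quadrant"
  shows "exit_point w \<in> E"
proof (cases "\<exists>t>0. w t \<notin> open_quadrant")
  case True
  obtain n where n: "hit0 w (real n) = exit_time w \<and> exit_time w < real n"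
    using exit_hit0[OF True] by (auto simp: eventually_sequentially)
  let ?S = "{t. 0 < t \<and> w t \<notin> open_quadrant}"
  have bdd: "bdd_below ?S" by (rule bdd_belowI[of _ 0]) auto
  have ne: "?S \<noteq> {}" using True by auto
  have "0 \<le> exit_time w" unfolding exit_time_def by (rule cInf_greatest[OF ne]) auto
  then have "0 < real n" using n by simp
  then have q: "w (exit_time w) \<in> quadrant" using hit0_in_quadrant[OF w, of "real n"] n by simp
  have cl: "closed ({0..} \<inter> w -` (- open_quadrant))"
    using continuous_closed_preimage[OF w(1) _ closed_Compl[OF open_open_quadrant]] by simp
  have "closure ?S \<subseteq> {0..} \<inter> w -` (- open_quadrant)"
    by (rule closure_minimal[OF _ cl]) auto
  moreover have "exit_time w \<in> closure ?S"
    unfolding exit_time_def by (rule closure_contains_Inf[OF ne bdd])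
  ultimately show ?thesis using q True by (auto simp: exit_point_def E_def)
qed (auto simp: exit_point_def E_def quadrant_def open_quadrant_def)

section \<open>Truncation and the limit of stopped expectations\<close>

text \<open>The radial projection onto the closed disc of radius \<open>K\<close>. Being continuous
  and bounded, it lets expectations pass to limits of stopping times by dominated
  convergence.\<close>

definition trunc :: "real \<Rightarrow> complex \<Rightarrow> complex"
  where "trunc K z = (K / max K (norm z)) *\<^sub>R z"

lemma continuous_on_trunc [continuous_intros]:
  assumes "0 < K" "continuous_on A f"
  shows "continuous_on A (\<lambda>x. trunc K (f x))"
  unfolding trunc_def using assms by (intro continuous_intros) (auto simp: max_def)

lemma norm_trunc_le: "0 < K \<Longrightarrow> norm (trunc K z) \<le> K"
  by (auto simp: trunc_def max_def)

lemma trunc_eq: "0 < K \<Longrightarrow> norm z \<le> K \<Longrightarrow> trunc K z = z"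
  by (simp add: trunc_def max_def)

text \<open>A Chebyshev-type bound: the truncation error is controlled by the second moment divided
  by \<open>K\<close>.\<close>

lemma trunc_diff_le:
  assumes "0 < K"
  shows "norm (trunc K z - z) \<le> (norm z)\<^sup>2 / K"
proof (cases "norm z \<le> K")
  case True
  then show ?thesis using assms by (simp add: trunc_eq)
next
  case False
  then have "trunc K z - z = (K / norm z - 1) *\<^sub>R z"
    by (simp add: trunc_def max_def scaleR_diff_left)
  also have "norm \<dots> = \<bar>K / norm z - 1\<bar> * norm z" by (rule norm_scaleR)
  also have "\<dots> = norm z - K" using False assms
    by (cases "z = 0") (auto simp: abs_if field_simps)
  also have "\<dots> \<le> norm z" using assms by simp
  also have "\<dots> \<le> (norm z)\<^sup>2 / K" using False assms
    by (simp add: power2_eq_square field_simps mult_right_mono)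
  finally show ?thesis .
qed

text \<open>A closed inequality for the expectation of a bounded continuous function survives
  pointwise limits. Measurability of the limit comes from the same convergence.\<close>

lemma expectation_limit_bound:
  fixes Y :: "nat \<Rightarrow> 'w \<Rightarrow> 'b::metric_space" and g :: "'b \<Rightarrow> complex"
  assumes M: "prob_space M" and Y: "\<And>n. Y n \<in> borel_measurable M"
    and lim: "\<And>\<omega>. \<omega> \<in> space M \<Longrightarrow> (\<lambda>n. Y n \<omega>) \<longlonglongrightarrow> Z \<omega>"
  shows "Z \<in> borel_measurable M"
    and "\<And>g m K c. continuous_on UNIV g \<Longrightarrow> (\<And>y. norm (g y :: complex) \<le> K) \<Longrightarrow>
      (\<And>n. norm ((LINT \<omega>|M. g (Y n \<omega>)) - m) \<le> c) \<Longrightarrow> norm ((LINT \<omega>|M. g (Z \<omega>)) - m) \<le> c"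
proof -
  interpret prob_space M by fact
  show Z[measurable]: "Z \<in> borel_measurable M" by (rule borel_measurable_LIMSEQ_metric[OF Y lim])
  note Y[measurable]
  fix g :: "'b \<Rightarrow> complex" and m K c
  assume g: "continuous_on UNIV g" "\<And>y. norm (g y) \<le> K" and c: "\<And>n. norm ((LINT \<omega>|M. g (Y n \<omega>)) - m) \<le> c"
  have [measurable]: "g \<in> borel_measurable borel" by (rule borel_measurable_continuous_onI[OF g(1)])
  have "(\<lambda>n. LINT \<omega>|M. g (Y n \<omega>)) \<longlonglongrightarrow> (LINT \<omega>|M. g (Z \<omega>))"
  proof (rule integral_dominated_convergence[where w = "\<lambda>_. K"])
    show "AE \<omega> in M. (\<lambda>n. g (Y n \<omega>)) \<longlonglongrightarrow> g (Z \<omega>)"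
      using g(1) lim by (intro AE_I2 continuous_on_tendsto_compose[OF g(1)]) auto
  qed (use g in auto)
  then show "norm ((LINT \<omega>|M. g (Z \<omega>)) - m) \<le> c"
    by (intro LIMSEQ_le_const2[OF tendsto_norm[OF tendsto_diff[OF _ tendsto_const]]]) (use c in auto)
qed

lemma norm_bexp: "norm (bexp a b t y) = exp (Re a * fst y + Re b * snd y - Re (a\<^sup>2 + b\<^sup>2) / 2 * t)"
  by (simp add: bexp_def)

text \<open>The exponential rate in \<open>t\<close> by which the squared modulus of
  \<open>bexp a b\<close> differs from the positive martingale with the parameters
  \<open>2 * Re a\<close> and \<open>2 * Re b\<close>.\<close>

definition growth_rate :: "complex \<Rightarrow> complex \<Rightarrow> real"
  where "growth_rate a b = (2 * (Re a)\<^sup>2 + 2 * (Re b)\<^sup>2) - Re (a\<^sup>2 + b\<^sup>2)"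

lemma bexp_of_real:
  "bexp (of_real a) (of_real b) t y = of_real (exp (a * fst y + b * snd y - (a\<^sup>2 + b\<^sup>2) / 2 * t))"
  by (simp add: bexp_def flip: exp_of_real)

lemma norm_bexp_sq:
  assumes t: "0 \<le> t" "t \<le> T"
  shows "(norm (bexp a b t y))\<^sup>2 \<le> exp (\<bar>growth_rate a b\<bar> * T) * norm (bexp (of_real (2 * Re a)) (of_real (2 * Re b)) t y)"
proof -
  have "(norm (bexp a b t y))\<^sup>2 = exp (growth_rate a b * t) * norm (bexp (of_real (2 * Re a)) (of_real (2 * Re b)) t y)"
    by (simp add: norm_bexp exp_add[symmetric] power2_eq_square growth_rate_def algebra_simps add_divide_distrib diff_divide_distrib)
  moreover have "growth_rate a b * t \<le> \<bar>growth_rate a b\<bar> * T"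
    using t by (intro mult_mono) auto
  ultimately show ?thesis by (simp add: mult_right_mono)
qed

text \<open>The second moment of the stopped exponential is bounded by another exponential
  martingale, whose expectation is again known by optional stopping. The resulting bound involves
  neither the mesh, nor \<open>d\<close>, nor \<open>e\<close>.\<close>

lemma discrete_stop_bound:
  fixes M :: "'w measure"
  assumes pbm: "planar_brownian_motion M x B" and d: "0 \<le> d" "d \<le> T" and T: "0 < T" and e: "0 < e" and K: "0 < K"
  defines "\<sigma> \<equiv> \<lambda>n \<omega>. real (LEAST i. 2 ^ n \<le> i \<or> \<not> (real i * (T / 2 ^ n) < d \<or>
      B (real i * (T / 2 ^ n)) \<omega> \<in> {e..} \<times> {e..})) * (T / 2 ^ n)"
  shows "(\<lambda>\<omega>. (\<sigma> n \<omega>, B (\<sigma> n \<omega>) \<omega>)) \<in> borel_measurable M"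
    and "norm ((LINT \<omega>|M. trunc K (bexp a b (\<sigma> n \<omega>) (B (\<sigma> n \<omega>) \<omega>))) - bexp a b 0 x)
      \<le> exp (\<bar>growth_rate a b\<bar> * T) * norm (bexp (of_real (2 * Re a)) (of_real (2 * Re b)) 0 x) / K"
proof -
  interpret prob_space M by (rule pbm_prob_space[OF pbm])
  define s where "s = (\<lambda>i. real i * (T / 2 ^ n))"
  \<comment> \<open>Grid times before \<open>d\<close> count as inside, so that the search for an
    exit begins at \<open>d\<close>.\<close>
  define R where "R = (\<lambda>i y. s i < d \<or> y \<in> {e..} \<times> {e..})"
  define J where "J = (\<lambda>\<omega>. LEAST i. 2 ^ n \<le> i \<or> \<not> R i (B (s i) \<omega>))"
  have \<sigma>: "\<sigma> n \<omega> = s (J \<omega>)" for \<omega>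
    by (simp add: \<sigma>_def s_def J_def R_def)
  have s0: "s 0 = 0" by (simp add: s_def)
  have s: "s i < s (Suc i)" for i using T by (simp add: s_def field_simps)
  have sp: "0 \<le> s i" for i using T by (simp add: s_def)
  have Rm[measurable]: "Measurable.pred borel (R i)" for i
    unfolding R_def using closed_Times[OF closed_atLeast closed_atLeast, of e e]
    by (intro pred_intros_logic pred_sets2[where N = borel]) (auto intro!: borel_closed)
  have [measurable]: "B (s i) \<in> borel_measurable M" for i by (rule pbm_measurable[OF pbm sp])
  have Jm[measurable]: "J \<in> measurable M (count_space UNIV)" unfolding J_def by measurable
  have pm: "(\<lambda>\<omega>. (s i, B (s i) \<omega>)) \<in> borel_measurable M" for i by measurable
  show ms: "(\<lambda>\<omega>. (\<sigma> n \<omega>, B (\<sigma> n \<omega>) \<omega>)) \<in> borel_measurable M"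
    unfolding \<sigma> by (rule measurable_compose_countable[where f = "\<lambda>i \<omega>. (s i, B (s i) \<omega>)", OF pm Jm])
  have sJ: "s (J \<omega>) \<le> T" for \<omega>
  proof -
    have "J \<omega> \<le> 2 ^ n" unfolding J_def by (rule Least_le) simp
    then have "real (J \<omega>) \<le> real (2 ^ n)" by (simp only: of_nat_le_iff)
    then show ?thesis using T by (simp add: s_def field_simps)
  qed
  define h where "h = (\<lambda>a b \<omega>. bexp a b (s (J \<omega>)) (B (s (J \<omega>)) \<omega>))"
  have int: "integrable M (h a b)" and eq: "(LINT \<omega>|M. h a b \<omega>) = bexp a b 0 x" for a b
    unfolding h_def J_def by (rule bexp_optional_stopping[OF pbm s0 s Rm])+
  have hm[measurable]: "h a b \<in> borel_measurable M" using int by auto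
  have contt: "continuous_on UNIV (trunc K)" using continuous_on_trunc[OF K continuous_on_id] by simp
  have [measurable]: "trunc K \<in> borel_measurable borel" by (rule borel_measurable_continuous_onI[OF contt])
  have inttr: "integrable M (\<lambda>\<omega>. trunc K (h a b \<omega>))"
    by (rule integrable_const_bound[where B = K]) (use norm_trunc_le[OF K] in auto)
  let ?\<alpha> = "complex_of_real (2 * Re a)" and ?\<beta> = "complex_of_real (2 * Re b)"
  \<comment> \<open>For real parameters the exponential is a positive number, so the expectation of
    its norm is the martingale expectation itself.\<close>
  have nh: "norm (h ?\<alpha> ?\<beta> \<omega>) = Re (h ?\<alpha> ?\<beta> \<omega>)" for \<omega>
    unfolding h_def bexp_of_real by simp
  have "norm ((LINT \<omega>|M. trunc K (h a b \<omega>)) - bexp a b 0 x) = norm (LINT \<omega>|M. (trunc K (h a b \<omega>) - h a b \<omega>))"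
    using int inttr eq by simp
  also have "\<dots> \<le> (LINT \<omega>|M. norm (trunc K (h a b \<omega>) - h a b \<omega>))"
    by (rule integral_norm_bound)
  also have "\<dots> \<le> (LINT \<omega>|M. exp (\<bar>growth_rate a b\<bar> * T) / K * norm (h ?\<alpha> ?\<beta> \<omega>))"
  proof (rule integral_mono)
    show "integrable M (\<lambda>\<omega>. norm (trunc K (h a b \<omega>) - h a b \<omega>))" using int inttr by auto
    show "integrable M (\<lambda>\<omega>. exp (\<bar>growth_rate a b\<bar> * T) / K * norm (h ?\<alpha> ?\<beta> \<omega>))" using int by auto
    fix \<omega>
    have "norm (trunc K (h a b \<omega>) - h a b \<omega>) \<le> (norm (h a b \<omega>))\<^sup>2 / K" by (rule trunc_diff_le[OF K])
    also have "\<dots> \<le> (exp (\<bar>growth_rate a b\<bar> * T) * norm (h ?\<alpha> ?\<beta> \<omega>)) / K"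
      unfolding h_def using K by (intro divide_right_mono norm_bexp_sq sp sJ) auto
    finally show "norm (trunc K (h a b \<omega>) - h a b \<omega>) \<le> exp (\<bar>growth_rate a b\<bar> * T) / K * norm (h ?\<alpha> ?\<beta> \<omega>)" by simp
  qed
  also have "\<dots> = exp (\<bar>growth_rate a b\<bar> * T) / K * (LINT \<omega>|M. Re (h ?\<alpha> ?\<beta> \<omega>))" unfolding nh by simp
  also have "(LINT \<omega>|M. Re (h ?\<alpha> ?\<beta> \<omega>)) = Re (LINT \<omega>|M. h ?\<alpha> ?\<beta> \<omega>)" by (rule integral_Re[OF int])
  also have "\<dots> \<le> norm (bexp ?\<alpha> ?\<beta> 0 x)" unfolding eq by (rule complex_Re_le_cmod)
  finally show "norm ((LINT \<omega>|M. trunc K (bexp a b (\<sigma> n \<omega>) (B (\<sigma> n \<omega>) \<omega>))) - bexp a b 0 x)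
      \<le> exp (\<bar>growth_rate a b\<bar> * T) * norm (bexp ?\<alpha> ?\<beta> 0 x) / K"
    using K by (simp add: \<sigma> h_def divide_right_mono mult_left_mono)
qed

text \<open>Three successive limits: the mesh tends to 0, the closed quadrants increase to the open
  one, and the start time decreases to 0.\<close>

lemma stopped_bound:
  fixes M :: "'w measure"
  assumes pbm: "planar_brownian_motion M x B" and T: "0 < T"
  shows "(\<lambda>\<omega>. (hit0 (\<lambda>t. B t \<omega>) T, B (hit0 (\<lambda>t. B t \<omega>) T) \<omega>)) \<in> borel_measurable M"
    and "0 < K \<Longrightarrow> norm ((LINT \<omega>|M. trunc K (bexp a b (hit0 (\<lambda>t. B t \<omega>) T) (B (hit0 (\<lambda>t. B t \<omega>) T) \<omega>))) - bexp a b 0 x)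
      \<le> exp (\<bar>growth_rate a b\<bar> * T) * norm (bexp (of_real (2 * Re a)) (of_real (2 * Re b)) 0 x) / K"
proof -
  define w where "w = (\<lambda>\<omega> t. B t \<omega>)"
  have M: "prob_space M" by (rule pbm_prob_space[OF pbm])
  have wc: "continuous_on {0..} (w \<omega>)" if "\<omega> \<in> space M" for \<omega>
    unfolding w_def by (rule pbm_continuous[OF pbm that])
  define C where "C = (\<lambda>K a b. exp (\<bar>growth_rate a b\<bar> * T) * norm (bexp (of_real (2 * Re a)) (of_real (2 * Re b)) 0 x) / K)"
  define G where "G = (\<lambda>K a b (y :: real \<times> real \<times> real). trunc K (bexp a b (fst y) (snd y)))"
  have Gc: "continuous_on UNIV (G K a b)" if "0 < K" for K a b
    unfolding G_def by (intro continuous_intros that)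
  have Gb: "norm (G K a b y) \<le> K" if "0 < K" for K a b y
    unfolding G_def by (rule norm_trunc_le[OF that])
  \<comment> \<open>Joint measurability of time and position together with the truncation bound.
    Both are inherited by pointwise limits of times, because the constant is the same for all
    times.\<close>
  define good where "good = (\<lambda>\<rho> :: 'w \<Rightarrow> real. (\<lambda>\<omega>. (\<rho> \<omega>, w \<omega> (\<rho> \<omega>))) \<in> borel_measurable M \<and>
      (\<forall>K a b. 0 < K \<longrightarrow> norm ((LINT \<omega>|M. G K a b (\<rho> \<omega>, w \<omega> (\<rho> \<omega>))) - bexp a b 0 x) \<le> C K a b))"
  have lim: "good \<rho>"
    if g: "\<And>n. good (\<rho>n n)" and l: "\<And>\<omega>. \<omega> \<in> space M \<Longrightarrow> (\<lambda>n. \<rho>n n \<omega>) \<longlonglongrightarrow> \<rho> \<omega>"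
      and p: "\<And>n \<omega>. \<omega> \<in> space M \<Longrightarrow> 0 \<le> \<rho>n n \<omega>" for \<rho>n \<rho>
  proof -
    have "(\<lambda>n. (\<rho>n n \<omega>, w \<omega> (\<rho>n n \<omega>))) \<longlonglongrightarrow> (\<rho> \<omega>, w \<omega> (\<rho> \<omega>))" if \<omega>: "\<omega> \<in> space M" for \<omega>
    proof (intro tendsto_Pair l[OF \<omega>])
      have "0 \<le> \<rho> \<omega>" using LIMSEQ_le_const[OF l[OF \<omega>]] p[OF \<omega>] by blast
      then show "(\<lambda>n. w \<omega> (\<rho>n n \<omega>)) \<longlonglongrightarrow> w \<omega> (\<rho> \<omega>)"
        using p[OF \<omega>] by (intro continuous_on_tendsto_compose[OF wc[OF \<omega>] l[OF \<omega>]]) auto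
    qed
    note * = expectation_limit_bound[where Y = "\<lambda>n \<omega>. (\<rho>n n \<omega>, w \<omega> (\<rho>n n \<omega>))" and Z = "\<lambda>\<omega>. (\<rho> \<omega>, w \<omega> (\<rho> \<omega>))", OF M _ this]
    show ?thesis unfolding good_def
      using g *(1) by (auto simp: good_def intro!: *(2)[OF _ _ Gc Gb])
  qed
  have g1: "good (\<lambda>\<omega>. hit (w \<omega>) ({e..} \<times> {e..}) d T)" if d: "0 \<le> d" "d \<le> T" and e: "0 < e" for d e
  proof (rule lim)
    let ?\<sigma> = "\<lambda>n \<omega>. real (LEAST i. 2 ^ n \<le> i \<or> \<not> (real i * (T / 2 ^ n) < d \<or>
      w \<omega> (real i * (T / 2 ^ n)) \<in> {e..} \<times> {e..})) * (T / 2 ^ n)"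
    show "good (?\<sigma> n)" for n
      unfolding good_def
    proof (intro conjI allI impI)
      show "(\<lambda>\<omega>. (?\<sigma> n \<omega>, w \<omega> (?\<sigma> n \<omega>))) \<in> borel_measurable M"
        unfolding w_def by (rule discrete_stop_bound(1)[OF pbm d T e zero_less_one])
      show "norm ((LINT \<omega>|M. G K a b (?\<sigma> n \<omega>, w \<omega> (?\<sigma> n \<omega>))) - bexp a b 0 x) \<le> C K a b" if "0 < K" for K a b
        unfolding G_def w_def C_def fst_conv snd_conv by (rule discrete_stop_bound(2)[OF pbm d T e that])
    qed
    show "(\<lambda>n. ?\<sigma> n \<omega>) \<longlonglongrightarrow> hit (w \<omega>) ({e..} \<times> {e..}) d T" if "\<omega> \<in> space M" for \<omega>
      by (rule grid_hit_tendsto[OF wc[OF that] d T]) (intro closed_Times closed_atLeast)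
    show "0 \<le> ?\<sigma> n \<omega>" for n \<omega> using T by simp
  qed
  have g2: "good (\<lambda>\<omega>. hit (w \<omega>) open_quadrant d T)" if d: "0 \<le> d" "d \<le> T" for d
    by (rule lim[OF g1[OF d] hit_shrink_tendsto[OF wc d]]) (use hit_ge[OF d(2)] d in \<open>auto intro: order_trans\<close>)
  have "good (\<lambda>\<omega>. hit0 (w \<omega>) T)"
  proof (rule lim[OF g2 hit_start_tendsto[OF T]])
    fix n :: nat and \<omega>
    show d: "0 \<le> T / real (n + 2)" "T / real (n + 2) \<le> T" using T by (auto simp: field_simps)
    show "0 \<le> hit (w \<omega>) open_quadrant (T / real (n + 2)) T" using hit_ge[OF d(2)] d(1) by (rule order_trans[rotated])
  qed
  then show "(\<lambda>\<omega>. (hit0 (\<lambda>t. B t \<omega>) T, B (hit0 (\<lambda>t. B t \<omega>) T) \<omega>)) \<in> borel_measurable M"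
    and "0 < K \<Longrightarrow> norm ((LINT \<omega>|M. trunc K (bexp a b (hit0 (\<lambda>t. B t \<omega>) T) (B (hit0 (\<lambda>t. B t \<omega>) T) \<omega>))) - bexp a b 0 x)
      \<le> exp (\<bar>growth_rate a b\<bar> * T) * norm (bexp (of_real (2 * Re a)) (of_real (2 * Re b)) 0 x) / K"
    unfolding good_def G_def w_def C_def by auto
qed

text \<open>The sign conditions make the exponential at most 1 in modulus on the closed quadrant at
  nonnegative times. Truncation at \<open>K \<ge> 1\<close> is then invisible, and the error bound
  vanishes as \<open>K\<close> grows.\<close>

lemma stopped_expectation:
  fixes M :: "'w measure"
  assumes pbm: "planar_brownian_motion M x B" and x: "x \<in> quadrant" and T: "0 < T"
    and ab: "Re a \<le> 0" "Re b \<le> 0" "0 \<le> Re (a\<^sup>2 + b\<^sup>2)"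
  shows "AE \<omega> in M. norm (bexp a b (hit0 (\<lambda>t. B t \<omega>) T) (B (hit0 (\<lambda>t. B t \<omega>) T) \<omega>)) \<le> 1"
    and "(LINT \<omega>|M. bexp a b (hit0 (\<lambda>t. B t \<omega>) T) (B (hit0 (\<lambda>t. B t \<omega>) T) \<omega>)) = bexp a b 0 x"
proof -
  let ?h = "\<lambda>\<omega>. bexp a b (hit0 (\<lambda>t. B t \<omega>) T) (B (hit0 (\<lambda>t. B t \<omega>) T) \<omega>)"
  show le: "AE \<omega> in M. norm (?h \<omega>) \<le> 1"
    using pbm_start[OF pbm] AE_space
  proof eventually_elim
    case (elim \<omega>)
    have q: "B (hit0 (\<lambda>t. B t \<omega>) T) \<omega> \<in> quadrant"
      using hit0_in_quadrant[OF pbm_continuous[OF pbm elim(2)] _ T] elim x by simp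
    have "0 \<le> hit0 (\<lambda>t. B t \<omega>) T" using hit0_ge T by simp
    then have "Re a * fst (B (hit0 (\<lambda>t. B t \<omega>) T) \<omega>) + Re b * snd (B (hit0 (\<lambda>t. B t \<omega>) T) \<omega>)
        - Re (a\<^sup>2 + b\<^sup>2) / 2 * hit0 (\<lambda>t. B t \<omega>) T \<le> 0 + 0 - 0"
      using ab q by (intro diff_mono add_mono mult_nonpos_nonneg mult_nonneg_nonneg) (auto simp: quadrant_def)
    then show ?case by (simp only: norm_bexp) simp
  qed
  define C where "C = exp (\<bar>growth_rate a b\<bar> * T) * norm (bexp (of_real (2 * Re a)) (of_real (2 * Re b)) 0 x)"
  note m = stopped_bound(1)[OF pbm T]
  have hm[measurable]: "?h \<in> borel_measurable M"
  proof -
    have "(\<lambda>y. bexp a b (fst y) (snd y)) \<in> borel_measurable borel"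
      by (intro borel_measurable_continuous_onI continuous_intros)
    from measurable_compose[OF m this] show ?thesis by simp
  qed
  have b: "norm ((LINT \<omega>|M. ?h \<omega>) - bexp a b 0 x) \<le> C / K" if K: "1 \<le> K" for K
  proof -
    have [measurable]: "trunc K \<in> borel_measurable borel"
      using K by (intro borel_measurable_continuous_onI continuous_intros) auto
    have "(LINT \<omega>|M. ?h \<omega>) = (LINT \<omega>|M. trunc K (?h \<omega>))"
    proof (rule integral_cong_AE)
      show "AE \<omega> in M. ?h \<omega> = trunc K (?h \<omega>)" using le by eventually_elim (use K in \<open>simp add: trunc_eq\<close>)
    qed measurable
    then show ?thesis using stopped_bound(2)[OF pbm T, of K a b] K by (simp add: C_def)
  qed
  have "(\<lambda>n. C / real n) \<longlonglongrightarrow> 0" by real_asymp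
  moreover have "eventually (\<lambda>n. norm ((LINT \<omega>|M. ?h \<omega>) - bexp a b 0 x) \<le> C / real n) sequentially"
    using eventually_ge_at_top[of 1] by eventually_elim (use b in auto)
  ultimately have "norm ((LINT \<omega>|M. ?h \<omega>) - bexp a b 0 x) \<le> 0"
    by (intro tendsto_le[OF _ _ tendsto_const]) auto
  then show "(LINT \<omega>|M. ?h \<omega>) = bexp a b 0 x" by simp
qed

section \<open>The exit law on holomorphic exponentials\<close>

text \<open>Letting the horizon tend to infinity turns the capped exit into the exit itself,
  provided that the path exits almost surely; that in turn follows from the martingales with a real
  parameter in the first coordinate only.\<close>

lemma exit_law_props:
  fixes M :: "'w measure"
  assumes pbm: "planar_brownian_motion M x B" and x: "x \<in> quadrant"
  shows "prob_space (exit_law M B)" and "AE y in exit_law M B. y \<in> E"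
    and "\<And>z. 0 \<le> Re z \<Longrightarrow> Im z \<le> 0 \<Longrightarrow>
      (LINT y|exit_law M B. exp (- z * Complex (fst y) (snd y))) = exp (- z * Complex (fst x) (snd x))"
proof -
  interpret prob_space M by (rule pbm_prob_space[OF pbm])
  define w where "w = (\<lambda>\<omega> t. B t \<omega>)"
  define \<tau> where "\<tau> = (\<lambda>n \<omega>. hit0 (w \<omega>) (real n))"
  define X where "X = (\<lambda>\<omega>. exit_point (w \<omega>))"
  define ex where "ex = (\<lambda>\<omega>. \<exists>t>0. w \<omega> t \<notin> open_quadrant)"
  have wc: "continuous_on {0..} (w \<omega>)" if "\<omega> \<in> space M" for \<omega>
    unfolding w_def by (rule pbm_continuous[OF pbm that])
  have m: "(\<lambda>\<omega>. (\<tau> n \<omega>, w \<omega> (\<tau> n \<omega>))) \<in> borel_measurable M" if "0 < n" for n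
    using stopped_bound(1)[OF pbm, of "real n"] that by (simp add: \<tau>_def w_def)
  have m1[measurable]: "(\<tau> (Suc n)) \<in> borel_measurable M" for n
    using measurable_compose[OF m[of "Suc n"] borel_measurable_continuous_onI[OF continuous_on_fst[OF continuous_on_id]]] by simp
  have m2[measurable]: "(\<lambda>\<omega>. w \<omega> (\<tau> (Suc n) \<omega>)) \<in> borel_measurable M" for n
    using measurable_compose[OF m[of "Suc n"] borel_measurable_continuous_onI[OF continuous_on_snd[OF continuous_on_id]]] by simp
  have ev: "eventually (\<lambda>n. \<tau> (Suc n) \<omega> = exit_time (w \<omega>) \<and> exit_time (w \<omega>) < real (Suc n)) sequentially"
    if "ex \<omega>" for \<omega>
    using exit_hit0[of "w \<omega>"] that unfolding ex_def \<tau>_def by (subst eventually_sequentially_Suc) simp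
  have nev: "\<tau> n \<omega> = real n" if "\<not> ex \<omega>" for n \<omega>
    using hit0_no_exit that unfolding ex_def \<tau>_def by blast
  \<comment> \<open>A capped time below its horizon signals a genuine exit. The alternative value 0
    is the point assigned to paths that never leave, so the limit is correct on every path and shows
    the measurability of the exit point.\<close>
  have Xl: "(\<lambda>n. if \<tau> (Suc n) \<omega> < real (Suc n) then w \<omega> (\<tau> (Suc n) \<omega>) else 0) \<longlonglongrightarrow> X \<omega>" for \<omega>
  proof (cases "ex \<omega>")
    case True
    show ?thesis
      by (rule tendsto_eventually, use ev[OF True] in eventually_elim)
        (use True in \<open>auto simp: X_def exit_point_def ex_def\<close>)
  next
    case False
    then have "exit_point (w \<omega>) = (0, 0)" by (auto simp: exit_point_def ex_def)
    then show ?thesis using False by (simp add: nev X_def zero_prod_def)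
  qed
  have Xm[measurable]: "X \<in> borel_measurable M"
    by (rule borel_measurable_LIMSEQ_metric[OF _ Xl]) measurable
  have exl: "(\<lambda>n. if \<tau> (Suc n) \<omega> < real (Suc n) then 1 else 0 :: real) \<longlonglongrightarrow> indicator {\<omega>. ex \<omega>} \<omega>" for \<omega>
  proof (cases "ex \<omega>")
    case True
    show ?thesis
      by (rule tendsto_eventually, use ev[OF True] in eventually_elim) (use True in auto)
  qed (simp add: nev)
  have exm: "(indicator {\<omega>. ex \<omega>} :: 'w \<Rightarrow> real) \<in> borel_measurable M"
    by (rule borel_measurable_LIMSEQ_metric[OF _ exl]) measurable
  have exs: "{\<omega>\<in>space M. ex \<omega>} \<in> sets M"
  proof -
    have "(indicator {\<omega>. ex \<omega>} :: 'w \<Rightarrow> real) -` {1} \<inter> space M \<in> sets M" by (rule measurable_sets[OF exm]) simp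
    moreover have "(indicator {\<omega>. ex \<omega>} :: 'w \<Rightarrow> real) -` {1} \<inter> space M = {\<omega>\<in>space M. ex \<omega>}"
      by (auto simp: indicator_eq_1_iff)
    ultimately show ?thesis by (simp only:)
  qed
  have law: "exit_law M B = distr M borel X" by (simp add: exit_law_def X_def w_def)
  show "prob_space (exit_law M B)" unfolding law by (rule prob_space_distr) measurable
  have E: "E \<in> sets borel"
    unfolding E_def using closed_quadrant open_open_quadrant by (intro sets.Diff borel_closed borel_open)
  show "AE y in exit_law M B. y \<in> E"
    unfolding law
  proof (subst AE_distr_iff)
    show "AE \<omega> in M. X \<omega> \<in> E"
      using pbm_start[OF pbm] AE_space
      by eventually_elim (use exit_point_in_E[OF wc] x in \<open>auto simp: X_def w_def\<close>)
  qed (use E in auto)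
  have st: "AE \<omega> in M. norm (bexp a b (\<tau> (Suc n) \<omega>) (w \<omega> (\<tau> (Suc n) \<omega>))) \<le> 1"
    and se: "(LINT \<omega>|M. bexp a b (\<tau> (Suc n) \<omega>) (w \<omega> (\<tau> (Suc n) \<omega>))) = bexp a b 0 x"
    if "Re a \<le> 0" "Re b \<le> 0" "0 \<le> Re (a\<^sup>2 + b\<^sup>2)" for a b n
    using stopped_expectation[OF pbm x _ that, of "real (Suc n)"] unfolding \<tau>_def w_def by (auto simp del: of_nat_Suc)
  have bm[measurable]: "(\<lambda>\<omega>. bexp a b (\<tau> (Suc n) \<omega>) (w \<omega> (\<tau> (Suc n) \<omega>))) \<in> borel_measurable M" for a b n
  proof -
    have "(\<lambda>y. bexp a b (fst y) (snd y)) \<in> borel_measurable borel"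
      by (intro borel_measurable_continuous_onI continuous_intros)
    from measurable_compose[OF m[of "Suc n"] this] show ?thesis by simp
  qed
  have exit_ae: "AE \<omega> in M. ex \<omega>"
  proof -
    \<comment> \<open>The martingale with \<open>a = - l\<close>, \<open>b = 0\<close> is at most 1
      almost surely at the stop, and on a path that never exits it is at most
      \<open>exp (- (l\<^sup>2 / 2 * real (Suc n)))\<close>. Sending \<open>n\<close> to infinity
      and then \<open>l\<close> to 0 forces probability 1.\<close>
    have ge: "exp (- l * fst x) \<le> prob {\<omega>\<in>space M. ex \<omega>}" if l: "0 < l" for l
    proof -
      let ?a = "- complex_of_real l"
      have ab: "Re ?a \<le> 0" "Re (0::complex) \<le> 0" "0 \<le> Re (?a\<^sup>2 + 0\<^sup>2)" using l by auto
      have sq: "Re (?a\<^sup>2 + 0\<^sup>2) = l\<^sup>2" by simp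
      let ?h = "\<lambda>n \<omega>. bexp ?a 0 (\<tau> (Suc n) \<omega>) (w \<omega> (\<tau> (Suc n) \<omega>))"
      have norm_se: "exp (- l * fst x) \<le> prob {\<omega>\<in>space M. ex \<omega>} + exp (- (l\<^sup>2 / 2 * real (Suc n)))" for n
      proof -
        have "exp (- l * fst x) = norm (LINT \<omega>|M. ?h n \<omega>)"
          unfolding se[OF ab] norm_bexp by simp
        also have "\<dots> \<le> (LINT \<omega>|M. norm (?h n \<omega>))" by (rule integral_norm_bound)
        also have "\<dots> \<le> (LINT \<omega>|M. indicator {\<omega>\<in>space M. ex \<omega>} \<omega> + exp (- (l\<^sup>2 / 2 * real (Suc n))))"
        proof (rule integral_mono_AE)
          show "integrable M (\<lambda>\<omega>. norm (?h n \<omega>))"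
            using st[OF ab, of n] by (intro integrable_norm integrable_const_bound[where B = 1]) auto
          show "integrable M (\<lambda>\<omega>. indicator {\<omega>\<in>space M. ex \<omega>} \<omega> + exp (- (l\<^sup>2 / 2 * real (Suc n))))"
            using exs by (intro Bochner_Integration.integrable_add integrable_const integrable_real_indicator) (auto simp: emeasure_eq_measure)
          show "AE \<omega> in M. norm (?h n \<omega>) \<le> indicator {\<omega>\<in>space M. ex \<omega>} \<omega> + exp (- (l\<^sup>2 / 2 * real (Suc n)))"
            using st[OF ab, of n] AE_space pbm_start[OF pbm]
          proof eventually_elim
            case (elim \<omega>)
            show ?case
            proof (cases "ex \<omega>")
              case True
              then show ?thesis using elim by (simp add: add_increasing2)
            next
              case False
              have "w \<omega> (hit0 (w \<omega>) (real (Suc n))) \<in> quadrant"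
                by (rule hit0_in_quadrant[OF wc[OF elim(2)]]) (use elim(3) x in \<open>simp_all add: w_def\<close>)
              then have "0 \<le> l * fst (w \<omega> (real (Suc n)))"
                using nev[OF False, of "Suc n"] l by (auto simp: \<tau>_def quadrant_def mem_Times_iff simp del: of_nat_Suc)
              then have "norm (?h n \<omega>) \<le> exp (- (l\<^sup>2 / 2 * real (Suc n)))"
                unfolding norm_bexp nev[OF False] sq by simp
              then show ?thesis using False by simp
            qed
          qed
        qed
        also have "\<dots> = prob {\<omega>\<in>space M. ex \<omega>} + exp (- (l\<^sup>2 / 2 * real (Suc n)))"
          using exs by (subst Bochner_Integration.integral_add)
            (auto intro!: integrable_real_indicator simp: emeasure_eq_measure prob_space)
        finally show ?thesis .
      qed
      have "(\<lambda>n. prob {\<omega>\<in>space M. ex \<omega>} + exp (- (l\<^sup>2 / 2 * real (Suc n)))) \<longlonglongrightarrow> prob {\<omega>\<in>space M. ex \<omega>} + 0"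
        using l by (intro tendsto_add tendsto_const) real_asymp
      then show ?thesis using norm_se by (intro LIMSEQ_le_const[of _ "prob {\<omega>\<in>space M. ex \<omega>}"]) auto
    qed
    have "(\<lambda>n. exp (- inverse (real (Suc n)) * fst x)) \<longlonglongrightarrow> exp (- 0 * fst x)"
      by (intro tendsto_intros LIMSEQ_inverse_real_of_nat)
    then have "1 \<le> prob {\<omega>\<in>space M. ex \<omega>}"
      using ge by (intro LIMSEQ_le_const2[of "\<lambda>n. exp (- inverse (real (Suc n)) * fst x)"]) (auto simp del: of_nat_Suc)
    then have "prob {\<omega>\<in>space M. ex \<omega>} = 1" using prob_le_1 by (rule antisym[rotated])
    then show ?thesis using prob_Collect_eq_1[OF exs] by simp
  qed
  fix z assume z: "0 \<le> Re z" "Im z \<le> 0"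
  \<comment> \<open>With \<open>a = - z\<close> and \<open>b = \<i> * a\<close> the sum of squares
    vanishes, so the time factor of \<open>bexp\<close> disappears and the holomorphic exponential
    remains.\<close>
  have ab: "Re (- z) \<le> 0" "Re (- \<i> * z) \<le> 0" "0 \<le> Re ((- z)\<^sup>2 + (- \<i> * z)\<^sup>2)" using z by (auto simp: power_mult_distrib)
  have be: "bexp (- z) (- \<i> * z) t y = exp (- z * Complex (fst y) (snd y))" for t y
    by (simp add: bexp_def Complex_eq power_mult_distrib algebra_simps)
  have em[measurable]: "(\<lambda>y :: real \<times> real. exp (- z * Complex (fst y) (snd y))) \<in> borel_measurable borel"
    unfolding Complex_eq by (intro borel_measurable_continuous_onI continuous_intros)
  have "(\<lambda>n. LINT \<omega>|M. bexp (- z) (- \<i> * z) (\<tau> (Suc n) \<omega>) (w \<omega> (\<tau> (Suc n) \<omega>))) \<longlonglongrightarrow>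
      (LINT \<omega>|M. exp (- z * Complex (fst (X \<omega>)) (snd (X \<omega>))))"
  proof (rule integral_dominated_convergence[where w = "\<lambda>_. 1"])
    show "AE \<omega> in M. (\<lambda>n. bexp (- z) (- \<i> * z) (\<tau> (Suc n) \<omega>) (w \<omega> (\<tau> (Suc n) \<omega>))) \<longlonglongrightarrow>
        exp (- z * Complex (fst (X \<omega>)) (snd (X \<omega>)))"
      using exit_ae
    proof eventually_elim
      case (elim \<omega>)
      show ?case unfolding be
        by (rule tendsto_eventually, use ev[OF elim] in eventually_elim)
          (use elim in \<open>auto simp: X_def exit_point_def ex_def\<close>)
    qed
  qed (use st[OF ab] measurable_compose[OF Xm em] in auto)
  then have "(LINT \<omega>|M. exp (- z * Complex (fst (X \<omega>)) (snd (X \<omega>)))) = exp (- z * Complex (fst x) (snd x))"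
    unfolding se[OF ab] by (simp only: be LIMSEQ_const_iff)
  then show "(LINT y|exit_law M B. exp (- z * Complex (fst y) (snd y))) = exp (- z * Complex (fst x) (snd x))"
    unfolding law using em by (subst integral_distr) simp_all
qed

section \<open>Density of exponentials on the boundary\<close>

definition cx :: "real \<times> real \<Rightarrow> complex"
  where "cx x = Complex (fst x) (snd x)"

definition hexp :: "complex \<Rightarrow> real \<times> real \<Rightarrow> complex"
  where "hexp z x = exp (- z * cx x)"

text \<open>The open fourth quadrant, so that \<open>hexp z\<close> decays along both half-axes; 0
  is adjoined for the constants.\<close>

definition Z :: "complex set"
  where "Z = {z. z = 0 \<or> (0 < Re z \<and> Im z < 0)}"

lemma cx_simps [simp]: "Re (cx x) = fst x" "Im (cx x) = snd x"
  by (simp_all add: cx_def)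

lemma continuous_on_cx [continuous_intros]: "continuous_on A f \<Longrightarrow> continuous_on A (\<lambda>x. cx (f x))"
  unfolding cx_def Complex_eq by (intro continuous_intros)

lemma continuous_on_hexp [continuous_intros]: "continuous_on A f \<Longrightarrow> continuous_on A (\<lambda>x. hexp z (f x))"
  unfolding hexp_def by (intro continuous_intros)

lemma E_iff: "x \<in> E \<longleftrightarrow> 0 \<le> fst x \<and> 0 \<le> snd x \<and> (fst x = 0 \<or> snd x = 0)"
  by (cases x) (auto simp: E_def quadrant_def open_quadrant_def)

lemma E_subset_quadrant: "E \<subseteq> quadrant"
  by (auto simp: E_def)

lemma Z_add: "z \<in> Z \<Longrightarrow> w \<in> Z \<Longrightarrow> z + w \<in> Z"
  by (auto simp: Z_def)

lemma Z_scale: "z \<in> Z \<Longrightarrow> 0 \<le> r \<Longrightarrow> of_real r * z \<in> Z"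
  by (auto simp: Z_def mult_pos_neg)

lemma norm_hexp: "norm (hexp z x) = exp (- (Re z * fst x - Im z * snd x))"
  by (simp add: hexp_def)

lemma norm_hexp_le_1:
  assumes "z \<in> Z" "x \<in> quadrant"
  shows "norm (hexp z x) \<le> 1"
proof -
  have "Im z * snd x \<le> 0" "0 \<le> Re z * fst x"
    using assms by (auto simp: Z_def quadrant_def mult_nonpos_nonneg)
  then show ?thesis by (simp add: norm_hexp)
qed

text \<open>Closed under products, since \<open>Z\<close> is closed under addition. The larger set
  \<open>core\<close> has the conjugates, but is only a linear space.\<close>

inductive_set expsp :: "(real \<times> real \<Rightarrow> complex) set" where
  exp: "z \<in> Z \<Longrightarrow> (\<lambda>x. c * hexp z x) \<in> expsp"
| add: "f \<in> expsp \<Longrightarrow> g \<in> expsp \<Longrightarrow> (\<lambda>x. f x + g x) \<in> expsp"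

inductive_set core :: "(real \<times> real \<Rightarrow> complex) set" where
  exp: "z \<in> Z \<Longrightarrow> (\<lambda>x. c * hexp z x) \<in> core"
| cnj: "z \<in> Z \<Longrightarrow> (\<lambda>x. c * cnj (hexp z x)) \<in> core"
| add: "f \<in> core \<Longrightarrow> g \<in> core \<Longrightarrow> (\<lambda>x. f x + g x) \<in> core"

text \<open>Uniform closure on \<open>E\<close>. Values off \<open>E\<close> are ignored, so the
  approximants may be functions on the whole plane and the limits need not be extensional.\<close>

definition ucl :: "(real \<times> real \<Rightarrow> complex) set \<Rightarrow> (real \<times> real \<Rightarrow> complex) set"
  where "ucl V = {f. \<forall>e>0. \<exists>g\<in>V. \<forall>x\<in>E. norm (f x - g x) \<le> e}"

lemma uclI: "(\<And>e. 0 < e \<Longrightarrow> \<exists>g\<in>V. \<forall>x\<in>E. norm (f x - g x) \<le> e) \<Longrightarrow> f \<in> ucl V"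
  by (simp add: ucl_def)

lemma uclE: "f \<in> ucl V \<Longrightarrow> 0 < e \<Longrightarrow> (\<And>g. g \<in> V \<Longrightarrow> (\<And>x. x \<in> E \<Longrightarrow> norm (f x - g x) \<le> e) \<Longrightarrow> thesis) \<Longrightarrow> thesis"
  unfolding ucl_def by blast

lemma ucl_subset: "V \<subseteq> ucl V"
  by (force simp: ucl_def)

lemma ucl_ucl:
  assumes "\<And>e. 0 < e \<Longrightarrow> \<exists>g\<in>ucl V. \<forall>x\<in>E. norm (f x - g x) \<le> e"
  shows "f \<in> ucl V"
proof (rule uclI)
  fix e :: real assume e: "0 < e"
  obtain g where g: "g \<in> ucl V" "\<And>x. x \<in> E \<Longrightarrow> norm (f x - g x) \<le> e / 2"
    using assms[of "e / 2"] e by auto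
  obtain h where h: "h \<in> V" "\<And>x. x \<in> E \<Longrightarrow> norm (g x - h x) \<le> e / 2"
    using uclE[OF g(1), of "e / 2"] e by auto
  have "norm (f x - h x) \<le> e" if "x \<in> E" for x
    using norm_triangle_ineq[of "f x - g x" "g x - h x"] g(2)[OF that] h(2)[OF that] by simp
  then show "\<exists>g\<in>V. \<forall>x\<in>E. norm (f x - g x) \<le> e" by (rule bexI[OF ballI h(1)])
qed

lemma ucl_add:
  assumes V: "\<And>f g. f \<in> V \<Longrightarrow> g \<in> V \<Longrightarrow> (\<lambda>x. f x + g x) \<in> V"
    and f: "f \<in> ucl V" and g: "g \<in> ucl V"
  shows "(\<lambda>x. f x + g x) \<in> ucl V"
proof (rule uclI)
  fix e :: real assume e: "0 < e"
  obtain f' where f': "f' \<in> V" "\<And>x. x \<in> E \<Longrightarrow> norm (f x - f' x) \<le> e / 2"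
    using uclE[OF f, of "e / 2"] e by auto
  obtain g' where g': "g' \<in> V" "\<And>x. x \<in> E \<Longrightarrow> norm (g x - g' x) \<le> e / 2"
    using uclE[OF g, of "e / 2"] e by auto
  have "norm (f x + g x - (f' x + g' x)) \<le> e" if "x \<in> E" for x
    using norm_triangle_ineq[of "f x - f' x" "g x - g' x"] f'(2)[OF that] g'(2)[OF that]
    by (simp add: algebra_simps)
  then show "\<exists>h\<in>V. \<forall>x\<in>E. norm (f x + g x - h x) \<le> e" by (rule bexI[OF ballI V[OF f'(1) g'(1)]])
qed

lemma expsp_bounded:
  assumes "f \<in> expsp"
  obtains K where "0 < K" "\<And>x. x \<in> E \<Longrightarrow> norm (f x) \<le> K"
proof -
  have "\<exists>K>0. \<forall>x\<in>E. norm (f x) \<le> K" using assms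
  proof induction
    case (exp z c)
    have "norm (c * hexp z x) \<le> norm c + 1" if "x \<in> E" for x
      using norm_hexp_le_1[OF exp, of x] that E_subset_quadrant
        mult_left_le[of "norm (hexp z x)" "norm c"] by (auto simp: norm_mult)
    then show ?case by (intro exI[of _ "norm c + 1"]) (auto simp: add_nonneg_pos)
  next
    case (add f g)
    then obtain K L where "K > 0" "L > 0" "\<forall>x\<in>E. norm (f x) \<le> K" "\<forall>x\<in>E. norm (g x) \<le> L" by auto
    then show ?case by (intro exI[of _ "K + L"]) (auto intro: norm_triangle_le add_mono)
  qed
  then show ?thesis using that by blast
qed

lemma expsp_mult:
  assumes "f \<in> expsp" "g \<in> expsp"
  shows "(\<lambda>x. f x * g x) \<in> expsp"
  using assms
proof (induction arbitrary: g)
  case (exp z c)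
  from exp(2) show ?case
  proof induction
    case (exp w d)
    have "(\<lambda>x. c * hexp z x * (d * hexp w x)) = (\<lambda>x. (c * d) * hexp (z + w) x)"
      by (simp add: hexp_def exp_add[symmetric] algebra_simps fun_eq_iff exp_diff exp_minus divide_inverse)
    then show ?case using expsp.exp[OF Z_add[OF \<open>z \<in> Z\<close> exp], of "c * d"] by simp
  next
    case (add f g)
    then show ?case using expsp.add[OF add.IH] by (simp add: distrib_left)
  qed
next
  case (add f h)
  then show ?case using expsp.add[OF add.IH(1)[OF add.prems] add.IH(2)[OF add.prems]] by (simp add: distrib_right)
qed

lemma expsp_const: "(\<lambda>x. c) \<in> expsp"
  using expsp.exp[of 0 c] by (simp add: Z_def hexp_def)

abbreviation "Aexp \<equiv> ucl expsp"

lemma Aexp_add: "f \<in> Aexp \<Longrightarrow> g \<in> Aexp \<Longrightarrow> (\<lambda>x. f x + g x) \<in> Aexp"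
  by (rule ucl_add) (rule expsp.add)

lemma Aexp_mult:
  assumes f: "f \<in> Aexp" and g: "g \<in> Aexp"
  shows "(\<lambda>x. f x * g x) \<in> Aexp"
proof (rule uclI)
  fix e :: real assume e: "0 < e"
  obtain f0 where f0: "f0 \<in> expsp" "\<And>x. x \<in> E \<Longrightarrow> norm (f x - f0 x) \<le> 1"
    using uclE[OF f, of 1] by auto
  obtain K0 where K0: "0 < K0" "\<And>x. x \<in> E \<Longrightarrow> norm (f0 x) \<le> K0" using expsp_bounded[OF f0(1)] by blast
  define K where "K = K0 + 1"
  have K: "0 < K" "\<And>x. x \<in> E \<Longrightarrow> norm (f x) \<le> K"
    using K0 f0(2) by (auto simp: K_def) (smt (verit) norm_triangle_sub)
  \<comment> \<open>The order of the choices matters: the bound \<open>L\<close> depends on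
    \<open>g'\<close>, so \<open>g\<close> is approximated first and \<open>f\<close> afterwards, to
    a precision depending on \<open>L\<close>.\<close>
  obtain g' where g': "g' \<in> expsp" "\<And>x. x \<in> E \<Longrightarrow> norm (g x - g' x) \<le> e / (2 * K)"
    using uclE[OF g, of "e / (2 * K)"] e K(1) by auto
  obtain L where L: "0 < L" "\<And>x. x \<in> E \<Longrightarrow> norm (g' x) \<le> L" using expsp_bounded[OF g'(1)] by blast
  obtain f' where f': "f' \<in> expsp" "\<And>x. x \<in> E \<Longrightarrow> norm (f x - f' x) \<le> e / (2 * L)"
    using uclE[OF f, of "e / (2 * L)"] e L(1) by auto
  have "norm (f x * g x - f' x * g' x) \<le> e" if x: "x \<in> E" for x
  proof -
    have "norm (f x * g x - f' x * g' x) = norm (f x * (g x - g' x) + (f x - f' x) * g' x)"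
      by (simp add: algebra_simps)
    also have "\<dots> \<le> norm (f x) * norm (g x - g' x) + norm (f x - f' x) * norm (g' x)"
      by (metis norm_mult norm_triangle_ineq)
    also have "\<dots> \<le> K * (e / (2 * K)) + e / (2 * L) * L"
      using K L g' f' x e by (intro add_mono mult_mono) auto
    also have "\<dots> = e" using K L by simp
    finally show ?thesis .
  qed
  then show "\<exists>h\<in>expsp. \<forall>x\<in>E. norm (f x * g x - h x) \<le> e"
    by (rule bexI[OF ballI expsp_mult[OF f'(1) g'(1)]])
qed

lemma Aexp_const: "(\<lambda>x. c) \<in> Aexp"
  using expsp_const ucl_subset by blast

lemma Aexp_power: "f \<in> Aexp \<Longrightarrow> (\<lambda>x. f x ^ n) \<in> Aexp"
  by (induction n) (simp_all add: Aexp_mult Aexp_const)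

lemma expsp_sum: "(\<And>k. k < N \<Longrightarrow> f k \<in> expsp) \<Longrightarrow> (\<lambda>x. \<Sum>k<N. f k x) \<in> expsp" for N :: nat
  by (induction N) (simp_all add: expsp_const expsp.add)

section \<open>Resolvent functions as limits of exponentials\<close>

lemma one_minus_exp_lower:
  fixes t :: complex
  assumes "0 < Re t"
  shows "Re t / (1 + Re t) \<le> norm (1 - exp (- t))"
proof -
  have "Re t / (1 + Re t) = 1 - 1 / (1 + Re t)" using assms by (simp add: field_simps)
  also have "\<dots> \<le> 1 - exp (- Re t)"
    using exp_ge_add_one_self[of "Re t"] assms by (simp add: exp_minus field_simps)
  also have "\<dots> \<le> norm (1 - exp (- t))"
    using norm_triangle_ineq2[of 1 "exp (- t)"] by simp
  finally show ?thesis .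
qed

text \<open>In a sector around the positive axis the two poles at 0 cancel. For
  \<open>Re t \<le> 1\<close> the numerator is at most \<open>3 * (norm t)\<^sup>2\<close>, by
  Taylor and \<open>exp 1 \<le> 3\<close>, and the denominator is at least
  \<open>norm t * Re t / 2\<close>, which gives \<open>6 * C\<close>. For larger \<open>Re t\<close>
  the terms are at most 2 and 1 in modulus.\<close>

lemma geometric_laplace_bound:
  fixes t :: complex
  assumes t: "0 < Re t" and C: "norm t \<le> C * Re t"
  shows "norm (1 / (1 - exp (- t)) - 1 / t) \<le> 6 * C + 3"
proof -
  have t0: "t \<noteq> 0" using t by auto
  have lo: "Re t / (1 + Re t) \<le> norm (1 - exp (- t))" by (rule one_minus_exp_lower[OF t])
  have lo0: "0 < Re t / (1 + Re t)" using t by simp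
  have e0: "1 - exp (- t) \<noteq> 0" using lo lo0 by auto
  have "0 < C * Re t" using t0 C by (metis less_le_trans zero_less_norm_iff)
  then have Cp: "0 < C" using t by (simp add: zero_less_mult_iff)
  show ?thesis
  proof (cases "Re t \<le> 1")
    case True
    have "norm (exp (- t) - (\<Sum>k\<le>1. (- t) ^ k / fact k)) \<le> exp \<bar>Re (- t)\<bar> * norm (- t) ^ Suc 1 / fact 1"
      by (rule Taylor_exp)
    then have "norm (exp (- t) - (1 - t)) \<le> exp (Re t) * (norm t)\<^sup>2"
      using t by (simp add: numeral_2_eq_2)
    also have "\<dots> \<le> 3 * (norm t)\<^sup>2"
      using True exp_le by (intro mult_right_mono order_trans[OF _ exp_le]) auto
    finally have num: "norm (exp (- t) - (1 - t)) \<le> 3 * (norm t)\<^sup>2" .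
    have "Re t / 2 \<le> Re t / (1 + Re t)" using t True by (intro divide_left_mono) auto
    then have den: "Re t / 2 \<le> norm (1 - exp (- t))" by (rule order_trans[OF _ lo])
    have "1 / (1 - exp (- t)) - 1 / t = (exp (- t) - (1 - t)) / (t * (1 - exp (- t)))"
    proof -
      have "1 / u - 1 / t = (t - u) / (t * u)" if "u \<noteq> 0" for u using that t0 by (simp add: field_simps)
      from this[OF e0] show ?thesis by (simp add: algebra_simps)
    qed
    then have "norm (1 / (1 - exp (- t)) - 1 / t) = norm (exp (- t) - (1 - t)) / (norm t * norm (1 - exp (- t)))"
      by (simp add: norm_divide norm_mult)
    also have "\<dots> \<le> 3 * (norm t)\<^sup>2 / (norm t * (Re t / 2))"
      using num den t t0 by (intro frac_le mult_left_mono) auto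
    also have "\<dots> = 6 * (norm t / Re t)" using t0 t by (simp add: power2_eq_square)
    also have "norm t / Re t \<le> C" using C t by (simp add: field_simps)
    finally show ?thesis by simp
  next
    case False
    have "1 / 2 \<le> Re t / (1 + Re t)" using False by (simp add: field_simps)
    then have "1 / 2 \<le> norm (1 - exp (- t))" by (rule order_trans[OF _ lo])
    then have "norm (1 / (1 - exp (- t))) \<le> 2" using e0 by (simp add: norm_divide field_simps)
    moreover have "1 \<le> norm t" using False complex_Re_le_cmod[of t] by simp
    then have "norm (1 / t) \<le> 1" using t0 by (simp add: norm_divide field_simps)
    ultimately have "norm (1 / (1 - exp (- t)) - 1 / t) \<le> 3"
      using norm_triangle_ineq4[of "1 / (1 - exp (- t))" "1 / t"] by linarith
    then show ?thesis using Cp by simp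
  qed
qed

text \<open>The geometric series in \<open>hexp z\<close>, scaled by \<open>z\<close>, is a Riemann sum of the Laplace integral of
  \<open>1 / (cx x + \<zeta>)\<close>.\<close>

lemma Aexp_geometric:
  assumes z: "z \<in> Z" and s: "0 < Re (z * \<zeta>)"
  shows "(\<lambda>x. 1 / (1 - exp (- (z * (cx x + \<zeta>))))) \<in> Aexp"
proof (rule uclI)
  fix e :: real assume e: "0 < e"
  define q where "q = (\<lambda>x. exp (- (z * (cx x + \<zeta>))))"
  define r where "r = exp (- Re (z * \<zeta>))"
  have r: "0 < r" "r < 1" using s by (auto simp: r_def)
  have q: "q x = exp (- (z * \<zeta>)) * hexp z x" for x
    by (simp add: q_def hexp_def exp_add[symmetric] algebra_simps)
  have qr: "norm (q x) \<le> r" if "x \<in> E" for x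
    using norm_hexp_le_1[OF z, of x] that E_subset_quadrant by (auto simp: q norm_mult r_def)
  have "(\<lambda>n. r ^ n / (1 - r)) \<longlonglongrightarrow> 0 / (1 - r)"
    using r by (intro tendsto_intros LIMSEQ_realpow_zero) auto
  then have "eventually (\<lambda>n. r ^ n / (1 - r) < e) sequentially"
    by (rule order_tendstoD) (use e in simp)
  then obtain N where N: "r ^ N / (1 - r) < e" by (auto simp: eventually_sequentially)
  have sum: "(\<lambda>x. \<Sum>k<N. q x ^ k) \<in> expsp"
  proof (rule expsp_sum)
    fix k
    have "(\<lambda>x. q x ^ k) = (\<lambda>x. exp (- (z * \<zeta>)) ^ k * hexp (of_real (real k) * z) x)"
      by (auto simp: q power_mult_distrib hexp_def exp_of_nat_mult[symmetric] mult_ac)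
    then show "(\<lambda>x. q x ^ k) \<in> expsp"
      using expsp.exp[OF Z_scale[OF z, of "real k"]] by simp
  qed
  have "norm (1 / (1 - q x) - (\<Sum>k<N. q x ^ k)) \<le> e" if x: "x \<in> E" for x
  proof -
    have "q x \<noteq> 1" using qr[OF x] r by auto
    then have "1 / (1 - q x) - (\<Sum>k<N. q x ^ k) = q x ^ N / (1 - q x)"
      by (simp add: sum_gp_strict field_simps)
    then have "norm (1 / (1 - q x) - (\<Sum>k<N. q x ^ k)) = norm (q x) ^ N / norm (1 - q x)"
      by (simp add: norm_divide norm_power)
    also have "\<dots> \<le> r ^ N / (1 - r)"
      using qr[OF x] r norm_triangle_ineq2[of 1 "q x"] by (intro frac_le power_mono) auto
    finally show ?thesis using N by simp
  qed
  then show "\<exists>g\<in>expsp. \<forall>x\<in>E. norm (1 / (1 - exp (- (z * (cx x + \<zeta>)))) - g x) \<le> e"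
    unfolding q_def by (rule bexI[OF ballI sum[unfolded q_def]])
qed

text \<open>For \<open>x\<close> in \<open>E\<close> the numbers \<open>z * (cx x + \<zeta>)\<close>
  stay in one sector, so the Riemann sums with step \<open>h\<close> converge to the Laplace
  integral uniformly on \<open>E\<close>, with an error linear in \<open>h\<close>.\<close>

lemma Aexp_laplace:
  assumes z: "z \<in> Z" and s: "0 < Re (z * \<zeta>)"
  shows "(\<lambda>x. 1 / (cx x + \<zeta>)) \<in> Aexp"
proof (rule ucl_ucl)
  fix e :: real assume e: "0 < e"
  have z0: "z \<noteq> 0" using s by auto
  then have zp: "0 < Re z" "0 < - Im z" using z by (auto simp: Z_def)
  define m where "m = min (Re z) (- Im z)"
  have m: "0 < m" using zp by (simp add: m_def)
  define \<delta> where "\<delta> = Re (z * \<zeta>)"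
  \<comment> \<open>The opening of the sector: \<open>Re (z * cx x)\<close> is at least
    \<open>m\<close> times the distance of \<open>x\<close> from the origin, and
    \<open>\<zeta>\<close> contributes \<open>\<delta>\<close> to the real part.\<close>
  define C where "C = norm z / m + norm (z * \<zeta>) / \<delta>"
  have v: "0 < Re (z * (cx x + \<zeta>)) \<and> norm (z * (cx x + \<zeta>)) \<le> C * Re (z * (cx x + \<zeta>))" if x: "x \<in> E" for x
  proof -
    define \<rho> where "\<rho> = fst x + snd x"
    have \<rho>: "norm (cx x) = \<rho>" "0 \<le> \<rho>" using x by (auto simp: cx_def E_iff \<rho>_def cmod_def)
    have re: "m * \<rho> \<le> Re (z * cx x)"
      using x mult_right_mono[of m "Re z" "fst x"] mult_right_mono[of m "- Im z" "snd x"]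
      by (simp add: E_iff \<rho>_def m_def distrib_left)
    have R: "Re (z * (cx x + \<zeta>)) = Re (z * cx x) + \<delta>" by (simp add: \<delta>_def algebra_simps)
    have "norm (z * (cx x + \<zeta>)) \<le> norm z * \<rho> + norm (z * \<zeta>)"
      using norm_triangle_ineq[of "z * cx x" "z * \<zeta>"] by (simp add: \<rho> norm_mult distrib_left)
    also have "\<dots> = norm z / m * (m * \<rho>) + norm (z * \<zeta>) / \<delta> * \<delta>" using m s by (simp add: \<delta>_def)
    also have "\<dots> \<le> C * (m * \<rho>) + C * \<delta>"
      using m s \<rho> by (intro add_mono mult_right_mono) (auto simp: C_def \<delta>_def)
    also have "\<dots> \<le> C * Re (z * (cx x + \<zeta>))"
      unfolding R distrib_left[symmetric] using re m s by (intro mult_left_mono) (auto simp: C_def \<delta>_def)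
    finally have "norm (z * (cx x + \<zeta>)) \<le> C * Re (z * (cx x + \<zeta>))" .
    moreover have "0 \<le> m * \<rho>" using m \<rho> by simp
    then have "0 < Re (z * (cx x + \<zeta>))" using re s unfolding R \<delta>_def by linarith
    ultimately show ?thesis by blast
  qed
  have C0: "0 \<le> C" using m s by (simp add: C_def \<delta>_def)
  \<comment> \<open>The step for which the error \<open>norm z * h * (6 * C + 3)\<close> is exactly
    \<open>e\<close>.\<close>
  define h where "h = e / (norm z * (6 * C + 3))"
  have h: "0 < h" using e z0 C0 by (simp add: h_def)
  define g where "g = (\<lambda>x. z * of_real h * (1 / (1 - exp (- ((of_real h * z) * (cx x + \<zeta>))))))"
  have gA: "g \<in> Aexp"
    unfolding g_def
  proof (intro Aexp_mult[OF Aexp_const] Aexp_geometric)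
    show "of_real h * z \<in> Z" using Z_scale[OF z, of h] h by simp
    have "Re (of_real h * z * \<zeta>) = h * Re (z * \<zeta>)" by (simp add: algebra_simps)
    then show "0 < Re (of_real h * z * \<zeta>)" using h s by simp
  qed
  have "norm (1 / (cx x + \<zeta>) - g x) \<le> e" if x: "x \<in> E" for x
  proof -
    define t where "t = of_real h * (z * (cx x + \<zeta>))"
    have Ret: "Re t = h * Re (z * (cx x + \<zeta>))" 
    proof -
      have "Re (of_real h * w) = h * Re w" for w by simp
      then show ?thesis unfolding t_def .
    qed
    have "norm t = h * norm (z * (cx x + \<zeta>))" unfolding t_def norm_mult[of "of_real h"] using h by simp
    then have b: "norm (1 / (1 - exp (- t)) - 1 / t) \<le> 6 * C + 3"
      using v[OF x] h Ret by (intro geometric_laplace_bound) (auto simp: mult_left_mono)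
    have ne: "cx x + \<zeta> \<noteq> 0"
    proof
      assume "cx x + \<zeta> = 0"
      then have "Re (z * (cx x + \<zeta>)) = 0" by (simp only: mult_zero_right zero_complex.sel)
      then show False using conjunct1[OF v[OF x]] by linarith
    qed
    have "z * of_real h * (1 / t) = 1 / (cx x + \<zeta>)" using ne z0 h by (simp add: t_def)
    moreover have "g x = z * of_real h * (1 / (1 - exp (- t)))" by (simp add: g_def t_def mult.assoc)
    ultimately have "1 / (cx x + \<zeta>) - g x = - (z * of_real h * (1 / (1 - exp (- t)) - 1 / t))"
      by (simp only: right_diff_distrib) simp
    then have "norm (1 / (cx x + \<zeta>) - g x) = norm z * h * norm (1 / (1 - exp (- t)) - 1 / t)"
      using h by (simp only: norm_minus_cancel norm_mult norm_of_real abs_of_pos)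
    also have "\<dots> \<le> norm z * h * (6 * C + 3)" using b h by (intro mult_left_mono) auto
    also have "\<dots> = e" using z0 C0 by (simp add: h_def)
    finally show ?thesis .
  qed
  then show "\<exists>g\<in>Aexp. \<forall>x\<in>E. norm (1 / (cx x + \<zeta>) - g x) \<le> e" by (rule bexI[OF ballI gA])
qed

section \<open>Trigonometric polynomials on the compactified boundary\<close>

definition sq :: "real \<times> real \<Rightarrow> real"
  where "sq x = (fst x)\<^sup>2 - (snd x)\<^sup>2"

text \<open>With \<open>sq\<close>, the one-point compactification of \<open>E\<close> becomes the projective line and \<open>cayley\<close> its
  parametrization by the unit circle, where trigonometric polynomials are dense.\<close>

definition cayley :: "real \<times> real \<Rightarrow> complex"
  where "cayley x = (of_real (sq x) - 2 * \<i>) / (of_real (sq x) + 2 * \<i>)"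

lemma cayley_den: "complex_of_real r + 2 * \<i> \<noteq> 0"
  by (simp add: complex_eq_iff)

lemma cayley_cnj: "cayley x * cnj (cayley x) = 1"
proof -
  have "complex_of_real r - 2 * \<i> \<noteq> 0" for r by (simp add: complex_eq_iff)
  moreover have "u / v * (v / u) = 1" if "u \<noteq> 0" "v \<noteq> 0" for u v :: complex using that by simp
  ultimately show ?thesis using cayley_den[of "sq x"] by (simp add: cayley_def del: times_divide_eq_left times_divide_eq_right times_divide_times_eq)
qed

lemma cayley_Aexp: "cayley \<in> Aexp"
proof -
  \<comment> \<open>Since the square of \<open>1 - \<i>\<close> is \<open>- 2 * \<i>\<close>, the
    two linear factors multiply to the square of \<open>cx x\<close> plus \<open>2 * \<i>\<close>,
    and on \<open>E\<close> that square is \<open>sq x\<close>. The multipliers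
    \<open>2 - \<i>\<close> and \<open>1 - 2 * \<i>\<close> are in \<open>Z\<close> and rotate
    \<open>1 - \<i>\<close> and \<open>- 1 + \<i>\<close> into the right half-plane.\<close>
  have "(\<lambda>x. 1 / (cx x + (1 - \<i>)) * (1 / (cx x + (- 1 + \<i>)))) \<in> Aexp"
    by (rule Aexp_mult[OF Aexp_laplace[of "2 - \<i>"] Aexp_laplace[of "1 - 2 * \<i>"]]) (auto simp: Z_def)
  then have A: "(\<lambda>x. 1 + (- 4 * \<i>) * (1 / (cx x + (1 - \<i>)) * (1 / (cx x + (- 1 + \<i>))))) \<in> Aexp"
    by (rule Aexp_add[OF Aexp_const Aexp_mult[OF Aexp_const]])
  have eq: "1 + (- 4 * \<i>) * (1 / (cx x + (1 - \<i>)) * (1 / (cx x + (- 1 + \<i>)))) = cayley x" if "x \<in> E" for x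
  proof -
    have "(cx x + (1 - \<i>)) * (cx x + (- 1 + \<i>)) = of_real (sq x) + 2 * \<i>"
      using that by (auto simp: E_iff sq_def complex_eq_iff power2_eq_square algebra_simps)
    then have "1 + (- 4 * \<i>) * (1 / (cx x + (1 - \<i>)) * (1 / (cx x + (- 1 + \<i>)))) = 1 + (- 4 * \<i>) / (of_real (sq x) + 2 * \<i>)"
      by simp
    then show ?thesis using cayley_den[of "sq x"] by (simp add: cayley_def field_simps)
  qed
  show ?thesis by (rule ucl_ucl, rule bexI[OF _ A]) (use eq in auto)
qed

lemma expsp_core: "f \<in> expsp \<Longrightarrow> f \<in> core"
proof (induction rule: expsp.induct)
  case (exp z c)
  then show ?case by (rule core.exp)
next
  case (add f g)
  show ?case by (rule core.add[OF add.IH])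
qed

lemma expsp_cnj_core: "f \<in> expsp \<Longrightarrow> (\<lambda>x. cnj (f x)) \<in> core"
proof (induction rule: expsp.induct)
  case (exp z c)
  then show ?case using core.cnj[of z "cnj c"] by simp
next
  case (add f g)
  show ?case using core.add[OF add.IH] by simp
qed

lemma core_scale: "f \<in> core \<Longrightarrow> (\<lambda>x. c * f x) \<in> core"
proof (induction rule: core.induct)
  case (exp z d)
  then show ?case using core.exp[of z "c * d"] by (simp add: mult.assoc)
next
  case (cnj z d)
  then show ?case using core.cnj[of z "c * d"] by (simp add: mult.assoc)
next
  case (add f g)
  then show ?case using core.add[OF add.IH] by (simp add: distrib_left)
qed

lemma Aexp_ucl_core: "f \<in> Aexp \<Longrightarrow> f \<in> ucl core"
  unfolding ucl_def using expsp_core by blast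

lemma Aexp_cnj_ucl_core:
  assumes "f \<in> Aexp" shows "(\<lambda>x. cnj (f x)) \<in> ucl core"
proof (rule uclI)
  fix e :: real assume "0 < e"
  then obtain g where g: "g \<in> expsp" "\<And>x. x \<in> E \<Longrightarrow> norm (f x - g x) \<le> e" using uclE[OF assms] by blast
  have "norm (cnj (f x) - cnj (g x)) \<le> e" if "x \<in> E" for x
    using g(2)[OF that] by (simp flip: complex_cnj_diff)
  then show "\<exists>g\<in>core. \<forall>x\<in>E. norm (cnj (f x) - g x) \<le> e" by (rule bexI[OF ballI expsp_cnj_core[OF g(1)]])
qed

lemma ucl_core_add: "f \<in> ucl core \<Longrightarrow> g \<in> ucl core \<Longrightarrow> (\<lambda>x. f x + g x) \<in> ucl core"
  by (rule ucl_add) (rule core.add)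

text \<open>Pure powers only: each member is then the sum of an element of \<open>Aexp\<close> and
  the conjugate of one, hence a uniform limit of elements of \<open>core\<close>.\<close>

inductive_set trig :: "(real \<times> real \<Rightarrow> complex) set" where
  pow: "(\<lambda>x. c * cayley x ^ n) \<in> trig"
| cnj: "(\<lambda>x. c * cnj (cayley x) ^ n) \<in> trig"
| add: "f \<in> trig \<Longrightarrow> g \<in> trig \<Longrightarrow> (\<lambda>x. f x + g x) \<in> trig"

lemma trig_ucl_core: "f \<in> trig \<Longrightarrow> f \<in> ucl core"
proof (induction rule: trig.induct)
  case (pow c n)
  show ?case by (intro Aexp_ucl_core Aexp_mult[OF Aexp_const] Aexp_power cayley_Aexp)
next
  case (cnj c n)
  have "(\<lambda>x. cnj (cnj c * cayley x ^ n)) \<in> ucl core"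
    by (intro Aexp_cnj_ucl_core Aexp_mult[OF Aexp_const] Aexp_power cayley_Aexp)
  then show ?case by simp
qed (rule ucl_core_add)

text \<open>On the unit circle conjugation is inversion. This is what makes \<open>trig\<close> an
  algebra although \<open>core\<close> is none.\<close>

lemma cayley_pow_cnj:
  "cayley x ^ n * cnj (cayley x) ^ m = (if m \<le> n then cayley x ^ (n - m) else cnj (cayley x) ^ (m - n))"
proof (cases "m \<le> n")
  case True
  then obtain k where k: "n = k + m" by (metis le_add_diff_inverse2)
  have "cayley x ^ n * cnj (cayley x) ^ m = cayley x ^ k * (cayley x * cnj (cayley x)) ^ m"
    unfolding k by (simp only: power_add power_mult_distrib mult.assoc)
  then show ?thesis using k by (simp only: cayley_cnj) simp
next
  case False
  then obtain k where k: "m = n + k" by (metis le_iff_add nat_le_linear)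
  have "cayley x ^ n * cnj (cayley x) ^ m = (cayley x * cnj (cayley x)) ^ n * cnj (cayley x) ^ k"
    unfolding k by (simp only: power_add power_mult_distrib mult.assoc)
  then show ?thesis using k False by (simp only: cayley_cnj) simp
qed

lemma trig_mult:
  assumes "f \<in> trig" "g \<in> trig"
  shows "(\<lambda>x. f x * g x) \<in> trig"
  using assms
proof (induction arbitrary: g)
  case (pow c n)
  from pow show ?case
  proof induction
    case (pow d m)
    then show ?case using trig.pow[of "c * d" "n + m"] by (simp add: power_add mult_ac)
  next
    case (cnj d m)
    have "(\<lambda>x. c * cayley x ^ n * (d * cnj (cayley x) ^ m)) = (\<lambda>x. (c * d) * (cayley x ^ n * cnj (cayley x) ^ m))"
      by (simp add: mult_ac)
    then show ?case unfolding cayley_pow_cnj by (cases "m \<le> n") (simp_all add: trig.pow trig.cnj)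
  next
    case (add f g)
    then show ?case using trig.add[OF add.IH] by (simp add: distrib_left)
  qed
next
  case (cnj c n)
  from cnj show ?case
  proof induction
    case (cnj d m)
    then show ?case using trig.cnj[of "c * d" "n + m"] by (simp add: power_add mult_ac)
  next
    case (pow d m)
    have "(\<lambda>x. c * cnj (cayley x) ^ n * (d * cayley x ^ m)) = (\<lambda>x. (c * d) * (cayley x ^ m * cnj (cayley x) ^ n))"
      by (simp add: mult_ac)
    then show ?case unfolding cayley_pow_cnj by (cases "n \<le> m") (simp_all add: trig.pow trig.cnj)
  next
    case (add f g)
    then show ?case using trig.add[OF add.IH] by (simp add: distrib_left)
  qed
next
  case (add f h)
  then show ?case using trig.add[OF add.IH(1)[OF add.prems] add.IH(2)[OF add.prems]] by (simp add: distrib_right)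
qed

lemma real_polynomial_trig:
  "real_polynomial_function p \<Longrightarrow> (\<lambda>x. of_real (p (cayley x))) \<in> trig"
proof (induction rule: real_polynomial_function.induct)
  case (linear f)
  interpret bounded_linear f by fact
  \<comment> \<open>A real linear form on the plane is a combination of the identity and
    conjugation; these are its coefficients.\<close>
  define p q where "p = of_real (f 1) / 2 - \<i> * of_real (f \<i>) / 2"
    and "q = of_real (f 1) / 2 + \<i> * of_real (f \<i>) / 2"
  have eq: "complex_of_real (f u) = p * u ^ 1 + q * cnj u ^ 1" for u
  proof -
    have "u = Re u *\<^sub>R 1 + Im u *\<^sub>R \<i>" by (simp add: complex_eq_iff)
    then have "f u = f (Re u *\<^sub>R 1 + Im u *\<^sub>R \<i>)" by (rule arg_cong)
    then have "f u = Re u * f 1 + Im u * f \<i>" by (simp only: add scaleR real_scaleR_def)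
    then show ?thesis by (simp add: p_def q_def complex_eq_iff algebra_simps)
  qed
  show ?case unfolding eq by (rule trig.add[OF trig.pow trig.cnj])
next
  case (const c)
  show ?case using trig.pow[of "of_real c" 0] by simp
next
  case (add f g)
  then show ?case using trig.add[OF add.IH] by simp
next
  case (mult f g)
  then show ?case using trig_mult[OF mult.IH] by simp
qed

lemma polynomial_trig:
  fixes g :: "complex \<Rightarrow> complex"
  assumes "polynomial_function g"
  shows "(\<lambda>x. g (cayley x)) \<in> trig"
proof -
  have "real_polynomial_function (Re \<circ> g)" "real_polynomial_function (Im \<circ> g)"
    using assms bounded_linear_Re bounded_linear_Im by (auto simp: polynomial_function_def)
  note this[THEN real_polynomial_trig]
  then have "(\<lambda>x. of_real ((Re \<circ> g) (cayley x)) + \<i> * cayley x ^ 0 * of_real ((Im \<circ> g) (cayley x))) \<in> trig"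
    by (intro trig.add trig_mult trig.pow)
  then show ?thesis by (simp flip: complex_eq)
qed

text \<open>The inverse of \<open>sq\<close> on \<open>E\<close>: nonnegative numbers go to the
  first axis, negative ones to the second.\<close>

definition pt :: "real \<Rightarrow> real \<times> real"
  where "pt r = (sqrt (max 0 r), sqrt (max 0 (- r)))"

lemma pt_in_E: "pt r \<in> E"
  by (auto simp: pt_def E_iff max_def)

lemma pt_sq: "x \<in> E \<Longrightarrow> pt (sq x) = x"
  by (cases x) (auto simp: pt_def sq_def E_iff max_def)

text \<open>Transported to the unit circle, \<open>f\<close> becomes continuous, its common limit
  along the two axes being the value at the point 1. Polynomials in the coordinates of the circle
  are trigonometric polynomials in \<open>cayley\<close>.\<close>

theorem core_dense:
  assumes f: "f \<in> Cl"
  shows "f \<in> ucl core"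
proof -
  obtain L where L: "((\<lambda>u. f (u, 0)) \<longlongrightarrow> L) at_top" "((\<lambda>v. f (0, v)) \<longlongrightarrow> L) at_top"
    and fc: "continuous_on E f" using f by (auto simp: Cl_def)
  define H where "H = (\<lambda>r. f (pt r))"
  have ptc: "continuous_on UNIV pt" unfolding pt_def by (intro continuous_intros)
  have Hc: "continuous_on UNIV H"
    unfolding H_def by (rule continuous_on_compose2[OF fc ptc]) (use pt_in_E in auto)
  have "(H \<longlongrightarrow> L) at_top"
  proof (rule Lim_transform_eventually)
    show "((\<lambda>r. f (sqrt r, 0)) \<longlongrightarrow> L) at_top" using filterlim_compose[OF L(1) sqrt_at_top] .
    show "eventually (\<lambda>r. f (sqrt r, 0) = H r) at_top"
      using eventually_ge_at_top[of 0] by eventually_elim (simp add: H_def pt_def max_def)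
  qed
  moreover have "(H \<longlongrightarrow> L) at_bot"
    unfolding filterlim_at_bot_mirror
  proof (rule Lim_transform_eventually)
    show "((\<lambda>r. f (0, sqrt r)) \<longlongrightarrow> L) at_top" using filterlim_compose[OF L(2) sqrt_at_top] .
    show "eventually (\<lambda>r. f (0, sqrt r) = H (- r)) at_top"
      using eventually_ge_at_top[of 0] by eventually_elim (simp add: H_def pt_def max_def)
  qed
  ultimately have Hinf: "(H \<longlongrightarrow> L) at_infinity"
    unfolding at_infinity_eq_at_top_bot by (rule filterlim_sup)
  \<comment> \<open>The inverse of the Cayley transform. It is real on the circle away from 1 and
    tends to infinity there.\<close>
  define \<rho> where "\<rho> = (\<lambda>\<zeta>::complex. 2 * \<i> * (1 + \<zeta>) / (1 - \<zeta>))"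
  define F where "F = (\<lambda>\<zeta>. if \<zeta> = 1 then L else H (Re (\<rho> \<zeta>)))"
  have im: "Im (\<rho> \<zeta>) = 0" if "norm \<zeta> = 1" for \<zeta>
  proof -
    have "\<rho> \<zeta> = 2 * \<i> * ((1 + \<zeta>) / (1 - \<zeta>))" by (simp add: \<rho>_def)
    moreover have "Im (2 * \<i> * w) = 2 * Re w" for w by simp
    ultimately have "Im (\<rho> \<zeta>) = 2 * Re ((1 + \<zeta>) / (1 - \<zeta>))" by (simp only:)
    also have "(1 + \<zeta>) / (1 - \<zeta>) = (1 + \<zeta>) * cnj (1 - \<zeta>) / of_real ((norm (1 - \<zeta>))\<^sup>2)"
      by (rule complex_div_cnj)
    also have "Re \<dots> = Re ((1 + \<zeta>) * cnj (1 - \<zeta>)) / (norm (1 - \<zeta>))\<^sup>2" by (rule Re_divide_of_real)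
    also have "Re ((1 + \<zeta>) * cnj (1 - \<zeta>)) = 1 - (norm \<zeta>)\<^sup>2"
      unfolding cmod_power2 by (simp add: algebra_simps power2_eq_square)
    finally show ?thesis using that by simp
  qed
  have Fc: "continuous_on (sphere 0 1) F"
    unfolding continuous_on_def
  proof
    fix \<zeta> :: complex assume \<zeta>: "\<zeta> \<in> sphere 0 1"
    show "(F \<longlongrightarrow> F \<zeta>) (at \<zeta> within sphere 0 1)"
    proof (cases "\<zeta> = 1")
      case True
      have lim: "filterlim (\<lambda>\<zeta>::complex. (1 + \<zeta>) / (1 - \<zeta>)) at_infinity (at 1 within sphere 0 1)"
      proof (rule filterlim_divide_at_infinity)
        show "((\<lambda>\<zeta>::complex. 1 + \<zeta>) \<longlongrightarrow> 1 + 1) (at 1 within sphere 0 1)" by (intro tendsto_add tendsto_diff tendsto_const tendsto_ident_at)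
        have "((\<lambda>\<zeta>::complex. 1 - \<zeta>) \<longlongrightarrow> 1 - 1) (at 1 within sphere 0 1)" by (intro tendsto_add tendsto_diff tendsto_const tendsto_ident_at)
        then show "filterlim (\<lambda>\<zeta>::complex. 1 - \<zeta>) (at 0) (at 1 within sphere 0 1)"
          by (intro filterlim_atI) (auto simp: eventually_at_filter)
      qed simp
      have "filterlim (\<lambda>\<zeta>. Re (\<rho> \<zeta>)) at_infinity (at 1 within sphere 0 1)"
        unfolding filterlim_at_infinity_conv_norm_at_top
      proof (rule filterlim_at_top_mono)
        show "filterlim (\<lambda>\<zeta>::complex. norm ((1 + \<zeta>) / (1 - \<zeta>))) at_top (at 1 within sphere 0 1)"
          using lim unfolding filterlim_at_infinity_conv_norm_at_top .
        show "eventually (\<lambda>\<zeta>. norm ((1 + \<zeta>) / (1 - \<zeta>)) \<le> norm (Re (\<rho> \<zeta>))) (at 1 within sphere 0 1)"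
        proof (rule eventually_at_topological[THEN iffD2], intro exI[of _ UNIV] conjI ballI impI)
          fix \<zeta> :: complex assume "\<zeta> \<in> sphere 0 1"
          then have "norm \<zeta> = 1" by simp
          then have "norm (\<rho> \<zeta>) = norm (Re (\<rho> \<zeta>))" using im by (simp add: cmod_def)
          moreover have "norm (\<rho> \<zeta>) = 2 * norm ((1 + \<zeta>) / (1 - \<zeta>))" by (simp add: \<rho>_def norm_divide norm_mult)
          ultimately show "norm ((1 + \<zeta>) / (1 - \<zeta>)) \<le> norm (Re (\<rho> \<zeta>))" by simp
        qed auto
      qed
      then have "((\<lambda>\<zeta>. H (Re (\<rho> \<zeta>))) \<longlongrightarrow> L) (at 1 within sphere 0 1)"
        by (rule filterlim_compose[OF Hinf])
      then have "(F \<longlongrightarrow> L) (at 1 within sphere 0 1)"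
        by (rule Lim_transform_eventually) (auto simp: F_def eventually_at_filter)
      then show ?thesis using True by (simp add: F_def)
    next
      case False
      have "continuous_on (- {1}) (\<lambda>\<zeta>. H (Re (\<rho> \<zeta>)))"
        unfolding \<rho>_def by (rule continuous_on_compose2[OF Hc]) (auto intro!: continuous_intros)
      then have "((\<lambda>\<zeta>. H (Re (\<rho> \<zeta>))) \<longlongrightarrow> H (Re (\<rho> \<zeta>))) (at \<zeta> within - {1})"
        using False by (simp add: continuous_on_def)
      moreover have "at \<zeta> within - {1} = at \<zeta>" using False by (intro at_within_open) auto
      ultimately have "((\<lambda>\<zeta>. H (Re (\<rho> \<zeta>))) \<longlongrightarrow> F \<zeta>) (at \<zeta>)" using False by (simp add: F_def)
      then have "(F \<longlongrightarrow> F \<zeta>) (at \<zeta>)"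
      proof (rule Lim_transform_eventually)
        show "eventually (\<lambda>\<zeta>. H (Re (\<rho> \<zeta>)) = F \<zeta>) (at \<zeta>)"
          unfolding eventually_at_topological
          by (rule exI[of _ "- {1}"]) (use False in \<open>auto simp: F_def\<close>)
      qed
      then show ?thesis by (rule tendsto_within_subset) simp
    qed
  qed
  have Fx: "F (cayley x) = f x" if "x \<in> E" for x
  proof -
    have d: "complex_of_real (sq x) + 2 * \<i> \<noteq> 0" by (rule cayley_den)
    have 1: "1 - cayley x = 4 * \<i> / (of_real (sq x) + 2 * \<i>)" using d by (simp add: cayley_def field_simps)
    have 2: "1 + cayley x = 2 * of_real (sq x) / (of_real (sq x) + 2 * \<i>)" using d by (simp add: cayley_def field_simps)
    have "cayley x \<noteq> 1" using 1 d by auto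
    moreover have "\<rho> (cayley x) = of_real (sq x)" unfolding \<rho>_def 1 2 using d by (simp add: field_simps)
    ultimately show ?thesis using pt_sq[OF that] by (simp add: F_def H_def)
  qed
  show ?thesis
  proof (rule ucl_ucl)
    fix e :: real assume "0 < e"
    from Stone_Weierstrass_polynomial_function[OF compact_sphere Fc this]
    obtain g where g: "polynomial_function g \<and> (\<forall>\<zeta>\<in>sphere 0 1. norm (F \<zeta> - g \<zeta>) < e)" by (rule exE)
    have "cayley x \<in> sphere 0 1" for x
    proof -
      have "norm (cayley x * cnj (cayley x)) = 1" by (simp only: cayley_cnj norm_one)
      then have "norm (cayley x) * norm (cayley x) = 1" by (simp only: norm_mult complex_mod_cnj)
      then have "norm (cayley x) = 1 \<or> norm (cayley x) = - 1" by (simp only: square_eq_1_iff)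
      then show ?thesis using norm_ge_zero[of "cayley x"] by (simp only: mem_sphere_0) linarith
    qed
    then have close: "norm (f x - g (cayley x)) \<le> e" if "x \<in> E" for x
      using bspec[OF conjunct2[OF g], of "cayley x"] Fx[OF that] by simp
    show "\<exists>g\<in>ucl core. \<forall>x\<in>E. norm (f x - g x) \<le> e"
      by (rule bexI[OF ballI trig_ucl_core[OF polynomial_trig[OF conjunct1[OF g]]]]) (rule close)
  qed
qed

section \<open>The Poisson kernel of the quadrant\<close>

text \<open>The exit density on the first axis for the starting point \<open>(a, b)\<close>: the
  half-plane Poisson kernel of \<open>(a, b)\<close> minus that of its mirror image
  \<open>(- a, b)\<close>, brought to a common denominator. Exchanging \<open>a\<close> and
  \<open>b\<close> gives the second axis.\<close>

definition kern :: "real \<Rightarrow> real \<Rightarrow> real \<Rightarrow> real"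
  where "kern a b u = 4 / pi * (u * a * b / (((u - a)\<^sup>2 + b\<^sup>2) * ((u + a)\<^sup>2 + b\<^sup>2)))"

lemma quad_lower: "b\<^sup>2 * (1 + u\<^sup>2) \<le> (1 + a\<^sup>2 + b\<^sup>2) * ((u - a)\<^sup>2 + (b::real)\<^sup>2)"
proof -
  have "(1 + a\<^sup>2 + b\<^sup>2) * ((u - a)\<^sup>2 + b\<^sup>2) - b\<^sup>2 * (1 + u\<^sup>2) = (u - a)\<^sup>2 + ((u - a) * a - b\<^sup>2)\<^sup>2"
    by (simp add: power2_eq_square algebra_simps)
  then show ?thesis by (smt (verit) zero_le_power2)
qed

lemma kern_nonneg: "0 \<le> a \<Longrightarrow> 0 \<le> b \<Longrightarrow> 0 \<le> u \<Longrightarrow> 0 \<le> kern a b u"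
  by (simp add: kern_def)

lemma kern_den_pos: "0 < b \<Longrightarrow> 0 < (u - a)\<^sup>2 + (b::real)\<^sup>2"
  by (simp add: add_nonneg_pos)

text \<open>The kernel decays like the third inverse power of \<open>u\<close>, so it leaves room
  for a factor of linear growth. \<open>quad_lower\<close> compares each quadratic factor of the
  denominator with \<open>1 + u\<^sup>2\<close>.\<close>

lemma kern_bound:
  assumes "0 < a" "0 < b"
  obtains C where "0 \<le> C" "\<And>u. 0 \<le> u \<Longrightarrow> kern a b u * (1 + u) \<le> C / (1 + u\<^sup>2)"
proof
  define m where "m = (1 + a\<^sup>2 + b\<^sup>2) / b\<^sup>2"
  have m: "0 < m" using assms by (simp add: m_def add_pos_nonneg)
  show "0 \<le> 4 / pi * (a * b) * (m * m) * 2" using assms m by simp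
  fix u :: real assume u: "0 \<le> u"
  have low: "(1 + u\<^sup>2) / m \<le> (u - c)\<^sup>2 + b\<^sup>2" if "c = a \<or> c = - a" for c
  proof -
    have "b\<^sup>2 * (1 + u\<^sup>2) \<le> (1 + a\<^sup>2 + b\<^sup>2) * ((u - c)\<^sup>2 + b\<^sup>2)"
      using quad_lower[of b u c] that by auto
    then show ?thesis using assms by (simp add: m_def field_simps add_pos_nonneg)
  qed
  have q: "0 < 1 + u\<^sup>2" by (simp add: add_pos_nonneg)
  have "(1 + u\<^sup>2) / m * ((1 + u\<^sup>2) / m) \<le> ((u - a)\<^sup>2 + b\<^sup>2) * ((u + a)\<^sup>2 + b\<^sup>2)"
    using low[of a] low[of "- a"] m q by (intro mult_mono) auto
  then have "u * a * b / (((u - a)\<^sup>2 + b\<^sup>2) * ((u + a)\<^sup>2 + b\<^sup>2)) \<le> u * a * b / ((1 + u\<^sup>2) / m * ((1 + u\<^sup>2) / m))"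
    using u assms m q kern_den_pos[OF assms(2), of u a] kern_den_pos[OF assms(2), of u "- a"]
    by (intro divide_left_mono) (auto intro!: mult_pos_pos divide_pos_pos)
  then have "kern a b u * (1 + u) \<le> 4 / pi * (u * a * b / ((1 + u\<^sup>2) / m * ((1 + u\<^sup>2) / m))) * (1 + u)"
    unfolding kern_def using u by (intro mult_right_mono mult_left_mono) auto
  also have "\<dots> = 4 / pi * (a * b) * (m * m) * (u * (1 + u)) / (1 + u\<^sup>2) / (1 + u\<^sup>2)"
    using m q by (simp add: field_simps)
  also have "\<dots> \<le> 4 / pi * (a * b) * (m * m) * (2 * (1 + u\<^sup>2)) / (1 + u\<^sup>2) / (1 + u\<^sup>2)"
  proof -
    have "u \<le> 1 + u\<^sup>2" using zero_le_power2[of "u - 1"] u by (simp add: power2_eq_square algebra_simps)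
    then have "u * (1 + u) \<le> 2 * (1 + u\<^sup>2)" using zero_le_power2[of u] by (simp add: distrib_left power2_eq_square)
    then show ?thesis using m q assms by (intro divide_right_mono mult_left_mono) auto
  qed
  also have "\<dots> = 4 / pi * (a * b) * (m * m) * 2 / (1 + u\<^sup>2)"
  proof -
    have cancel: "k * (2 * d) / d / d = k * 2 / d" if "0 < d" for k d :: real using that by simp
    show ?thesis by (rule cancel[OF q])
  qed
  finally show "kern a b u * (1 + u) \<le> 4 / pi * (a * b) * (m * m) * 2 / (1 + u\<^sup>2)" .
qed

lemma continuous_on_kern [continuous_intros]: "0 < b \<Longrightarrow> continuous_on A (kern a b)"
  unfolding kern_def
  by (intro continuous_intros) (metis add_nonneg_pos less_numeral_extra(3) mult_eq_0_iff zero_le_power2 zero_less_power)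

lemma integrable_inverse_one_plus_sq: "integrable lborel (\<lambda>u::real. 1 / (1 + u\<^sup>2))"
  using integrable_inverse_1_plus_square
  by (simp add: set_integrable_def einterval_def inverse_eq_divide)

lemma set_integrable_dominated:
  fixes f :: "real \<Rightarrow> complex"
  assumes m: "set_borel_measurable lborel {0<..} f" and b: "\<And>u. 0 < u \<Longrightarrow> norm (f u) \<le> C / (1 + u\<^sup>2)"
  shows "set_integrable lborel {0<..} f"
  unfolding set_integrable_def
proof (rule Bochner_Integration.integrable_bound)
  show "integrable lborel (\<lambda>u::real. C * (1 / (1 + u\<^sup>2)))"
    using integrable_inverse_one_plus_sq by (rule integrable_mult_right)
  show "(\<lambda>x. indicator {0<..} x *\<^sub>R f x) \<in> borel_measurable lborel"
    using m by (simp add: set_borel_measurable_def)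
  show "AE x in lborel. norm (indicator {0<..} x *\<^sub>R f x) \<le> norm (C * (1 / (1 + x\<^sup>2)))"
    using order_trans[OF b abs_ge_self] by (intro AE_I2) (auto simp: indicator_def)
qed

text \<open>Connects Lebesgue integrals over the open half-line with gauge integrals over
  \<open>{0..real n}\<close>, in which contour integrals are expressed. Since
  \<open>f 0 = 0\<close>, including the endpoint changes nothing.\<close>

lemma half_line_integral:
  fixes f :: "real \<Rightarrow> complex"
  assumes c: "continuous_on {0..} f" and f0: "f 0 = 0" and b: "\<And>u. 0 < u \<Longrightarrow> norm (f u) \<le> C / (1 + u\<^sup>2)"
  shows "set_integrable lborel {0<..} f"
    and "(\<lambda>n. integral {0..real n} f) \<longlonglongrightarrow> (LINT u:{0<..}|lborel. f u)"
proof -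
  have m: "(\<lambda>x. indicator {0..} x *\<^sub>R f x) \<in> borel_measurable borel"
    using borel_measurable_continuous_on_indicator[OF _ c] by simp
  have eq0: "indicator {0<..} x *\<^sub>R f x = indicator {0..} x *\<^sub>R f x" for x
    using f0 by (cases "x = 0") (auto simp: indicator_def)
  show int: "set_integrable lborel {0<..} f"
    by (rule set_integrable_dominated[OF _ b]) (use m in \<open>simp add: set_borel_measurable_def eq0\<close>)
  have "(\<lambda>n. LINT u|lborel. indicator {0..real n} u *\<^sub>R f u) \<longlonglongrightarrow> (LINT u|lborel. indicator {0<..} u *\<^sub>R f u)"
  proof (rule integral_dominated_convergence[where w = "\<lambda>u. C * (1 / (1 + u\<^sup>2))"])
    show "integrable lborel (\<lambda>u::real. C * (1 / (1 + u\<^sup>2)))"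
      using integrable_inverse_one_plus_sq by (rule integrable_mult_right)
    show "(\<lambda>u. indicator {0<..} u *\<^sub>R f u) \<in> borel_measurable lborel" using m by (simp add: eq0)
    show "(\<lambda>u. indicator {0..real n} u *\<^sub>R f u) \<in> borel_measurable lborel" for n
      using borel_measurable_continuous_on_indicator[OF _ continuous_on_subset[OF c], of "{0..real n}"] by simp
    show "AE u in lborel. (\<lambda>n. indicator {0..real n} u *\<^sub>R f u) \<longlonglongrightarrow> indicator {0<..} u *\<^sub>R f u"
    proof (rule AE_I2)
      fix u :: real
      have "eventually (\<lambda>n. u \<le> real n) sequentially" by real_asymp
      then have "eventually (\<lambda>n. indicator {0<..} u *\<^sub>R f u = indicator {0..real n} u *\<^sub>R f u) sequentially"
        unfolding eq0 by eventually_elim (auto simp: indicator_def)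
      then show "(\<lambda>n. indicator {0..real n} u *\<^sub>R f u) \<longlonglongrightarrow> indicator {0<..} u *\<^sub>R f u"
        by (rule Lim_transform_eventually[OF tendsto_const])
    qed
    have "norm (f 1) \<le> C / 2" using b[of 1] by simp
    then have "0 \<le> C" using norm_ge_zero[of "f 1"] by linarith
    then have Cp: "0 \<le> C / (1 + u\<^sup>2)" for u :: real by simp
    show "AE u in lborel. norm (indicator {0..real n} u *\<^sub>R f u) \<le> C * (1 / (1 + u\<^sup>2))" for n
    proof (rule AE_I2)
      fix u :: real
      show "norm (indicator {0..real n} u *\<^sub>R f u) \<le> C * (1 / (1 + u\<^sup>2))"
      proof (cases "0 < u")
        case True
        then show ?thesis using b[OF True] Cp[of u] by (simp add: indicator_def)
      next
        case False
        then have "indicator {0..real n} u *\<^sub>R f u = 0" using f0 by (cases "u = 0") (auto simp: indicator_def)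
        then show ?thesis using Cp[of u] by (simp only: norm_zero) simp
      qed
    qed
  qed
  moreover have "(LINT u|lborel. indicator {0..real n} u *\<^sub>R f u) = integral {0..real n} f" for n
  proof -
    have "set_integrable lborel {0..real n} f"
      unfolding set_integrable_def by (rule borel_integrable_compact) (auto intro: continuous_on_subset[OF c])
    from set_borel_integral_eq_integral(2)[OF this] show ?thesis by (simp add: set_lebesgue_integral_def)
  qed
  ultimately show "(\<lambda>n. integral {0..real n} f) \<longlonglongrightarrow> (LINT u:{0<..}|lborel. f u)"
    by (simp add: set_lebesgue_integral_def)
qed

section \<open>The Poisson formula for entire functions\<close>

text \<open>The kernel \<open>8 \<i> a b w / ((w\<^sup>2 - w0\<^sup>2) (w\<^sup>2 - cnj w0\<^sup>2))\<close> with \<open>w0 = a + \<i> b\<close> is the sum of the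
  Cauchy kernels of \<open>w0\<close> and \<open>- w0\<close> minus those of the reflected points \<open>cnj w0\<close> and \<open>- cnj w0\<close>; restricted to
  the two axes it is \<open>2 \<pi> \<i>\<close> times the Poisson kernel of the quadrant.\<close>

lemma poisson_entire:
  fixes F :: "complex \<Rightarrow> complex"
  assumes a: "0 < a" and b: "0 < b" and F: "F holomorphic_on UNIV"
    and Fb: "\<And>w. 0 \<le> Re w \<Longrightarrow> 0 \<le> Im w \<Longrightarrow> norm (F w) \<le> C * (1 + norm w)"
  shows "set_integrable lborel {0<..} (\<lambda>u. kern a b u *\<^sub>R F (of_real u))" (is ?int1)
    and "set_integrable lborel {0<..} (\<lambda>v. kern b a v *\<^sub>R F (\<i> * of_real v))" (is ?int2)
    and "(LINT u:{0<..}|lborel. kern a b u *\<^sub>R F (of_real u)) +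
      (LINT v:{0<..}|lborel. kern b a v *\<^sub>R F (\<i> * of_real v)) = F (Complex a b)"
proof -
  define w0 where "w0 = Complex a b"
  \<comment> \<open>The pole at \<open>w0\<close> is split off from the kernel; the remaining factor
    equals 1 at \<open>w0\<close>, so Cauchy's formula returns \<open>F w0\<close>.\<close>
  define g where "g = (\<lambda>w. F w * (8 * \<i> * of_real (a * b) * w / ((w + w0) * (w\<^sup>2 - (cnj w0)\<^sup>2))))"
  define P where "P = (\<lambda>w. g w / (w - w0))"
  have C: "0 \<le> C" using Fb[of 0] norm_ge_zero[of "F 0"] by (simp del: norm_ge_zero)
  have Fc: "continuous_on UNIV F" by (rule holomorphic_on_imp_continuous_on[OF F])
  have Fi: "continuous_on A (\<lambda>x. F (h x))" if "continuous_on A h" for A and h :: "real \<Rightarrow> complex"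
    by (rule continuous_on_compose2[OF Fc that]) auto
  obtain C1 where C1: "0 \<le> C1" "\<And>u. 0 \<le> u \<Longrightarrow> kern a b u * (1 + u) \<le> C1 / (1 + u\<^sup>2)"
    using kern_bound[OF a b] by blast
  obtain C2 where C2: "0 \<le> C2" "\<And>u. 0 \<le> u \<Longrightarrow> kern b a u * (1 + u) \<le> C2 / (1 + u\<^sup>2)"
    using kern_bound[OF b a] by blast
  have b1: "norm (kern a b u *\<^sub>R F (of_real u)) \<le> C * C1 / (1 + u\<^sup>2)" if u: "0 < u" for u
  proof -
    have "norm (kern a b u *\<^sub>R F (of_real u)) \<le> kern a b u * (C * (1 + u))"
      using Fb[of "of_real u"] u a b kern_nonneg[of a b u] by (simp add: mult_left_mono)
    also have "\<dots> = C * (kern a b u * (1 + u))" by simp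
    also have "\<dots> \<le> C * (C1 / (1 + u\<^sup>2))" using C1(2)[of u] u C by (intro mult_left_mono) auto
    finally show ?thesis by simp
  qed
  have b2: "norm (kern b a u *\<^sub>R F (\<i> * of_real u)) \<le> C * C2 / (1 + u\<^sup>2)" if u: "0 < u" for u
  proof -
    have "norm (kern b a u *\<^sub>R F (\<i> * of_real u)) \<le> kern b a u * (C * (1 + u))"
      using Fb[of "\<i> * of_real u"] u a b kern_nonneg[of b a u] by (simp add: mult_left_mono norm_mult)
    also have "\<dots> = C * (kern b a u * (1 + u))" by simp
    also have "\<dots> \<le> C * (C2 / (1 + u\<^sup>2))" using C2(2)[of u] u C by (intro mult_left_mono) auto
    finally show ?thesis by simp
  qed
  have c1: "continuous_on {0..} (\<lambda>u. kern a b u *\<^sub>R F (of_real u))"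
    and c2: "continuous_on {0..} (\<lambda>u. kern b a u *\<^sub>R F (\<i> * of_real u))"
    using a b by (auto intro!: continuous_intros Fi)
  have k0: "kern a b 0 *\<^sub>R F (of_real 0) = 0" "kern b a 0 *\<^sub>R F (\<i> * of_real 0) = 0" by (simp_all add: kern_def)
  note h1 = half_line_integral[OF c1 k0(1) b1] and h2 = half_line_integral[OF c2 k0(2) b2]
  show ?int1 by (rule h1(1))
  show ?int2 by (rule h2(1))
  \<comment> \<open>A convex neighbourhood of the closed first quadrant that avoids the other three
    poles, which lie on its boundary lines.\<close>
  define S where "S = {w. - a < Re w} \<inter> {w. - b < Im w}"
  have S: "convex S" "open S" unfolding S_def
    by (intro convex_Int convex_halfspace_Re_gt convex_halfspace_Im_gt open_Int open_halfspace_Re_gt open_halfspace_Im_gt)+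
  have den: "(w + w0) * (w\<^sup>2 - (cnj w0)\<^sup>2) \<noteq> 0" if "w \<in> S" for w
  proof -
    have "w + w0 \<noteq> 0" using that a by (auto simp: S_def w0_def complex_eq_iff)
    moreover have "w \<noteq> cnj w0" "w \<noteq> - cnj w0" using that by (auto simp: S_def w0_def complex_eq_iff)
    then have "w\<^sup>2 \<noteq> (cnj w0)\<^sup>2" by (simp add: power2_eq_iff)
    ultimately show ?thesis by simp
  qed
  have gh: "g holomorphic_on S" unfolding g_def
    using den by (intro holomorphic_intros holomorphic_on_subset[OF F]) auto
  have w0S: "w0 \<in> S" using a b by (simp add: S_def w0_def)
  have gw0: "g w0 = F w0"
  proof -
    have "w0\<^sup>2 - (cnj w0)\<^sup>2 = 4 * \<i> * of_real (a * b)"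
      by (simp add: w0_def complex_eq_iff power2_eq_square)
    then have "8 * \<i> * of_real (a * b) * w0 = (w0 + w0) * (w0\<^sup>2 - (cnj w0)\<^sup>2)" by simp
    then show ?thesis using den[OF w0S] by (simp add: g_def)
  qed
  have Pf: "P w = F w * (8 * \<i> * of_real (a * b) * w / ((w\<^sup>2 - w0\<^sup>2) * (w\<^sup>2 - (cnj w0)\<^sup>2)))" for w
    by (simp add: P_def g_def power2_eq_square algebra_simps)
  have Pu: "P (of_real u) = 2 * pi * \<i> * (kern a b u *\<^sub>R F (of_real u))" for u
  proof -
    have "((of_real u)\<^sup>2 - w0\<^sup>2) * ((of_real u)\<^sup>2 - (cnj w0)\<^sup>2) = of_real (((u - a)\<^sup>2 + b\<^sup>2) * ((u + a)\<^sup>2 + b\<^sup>2))"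
      by (simp add: w0_def complex_eq_iff power2_eq_square algebra_simps)
    then show ?thesis unfolding Pf kern_def by (simp add: scaleR_conv_of_real mult_ac)
  qed
  have Pv: "P (Complex 0 v) = - (2 * pi * (kern b a v *\<^sub>R F (\<i> * of_real v)))" for v
  proof -
    have "((Complex 0 v)\<^sup>2 - w0\<^sup>2) * ((Complex 0 v)\<^sup>2 - (cnj w0)\<^sup>2) = of_real (((v - b)\<^sup>2 + a\<^sup>2) * ((v + b)\<^sup>2 + a\<^sup>2))"
      by (simp add: w0_def complex_eq_iff power2_eq_square algebra_simps)
    moreover have "8 * \<i> * of_real (a * b) * Complex 0 v = - of_real (8 * (a * b) * v)"
      by (simp add: complex_eq_iff)
    moreover have "Complex 0 v = \<i> * of_real v" by (simp add: complex_eq_iff)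
    ultimately show ?thesis unfolding Pf kern_def by (simp add: scaleR_conv_of_real mult_ac)
  qed
  define N0 where "N0 = 1 + norm w0 * 2"
  \<comment> \<open>Cauchy's formula on the square with corner \<open>Complex R R\<close>. On the
    two far sides \<open>F\<close> grows linearly, the kernel is of order three in
    \<open>1 / R\<close>, and the length is \<open>R\<close>, so they contribute at most a multiple
    of \<open>1 / R\<close>. From \<open>N0\<close> on, the square contains \<open>w0\<close> and
    the far points have at least twice its modulus.\<close>
  have key: "norm (integral {0..R} (\<lambda>u. kern a b u *\<^sub>R F (of_real u)) + integral {0..R} (\<lambda>v. kern b a v *\<^sub>R F (\<i> * of_real v))
      - F w0) \<le> 64 * C * (a * b) / R" if R: "N0 \<le> R" for R
  proof -
    have w0n: "0 \<le> norm w0" "a \<le> norm w0" "b \<le> norm w0"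
      using complex_Re_le_cmod[of w0] abs_Im_le_cmod[of w0] by (auto simp: w0_def)
    have R1: "1 \<le> R" "a < R" "b < R" "2 * norm w0 \<le> R" using R w0n a b unfolding N0_def by linarith+
    let ?p = "rectpath 0 (Complex R R)"
    have pim: "path_image ?p \<subseteq> S - {w0}"
      using R1 a b by (subst path_image_rectpath) (auto simp: S_def w0_def complex_eq_iff)
    have wn: "winding_number ?p w0 = 1"
      by (rule winding_number_rectpath) (use R1 a b in \<open>auto simp: w0_def in_box_complex_iff\<close>)
    have w0i: "w0 \<in> interior S" using w0S S interior_open by auto
    have tot: "(P has_contour_integral (2 * pi * \<i> * F w0)) ?p"
      using Cauchy_integral_formula_convex_simple[OF S(1) gh w0i _ pim] wn
      by (simp add: P_def gw0)
    have Pc: "continuous_on (S - {w0}) P" unfolding P_def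
      by (intro continuous_intros continuous_on_subset[OF holomorphic_on_imp_continuous_on[OF gh]]) auto
    define p1 p2 p3 p4 where "p1 = (0 :: complex)" and "p2 = Complex R 0" and "p3 = Complex R R" and "p4 = Complex 0 R"
    have rp: "?p = linepath p1 p2 +++ linepath p2 p3 +++ linepath p3 p4 +++ linepath p4 p1"
      by (simp add: rectpath_def Let_def p1_def p2_def p3_def p4_def)
    have pims: "path_image ?p = closed_segment p1 p2 \<union> closed_segment p2 p3 \<union> closed_segment p3 p4 \<union> closed_segment p4 p1"
      unfolding rp by (simp add: path_image_join Un_assoc)
    have ci: "P contour_integrable_on linepath p q" if "closed_segment p q \<subseteq> path_image ?p" for p q
      by (rule contour_integrable_continuous_linepath[OF continuous_on_subset[OF Pc]]) (use that pim in auto)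
    define I where "I = (\<lambda>p q. contour_integral (linepath p q) P)"
    have hi: "(P has_contour_integral I p q) (linepath p q)" if "closed_segment p q \<subseteq> path_image ?p" for p q
      unfolding I_def by (rule has_contour_integral_integral[OF ci[OF that]])
    have "(P has_contour_integral (I p1 p2 + (I p2 p3 + (I p3 p4 + I p4 p1)))) ?p"
      unfolding rp by (intro has_contour_integral_join hi valid_path_join) (auto simp: pims)
    then have sum: "I p1 p2 + (I p2 p3 + (I p3 p4 + I p4 p1)) = 2 * pi * \<i> * F w0"
      using tot by (rule has_contour_integral_unique)
    have "((\<lambda>x. P (of_real x)) has_integral I p1 p2) {0..R}"
    proof -
      have "(P has_contour_integral I p1 p2) (linepath p1 p2)" by (rule hi) (auto simp: pims)
      then show ?thesis
        using has_contour_integral_linepath_Reals_iff[of p1 p2 P "I p1 p2"] R1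
        by (simp add: p1_def p2_def complex_is_Real_iff)
    qed
    then have I1: "I p1 p2 = 2 * pi * \<i> * integral {0..R} (\<lambda>u. kern a b u *\<^sub>R F (of_real u))"
      unfolding Pu by (metis integral_mult_right integral_unique)
    \<comment> \<open>The left side runs downwards; reversed and parametrised by height, it carries
      the factor \<open>\<i>\<close>, which turns the real values of the kernel there into the
      second axis integral.\<close>
    have "((\<lambda>x. P (Complex 0 x)) has_integral (- \<i> * (- I p4 p1))) {0..R}"
    proof -
      have "(P has_contour_integral I p4 p1) (linepath p4 p1)" by (rule hi) (auto simp: pims)
      then have "(P has_contour_integral - I p4 p1) (linepath p1 p4)"
        by (rule has_contour_integral_reverse_linepath)
      then show ?thesis
        using has_contour_integral_linepath_same_Re_iff[of p1 0 p4 0 R P "- I p4 p1"] R1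
        by (simp add: p1_def p4_def)
    qed
    then have "integral {0..R} (\<lambda>v. P (Complex 0 v)) = - \<i> * (- I p4 p1)" by (rule integral_unique)
    then have "integral {0..R} (\<lambda>v. - (2 * pi * (kern b a v *\<^sub>R F (\<i> * of_real v)))) = \<i> * I p4 p1"
      unfolding Pv by simp
    then have "- (2 * pi * integral {0..R} (\<lambda>v. kern b a v *\<^sub>R F (\<i> * of_real v))) = \<i> * I p4 p1"
      by (simp only: integral_neg integral_mult_right)
    then have "\<i> * (- (2 * pi * integral {0..R} (\<lambda>v. kern b a v *\<^sub>R F (\<i> * of_real v)))) = \<i> * (\<i> * I p4 p1)"
      by (rule arg_cong)
    moreover have "\<i> * (\<i> * z) = - z" for z by (simp flip: mult.assoc)
    ultimately have "- (\<i> * (2 * pi * integral {0..R} (\<lambda>v. kern b a v *\<^sub>R F (\<i> * of_real v)))) = - I p4 p1"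
      by (simp only: mult_minus_right)
    then have I4: "I p4 p1 = 2 * pi * \<i> * integral {0..R} (\<lambda>v. kern b a v *\<^sub>R F (\<i> * of_real v))"
      by (simp only: neg_equal_iff_equal mult_ac)
    have far: "norm (P w) \<le> 64 * C * (a * b) / R\<^sup>2" if w: "0 \<le> Re w" "0 \<le> Im w" "R \<le> norm w" for w
    proof -
      let ?n = "norm w"
      have n1: "1 \<le> ?n" "2 * norm w0 \<le> ?n" using w R1 by auto
      have n2: "2 * (norm w0)\<^sup>2 \<le> ?n\<^sup>2"
      proof -
        have "(2 * norm w0)\<^sup>2 \<le> ?n\<^sup>2" using n1 by (intro power_mono) auto
        then have "4 * (norm w0)\<^sup>2 \<le> ?n\<^sup>2" by (simp add: power_mult_distrib)
        then show ?thesis using zero_le_power2[of "norm w0"] by linarith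
      qed
      have l: "?n\<^sup>2 / 2 \<le> norm (w\<^sup>2 - z\<^sup>2)" if "norm z = norm w0" for z
        using norm_triangle_ineq2[of "w\<^sup>2" "z\<^sup>2"] n2 that by (simp add: norm_power)
      have "norm (P w) = norm (F w) * (8 * (a * b) * ?n / (norm (w\<^sup>2 - w0\<^sup>2) * norm (w\<^sup>2 - (cnj w0)\<^sup>2)))"
        unfolding Pf using a b by (simp add: norm_mult norm_divide)
      also have "\<dots> \<le> (C * (1 + ?n)) * (8 * (a * b) * ?n / (?n\<^sup>2 / 2 * (?n\<^sup>2 / 2)))"
      proof (rule mult_mono)
        have "?n\<^sup>2 / 2 * (?n\<^sup>2 / 2) \<le> norm (w\<^sup>2 - w0\<^sup>2) * norm (w\<^sup>2 - (cnj w0)\<^sup>2)"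
          using l[of w0] l[of "cnj w0"] by (intro mult_mono) auto
        moreover have "0 < ?n\<^sup>2 / 2 * (?n\<^sup>2 / 2)" using n1 by (intro mult_pos_pos) auto
        ultimately show "8 * (a * b) * ?n / (norm (w\<^sup>2 - w0\<^sup>2) * norm (w\<^sup>2 - (cnj w0)\<^sup>2)) \<le> 8 * (a * b) * ?n / (?n\<^sup>2 / 2 * (?n\<^sup>2 / 2))"
          using a b by (intro frac_le) auto
      qed (use Fb[OF w(1,2)] a b C in auto)
      also have "\<dots> \<le> (C * (?n + ?n)) * (8 * (a * b) * ?n / (?n\<^sup>2 / 2 * (?n\<^sup>2 / 2)))"
        using n1 C a b by (intro mult_right_mono mult_left_mono) auto
      also have "\<dots> = 64 * C * (a * b) / ?n\<^sup>2" using n1 by (simp add: power2_eq_square field_simps)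
      also have "\<dots> \<le> 64 * C * (a * b) / R\<^sup>2"
        using w R1 C a b by (intro divide_left_mono power_mono mult_pos_pos) auto
      finally show ?thesis .
    qed
    have B0: "0 \<le> 64 * C * (a * b) / R\<^sup>2" using C a b by simp
    have I2: "norm (I p2 p3) \<le> 64 * C * (a * b) / R\<^sup>2 * norm (p3 - p2)"
    proof (rule has_contour_integral_bound_linepath[OF _ B0])
      show "(P has_contour_integral I p2 p3) (linepath p2 p3)" by (rule hi) (auto simp: pims)
      fix w assume "w \<in> closed_segment p2 p3"
      then have "Re w = R" "0 \<le> Im w" using R1 by (auto simp: p2_def p3_def closed_segment_same_Re closed_segment_eq_real_ivl)
      then show "norm (P w) \<le> 64 * C * (a * b) / R\<^sup>2" using R1 complex_Re_le_cmod[of w] by (intro far) auto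
    qed
    have I3: "norm (I p3 p4) \<le> 64 * C * (a * b) / R\<^sup>2 * norm (p4 - p3)"
    proof (rule has_contour_integral_bound_linepath[OF _ B0])
      show "(P has_contour_integral I p3 p4) (linepath p3 p4)" by (rule hi) (auto simp: pims)
      fix w assume "w \<in> closed_segment p3 p4"
      then have "Im w = R" "0 \<le> Re w" using R1 by (auto simp: p3_def p4_def closed_segment_same_Im closed_segment_eq_real_ivl)
      then show "norm (P w) \<le> 64 * C * (a * b) / R\<^sup>2" using R1 abs_Im_le_cmod[of w] by (intro far) auto
    qed
    have len: "norm (p3 - p2) = R" "norm (p4 - p3) = R" using R1 by (auto simp: p2_def p3_def p4_def cmod_def)
    define J where "J = integral {0..R} (\<lambda>u. kern a b u *\<^sub>R F (of_real u)) + integral {0..R} (\<lambda>v. kern b a v *\<^sub>R F (\<i> * of_real v)) - F w0"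
    have "2 * pi * \<i> * J = - (I p2 p3 + I p3 p4)"
    proof -
      have "2 * pi * \<i> * (p + q - f) = - (x + y)" if "2 * pi * \<i> * p + (x + (y + 2 * pi * \<i> * q)) = 2 * pi * \<i> * f" for p q x y f
      proof -
        have "2 * pi * \<i> * (p + q - f) = 2 * pi * \<i> * p + 2 * pi * \<i> * q - (2 * pi * \<i> * p + (x + (y + 2 * pi * \<i> * q)))"
          unfolding that by (simp add: algebra_simps)
        then show ?thesis by simp
      qed
      from this[OF sum[unfolded I1 I4]] show ?thesis unfolding J_def .
    qed
    then have "norm (2 * pi * \<i> * J) = norm (- (I p2 p3 + I p3 p4))" by (rule arg_cong)
    then have "norm (2 * pi * \<i> * J) = norm (I p2 p3 + I p3 p4)" by (simp only: norm_minus_cancel)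
    then have "2 * pi * norm J = norm (I p2 p3 + I p3 p4)" by (simp add: norm_mult)
    also have "\<dots> \<le> 64 * C * (a * b) / R\<^sup>2 * R + 64 * C * (a * b) / R\<^sup>2 * R"
      using I2 I3 unfolding len by (intro norm_triangle_le add_mono)
    also have "\<dots> = 2 * (64 * C * (a * b) / R)" using R1 by (simp add: power2_eq_square)
    finally have "pi * norm J \<le> 64 * C * (a * b) / R" by simp
    moreover have "norm J \<le> pi * norm J" using pi_ge_two mult_right_mono[of 1 pi "norm J"] by simp
    ultimately show ?thesis unfolding J_def by linarith
  qed
  have "(\<lambda>n. integral {0..real n} (\<lambda>u. kern a b u *\<^sub>R F (of_real u)) + integral {0..real n} (\<lambda>v. kern b a v *\<^sub>R F (\<i> * of_real v)) - F w0)
      \<longlonglongrightarrow> 0"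
  proof (rule Lim_null_comparison)
    show "(\<lambda>n. 64 * C * (a * b) / real n) \<longlonglongrightarrow> 0" by real_asymp
    have "eventually (\<lambda>n. N0 \<le> real n) sequentially" by real_asymp
    then show "eventually (\<lambda>n. norm (integral {0..real n} (\<lambda>u. kern a b u *\<^sub>R F (of_real u)) +
        integral {0..real n} (\<lambda>v. kern b a v *\<^sub>R F (\<i> * of_real v)) - F w0) \<le> 64 * C * (a * b) / real n) sequentially"
      by eventually_elim (rule key)
  qed
  moreover have "(\<lambda>n. integral {0..real n} (\<lambda>u. kern a b u *\<^sub>R F (of_real u)) + integral {0..real n} (\<lambda>v. kern b a v *\<^sub>R F (\<i> * of_real v)) - F w0)
      \<longlonglongrightarrow> (LINT u:{0<..}|lborel. kern a b u *\<^sub>R F (of_real u)) + (LINT v:{0<..}|lborel. kern b a v *\<^sub>R F (\<i> * of_real v)) - F w0"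
    by (intro tendsto_intros h1(2) h2(2))
  ultimately have "(LINT u:{0<..}|lborel. kern a b u *\<^sub>R F (of_real u)) + (LINT v:{0<..}|lborel. kern b a v *\<^sub>R F (\<i> * of_real v)) - F w0 = 0"
    using LIMSEQ_unique by blast
  then show "(LINT u:{0<..}|lborel. kern a b u *\<^sub>R F (of_real u)) +
      (LINT v:{0<..}|lborel. kern b a v *\<^sub>R F (\<i> * of_real v)) = F (Complex a b)"
    by (simp add: w0_def)
qed

lemma axis_continuous:
  assumes "continuous_on E f"
  shows "continuous_on {0..} (\<lambda>u. f (u, 0))" and "continuous_on {0..} (\<lambda>v. f (0, v))"
  by (rule continuous_on_compose2[OF assms], intro continuous_intros, auto simp: E_iff)+

text \<open>The Poisson formula for \<open>F w = 1\<close> gives the total mass, that for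
  \<open>F w = w\<close> the first moment, as its real part. The second application is the reason
  for admitting linear growth.\<close>

lemma kern_facts:
  assumes a: "0 < a" and b: "0 < b"
  shows "set_integrable lborel {0<..} (kern a b)" and "set_integrable lborel {0<..} (\<lambda>u. kern a b u * u)"
    and "(LINT u:{0<..}|lborel. kern a b u) + (LINT u:{0<..}|lborel. kern b a u) = 1"
    and "(LINT u:{0<..}|lborel. kern a b u * u) = a"
proof -
  have cr: "set_integrable lborel {0<..} g" if "set_integrable lborel {0<..} (\<lambda>u. complex_of_real (g u))" for g :: "real \<Rightarrow> real"
    using integrable_Re[OF that[unfolded set_integrable_def]] by (simp add: set_integrable_def)
  have I1: "set_integrable lborel {0<..} (\<lambda>u. kern a b u *\<^sub>R (1::complex))"
    "set_integrable lborel {0<..} (\<lambda>u. kern b a u *\<^sub>R (1::complex))"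
    "(LINT u:{0<..}|lborel. kern a b u *\<^sub>R (1::complex)) + (LINT u:{0<..}|lborel. kern b a u *\<^sub>R (1::complex)) = 1"
    using poisson_entire[OF a b, of "\<lambda>_. 1" 1] by auto
  have I2: "set_integrable lborel {0<..} (\<lambda>u. kern a b u *\<^sub>R complex_of_real u)"
    "(LINT u:{0<..}|lborel. kern a b u *\<^sub>R complex_of_real u) + (LINT u:{0<..}|lborel. kern b a u *\<^sub>R (\<i> * of_real u)) = Complex a b"
    using poisson_entire[OF a b, of "\<lambda>w. w" 1] by auto
  show "set_integrable lborel {0<..} (kern a b)"
    by (rule cr) (use I1(1) in \<open>simp add: scaleR_conv_of_real\<close>)
  show "set_integrable lborel {0<..} (\<lambda>u. kern a b u * u)"
    by (rule cr) (use I2(1) in \<open>simp add: scaleR_conv_of_real\<close>)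
  have c1: "(LINT u:{0<..}|lborel. g u *\<^sub>R (1::complex)) = of_real (LINT u:{0<..}|lborel. g u)" for g :: "real \<Rightarrow> real"
    by (simp add: scaleR_conv_of_real set_integral_complex_of_real)
  have "complex_of_real ((LINT u:{0<..}|lborel. kern a b u) + (LINT u:{0<..}|lborel. kern b a u)) = 1"
    using I1(3) unfolding c1 by simp
  then show "(LINT u:{0<..}|lborel. kern a b u) + (LINT u:{0<..}|lborel. kern b a u) = 1"
    by (simp only: of_real_eq_1_iff)
  have "(\<lambda>u. kern a b u *\<^sub>R complex_of_real u) = (\<lambda>u. complex_of_real (kern a b u * u))"
    by (simp add: scaleR_conv_of_real fun_eq_iff)
  then have c2: "(LINT u:{0<..}|lborel. kern a b u *\<^sub>R complex_of_real u) = of_real (LINT u:{0<..}|lborel. kern a b u * u)"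
    by (simp only: set_integral_complex_of_real)
  have "(\<lambda>u. kern b a u *\<^sub>R (\<i> * complex_of_real u)) = (\<lambda>u. \<i> * complex_of_real (kern b a u * u))"
    by (simp add: scaleR_conv_of_real fun_eq_iff mult_ac)
  then have c3: "(LINT u:{0<..}|lborel. kern b a u *\<^sub>R (\<i> * complex_of_real u)) = \<i> * of_real (LINT u:{0<..}|lborel. kern b a u * u)"
    by (simp only: set_integral_complex_of_real set_integral_mult_right)
  show "(LINT u:{0<..}|lborel. kern a b u * u) = a"
    using arg_cong[OF I2(2), of Re] unfolding c2 c3 by simp
qed

lemma kern_scaleR_integrable:
  fixes g :: "real \<Rightarrow> complex"
  assumes a: "0 < a" and b: "0 < b" and g: "continuous_on {0..} g" "\<And>u. 0 \<le> u \<Longrightarrow> norm (g u) \<le> K * (1 + u)"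
  shows "set_integrable lborel {0<..} (\<lambda>u. kern a b u *\<^sub>R g u)"
proof -
  obtain C where C: "0 \<le> C" "\<And>u. 0 \<le> u \<Longrightarrow> kern a b u * (1 + u) \<le> C / (1 + u\<^sup>2)"
    using kern_bound[OF a b] by blast
  have K: "0 \<le> K" using g(2)[of 0] norm_ge_zero[of "g 0"] by (simp del: norm_ge_zero)
  show ?thesis
  proof (rule half_line_integral(1)[where C = "K * C"])
    show "continuous_on {0..} (\<lambda>u. kern a b u *\<^sub>R g u)" using b g by (intro continuous_intros)
    show "kern a b 0 *\<^sub>R g 0 = 0" by (simp add: kern_def)
    fix u :: real assume u: "0 < u"
    have "norm (kern a b u *\<^sub>R g u) \<le> kern a b u * (K * (1 + u))"
      using kern_nonneg[of a b u] a b u g(2)[of u] by (simp add: mult_left_mono)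
    also have "\<dots> = K * (kern a b u * (1 + u))" by simp
    also have "\<dots> \<le> K * (C / (1 + u\<^sup>2))" using C(2)[of u] u K by (intro mult_left_mono) auto
    finally show "norm (kern a b u *\<^sub>R g u) \<le> K * C / (1 + u\<^sup>2)" by simp
  qed
qed

section \<open>The Poisson integral of a boundary function\<close>

definition poisson :: "(real \<times> real \<Rightarrow> complex) \<Rightarrow> real \<times> real \<Rightarrow> complex"
  where "poisson f x = (LINT u:{0<..}|lborel. kern (fst x) (snd x) u *\<^sub>R f (u, 0)) +
    (LINT v:{0<..}|lborel. kern (snd x) (fst x) v *\<^sub>R f (0, v))"

lemma poisson_integrable:
  fixes f :: "real \<times> real \<Rightarrow> complex"
  assumes x: "x \<in> open_quadrant" and f: "continuous_on E f" "\<And>y. y \<in> E \<Longrightarrow> norm (f y) \<le> K"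
  shows "set_integrable lborel {0<..} (\<lambda>u. kern (fst x) (snd x) u *\<^sub>R f (u, 0))"
    and "set_integrable lborel {0<..} (\<lambda>v. kern (snd x) (fst x) v *\<^sub>R f (0, v))"
proof -
  have x': "0 < fst x" "0 < snd x" using x by (auto simp: open_quadrant_def)
  have K: "0 \<le> K" using f(2)[of "(0, 0)"] norm_ge_zero[of "f (0, 0)"] by (simp add: E_iff del: norm_ge_zero)
  have le: "K \<le> K * (1 + u)" if "0 \<le> u" for u using K that by (simp add: distrib_left)
  show "set_integrable lborel {0<..} (\<lambda>u. kern (fst x) (snd x) u *\<^sub>R f (u, 0))"
    by (rule kern_scaleR_integrable[OF x' axis_continuous(1)[OF f(1)]])
      (rule order_trans[OF f(2) le], auto simp: E_iff)
  show "set_integrable lborel {0<..} (\<lambda>v. kern (snd x) (fst x) v *\<^sub>R f (0, v))"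
    by (rule kern_scaleR_integrable[OF x'(2,1) axis_continuous(2)[OF f(1)]])
      (rule order_trans[OF f(2) le], auto simp: E_iff)
qed

lemma poisson_diff:
  assumes x: "x \<in> open_quadrant" and f: "continuous_on E f" "\<And>y. y \<in> E \<Longrightarrow> norm (f y) \<le> K"
    and g: "continuous_on E g" "\<And>y. y \<in> E \<Longrightarrow> norm (g y) \<le> L"
  shows "poisson (\<lambda>y. f y - g y) x = poisson f x - poisson g x"
  unfolding poisson_def scaleR_diff_right
  by (simp add: set_integral_diff poisson_integrable[OF x f] poisson_integrable[OF x g])

lemma poisson_add:
  assumes x: "x \<in> open_quadrant" and f: "continuous_on E f" "\<And>y. y \<in> E \<Longrightarrow> norm (f y) \<le> K"
    and g: "continuous_on E g" "\<And>y. y \<in> E \<Longrightarrow> norm (g y) \<le> L"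
  shows "poisson (\<lambda>y. f y + g y) x = poisson f x + poisson g x"
  unfolding poisson_def scaleR_add_right
  by (simp add: set_integral_add poisson_integrable[OF x f] poisson_integrable[OF x g])

text \<open>The kernel is nonnegative and its masses on the two axes add up to 1.\<close>

lemma poisson_norm_le:
  assumes x: "x \<in> open_quadrant" and f: "continuous_on E f" "\<And>y. y \<in> E \<Longrightarrow> norm (f y) \<le> K"
  shows "norm (poisson f x) \<le> K"
proof -
  have x': "0 < fst x" "0 < snd x" using x by (auto simp: open_quadrant_def)
  have half: "norm (LINT u:{0<..}|lborel. kern a b u *\<^sub>R g u) \<le> K * (LINT u:{0<..}|lborel. kern a b u)"
    if ab: "0 < a" "0 < b" and i: "set_integrable lborel {0<..} (\<lambda>u. kern a b u *\<^sub>R g u)"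
      and g: "\<And>u. 0 \<le> u \<Longrightarrow> norm (g u) \<le> K" for a b and g :: "real \<Rightarrow> complex"
  proof -
    have "norm (LINT u:{0<..}|lborel. kern a b u *\<^sub>R g u) \<le> (LINT u:{0<..}|lborel. norm (kern a b u *\<^sub>R g u))"
      by (rule set_integral_norm_bound[OF i])
    also have "\<dots> \<le> (LINT u:{0<..}|lborel. K * kern a b u)"
    proof (rule set_integral_mono)
      show "set_integrable lborel {0<..} (\<lambda>u. norm (kern a b u *\<^sub>R g u))" by (rule set_integrable_norm[OF i])
      show "set_integrable lborel {0<..} (\<lambda>u. K * kern a b u)" using kern_facts(1)[OF ab] by simp
      show "norm (kern a b u *\<^sub>R g u) \<le> K * kern a b u" if "u \<in> {0<..}" for u
        using mult_left_mono[OF g[of u], of "kern a b u"] kern_nonneg[of a b u] ab that by (simp add: mult.commute)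
    qed
    finally show ?thesis by simp
  qed
  have "norm (poisson f x) \<le> K * (LINT u:{0<..}|lborel. kern (fst x) (snd x) u) + K * (LINT u:{0<..}|lborel. kern (snd x) (fst x) u)"
    unfolding poisson_def using x' f(2)
    by (intro norm_triangle_mono half poisson_integrable[OF x f]) (auto simp: E_iff)
  then show ?thesis using kern_facts(3)[OF x'] by (simp flip: distrib_left)
qed

lemma poisson_hexp:
  assumes x: "x \<in> open_quadrant" and z: "z \<in> Z"
  shows "poisson (\<lambda>y. c * hexp z y) x = c * hexp z x"
proof -
  have x': "0 < fst x" "0 < snd x" using x by (auto simp: open_quadrant_def)
  have b: "norm (c * exp (- z * w)) \<le> norm c * (1 + norm w)" if w: "0 \<le> Re w" "0 \<le> Im w" for w
  proof -
    have "norm (exp (- z * w)) \<le> 1"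
      using norm_hexp_le_1[OF z, of "(Re w, Im w)"] w by (simp add: hexp_def cx_def quadrant_def)
    then have "norm (exp (- z * w)) \<le> 1 + norm w" by (rule order_trans) simp
    then show ?thesis by (simp add: norm_mult mult_left_mono)
  qed
  have "(\<lambda>w. c * exp (- z * w)) holomorphic_on UNIV" by (intro holomorphic_intros)
  note p = poisson_entire(3)[OF x' this b]
  have "cx (u, 0) = of_real u" "cx (0, u) = \<i> * of_real u" for u by (simp_all add: cx_def complex_eq_iff)
  then show ?thesis using p by (simp add: poisson_def hexp_def) (simp add: cx_def)
qed

lemma poisson_cnj: "poisson (\<lambda>y. cnj (f y)) x = cnj (poisson f x)"
proof -
  have "(LINT u:{0<..}|lborel. k u *\<^sub>R cnj (g u)) = cnj (LINT u:{0<..}|lborel. k u *\<^sub>R g u)" for k :: "real \<Rightarrow> real" and g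
    unfolding set_lebesgue_integral_def by (subst Bochner_Integration.integral_cnj[symmetric]) simp
  then show ?thesis by (simp add: poisson_def)
qed

lemma core_continuous: "f \<in> core \<Longrightarrow> continuous_on A f"
proof (induction rule: core.induct)
  case (add f g)
  then show ?case by (intro continuous_intros)
qed (intro continuous_intros)+

lemma core_bounded:
  assumes "f \<in> core"
  obtains K where "\<And>x. x \<in> quadrant \<Longrightarrow> norm (f x) \<le> K"
proof -
  have "\<exists>K. \<forall>x\<in>quadrant. norm (f x) \<le> K" using assms
  proof induction
    case (exp z c)
    have "norm (c * hexp z x) \<le> norm c" if "x \<in> quadrant" for x
      using norm_hexp_le_1[OF exp that] mult_left_le[of "norm (hexp z x)" "norm c"] by (simp add: norm_mult)
    then show ?case by blast
  next
    case (cnj z c)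
    have "norm (c * cnj (hexp z x)) \<le> norm c" if "x \<in> quadrant" for x
      using norm_hexp_le_1[OF cnj that] mult_left_le[of "norm (hexp z x)" "norm c"] by (simp add: norm_mult)
    then show ?case by blast
  next
    case (add f g)
    then obtain K L where "\<forall>x\<in>quadrant. norm (f x) \<le> K" "\<forall>x\<in>quadrant. norm (g x) \<le> L" by blast
    then have "norm (f x + g x) \<le> K + L" if "x \<in> quadrant" for x
      using that by (intro norm_triangle_mono) auto
    then show ?case by blast
  qed
  then show ?thesis using that by blast
qed

text \<open>Uniform approximation by the bounded functions of \<open>core\<close> takes the place of
  a compactness argument on \<open>E\<close> with its point at infinity.\<close>

lemma Cl_bounded:
  assumes "f \<in> Cl"
  obtains K where "0 \<le> K" "\<And>x. x \<in> E \<Longrightarrow> norm (f x) \<le> K"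
proof -
  obtain h where h: "h \<in> core" "\<And>x. x \<in> E \<Longrightarrow> norm (f x - h x) \<le> 1"
    using uclE[OF core_dense[OF assms], of 1] by auto
  obtain K where K: "\<And>x. x \<in> quadrant \<Longrightarrow> norm (h x) \<le> K" using core_bounded[OF h(1)] by blast
  have "norm (f x) \<le> \<bar>K\<bar> + 1" if "x \<in> E" for x
    using norm_triangle_ineq[of "f x - h x" "h x"] h(2)[OF that] K[of x] that E_subset_quadrant by auto
  then show ?thesis by (intro that[of "\<bar>K\<bar> + 1"]) auto
qed

lemma poisson_core:
  assumes x: "x \<in> open_quadrant" and f: "f \<in> core"
  shows "poisson f x = f x"
  using f
proof induction
  case (exp z c)
  then show ?case by (rule poisson_hexp[OF x])
next
  case (cnj z c)
  have "poisson (\<lambda>y. cnj (cnj c * hexp z y)) x = cnj (cnj c * hexp z x)"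
    unfolding poisson_cnj poisson_hexp[OF x cnj] ..
  then show ?case by simp
next
  case (add f g)
  obtain K where K: "\<And>x. x \<in> quadrant \<Longrightarrow> norm (f x) \<le> K" using core_bounded[OF add.hyps(1)] by blast
  obtain L where L: "\<And>x. x \<in> quadrant \<Longrightarrow> norm (g x) \<le> L" using core_bounded[OF add.hyps(2)] by blast
  show ?case
    using poisson_add[OF x core_continuous[OF add.hyps(1)] K core_continuous[OF add.hyps(2)] L] add.IH
      E_subset_quadrant by auto
qed

lemma E_borel [measurable]: "E \<in> sets borel"
proof -
  have "closed quadrant" unfolding quadrant_def by (intro closed_Times closed_atLeast)
  moreover have "open open_quadrant" unfolding open_quadrant_def by (intro open_Times open_greaterThan)
  ultimately show ?thesis unfolding E_def by (intro sets.Diff borel_closed borel_open)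
qed

section \<open>Exit laws as harmonic extension\<close>

text \<open>All that the remaining argument takes from Brownian motion.\<close>

locale exit_kernel =
  fixes Q :: "real \<times> real \<Rightarrow> (real \<times> real) measure"
  assumes Q_prob: "x \<in> quadrant \<Longrightarrow> prob_space (Q x)"
    and Q_sets: "x \<in> quadrant \<Longrightarrow> sets (Q x) = sets borel"
    and Q_E: "x \<in> quadrant \<Longrightarrow> AE y in Q x. y \<in> E"
    and Q_exp: "x \<in> quadrant \<Longrightarrow> z \<in> Z \<Longrightarrow> (LINT y|Q x. hexp z y) = hexp z x"
begin

lemma Q_integrable:
  assumes x: "x \<in> quadrant" and f: "continuous_on E f" "\<And>y. y \<in> E \<Longrightarrow> norm (f y :: complex) \<le> K"
  shows "set_integrable (Q x) E f"
proof -
  interpret prob_space "Q x" by (rule Q_prob[OF x])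
  have "(\<lambda>y. indicator E y *\<^sub>R f y) \<in> borel_measurable borel"
    by (rule borel_measurable_continuous_on_indicator[OF E_borel f(1)])
  then have "(\<lambda>y. indicator E y *\<^sub>R f y) \<in> borel_measurable (Q x)"
    by (simp add: measurable_cong_sets[OF Q_sets[OF x] refl])
  then show ?thesis
    unfolding set_integrable_def by (rule integrable_const_bound[where B = "max K 0", rotated]) (auto simp: indicator_def le_max_iff_disj f)
qed

lemma Q_norm_le:
  assumes x: "x \<in> quadrant" and f: "continuous_on E f" "\<And>y. y \<in> E \<Longrightarrow> norm (f y :: complex) \<le> K"
  shows "norm (LINT y:E|Q x. f y) \<le> K"
proof -
  interpret prob_space "Q x" by (rule Q_prob[OF x])
  have K: "0 \<le> K" using f(2)[of "(0, 0)"] norm_ge_zero[of "f (0, 0)"] by (simp add: E_iff del: norm_ge_zero)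
  have "norm (LINT y:E|Q x. f y) \<le> (LINT y|Q x. norm (indicator E y *\<^sub>R f y))"
    unfolding set_lebesgue_integral_def by (rule integral_norm_bound)
  also have "\<dots> \<le> (LINT y|Q x. K)"
  proof (rule integral_mono)
    show "integrable (Q x) (\<lambda>y. norm (indicator E y *\<^sub>R f y))"
      using Q_integrable[OF x f] unfolding set_integrable_def by (rule integrable_norm)
  qed (use K f(2) in \<open>auto simp: indicator_def\<close>)
  also have "\<dots> = K" by (simp add: prob_space)
  finally show ?thesis .
qed

lemma Q_set_integral:
  assumes x: "x \<in> quadrant" and f: "continuous_on UNIV f"
  shows "(LINT y:E|Q x. f y) = (LINT y|Q x. f y :: complex)"
  unfolding set_lebesgue_integral_def
proof (rule integral_cong_AE)
  have [measurable]: "f \<in> borel_measurable borel" by (rule borel_measurable_continuous_onI[OF f])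
  show "f \<in> borel_measurable (Q x)" "(\<lambda>y. indicator E y *\<^sub>R f y) \<in> borel_measurable (Q x)"
    by (simp_all add: measurable_cong_sets[OF Q_sets[OF x] refl])
  show "AE y in Q x. indicator E y *\<^sub>R f y = f y"
    using Q_E[OF x] by eventually_elim simp
qed

lemma Q_core:
  assumes x: "x \<in> quadrant" and f: "f \<in> core"
  shows "(LINT y:E|Q x. f y) = f x"
  using f
proof induction
  case (exp z c)
  have "continuous_on UNIV (hexp z)" by (intro continuous_intros)
  then show ?case using Q_exp[OF x exp] by (simp add: Q_set_integral[OF x])
next
  case (cnj z c)
  have c: "continuous_on UNIV (\<lambda>y. cnj (hexp z y))" by (intro continuous_intros)
  have "(LINT y:E|Q x. cnj (hexp z y)) = cnj (LINT y|Q x. hexp z y)"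
    unfolding Q_set_integral[OF x c] by simp
  then show ?case using Q_exp[OF x cnj] by simp
next
  case (add f g)
  obtain K where K: "\<And>x. x \<in> quadrant \<Longrightarrow> norm (f x) \<le> K" using core_bounded[OF add.hyps(1)] by blast
  obtain L where L: "\<And>x. x \<in> quadrant \<Longrightarrow> norm (g x) \<le> L" using core_bounded[OF add.hyps(2)] by blast
  have "set_integrable (Q x) E f" "set_integrable (Q x) E g"
    using K L E_subset_quadrant
    by (auto intro!: Q_integrable[OF x core_continuous[OF add.hyps(1)], of K] Q_integrable[OF x core_continuous[OF add.hyps(2)], of L])
  then show ?case using add.IH by (simp add: set_integral_add)
qed

lemma Q_diff:
  assumes x: "x \<in> quadrant" and f: "continuous_on E f" "\<And>y. y \<in> E \<Longrightarrow> norm (f y :: complex) \<le> K"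
    and g: "continuous_on E g" "\<And>y. y \<in> E \<Longrightarrow> norm (g y) \<le> L"
  shows "(LINT y:E|Q x. f y - g y) = (LINT y:E|Q x. f y) - (LINT y:E|Q x. g y)"
  by (simp add: set_integral_diff Q_integrable[OF x f] Q_integrable[OF x g])

text \<open>Both sides are contractions in \<open>f\<close> that agree on the dense set \<open>core\<close>.\<close>

lemma Q_Cl_approx:
  assumes x: "x \<in> quadrant" and f: "f \<in> Cl" and h: "h \<in> core" "\<And>y. y \<in> E \<Longrightarrow> norm (f y - h y) \<le> e"
  shows "norm ((LINT y:E|Q x. f y) - h x) \<le> e"
proof -
  have fc: "continuous_on E f" using f by (auto simp: Cl_def)
  obtain K where K: "\<And>x. x \<in> E \<Longrightarrow> norm (f x) \<le> K" using Cl_bounded[OF f] by blast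
  obtain L where L: "\<And>x. x \<in> quadrant \<Longrightarrow> norm (h x) \<le> L" using core_bounded[OF h(1)] by blast
  have "(LINT y:E|Q x. f y - h y) = (LINT y:E|Q x. f y) - h x"
    using Q_diff[OF x fc K core_continuous[OF h(1)], of L] L E_subset_quadrant Q_core[OF x h(1)] by auto
  moreover have "norm (LINT y:E|Q x. f y - h y) \<le> e"
    by (rule Q_norm_le[OF x _ h(2)]) (intro continuous_intros fc core_continuous h)
  ultimately show ?thesis by simp
qed

text \<open>For a starting point in \<open>E\<close> the harmonic functions of \<open>core\<close>
  are evaluated at the point itself; by density the exit law then acts on \<open>Cl\<close> as a
  point mass.\<close>

lemma Q_boundary:
  assumes x: "x \<in> E" and f: "f \<in> Cl"
  shows "(LINT y:E|Q x. f y) = f x"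
proof -
  have "norm ((LINT y:E|Q x. f y) - f x) \<le> e" if "0 < e" for e
  proof -
    obtain h where h: "h \<in> core" "\<And>x. x \<in> E \<Longrightarrow> norm (f x - h x) \<le> e / 2"
      using uclE[OF core_dense[OF f], of "e / 2"] \<open>0 < e\<close> by auto
    have "norm ((LINT y:E|Q x. f y) - h x) \<le> e / 2"
      by (rule Q_Cl_approx[OF _ f h]) (use x E_subset_quadrant in auto)
    then show ?thesis using h(2)[OF x] norm_triangle_ineq4[of "(LINT y:E|Q x. f y) - h x" "f x - h x"] by simp
  qed
  then have "norm ((LINT y:E|Q x. f y) - f x) \<le> 0" by (rule field_le_epsilon[of _ 0, simplified])
  then show ?thesis by simp
qed

lemma Q_poisson:
  assumes x: "x \<in> open_quadrant" and f: "f \<in> Cl"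
  shows "(LINT y:E|Q x. f y) = poisson f x"
proof -
  have xq: "x \<in> quadrant" using x by (auto simp: open_quadrant_def quadrant_def)
  have fc: "continuous_on E f" using f by (auto simp: Cl_def)
  obtain K where K: "\<And>x. x \<in> E \<Longrightarrow> norm (f x) \<le> K" using Cl_bounded[OF f] by blast
  have "norm ((LINT y:E|Q x. f y) - poisson f x) \<le> e" if "0 < e" for e
  proof -
    obtain h where h: "h \<in> core" "\<And>x. x \<in> E \<Longrightarrow> norm (f x - h x) \<le> e / 2"
      using uclE[OF core_dense[OF f], of "e / 2"] \<open>0 < e\<close> by auto
    obtain L where L: "\<And>x. x \<in> quadrant \<Longrightarrow> norm (h x) \<le> L" using core_bounded[OF h(1)] by blast
    have 1: "norm ((LINT y:E|Q x. f y) - h x) \<le> e / 2" by (rule Q_Cl_approx[OF xq f h])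
    have "poisson (\<lambda>y. f y - h y) x = poisson f x - h x"
      using poisson_diff[OF x fc K core_continuous[OF h(1)], of L] L E_subset_quadrant poisson_core[OF x h(1)] by auto
    moreover have "norm (poisson (\<lambda>y. f y - h y) x) \<le> e / 2"
      by (rule poisson_norm_le[OF x _ h(2)]) (intro continuous_intros fc core_continuous h)
    ultimately show ?thesis
      using 1 norm_triangle_ineq4[of "(LINT y:E|Q x. f y) - h x" "poisson f x - h x"] by simp
  qed
  then have "norm ((LINT y:E|Q x. f y) - poisson f x) \<le> 0" by (rule field_le_epsilon[of _ 0, simplified])
  then show ?thesis by simp
qed

end

text \<open>Brownian scaling, visible as homogeneity of the kernel of degree -1.\<close>

lemma poisson_scale:
  assumes s: "0 < s"
  shows "poisson f (s *\<^sub>R x) = poisson (\<lambda>y. f (s *\<^sub>R y)) x"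
proof -
  have k: "s * kern (s * a) (s * b) (s * u) = kern a b u" for a b u
  proof -
    have 1: "(s * u - s * a)\<^sup>2 + (s * b)\<^sup>2 = s\<^sup>2 * ((u - a)\<^sup>2 + b\<^sup>2)" "(s * u + s * a)\<^sup>2 + (s * b)\<^sup>2 = s\<^sup>2 * ((u + a)\<^sup>2 + b\<^sup>2)"
      by (simp_all add: power2_eq_square algebra_simps)
    have "s * (s * u * (s * a) * (s * b)) = (s\<^sup>2 * s\<^sup>2) * (u * a * b)" by (simp add: power2_eq_square)
    moreover have "s\<^sup>2 * X * (s\<^sup>2 * Y) = (s\<^sup>2 * s\<^sup>2) * (X * Y)" for X Y by simp
    ultimately have main: "s * ((s * u) * (s * a) * (s * b) / ((s\<^sup>2 * ((u - a)\<^sup>2 + b\<^sup>2)) * (s\<^sup>2 * ((u + a)\<^sup>2 + b\<^sup>2))))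
        = u * a * b / (((u - a)\<^sup>2 + b\<^sup>2) * ((u + a)\<^sup>2 + b\<^sup>2))"
      using s by (simp only: times_divide_eq_right) simp
    show ?thesis unfolding kern_def 1 mult.left_commute[of s "4 / pi"] main ..
  qed
  have "(LINT u:{0<..}|lborel. kern (s * a) (s * b) u *\<^sub>R g u) = (LINT u:{0<..}|lborel. kern a b u *\<^sub>R g (s * u))"
    for a b and g :: "real \<Rightarrow> complex"
  proof -
    have "(LINT u:{0<..}|lborel. kern (s * a) (s * b) u *\<^sub>R g u)
        = s *\<^sub>R (LINT u|lborel. indicator {0<..} (0 + s * u) *\<^sub>R kern (s * a) (s * b) (0 + s * u) *\<^sub>R g (0 + s * u))"
      unfolding set_lebesgue_integral_def
      using lborel_integral_real_affine[of s "\<lambda>u. indicator {0<..} u *\<^sub>R kern (s * a) (s * b) u *\<^sub>R g u" 0] s by simp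
    also have "\<dots> = (LINT u|lborel. s *\<^sub>R (indicator {0<..} (0 + s * u) *\<^sub>R kern (s * a) (s * b) (0 + s * u) *\<^sub>R g (0 + s * u)))"
      by (simp only: integral_scaleR_right)
    also have "\<dots> = (LINT u:{0<..}|lborel. kern a b u *\<^sub>R g (s * u))"
      unfolding set_lebesgue_integral_def
    proof (rule Bochner_Integration.integral_cong[OF refl])
      fix u :: real
      have "indicator {0<..} (0 + s * u) = (indicator {0<..} u :: real)"
        using s by (auto simp: indicator_def zero_less_mult_iff)
      moreover have "s *\<^sub>R (i *\<^sub>R q *\<^sub>R y) = i *\<^sub>R (s * q) *\<^sub>R y" for i q and y :: complex by simp
      ultimately show "s *\<^sub>R (indicator {0<..} (0 + s * u) *\<^sub>R kern (s * a) (s * b) (0 + s * u) *\<^sub>R g (0 + s * u)) =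
          indicator {0<..} u *\<^sub>R kern a b u *\<^sub>R g (s * u)"
        by (simp only: add_0 k)
    qed
    finally show ?thesis .
  qed
  then show ?thesis by (simp add: poisson_def)
qed

section \<open>Derivatives along the axes\<close>

text \<open>One axis of the conditions in \<open>Cl2\<close>, with the derivatives as explicit
  functions \<open>d\<close> and \<open>s\<close>, so that both axes are served by one argument. The
  value \<open>d 0\<close> is the continuous extension.\<close>

definition axis_C2 :: "(real \<Rightarrow> complex) \<Rightarrow> (real \<Rightarrow> complex) \<Rightarrow> (real \<Rightarrow> complex) \<Rightarrow> real \<Rightarrow> bool"
  where "axis_C2 g d s C \<longleftrightarrow>
    (\<forall>u>0. (g has_vector_derivative d u) (at u)) \<and>
    (\<forall>u>0. (d has_vector_derivative s u) (at u)) \<and>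
    (d \<longlongrightarrow> d 0) (at_right 0) \<and>
    ((\<lambda>u. u *\<^sub>R d u) \<longlongrightarrow> 0) at_top \<and>
    (\<forall>u>0. u * norm (s u) \<le> C)"

lemma axis_deriv_eq:
  assumes "\<And>u. 0 < u \<Longrightarrow> (g has_vector_derivative d u) (at u)" and "0 < u"
  shows "axis_deriv g u = d u"
  using assms by (simp add: axis_deriv_def vector_derivative_at)

lemma axis_C2_axis_deriv:
  assumes diff: "\<forall>u>0. g differentiable (at u)" and lim: "\<exists>L. (axis_deriv g \<longlongrightarrow> L) (at_right 0)"
    and dec: "((\<lambda>u. u *\<^sub>R axis_deriv g u) \<longlongrightarrow> 0) at_top"
    and diff2: "\<forall>u>0. axis_deriv g differentiable (at u)"
    and b: "\<And>u. 0 < u \<Longrightarrow> u * norm (vector_derivative (axis_deriv g) (at u)) \<le> C"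
  shows "axis_C2 g (axis_deriv g) (\<lambda>u. vector_derivative (axis_deriv g) (at u)) C"
proof -
  obtain L where L: "(axis_deriv g \<longlongrightarrow> L) (at_right 0)" using lim by blast
  have "((\<lambda>u. vector_derivative g (at u)) \<longlongrightarrow> L) (at_right 0)"
    by (rule Lim_transform_eventually[OF L]) (auto simp: eventually_at_right_field axis_deriv_def intro!: exI[of _ 1])
  then have "axis_deriv g 0 = L"
    unfolding axis_deriv_def using tendsto_Lim[OF trivial_limit_at_right_real] by simp
  then show ?thesis
    using L dec b diff2 diff vector_derivative_works[of g] vector_derivative_works[of "axis_deriv g"]
    by (auto simp: axis_C2_def axis_deriv_def)
qed

lemma Cl2_axis_C2:
  assumes f: "f \<in> Cl2"
  obtains s1 s2 C where "axis_C2 (\<lambda>u. f (u, 0)) (\<lambda>u. pd1 f (u, 0)) s1 C" "axis_C2 (\<lambda>v. f (0, v)) (\<lambda>v. pd2 f (0, v)) s2 C"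
proof -
  have pd: "(\<lambda>u. pd1 f (u, 0)) = axis_deriv (\<lambda>u. f (u, 0))" "(\<lambda>v. pd2 f (0, v)) = axis_deriv (\<lambda>v. f (0, v))"
    by (auto simp: pd1_def pd2_def)
  let ?s1 = "\<lambda>r. vector_derivative (axis_deriv (\<lambda>u. f (u, 0))) (at r)"
  let ?s2 = "\<lambda>r. vector_derivative (axis_deriv (\<lambda>v. f (0, v))) (at r)"
  have *: "(\<forall>u>0. (\<lambda>u. f (u, 0)) differentiable (at u)) \<and>
    (\<exists>L. (axis_deriv (\<lambda>u. f (u, 0)) \<longlongrightarrow> L) (at_right 0)) \<and>
    (\<forall>v>0. (\<lambda>v. f (0, v)) differentiable (at v)) \<and>
    (\<exists>L. (axis_deriv (\<lambda>v. f (0, v)) \<longlongrightarrow> L) (at_right 0)) \<and>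
    ((\<lambda>u. u *\<^sub>R axis_deriv (\<lambda>u. f (u, 0)) u) \<longlongrightarrow> 0) at_top \<and>
    ((\<lambda>v. v *\<^sub>R axis_deriv (\<lambda>v. f (0, v)) v) \<longlongrightarrow> 0) at_top \<and>
    (\<forall>u>0. axis_deriv (\<lambda>u. f (u, 0)) differentiable (at u)) \<and>
    (\<forall>v>0. axis_deriv (\<lambda>v. f (0, v)) differentiable (at v)) \<and>
    bdd_above ((\<lambda>r. r * (norm (?s1 r) + norm (?s2 r))) ` {0<..})"
    using f unfolding Cl2_def mem_Collect_eq pd fun_cong[OF pd(1)] fun_cong[OF pd(2)]
    by (elim conjE, intro conjI) assumption+
  then have "bdd_above ((\<lambda>r. r * (norm (?s1 r) + norm (?s2 r))) ` {0<..})" by (elim conjE)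
  then obtain C where "\<forall>y\<in>(\<lambda>r. r * (norm (?s1 r) + norm (?s2 r))) ` {0<..}. y \<le> C"
    unfolding bdd_above_def by (rule exE)
  then have C: "\<And>r. r \<in> {0<..} \<Longrightarrow> r * (norm (?s1 r) + norm (?s2 r)) \<le> C" by (rule bspec[OF _ imageI])
  have C12: "r * norm (?s1 r) \<le> C" "r * norm (?s2 r) \<le> C" if "0 < r" for r
  proof -
    have "0 \<le> r * norm (?s1 r)" "0 \<le> r * norm (?s2 r)" using that by auto
    moreover have "r * norm (?s1 r) + r * norm (?s2 r) \<le> C"
      using C[of r] that by (simp add: distrib_left)
    ultimately show "r * norm (?s1 r) \<le> C" "r * norm (?s2 r) \<le> C" by linarith+
  qed
  show ?thesis
  proof (rule that[of ?s1 C ?s2], unfold pd)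
    show "axis_C2 (\<lambda>u. f (u, 0)) (axis_deriv (\<lambda>u. f (u, 0))) ?s1 C"
      using * by (intro axis_C2_axis_deriv C12) simp_all
    show "axis_C2 (\<lambda>v. f (0, v)) (axis_deriv (\<lambda>v. f (0, v))) ?s2 C"
      using * by (intro axis_C2_axis_deriv C12) simp_all
  qed
qed

lemma axis_C2_differentiable:
  assumes A: "axis_C2 g d s C" and u: "0 < u"
  shows "g differentiable (at u)" "axis_deriv g differentiable (at u)"
    "vector_derivative (axis_deriv g) (at u) = s u"
proof -
  have d: "axis_deriv g v = d v" if "0 < v" for v
    using A that by (intro axis_deriv_eq) (auto simp: axis_C2_def)
  show "g differentiable (at u)" using A u by (auto simp: axis_C2_def differentiableI_vector)
  have "(axis_deriv g has_vector_derivative s u) (at u)"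
    by (rule has_vector_derivative_transform_within_open[of d _ _ "{0<..}"]) (use A u d in \<open>auto simp: axis_C2_def\<close>)
  then show "axis_deriv g differentiable (at u)" "vector_derivative (axis_deriv g) (at u) = s u"
    by (auto simp: differentiableI_vector vector_derivative_at)
qed

lemma axis_C2_deriv_continuous:
  assumes A: "axis_C2 g d s C"
  shows "continuous_on {0..} d"
  unfolding continuous_on_def
proof
  fix u :: real assume "u \<in> {0..}"
  then consider "u = 0" | "0 < u" by fastforce
  then show "(d \<longlongrightarrow> d u) (at u within {0..})"
  proof cases
    case 1
    then show ?thesis using A by (simp add: axis_C2_def at_within_Ici_at_right)
  next
    case 2
    then have "(d has_vector_derivative s u) (at u)" using A by (auto simp: axis_C2_def)
    then have "isCont d u" by (rule has_vector_derivative_continuous)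
    then show ?thesis unfolding isCont_def by (rule tendsto_within_subset) simp
  qed
qed

lemma Cl2I:
  assumes f: "f \<in> Cl" and A1: "axis_C2 (\<lambda>u. f (u, 0)) d1 s1 C1" and A2: "axis_C2 (\<lambda>v. f (0, v)) d2 s2 C2"
  shows "f \<in> Cl2"
proof -
  have pd: "(\<lambda>u. pd1 f (u, 0)) = axis_deriv (\<lambda>u. f (u, 0))" "(\<lambda>v. pd2 f (0, v)) = axis_deriv (\<lambda>v. f (0, v))"
    by (auto simp: pd1_def pd2_def)
  have e: "axis_deriv g u = d u" if "axis_C2 g d s C" "0 < u" for g d s C u
    using that by (intro axis_deriv_eq) (auto simp: axis_C2_def)
  have lim: "(axis_deriv g \<longlongrightarrow> d 0) (at_right 0)" if "axis_C2 g d s C" for g d s C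
    by (rule Lim_transform_eventually[of d])
      (use that e[OF that] in \<open>auto simp: axis_C2_def eventually_at_right_field intro!: exI[of _ 1]\<close>)
  have dec: "((\<lambda>u. u *\<^sub>R axis_deriv g u) \<longlongrightarrow> 0) at_top" if "axis_C2 g d s C" for g d s C
  proof (rule Lim_transform_eventually[of "\<lambda>u. u *\<^sub>R d u"])
    show "((\<lambda>u. u *\<^sub>R d u) \<longlongrightarrow> 0) at_top" using that by (simp add: axis_C2_def)
    show "eventually (\<lambda>u. u *\<^sub>R d u = u *\<^sub>R axis_deriv g u) at_top"
      using eventually_gt_at_top[of 0] by eventually_elim (simp add: e[OF that])
  qed
  have cont: "continuous_on {0<..} (axis_deriv g)" if "axis_C2 g d s C" for g d s C
  proof (rule continuous_on_eq)
    show "continuous_on {0<..} d" by (rule continuous_on_subset[OF axis_C2_deriv_continuous[OF that]]) auto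
  qed (simp add: e[OF that])
  have "bdd_above ((\<lambda>r. r * (norm (vector_derivative (axis_deriv (\<lambda>u. f (u, 0))) (at r)) +
      norm (vector_derivative (axis_deriv (\<lambda>v. f (0, v))) (at r)))) ` {0<..})"
  proof (rule bdd_aboveI2)
    fix r :: real assume "r \<in> {0<..}"
    then have r: "0 < r" by simp
    have "r * norm (s1 r) \<le> C1" "r * norm (s2 r) \<le> C2" using A1 A2 r by (auto simp: axis_C2_def)
    then show "r * (norm (vector_derivative (axis_deriv (\<lambda>u. f (u, 0))) (at r)) +
      norm (vector_derivative (axis_deriv (\<lambda>v. f (0, v))) (at r))) \<le> C1 + C2"
      unfolding axis_C2_differentiable(3)[OF A1 r] axis_C2_differentiable(3)[OF A2 r] by (simp add: distrib_left)
  qed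
  then show ?thesis
    unfolding Cl2_def mem_Collect_eq pd fun_cong[OF pd(1)] fun_cong[OF pd(2)]
    using f lim[OF A1] lim[OF A2] dec[OF A1] dec[OF A2] cont[OF A1] cont[OF A2]
      axis_C2_differentiable(1,2)[OF A1] axis_C2_differentiable(1,2)[OF A2]
    by blast
qed

section \<open>Mean value and Taylor estimates\<close>

lemma interval_lipschitz:
  fixes g :: "real \<Rightarrow> complex"
  assumes c: "continuous_on {p..q} g" and d: "\<And>x. p < x \<Longrightarrow> x < q \<Longrightarrow> (g has_vector_derivative g' x) (at x)"
    and b: "\<And>x. p < x \<Longrightarrow> x < q \<Longrightarrow> norm (g' x) \<le> M" and st: "s \<in> {p..q}" "t \<in> {p..q}"
  shows "norm (g s - g t) \<le> M * \<bar>s - t\<bar>"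
proof -
  have *: "norm (g t - g s) \<le> M * (t - s)" if "s \<in> {p..q}" "t \<in> {p..q}" "s < t" for s t
  proof -
    have "norm (g t - g s) \<le> M * t - M * s"
    proof (rule differentiable_bound_general[OF \<open>s < t\<close>])
      show "continuous_on {s..t} g" using c by (rule continuous_on_subset) (use that in auto)
      show "continuous_on {s..t} (\<lambda>x. M * x)" by (intro continuous_intros)
      fix x assume "s < x" "x < t"
      then show "(g has_vector_derivative g' x) (at x)" "norm (g' x) \<le> M" using that d b by auto
      show "((\<lambda>x. M * x) has_vector_derivative M) (at x)"
        by (auto intro!: derivative_eq_intros simp flip: has_real_derivative_iff_has_vector_derivative)
    qed
    then show ?thesis by (simp add: right_diff_distrib)
  qed
  consider "s = t" | "s < t" | "t < s" by linarith
  then show ?thesis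
    by cases (use *[OF st] *[OF st(2,1)] in \<open>simp_all add: norm_minus_commute\<close>)
qed

text \<open>The derivative is continuous up to 0, hence bounded on compact intervals, and far out it
  is small because \<open>u *\<^sub>R d u\<close> tends to 0.\<close>

lemma axis_C2_lipschitz:
  assumes A: "axis_C2 g d s C" and g: "continuous_on {0..} g"
  obtains M where "0 \<le> M" "\<And>u. 0 \<le> u \<Longrightarrow> norm (d u) \<le> M"
    "\<And>u v. 0 \<le> u \<Longrightarrow> 0 \<le> v \<Longrightarrow> norm (g u - g v) \<le> M * \<bar>u - v\<bar>"
proof -
  have "((\<lambda>u. u *\<^sub>R d u) \<longlongrightarrow> 0) at_top" using A by (simp add: axis_C2_def)
  then have "((\<lambda>u. norm (u *\<^sub>R d u)) \<longlongrightarrow> 0) at_top" by (rule tendsto_norm_zero)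
  then have "eventually (\<lambda>u. norm (u *\<^sub>R d u) < 1) at_top" by (rule order_tendstoD) simp
  then obtain N where N: "\<And>u. N \<le> u \<Longrightarrow> norm (u *\<^sub>R d u) < 1" by (auto simp: eventually_at_top_linorder)
  have far: "norm (d u) \<le> 1" if "max N 1 \<le> u" for u
  proof -
    have "norm (d u) \<le> u * norm (d u)" using that mult_right_mono[of 1 u "norm (d u)"] by simp
    then show ?thesis using N[of u] that by simp
  qed
  have "compact (d ` {0..max N 1})"
    by (intro compact_continuous_image continuous_on_subset[OF axis_C2_deriv_continuous[OF A]]) auto
  then have "bounded (d ` {0..max N 1})" by (rule compact_imp_bounded)
  then obtain K where "\<forall>y\<in>d ` {0..max N 1}. norm y \<le> K" unfolding bounded_iff by (rule exE)
  then have K: "\<And>u. u \<in> {0..max N 1} \<Longrightarrow> norm (d u) \<le> K" by (rule bspec[OF _ imageI])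
  define M where "M = max K 1"
  have M: "0 \<le> M" "norm (d u) \<le> M" if "0 \<le> u" for u
  proof -
    show "0 \<le> M" by (simp add: M_def)
    show "norm (d u) \<le> M"
    proof (cases "u \<le> max N 1")
      case True
      then show ?thesis using K[of u] that by (simp add: M_def le_max_iff_disj)
    next
      case False
      then have "norm (d u) \<le> 1" by (intro far) linarith
      then show ?thesis by (simp add: M_def le_max_iff_disj)
    qed
  qed
  show ?thesis
  proof (rule that[of M])
    fix u v :: real assume uv: "0 \<le> u" "0 \<le> v"
    show "norm (g u - g v) \<le> M * \<bar>u - v\<bar>"
      by (rule interval_lipschitz[of 0 "max u v"])
        (use A M uv in \<open>auto simp: axis_C2_def intro: continuous_on_subset[OF g]\<close>)
  qed (use M in auto)
qed

text \<open>On the interval from \<open>a / 2\<close> to \<open>3 * a / 2\<close> the second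
  derivative is at most \<open>2 * C / a\<close>. The weight \<open>r\<close> in the bound on second
  derivatives is what makes the remainder linear in \<open>a\<close>.\<close>

lemma axis_C2_taylor:
  assumes A: "axis_C2 g d s C" and a: "0 < a" and u: "\<bar>u - 1\<bar> \<le> 1 / 2"
  shows "norm (g (a * u) - g a - (a * (u - 1)) *\<^sub>R d a) \<le> 2 * C * a * (u - 1)\<^sup>2"
proof -
  define S where "S = {a / 2 .. 3 * a / 2}"
  have C: "0 \<le> C"
  proof -
    have "0 \<le> 1 * norm (s 1)" by simp
    also have "\<dots> \<le> C" using A unfolding axis_C2_def by (metis zero_less_one)
    finally show ?thesis .
  qed
  have au: "a * u \<in> S" "a \<in> S"
  proof -
    have "1 / 2 \<le> u" "u \<le> 3 / 2" using u by linarith+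
    then have "a * (1 / 2) \<le> a * u" "a * u \<le> a * (3 / 2)" using a by (intro mult_left_mono; simp)+
    then show "a * u \<in> S" "a \<in> S" using a by (auto simp: S_def)
  qed
  have Sp: "0 < x" if "x \<in> S" for x using that a by (auto simp: S_def)
  have seg: "closed_segment a (a * u) \<subseteq> S"
    using au by (intro closed_segment_subset) (auto simp: S_def)
  have lip: "norm (d x - d a) \<le> 2 * C / a * \<bar>x - a\<bar>" if x: "x \<in> S" for x
  proof (rule interval_lipschitz[of "a / 2" "3 * a / 2" d s])
    show "continuous_on {a / 2..3 * a / 2} d"
      using continuous_on_subset[OF axis_C2_deriv_continuous[OF A]] a by auto
    fix y assume y: "a / 2 < y" "y < 3 * a / 2"
    then show "(d has_vector_derivative s y) (at y)" using A a by (auto simp: axis_C2_def)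
    have "y * norm (s y) \<le> C" using A a y by (auto simp: axis_C2_def)
    moreover have "a / 2 * norm (s y) \<le> y * norm (s y)" using y by (intro mult_right_mono) auto
    ultimately have "a / 2 * norm (s y) \<le> C" by simp
    then show "norm (s y) \<le> 2 * C / a" using a by (simp add: field_simps)
  qed (use x au in \<open>auto simp: S_def\<close>)
  define S' where "S' = closed_segment a (a * u)"
  have "norm (g (a * u) - g a - (a * u - a) *\<^sub>R d a) \<le> norm (a * u - a) * (2 * C / a * \<bar>a * u - a\<bar>)"
  proof (rule vector_differentiable_bound_linearization[where S = S' and f' = d])
    fix x assume x: "x \<in> S'"
    then have xS: "x \<in> S" using seg by (auto simp: S'_def)
    show "(g has_vector_derivative d x) (at x within S')"
      using A Sp[OF xS] by (auto simp: axis_C2_def intro: has_vector_derivative_at_within)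
    have "\<bar>x - a\<bar> \<le> \<bar>a * u - a\<bar>"
      using x segment_bound1[of x a "a * u"] by (simp add: S'_def)
    then show "norm (d x - d a) \<le> 2 * C / a * \<bar>a * u - a\<bar>"
      using C a by (intro order_trans[OF lip[OF xS]] mult_left_mono) auto
  qed (auto simp: S'_def)
  also have "norm (a * u - a) * (2 * C / a * \<bar>a * u - a\<bar>) = 2 * C / a * \<bar>a * u - a\<bar>\<^sup>2"
    by (simp add: power2_eq_square)
  also have "\<dots> = 2 * C * a * (u - 1)\<^sup>2"
    using a by (simp add: power2_eq_square field_simps)
  finally show ?thesis by (simp add: right_diff_distrib)
qed

text \<open>The factor \<open>(u - 1)\<^sup>2 / (1 + u)\<close> combines second-order vanishing at 1
  with linear growth. Close to 1 Taylor applies, and \<open>2 * (1 + u) \<le> 5\<close> gives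
  \<open>5 * C\<close>; away from 1 the Lipschitz bound applies, and
  \<open>1 + u \<le> 5 * \<bar>u - 1\<bar>\<close> gives \<open>10 * M\<close>. The constant does
  not depend on \<open>a\<close>, so the bound stays usable after division by \<open>a\<close> as
  \<open>a\<close> tends to 0.\<close>

lemma axis_C2_difference_bound:
  assumes A: "axis_C2 g d s C" and g: "continuous_on {0..} g"
  obtains K where "0 \<le> K" "\<And>a u. 0 < a \<Longrightarrow> 0 \<le> u \<Longrightarrow>
    norm (g (a * u) - g a - (a * (u - 1)) *\<^sub>R d a) \<le> K * a * ((u - 1)\<^sup>2 / (1 + u))"
proof -
  obtain M where M: "0 \<le> M" "\<And>u. 0 \<le> u \<Longrightarrow> norm (d u) \<le> M"
    "\<And>u v. 0 \<le> u \<Longrightarrow> 0 \<le> v \<Longrightarrow> norm (g u - g v) \<le> M * \<bar>u - v\<bar>"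
    using axis_C2_lipschitz[OF A g] by blast
  have C: "0 \<le> C"
  proof -
    have "0 \<le> 1 * norm (s 1)" by simp
    also have "\<dots> \<le> C" using A unfolding axis_C2_def by (metis zero_less_one)
    finally show ?thesis .
  qed
  show ?thesis
  proof (rule that[of "10 * M + 5 * C"])
    show "0 \<le> 10 * M + 5 * C" using M C by simp
    fix a u :: real assume a: "0 < a" and u: "0 \<le> u"
    show "norm (g (a * u) - g a - (a * (u - 1)) *\<^sub>R d a) \<le> (10 * M + 5 * C) * a * ((u - 1)\<^sup>2 / (1 + u))"
    proof (cases "\<bar>u - 1\<bar> \<le> 1 / 2")
      case True
      have "u - 1 \<le> 1 / 2" using True by (rule abs_le_D1)
      then have "2 * (1 + u) \<le> 5" by simp
      then have "2 * C * a * (u - 1)\<^sup>2 * (1 + u) \<le> 5 * C * a * (u - 1)\<^sup>2"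
        using mult_left_mono[of "2 * (1 + u)" 5 "C * a * (u - 1)\<^sup>2"] C a by (simp add: algebra_simps)
      also have "\<dots> \<le> (10 * M + 5 * C) * a * (u - 1)\<^sup>2" using M C a by (intro mult_right_mono) auto
      finally have "2 * C * a * (u - 1)\<^sup>2 \<le> (10 * M + 5 * C) * a * ((u - 1)\<^sup>2 / (1 + u))"
        using u by (simp add: field_simps)
      then show ?thesis using axis_C2_taylor[OF A a True] by (rule order_trans[rotated])
    next
      case False
      have "norm (g (a * u) - g a) \<le> M * \<bar>a * u - a\<bar>" using a u by (intro M) auto
      also have "a * u - a = a * (u - 1)" by (simp add: right_diff_distrib)
      also have "\<bar>a * (u - 1)\<bar> = a * \<bar>u - 1\<bar>" using a by (simp add: abs_mult)
      finally have 1: "norm (g (a * u) - g a) \<le> M * (a * \<bar>u - 1\<bar>)" .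
      have 2: "norm ((a * (u - 1)) *\<^sub>R d a) \<le> M * (a * \<bar>u - 1\<bar>)"
        using M(2)[of a] a mult_left_mono[of "norm (d a)" M "a * \<bar>u - 1\<bar>"] by (simp add: abs_mult mult_ac)
      have "norm (g (a * u) - g a - (a * (u - 1)) *\<^sub>R d a) \<le> 2 * M * a * \<bar>u - 1\<bar>"
        using norm_triangle_ineq4[of "g (a * u) - g a" "(a * (u - 1)) *\<^sub>R d a"] 1 2 by simp
      also have "\<dots> \<le> (10 * M + 5 * C) * a * ((u - 1)\<^sup>2 / (1 + u))"
      proof -
        have "1 + u \<le> 5 * \<bar>u - 1\<bar>"
        proof -
          consider "u < 1 / 2" | "3 / 2 < u" using False by (simp only: abs_le_iff) linarith
          then show ?thesis by cases simp_all
        qed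
        then have "\<bar>u - 1\<bar> * (1 + u) \<le> \<bar>u - 1\<bar> * (5 * \<bar>u - 1\<bar>)" by (intro mult_left_mono) auto
        also have "\<dots> = 5 * (u - 1)\<^sup>2" by (simp only: mult.left_commute[of _ 5] abs_mult_self_eq power2_eq_square)
        finally have "\<bar>u - 1\<bar> \<le> 5 * (u - 1)\<^sup>2 / (1 + u)" using u by (subst pos_le_divide_eq) auto
        then have "\<bar>u - 1\<bar> \<le> 5 * ((u - 1)\<^sup>2 / (1 + u))" by simp
        then have "2 * M * a * \<bar>u - 1\<bar> \<le> 2 * M * a * (5 * ((u - 1)\<^sup>2 / (1 + u)))"
          using M a by (intro mult_left_mono) auto
        also have "\<dots> = 10 * M * a * ((u - 1)\<^sup>2 / (1 + u))" by simp
        also have "\<dots> \<le> (10 * M + 5 * C) * a * ((u - 1)\<^sup>2 / (1 + u))"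
          using C a u by (intro mult_right_mono) auto
        finally show ?thesis .
      qed
      finally show ?thesis .
    qed
  qed
qed

text \<open>The mean value inequality for \<open>g x - x *\<^sub>R d 0\<close>, whose derivative is
  small near 0.\<close>

lemma axis_C2_right_derivative:
  assumes A: "axis_C2 g d s C" and g: "continuous_on {0..} g"
  shows "((\<lambda>r. (1 / r) *\<^sub>R (g r - g 0)) \<longlongrightarrow> d 0) (at_right 0)"
proof (rule tendstoI)
  fix e :: real assume e: "0 < e"
  have "(d \<longlongrightarrow> d 0) (at_right 0)" using A by (simp add: axis_C2_def)
  then have "eventually (\<lambda>u. dist (d u) (d 0) < e / 2) (at_right 0)" by (rule tendstoD) (use e in simp)
  then obtain b where b: "0 < b" "\<And>u. 0 < u \<Longrightarrow> u < b \<Longrightarrow> dist (d u) (d 0) < e / 2"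
    by (auto simp: eventually_at_right_field)
  have "dist ((1 / r) *\<^sub>R (g r - g 0)) (d 0) < e" if r: "0 < r" "r < b" for r
  proof -
    define h where "h = (\<lambda>x. g x - x *\<^sub>R d 0)"
    have "norm (h r - h 0) \<le> e / 2 * \<bar>r - 0\<bar>"
    proof (rule interval_lipschitz[of 0 r])
      show "continuous_on {0..r} h"
        unfolding h_def by (intro continuous_intros continuous_on_subset[OF g]) auto
      fix x assume x: "0 < x" "x < r"
      have "(g has_vector_derivative d x) (at x)" using A x by (auto simp: axis_C2_def)
      then show "(h has_vector_derivative d x - d 0) (at x)"
        unfolding h_def by (auto intro!: derivative_eq_intros)
      show "norm (d x - d 0) \<le> e / 2" using b(2)[of x] x r by (simp add: dist_norm)
    qed (use r in auto)
    moreover have "(1 / r) *\<^sub>R (g r - g 0) - d 0 = (1 / r) *\<^sub>R (h r - h 0)"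
      using r by (simp add: h_def algebra_simps)
    then have eq: "norm ((1 / r) *\<^sub>R (g r - g 0) - d 0) = norm (h r - h 0) / r"
      using r by (simp only: norm_scaleR) simp
    ultimately have "norm ((1 / r) *\<^sub>R (g r - g 0) - d 0) \<le> e / 2"
      unfolding eq using r by (simp add: divide_le_eq)
    then show ?thesis using e by (simp add: dist_norm)
  qed
  then show "eventually (\<lambda>r. dist ((1 / r) *\<^sub>R (g r - g 0)) (d 0) < e) (at_right 0)"
    using b(1) by (auto simp: eventually_at_right_field)
qed

section \<open>The derivative of the exit law\<close>

text \<open>By scaling, the transversal difference quotient of the Poisson integral at \<open>(a, 0)\<close> is an integral
  against the rescaled kernels \<open>nk1 h\<close> and \<open>nk2 h\<close>, whose limits for \<open>h = 0\<close> are the densities of \<open>nu\<close>.\<close>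

definition nk1 :: "real \<Rightarrow> real \<Rightarrow> real"
  where "nk1 h u = 4 / pi * (u / (((u - 1)\<^sup>2 + h\<^sup>2) * ((u + 1)\<^sup>2 + h\<^sup>2)))"

definition nk2 :: "real \<Rightarrow> real \<Rightarrow> real"
  where "nk2 h v = 4 / pi * (v / (((v - h)\<^sup>2 + 1) * ((v + h)\<^sup>2 + 1)))"

lemma nk_0: "nk1 0 = nu_density1" "nk2 0 = nu_density2"
proof -
  show "nk1 0 = nu_density1"
    by (simp add: nk1_def nu_density1_def fun_eq_iff power2_commute[of 1] add.commute)
  have "(v\<^sup>2 + 1) * (v\<^sup>2 + 1) = (1 + v\<^sup>2)\<^sup>2" for v :: real by (simp add: power2_eq_square add.commute)
  then show "nk2 0 = nu_density2" by (simp add: nk2_def nu_density2_def fun_eq_iff)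
qed

lemma nk_kern: "kern 1 h u = h * nk1 h u" "kern h 1 v = h * nk2 h v"
  by (simp_all add: kern_def nk1_def nk2_def)

lemma nk_nonneg: "0 \<le> u \<Longrightarrow> 0 \<le> nk1 h u" "0 \<le> v \<Longrightarrow> 0 \<le> nk2 h v"
  by (simp_all add: nk1_def nk2_def)

lemma nk_measurable [measurable]: "nk1 h \<in> borel_measurable borel" "nk2 h \<in> borel_measurable borel"
  unfolding nk1_def nk2_def by measurable

text \<open>The factor \<open>(u - 1)\<^sup>2\<close> cancels the singularity that the kernel
  develops at 1 as \<open>h\<close> tends to 0, uniformly in \<open>h\<close>.\<close>

lemma nk1_bound:
  assumes u: "0 < u"
  shows "nk1 h u * ((u - 1)\<^sup>2 / (1 + u)) \<le> 4 / pi / (1 + u\<^sup>2)"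
proof (cases "u = 1")
  case False
  define p where "p = (u - 1)\<^sup>2"
  have p: "0 < p" using False by (simp add: p_def)
  define D where "D = (p + h\<^sup>2) * ((u + 1)\<^sup>2 + h\<^sup>2)"
  have "p * (1 + u\<^sup>2) \<le> (p + h\<^sup>2) * ((u + 1)\<^sup>2 + h\<^sup>2)"
    using p u by (intro mult_mono) (auto simp: power2_eq_square algebra_simps)
  then have D: "p * (1 + u\<^sup>2) \<le> D" by (simp add: D_def)
  have q: "0 < p * (1 + u\<^sup>2)" using p by (simp add: add_pos_nonneg)
  have "u / D * (p / (1 + u)) \<le> u / (p * (1 + u\<^sup>2)) * (p / (1 + u))"
    using D q u p by (intro mult_right_mono divide_left_mono) auto
  also have "\<dots> = u / (1 + u) / (1 + u\<^sup>2)" using p by simp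
  also have "\<dots> \<le> 1 / (1 + u\<^sup>2)" using u by (intro divide_right_mono) auto
  finally have "4 / pi * (u / D * (p / (1 + u))) \<le> 4 / pi * (1 / (1 + u\<^sup>2))"
    by (intro mult_left_mono) auto
  then show ?thesis by (simp add: nk1_def p_def D_def)
qed simp

text \<open>No singularity arises on the other axis; for \<open>h \<le> 1\<close> the first
  quadratic factor is at least \<open>(1 + v\<^sup>2) / 3\<close> and the second at least
  \<open>1 + v\<^sup>2\<close>. With \<open>v * (1 + v) \<le> 2 * (1 + v\<^sup>2)\<close> the
  constant becomes 4 times 3 times 2.\<close>

lemma nk2_bound:
  assumes v: "0 < v" and h: "0 \<le> h" "h \<le> 1"
  shows "nk2 h v * (1 + v) \<le> 24 / pi / (1 + v\<^sup>2)"
proof -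
  have q: "0 < 1 + v\<^sup>2" by (simp add: add_pos_nonneg)
  have "1\<^sup>2 * (1 + v\<^sup>2) \<le> (1 + h\<^sup>2 + 1\<^sup>2) * ((v - h)\<^sup>2 + 1\<^sup>2)" by (rule quad_lower)
  also have "\<dots> \<le> 3 * ((v - h)\<^sup>2 + 1\<^sup>2)"
    using h by (intro mult_right_mono) (auto simp: power_le_one)
  finally have "(1 + v\<^sup>2) / 3 \<le> (v - h)\<^sup>2 + 1" by simp
  moreover have "1 + v\<^sup>2 \<le> (v + h)\<^sup>2 + 1" using v h by (simp add: power_mono)
  ultimately have "(1 + v\<^sup>2) / 3 * (1 + v\<^sup>2) \<le> ((v - h)\<^sup>2 + 1) * ((v + h)\<^sup>2 + 1)"
    using q by (intro mult_mono) auto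
  then have "v / (((v - h)\<^sup>2 + 1) * ((v + h)\<^sup>2 + 1)) \<le> v / ((1 + v\<^sup>2) / 3 * (1 + v\<^sup>2))"
    using v q by (intro divide_left_mono mult_pos_pos) (auto intro: add_nonneg_pos)
  then have "v / (((v - h)\<^sup>2 + 1) * ((v + h)\<^sup>2 + 1)) * (1 + v) \<le> v / ((1 + v\<^sup>2) / 3 * (1 + v\<^sup>2)) * (1 + v)"
    using v by (intro mult_right_mono) auto
  also have "\<dots> = 3 * (v * (1 + v)) / (1 + v\<^sup>2) / (1 + v\<^sup>2)" by simp
  also have "\<dots> \<le> 3 * (2 * (1 + v\<^sup>2)) / (1 + v\<^sup>2) / (1 + v\<^sup>2)"
  proof -
    have "v \<le> 1 + v\<^sup>2" using zero_le_power2[of "v - 1"] v by (simp add: power2_eq_square algebra_simps)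
    then have "v * (1 + v) \<le> 2 * (1 + v\<^sup>2)" using zero_le_power2[of v] by (simp add: distrib_left power2_eq_square)
    then show ?thesis using q by (intro divide_right_mono mult_left_mono) auto
  qed
  also have "\<dots> = 6 / (1 + v\<^sup>2)"
  proof -
    have "3 * (2 * t) / t / t = 6 / t" if "0 < t" for t :: real using that by simp
    then show ?thesis using q .
  qed
  finally have "4 / pi * (v / (((v - h)\<^sup>2 + 1) * ((v + h)\<^sup>2 + 1)) * (1 + v)) \<le> 4 / pi * (6 / (1 + v\<^sup>2))"
    by (intro mult_left_mono) auto
  then show ?thesis by (simp add: nk2_def)
qed

text \<open>Both half-axes are unfolded onto the real line, \<open>r > 0\<close> representing \<open>(r, 0)\<close> and \<open>r < 0\<close>
  representing \<open>(0, - r)\<close>.\<close>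

lemma integral_nu:
  fixes F :: "real \<times> real \<Rightarrow> complex"
  assumes F: "continuous_on E F"
    and i1: "set_integrable lborel {0<..} (\<lambda>u. nu_density1 u *\<^sub>R F (u, 0))"
    and i2: "set_integrable lborel {0<..} (\<lambda>v. nu_density2 v *\<^sub>R F (0, v))"
  shows "(LINT y:E|nu. F y) = (LINT u:{0<..}|lborel. nu_density1 u *\<^sub>R F (u, 0)) +
    (LINT v:{0<..}|lborel. nu_density2 v *\<^sub>R F (0, v))"
proof -
  define \<delta> where "\<delta> = (\<lambda>r. indicator {0<..} r * nu_density1 r + indicator {0<..} (- r) * nu_density2 (- r))"
  define k where "k = (\<lambda>r::real. (max 0 r, max 0 (- r)))"
  have [measurable]: "nu_density1 \<in> borel_measurable borel" "nu_density2 \<in> borel_measurable borel"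
    using nk_measurable[of 0] by (auto simp: nk_0)
  have k[measurable]: "k \<in> borel_measurable borel"
    unfolding k_def by (intro borel_measurable_continuous_onI continuous_intros)
  have \<delta>m[measurable]: "\<delta> \<in> borel_measurable borel" unfolding \<delta>_def by measurable
  have np: "0 \<le> u \<Longrightarrow> 0 \<le> nu_density1 u" "0 \<le> u \<Longrightarrow> 0 \<le> nu_density2 u" for u
    using nk_nonneg[of u 0] by (auto simp: nk_0)
  have \<delta>0: "0 \<le> \<delta> r" for r
    using np[of r] np[of "- r"] by (auto simp: \<delta>_def indicator_def)
  have nu: "nu = distr (density lborel (\<lambda>r. ennreal (\<delta> r))) borel k"
  proof (rule measure_eqI)
    fix A assume "A \<in> sets nu"
    then have A[measurable]: "A \<in> sets borel" by simp
    have [measurable]: "(\<lambda>u::real. (u, 0::real)) \<in> borel_measurable borel" "(\<lambda>v::real. (0::real, v)) \<in> borel_measurable borel"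
      by (intro borel_measurable_continuous_onI continuous_intros)+
    have "emeasure (distr (density lborel (\<lambda>r. ennreal (\<delta> r))) borel k) A
        = (\<integral>\<^sup>+r. ennreal (\<delta> r) * indicator A (k r) \<partial>lborel)"
      by (subst emeasure_distr, simp, simp, subst emeasure_density)
        (auto intro!: nn_integral_cong measurable_sets_borel[OF k] simp: indicator_def)
    also have "\<dots> = (\<integral>\<^sup>+r. indicator {0<..} r * (ennreal (nu_density1 r) * indicator A (r, 0)) +
        indicator {0<..} (- r) * (ennreal (nu_density2 (- r)) * indicator A (0, - r)) \<partial>lborel)"
      by (intro nn_integral_cong) (auto simp: \<delta>_def k_def indicator_def)
    also have "\<dots> = (\<integral>\<^sup>+r. indicator {0<..} r * (ennreal (nu_density1 r) * indicator A (r, 0)) \<partial>lborel) +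
        (\<integral>\<^sup>+r. indicator {0<..} (- r) * (ennreal (nu_density2 (- r)) * indicator A (0, - r)) \<partial>lborel)"
      by (rule nn_integral_add) auto
    also have "(\<integral>\<^sup>+r. indicator {0<..} (- r) * (ennreal (nu_density2 (- r)) * indicator A (0, - r)) \<partial>lborel)
        = (\<integral>\<^sup>+r. indicator {0<..} r * (ennreal (nu_density2 r) * indicator A (0, r)) \<partial>lborel)"
      using nn_integral_real_affine[of "\<lambda>r. indicator {0<..} r * (ennreal (nu_density2 r) * indicator A (0, r))" "-1" 0]
      by simp
    finally show "emeasure nu A = emeasure (distr (density lborel (\<lambda>r. ennreal (\<delta> r))) borel k) A"
      unfolding emeasure_nu[OF A] by (simp add: mult_ac)
  qed simp
  have Fm[measurable]: "(\<lambda>y. indicator E y *\<^sub>R F y) \<in> borel_measurable borel"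
    by (rule borel_measurable_continuous_on_indicator[OF E_borel F])
  have "(LINT y:E|nu. F y) = (LINT r|lborel. \<delta> r *\<^sub>R (indicator E (k r) *\<^sub>R F (k r)))"
    unfolding set_lebesgue_integral_def nu using \<delta>0
    by (subst integral_distr, simp, simp, subst integral_density)
      (auto intro!: measurable_compose[OF k Fm])
  also have "\<dots> = (LINT r|lborel. indicator {0<..} r *\<^sub>R nu_density1 r *\<^sub>R F (r, 0) +
      indicator {0<..} (- r) *\<^sub>R nu_density2 (- r) *\<^sub>R F (0, - r))"
    by (intro Bochner_Integration.integral_cong) (auto simp: \<delta>_def k_def indicator_def E_iff)
  also have "\<dots> = (LINT r|lborel. indicator {0<..} r *\<^sub>R nu_density1 r *\<^sub>R F (r, 0)) +
      (LINT r|lborel. indicator {0<..} (- r) *\<^sub>R nu_density2 (- r) *\<^sub>R F (0, - r))"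
  proof (rule Bochner_Integration.integral_add)
    show "integrable lborel (\<lambda>r. indicator {0<..} r *\<^sub>R nu_density1 r *\<^sub>R F (r, 0))"
      using i1 by (simp add: set_integrable_def)
    show "integrable lborel (\<lambda>r. indicator {0<..} (- r) *\<^sub>R nu_density2 (- r) *\<^sub>R F (0, - r))"
      using lborel_integrable_real_affine[OF i2[unfolded set_integrable_def], of "-1" 0] by simp
  qed
  also have "(LINT r|lborel. indicator {0<..} (- r) *\<^sub>R nu_density2 (- r) *\<^sub>R F (0, - r))
      = (LINT r|lborel. indicator {0<..} r *\<^sub>R nu_density2 r *\<^sub>R F (0, r))"
    using lborel_integral_real_affine[of "-1" "\<lambda>r. indicator {0<..} r *\<^sub>R nu_density2 r *\<^sub>R F (0, r)" 0] by simp
  finally show ?thesis by (simp add: set_lebesgue_integral_def)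
qed

section \<open>The transversal difference quotient\<close>

text \<open>With \<Delta>2, the integrand of \<open>G2\<close> at \<open>(a, 0)\<close> on the two
  axes. On the second axis the first coordinate is 0, so the compensator appears there as
  \<open>a *\<^sub>R pd1 f (a, 0)\<close> with a plus sign.\<close>

definition \<Delta>1 :: "(real \<times> real \<Rightarrow> complex) \<Rightarrow> real \<Rightarrow> real \<Rightarrow> complex"
  where "\<Delta>1 f a u = f (a * u, 0) - f (a, 0) - (a * (u - 1)) *\<^sub>R pd1 f (a, 0)"

definition \<Delta>2 :: "(real \<times> real \<Rightarrow> complex) \<Rightarrow> real \<Rightarrow> real \<Rightarrow> complex"
  where "\<Delta>2 f a v = f (0, a * v) - f (a, 0) + a *\<^sub>R pd1 f (a, 0)"

text \<open>The rate at which the Poisson integral departs from its value at \<open>(a, 0)\<close>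
  in the transversal direction, at height \<open>a * h\<close>; for \<open>h = 0\<close> it is
  \<open>G2\<close>.\<close>

definition Jf :: "(real \<times> real \<Rightarrow> complex) \<Rightarrow> real \<Rightarrow> real \<Rightarrow> complex"
  where "Jf f a h = (1 / a) *\<^sub>R ((LINT u:{0<..}|lborel. nk1 h u *\<^sub>R \<Delta>1 f a u) + (LINT v:{0<..}|lborel. nk2 h v *\<^sub>R \<Delta>2 f a v))"

lemma Cl2_Cl: "f \<in> Cl2 \<Longrightarrow> f \<in> Cl"
  by (simp add: Cl2_def)

lemma Cl2_continuous: "f \<in> Cl2 \<Longrightarrow> continuous_on E f"
  by (simp add: Cl2_def Cl_def)

lemma \<Delta>_continuous:
  assumes f: "continuous_on E f" and a: "0 \<le> a"
  shows "continuous_on {0..} (\<Delta>1 f a)" "continuous_on {0..} (\<Delta>2 f a)"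
  unfolding \<Delta>1_def \<Delta>2_def
  by (intro continuous_intros continuous_on_compose2[OF f] continuous_on_Pair; use a in \<open>auto simp: E_iff\<close>)+

text \<open>The powers of \<open>u\<close> are those that the bounds on \<open>nk1\<close> and
  \<open>nk2\<close> can absorb, and both bounds are linear in \<open>a\<close>.\<close>

lemma \<Delta>_bounds:
  assumes f: "f \<in> Cl2"
  obtains K where "0 \<le> K"
    "\<And>a u. 0 < a \<Longrightarrow> 0 \<le> u \<Longrightarrow> norm (\<Delta>1 f a u) \<le> K * a * ((u - 1)\<^sup>2 / (1 + u))"
    "\<And>a v. 0 < a \<Longrightarrow> 0 \<le> v \<Longrightarrow> norm (\<Delta>2 f a v) \<le> K * a * (1 + v)"
proof -
  obtain s1 s2 C where A: "axis_C2 (\<lambda>u. f (u, 0)) (\<lambda>u. pd1 f (u, 0)) s1 C" "axis_C2 (\<lambda>v. f (0, v)) (\<lambda>v. pd2 f (0, v)) s2 C"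
    using Cl2_axis_C2[OF f] .
  note c = axis_continuous[OF Cl2_continuous[OF f]]
  obtain K where K: "0 \<le> K" "\<And>a u. 0 < a \<Longrightarrow> 0 \<le> u \<Longrightarrow> norm (\<Delta>1 f a u) \<le> K * a * ((u - 1)\<^sup>2 / (1 + u))"
    using axis_C2_difference_bound[OF A(1) c(1)] unfolding \<Delta>1_def by blast
  obtain M1 where M1: "0 \<le> M1" "\<And>u. 0 \<le> u \<Longrightarrow> norm (pd1 f (u, 0)) \<le> M1"
    "\<And>u v. 0 \<le> u \<Longrightarrow> 0 \<le> v \<Longrightarrow> norm (f (u, 0) - f (v, 0)) \<le> M1 * \<bar>u - v\<bar>"
    using axis_C2_lipschitz[OF A(1) c(1)] by blast
  obtain M2 where M2: "0 \<le> M2" "\<And>u. 0 \<le> u \<Longrightarrow> norm (pd2 f (0, u)) \<le> M2"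
    "\<And>u v. 0 \<le> u \<Longrightarrow> 0 \<le> v \<Longrightarrow> norm (f (0, u) - f (0, v)) \<le> M2 * \<bar>u - v\<bar>"
    using axis_C2_lipschitz[OF A(2) c(2)] by blast
  show ?thesis
  proof (rule that[of "max K (M2 + 2 * M1)"])
    show "0 \<le> max K (M2 + 2 * M1)" using K by simp
    fix a u :: real assume a: "0 < a" and u: "0 \<le> u"
    have "K * a * ((u - 1)\<^sup>2 / (1 + u)) \<le> max K (M2 + 2 * M1) * a * ((u - 1)\<^sup>2 / (1 + u))"
      using a u by (intro mult_right_mono) auto
    then show "norm (\<Delta>1 f a u) \<le> max K (M2 + 2 * M1) * a * ((u - 1)\<^sup>2 / (1 + u))"
      using K(2)[OF a u] by (rule order_trans[rotated])
    have "\<Delta>2 f a u = (f (0, a * u) - f (0, 0)) - (f (a, 0) - f (0, 0)) + a *\<^sub>R pd1 f (a, 0)"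
      by (simp add: \<Delta>2_def)
    also have "norm \<dots> \<le> norm (f (0, a * u) - f (0, 0)) + norm (f (a, 0) - f (0, 0)) + norm (a *\<^sub>R pd1 f (a, 0))"
      by (intro norm_triangle_mono norm_triangle_ineq4 order_refl)
    also have "\<dots> \<le> M2 * (a * u) + M1 * a + a * M1"
      using M2(3)[of "a * u" 0] M1(3)[of a 0] M1(2)[of a] a u
      by (intro add_mono) (auto intro: mult_left_mono)
    also have "\<dots> \<le> (M2 + 2 * M1) * a * (1 + u)"
    proof -
      have "0 \<le> M2 * a + 2 * M1 * (a * u)" using M1 M2 a u by simp
      then show ?thesis by (simp add: algebra_simps)
    qed
    also have "\<dots> \<le> max K (M2 + 2 * M1) * a * (1 + u)"
      using a u by (intro mult_right_mono) auto
    finally show "norm (\<Delta>2 f a u) \<le> max K (M2 + 2 * M1) * a * (1 + u)" .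
  qed
qed

lemma nk_\<Delta>_bound:
  assumes K: "0 \<le> K" and a: "0 < a" and u: "0 < u"
  shows "norm x \<le> K * a * ((u - 1)\<^sup>2 / (1 + u)) \<Longrightarrow> norm (nk1 h u *\<^sub>R (x :: complex)) \<le> K * a * (4 / pi) / (1 + u\<^sup>2)"
    and "0 \<le> h \<Longrightarrow> h \<le> 1 \<Longrightarrow> norm x \<le> K * a * (1 + u) \<Longrightarrow> norm (nk2 h u *\<^sub>R x) \<le> K * a * (24 / pi) / (1 + u\<^sup>2)"
proof -
  assume x: "norm x \<le> K * a * ((u - 1)\<^sup>2 / (1 + u))"
  have n: "0 \<le> nk1 h u" by (rule nk_nonneg(1)[OF less_imp_le[OF u]])
  then have "norm (nk1 h u *\<^sub>R x) = nk1 h u * norm x" by simp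
  also have "\<dots> \<le> nk1 h u * (K * a * ((u - 1)\<^sup>2 / (1 + u)))" by (rule mult_left_mono[OF x n])
  also have "\<dots> = K * a * (nk1 h u * ((u - 1)\<^sup>2 / (1 + u)))" by simp
  also have "\<dots> \<le> K * a * (4 / pi / (1 + u\<^sup>2))" using K a by (intro mult_left_mono nk1_bound[OF u]) auto
  finally show "norm (nk1 h u *\<^sub>R x) \<le> K * a * (4 / pi) / (1 + u\<^sup>2)" by simp
next
  assume h: "0 \<le> h" "h \<le> 1" and x: "norm x \<le> K * a * (1 + u)"
  have n: "0 \<le> nk2 h u" by (rule nk_nonneg(2)[OF less_imp_le[OF u]])
  then have "norm (nk2 h u *\<^sub>R x) = nk2 h u * norm x" by simp
  also have "\<dots> \<le> nk2 h u * (K * a * (1 + u))" by (rule mult_left_mono[OF x n])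
  also have "\<dots> = K * a * (nk2 h u * (1 + u))" by simp
  also have "\<dots> \<le> K * a * (24 / pi / (1 + u\<^sup>2))" using K a by (intro mult_left_mono nk2_bound[OF u h]) auto
  finally show "norm (nk2 h u *\<^sub>R x) \<le> K * a * (24 / pi) / (1 + u\<^sup>2)" by simp
qed

lemma half_line_measurable:
  fixes g :: "real \<Rightarrow> complex"
  assumes g: "continuous_on {0..} g" and k: "k \<in> borel_measurable borel"
  shows "(\<lambda>u. indicator {0<..} u *\<^sub>R k u *\<^sub>R g u) \<in> borel_measurable lborel"
proof -
  have "(\<lambda>u. indicator {0<..} u *\<^sub>R g u) \<in> borel_measurable borel"
    by (rule borel_measurable_continuous_on_indicator[OF _ continuous_on_subset[OF g]]) auto
  then have "(\<lambda>u. k u *\<^sub>R (indicator {0<..} u *\<^sub>R g u)) \<in> borel_measurable borel" using k by measurable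
  then show ?thesis by (simp add: mult.commute)
qed

lemma nk_\<Delta>_integrable:
  assumes f: "f \<in> Cl2" and a: "0 < a"
  shows "set_integrable lborel {0<..} (\<lambda>u. nk1 h u *\<^sub>R \<Delta>1 f a u)"
    and "0 \<le> h \<Longrightarrow> h \<le> 1 \<Longrightarrow> set_integrable lborel {0<..} (\<lambda>v. nk2 h v *\<^sub>R \<Delta>2 f a v)"
proof -
  obtain K where K: "0 \<le> K"
    "\<And>a u. 0 < a \<Longrightarrow> 0 \<le> u \<Longrightarrow> norm (\<Delta>1 f a u) \<le> K * a * ((u - 1)\<^sup>2 / (1 + u))"
    "\<And>a v. 0 < a \<Longrightarrow> 0 \<le> v \<Longrightarrow> norm (\<Delta>2 f a v) \<le> K * a * (1 + v)"
    using \<Delta>_bounds[OF f] by blast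
  note c = \<Delta>_continuous[OF Cl2_continuous[OF f] less_imp_le[OF a]]
  show "set_integrable lborel {0<..} (\<lambda>u. nk1 h u *\<^sub>R \<Delta>1 f a u)"
  proof (rule set_integrable_dominated)
    show "set_borel_measurable lborel {0<..} (\<lambda>u. nk1 h u *\<^sub>R \<Delta>1 f a u)"
      unfolding set_borel_measurable_def by (rule half_line_measurable[OF c(1) nk_measurable(1)])
    show "norm (nk1 h u *\<^sub>R \<Delta>1 f a u) \<le> K * a * (4 / pi) / (1 + u\<^sup>2)" if "0 < u" for u
      using that by (intro nk_\<Delta>_bound(1)[OF K(1) a] K(2)[OF a]) auto
  qed
  assume h: "0 \<le> h" "h \<le> 1"
  show "set_integrable lborel {0<..} (\<lambda>v. nk2 h v *\<^sub>R \<Delta>2 f a v)"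
  proof (rule set_integrable_dominated)
    show "set_borel_measurable lborel {0<..} (\<lambda>v. nk2 h v *\<^sub>R \<Delta>2 f a v)"
      unfolding set_borel_measurable_def by (rule half_line_measurable[OF c(2) nk_measurable(2)])
    show "norm (nk2 h u *\<^sub>R \<Delta>2 f a u) \<le> K * a * (24 / pi) / (1 + u\<^sup>2)" if "0 < u" for u
      using that by (intro nk_\<Delta>_bound(2)[OF K(1) a] K(3)[OF a] h) auto
  qed
qed

lemma G2_eq_Jf:
  assumes f: "f \<in> Cl2" and a: "0 < a"
  shows "G2 f (a, 0) = Jf f a 0"
proof -
  define F where "F = (\<lambda>y. f (a *\<^sub>R y) - f (a, 0) - (a * (fst y - 1)) *\<^sub>R pd1 f (a, 0))"
  have F: "continuous_on E F" unfolding F_def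
    by (intro continuous_intros continuous_on_compose2[OF Cl2_continuous[OF f]]) (use a in \<open>auto simp: E_iff\<close>)
  have F1: "F (u, 0) = \<Delta>1 f a u" and F2: "F (0, u) = \<Delta>2 f a u" for u
    by (simp_all add: F_def \<Delta>1_def \<Delta>2_def)
  have "(LINT y:E|nu. F y) = (LINT u:{0<..}|lborel. nk1 0 u *\<^sub>R \<Delta>1 f a u) + (LINT v:{0<..}|lborel. nk2 0 v *\<^sub>R \<Delta>2 f a v)"
    using integral_nu[OF F] nk_\<Delta>_integrable[OF f a, of 0] by (simp add: F1 F2 nk_0)
  then show ?thesis using a by (simp add: G2_def Jf_def F_def)
qed

text \<open>The common shape of the later splittings: a compensated integrand plus constants
  weighted by real kernels, whose integrals are a mass or a first moment.\<close>

lemma set_integral_combination: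
  fixes A :: "real \<Rightarrow> complex" and k m :: "real \<Rightarrow> real"
  assumes "set_integrable M U A" "set_integrable M U k" "set_integrable M U m"
  shows "(LINT u:U|M. h *\<^sub>R A u + (k u *\<^sub>R X + m u *\<^sub>R Y)) =
    h *\<^sub>R (LINT u:U|M. A u) + ((LINT u:U|M. k u) *\<^sub>R X + (LINT u:U|M. m u) *\<^sub>R Y)"
proof -
  have i: "set_integrable M U (\<lambda>u. h *\<^sub>R A u)" "set_integrable M U (\<lambda>u. k u *\<^sub>R X)" "set_integrable M U (\<lambda>u. m u *\<^sub>R Y)"
    using assms by auto
  have sl: "(LINT u:U|M. g u *\<^sub>R Z) = (LINT u:U|M. g u) *\<^sub>R Z" if "set_integrable M U g" for g :: "real \<Rightarrow> real" and Z :: complex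
    using that integral_scaleR_left[of Z M "\<lambda>u. indicator U u *\<^sub>R g u"]
    by (simp add: set_lebesgue_integral_def set_integrable_def)
  show ?thesis
    unfolding set_integral_add(2)[OF i(1) set_integral_add(1)[OF i(2,3)]] set_integral_add(2)[OF i(2,3)]
    by (simp only: set_integral_scaleR_right sl[OF assms(2)] sl[OF assms(3)])
qed

text \<open>An exact identity, not an expansion. After scaling by \<open>a\<close>, the kernels at
  \<open>(1, h)\<close> have total mass 1 and first moment 1 in the first coordinate, so subtracting
  the first-order Taylor polynomial at \<open>(a, 0)\<close> leaves exactly the compensated
  integral, with the factor \<open>h\<close> taken out of the kernel.\<close>

lemma poisson_Jf:
  assumes f: "f \<in> Cl2" and a: "0 < a" and h: "0 < h" "h \<le> 1"
  shows "poisson f (a, a * h) = f (a, 0) + (a * h) *\<^sub>R Jf f a h"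
proof -
  note kf = kern_facts[OF zero_less_one h(1)] kern_facts[OF h(1) zero_less_one]
  define P where "P = pd1 f (a, 0)"
  have s1: "kern 1 h u *\<^sub>R f (a * u, 0) = h *\<^sub>R (nk1 h u *\<^sub>R \<Delta>1 f a u) + (kern 1 h u *\<^sub>R (f (a, 0) - a *\<^sub>R P) + (kern 1 h u * u) *\<^sub>R (a *\<^sub>R P))" for u
    unfolding nk_kern \<Delta>1_def P_def by (simp add: scaleR_conv_of_real algebra_simps)
  have s2: "kern h 1 u *\<^sub>R f (0, a * u) = h *\<^sub>R (nk2 h u *\<^sub>R \<Delta>2 f a u) + kern h 1 u *\<^sub>R (f (a, 0) - a *\<^sub>R P)" for u
    unfolding nk_kern \<Delta>2_def P_def by (simp add: scaleR_conv_of_real algebra_simps)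
  note i1 = nk_\<Delta>_integrable(1)[OF f a, of h] and i2 = nk_\<Delta>_integrable(2)[OF f a less_imp_le[OF h(1)] h(2)]
  have I1: "(LINT u:{0<..}|lborel. kern 1 h u *\<^sub>R f (a * u, 0)) = h *\<^sub>R (LINT u:{0<..}|lborel. nk1 h u *\<^sub>R \<Delta>1 f a u)
      + ((LINT u:{0<..}|lborel. kern 1 h u) *\<^sub>R (f (a, 0) - a *\<^sub>R P) + 1 *\<^sub>R (a *\<^sub>R P))"
    unfolding s1 by (simp only: set_integral_combination[OF i1 kf(1,2)] kf(4))
  have I2: "(LINT u:{0<..}|lborel. kern h 1 u *\<^sub>R f (0, a * u)) = h *\<^sub>R (LINT u:{0<..}|lborel. nk2 h u *\<^sub>R \<Delta>2 f a u)
      + (LINT u:{0<..}|lborel. kern h 1 u) *\<^sub>R (f (a, 0) - a *\<^sub>R P)"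
    using set_integral_combination[OF i2 kf(5) kf(5), of h "f (a, 0) - a *\<^sub>R P" 0] unfolding s2 by simp
  define \<kappa> where "\<kappa> = (LINT u:{0<..}|lborel. kern 1 h u)"
  define A where "A = (LINT u:{0<..}|lborel. nk1 h u *\<^sub>R \<Delta>1 f a u)"
  define B where "B = (LINT u:{0<..}|lborel. nk2 h u *\<^sub>R \<Delta>2 f a u)"
  have k2: "(LINT u:{0<..}|lborel. kern h 1 u) = 1 - \<kappa>" using kf(3) by (simp add: \<kappa>_def)
  have "poisson f (a, a * h) = (LINT u:{0<..}|lborel. kern 1 h u *\<^sub>R f (a * u, 0)) + (LINT u:{0<..}|lborel. kern h 1 u *\<^sub>R f (0, a * u))"
    using poisson_scale[OF a, of f "(1, h)"] by (simp add: poisson_def)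
  then have p: "poisson f (a, a * h) = h *\<^sub>R A + (\<kappa> *\<^sub>R (f (a, 0) - a *\<^sub>R P) + 1 *\<^sub>R (a *\<^sub>R P)) +
      (h *\<^sub>R B + (1 - \<kappa>) *\<^sub>R (f (a, 0) - a *\<^sub>R P))"
    by (simp only: I1 I2 k2 A_def B_def \<kappa>_def)
  have "Jf f a h = (1 / a) *\<^sub>R (A + B)" by (simp add: Jf_def A_def B_def)
  then have "(a * h) *\<^sub>R Jf f a h = h *\<^sub>R (A + B)" using a by simp
  then show ?thesis unfolding p by (simp add: algebra_simps)
qed

text \<open>Dominated convergence with a majorant uniform in \<open>a n\<close> and
  \<open>h n\<close>. The limits of the rescaled integrands are left open, because the base point
  may converge to a positive number, to 0 or to infinity.\<close>

lemma Jf_limit: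
  assumes f: "f \<in> Cl2" and a: "\<And>n. 0 < a n" and h: "\<And>n. 0 \<le> h n" "\<And>n. h n \<le> 1" "h \<longlonglongrightarrow> 0"
    and l1: "\<And>u. 0 < u \<Longrightarrow> (\<lambda>n. (1 / a n) *\<^sub>R \<Delta>1 f (a n) u) \<longlonglongrightarrow> \<phi>1 u"
    and l2: "\<And>v. 0 < v \<Longrightarrow> (\<lambda>n. (1 / a n) *\<^sub>R \<Delta>2 f (a n) v) \<longlonglongrightarrow> \<phi>2 v"
  shows "(\<lambda>n. Jf f (a n) (h n)) \<longlonglongrightarrow>
    (LINT u:{0<..}|lborel. nk1 0 u *\<^sub>R \<phi>1 u) + (LINT v:{0<..}|lborel. nk2 0 v *\<^sub>R \<phi>2 v)"
proof -
  obtain K where K: "0 \<le> K"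
    "\<And>a u. 0 < a \<Longrightarrow> 0 \<le> u \<Longrightarrow> norm (\<Delta>1 f a u) \<le> K * a * ((u - 1)\<^sup>2 / (1 + u))"
    "\<And>a v. 0 < a \<Longrightarrow> 0 \<le> v \<Longrightarrow> norm (\<Delta>2 f a v) \<le> K * a * (1 + v)"
    using \<Delta>_bounds[OF f] by blast
  have dom: "(\<lambda>n. LINT u:{0<..}|lborel. k (h n) u *\<^sub>R ((1 / a n) *\<^sub>R D n u)) \<longlonglongrightarrow> (LINT u:{0<..}|lborel. k 0 u *\<^sub>R \<phi> u)"
    if km: "\<And>r. k r \<in> borel_measurable borel" and D: "\<And>n. continuous_on {0..} (D n)"
      and b: "\<And>n u. 0 < u \<Longrightarrow> norm (k (h n) u *\<^sub>R D n u) \<le> K * a n * C / (1 + u\<^sup>2)"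
      and l: "\<And>u. 0 < u \<Longrightarrow> (\<lambda>n. k (h n) u *\<^sub>R ((1 / a n) *\<^sub>R D n u)) \<longlonglongrightarrow> k 0 u *\<^sub>R \<phi> u"
    for k :: "real \<Rightarrow> real \<Rightarrow> real" and D and C and \<phi> :: "real \<Rightarrow> complex"
    unfolding set_lebesgue_integral_def
  proof (rule integral_dominated_convergence[where w = "\<lambda>u. K * C * (1 / (1 + u\<^sup>2)) * indicator {0<..} u"])
    show "integrable lborel (\<lambda>u::real. K * C * (1 / (1 + u\<^sup>2)) * indicator {0<..} u)"
      using integrable_mult_right[OF integrable_inverse_one_plus_sq, of "K * C"]
      by (rule integrable_real_mult_indicator[rotated]) simp
    have lim: "(\<lambda>n. indicator {0<..} u *\<^sub>R k (h n) u *\<^sub>R (1 / a n) *\<^sub>R D n u) \<longlonglongrightarrow> indicator {0<..} u *\<^sub>R k 0 u *\<^sub>R \<phi> u" for u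
      using l[of u] by (cases "0 < u") auto
    then show "AE u in lborel. (\<lambda>n. indicator {0<..} u *\<^sub>R k (h n) u *\<^sub>R (1 / a n) *\<^sub>R D n u) \<longlonglongrightarrow> indicator {0<..} u *\<^sub>R k 0 u *\<^sub>R \<phi> u"
      by simp
    show m: "(\<lambda>u. indicator {0<..} u *\<^sub>R k (h n) u *\<^sub>R (1 / a n) *\<^sub>R D n u) \<in> borel_measurable lborel" for n
      by (rule half_line_measurable[OF _ km]) (intro continuous_intros D)
    show "(\<lambda>u. indicator {0<..} u *\<^sub>R k 0 u *\<^sub>R \<phi> u) \<in> borel_measurable lborel"
      by (rule borel_measurable_LIMSEQ_metric[OF m lim])
    show "AE u in lborel. norm (indicator {0<..} u *\<^sub>R k (h n) u *\<^sub>R (1 / a n) *\<^sub>R D n u)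
        \<le> K * C * (1 / (1 + u\<^sup>2)) * indicator {0<..} u" for n
    proof (rule AE_I2)
      fix u :: real
      show "norm (indicator {0<..} u *\<^sub>R k (h n) u *\<^sub>R (1 / a n) *\<^sub>R D n u) \<le> K * C * (1 / (1 + u\<^sup>2)) * indicator {0<..} u"
      proof (cases "0 < u")
        case True
        have "norm (k (h n) u *\<^sub>R (1 / a n) *\<^sub>R D n u) = norm (k (h n) u *\<^sub>R D n u) / a n"
          using a[of n] by simp
        also have "\<dots> \<le> K * a n * C / (1 + u\<^sup>2) / a n"
          using a[of n] by (intro divide_right_mono b True) auto
        also have "\<dots> = K * C * (1 / (1 + u\<^sup>2))" using a[of n] by simp
        finally show ?thesis using True by simp
      qed simp
    qed
  qed
  have n1: "(\<lambda>n. nk1 (h n) u *\<^sub>R ((1 / a n) *\<^sub>R \<Delta>1 f (a n) u)) \<longlonglongrightarrow> nk1 0 u *\<^sub>R \<phi>1 u" if u: "0 < u" for u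
  \<comment> \<open>At 1 the kernel \<open>nk1 (h n)\<close> diverges while \<open>nk1 0\<close> is
    0 by the convention for division; the integrand vanishes there for every
    \<open>n\<close>.\<close>
  proof (cases "u = 1")
    case True
    then have "\<Delta>1 f (a n) u = 0" for n by (simp add: \<Delta>1_def)
    moreover from this have "\<phi>1 u = 0" using l1[OF u] by (simp add: LIMSEQ_const_iff)
    ultimately show ?thesis by simp
  next
    case False
    have "(\<lambda>n. nk1 (h n) u) \<longlonglongrightarrow> nk1 0 u"
      unfolding nk1_def using False u by (intro tendsto_intros h(3)) (auto simp: power2_eq_square)
    then show ?thesis by (intro tendsto_scaleR l1 u)
  qed
  have n2: "(\<lambda>n. nk2 (h n) u *\<^sub>R ((1 / a n) *\<^sub>R \<Delta>2 f (a n) u)) \<longlonglongrightarrow> nk2 0 u *\<^sub>R \<phi>2 u" if u: "0 < u" for u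
  proof (intro tendsto_scaleR l2 u)
    have ne: "x * x + 1 \<noteq> 0" for x :: real using zero_le_square[of x] by linarith
    show "(\<lambda>n. nk2 (h n) u) \<longlonglongrightarrow> nk2 0 u"
      unfolding nk2_def by (intro tendsto_intros h(3)) (auto simp: power2_eq_square ne)
  qed
  have D1: "continuous_on {0..} (\<Delta>1 f (a n))" and D2: "continuous_on {0..} (\<Delta>2 f (a n))" for n
    using \<Delta>_continuous[OF Cl2_continuous[OF f] less_imp_le[OF a]] by auto
  have L1: "(\<lambda>n. LINT u:{0<..}|lborel. nk1 (h n) u *\<^sub>R ((1 / a n) *\<^sub>R \<Delta>1 f (a n) u)) \<longlonglongrightarrow> (LINT u:{0<..}|lborel. nk1 0 u *\<^sub>R \<phi>1 u)"
    by (rule dom[where C = "4 / pi", OF nk_measurable(1) D1 _ n1])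
      (intro nk_\<Delta>_bound(1)[OF K(1) a] K(2)[OF a]; simp)
  have L2: "(\<lambda>n. LINT u:{0<..}|lborel. nk2 (h n) u *\<^sub>R ((1 / a n) *\<^sub>R \<Delta>2 f (a n) u)) \<longlonglongrightarrow> (LINT u:{0<..}|lborel. nk2 0 u *\<^sub>R \<phi>2 u)"
    by (rule dom[where C = "24 / pi", OF nk_measurable(2) D2 _ n2])
      (intro nk_\<Delta>_bound(2)[OF K(1) a] K(3)[OF a] h; simp)
  have sw: "(LINT u:{0<..}|lborel. k u *\<^sub>R (c *\<^sub>R D u)) = c *\<^sub>R (LINT u:{0<..}|lborel. k u *\<^sub>R D u)" for k :: "real \<Rightarrow> real" and c and D :: "real \<Rightarrow> complex"
    by (simp only: scaleR_left_commute[of _ c] set_integral_scaleR_right)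
  show ?thesis using tendsto_add[OF L1 L2] by (simp only: Jf_def sw scaleR_add_right)
qed

lemma Jf_limit_eventually:
  assumes f: "f \<in> Cl2" and a: "eventually (\<lambda>n. 0 < a n) sequentially" and h: "eventually (\<lambda>n. 0 \<le> h n) sequentially" "h \<longlonglongrightarrow> 0"
    and l1: "\<And>u. 0 < u \<Longrightarrow> (\<lambda>n. (1 / a n) *\<^sub>R \<Delta>1 f (a n) u) \<longlonglongrightarrow> \<phi>1 u"
    and l2: "\<And>v. 0 < v \<Longrightarrow> (\<lambda>n. (1 / a n) *\<^sub>R \<Delta>2 f (a n) v) \<longlonglongrightarrow> \<phi>2 v"
  shows "(\<lambda>n. Jf f (a n) (h n)) \<longlonglongrightarrow>
    (LINT u:{0<..}|lborel. nk1 0 u *\<^sub>R \<phi>1 u) + (LINT v:{0<..}|lborel. nk2 0 v *\<^sub>R \<phi>2 v)"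
proof -
  have "eventually (\<lambda>n. h n < 1) sequentially" by (rule order_tendstoD(2)[OF h(2)]) simp
  with a h(1) have "eventually (\<lambda>n. 0 < a n \<and> 0 \<le> h n \<and> h n \<le> 1) sequentially"
    by eventually_elim auto
  then obtain N where N: "\<And>n. N \<le> n \<Longrightarrow> 0 < a n \<and> 0 \<le> h n \<and> h n \<le> 1" by (auto simp: eventually_sequentially)
  show ?thesis
    by (rule LIMSEQ_offset[of _ N], rule Jf_limit[OF f])
      (use N LIMSEQ_ignore_initial_segment[OF h(2)] LIMSEQ_ignore_initial_segment[OF l1] LIMSEQ_ignore_initial_segment[OF l2] in auto)
qed

lemma has_vector_derivative_quotient:
  assumes "(g has_vector_derivative d) (at x)"
  shows "((\<lambda>h. (1 / h) *\<^sub>R (g (x + h) - g x)) \<longlongrightarrow> d) (at 0)"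
proof -
  have "((\<lambda>h. norm (g (x + h) - g x - h *\<^sub>R d) / norm h) \<longlongrightarrow> 0) (at 0)"
    using assms by (simp add: has_vector_derivative_def has_derivative_at)
  then have "((\<lambda>h. (1 / h) *\<^sub>R (g (x + h) - g x) - d) \<longlongrightarrow> 0) (at 0)"
  proof (rule Lim_null_comparison[rotated])
    show "eventually (\<lambda>h. norm ((1 / h) *\<^sub>R (g (x + h) - g x) - d) \<le> norm (g (x + h) - g x - h *\<^sub>R d) / norm h) (at 0)"
      unfolding eventually_at_filter
    proof (intro always_eventually allI impI)
      fix h :: real assume h: "h \<noteq> 0"
      have "(1 / h) *\<^sub>R (g (x + h) - g x) - d = (1 / h) *\<^sub>R (g (x + h) - g x - h *\<^sub>R d)"
        using h by (simp add: scaleR_diff_right)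
      then have "norm ((1 / h) *\<^sub>R (g (x + h) - g x) - d) = \<bar>1 / h\<bar> * norm (g (x + h) - g x - h *\<^sub>R d)"
        by (simp only: norm_scaleR)
      then show "norm ((1 / h) *\<^sub>R (g (x + h) - g x) - d) \<le> norm (g (x + h) - g x - h *\<^sub>R d) / norm h"
        by simp
    qed
  qed
  then show ?thesis using Lim_null by blast
qed

lemma tendsto_at_right_sequentially_iff:
  fixes f :: "real \<Rightarrow> 'b::topological_space"
  shows "(\<And>X. (\<And>n. 0 < X n) \<Longrightarrow> X \<longlonglongrightarrow> 0 \<Longrightarrow> (\<lambda>n. f (X n)) \<longlonglongrightarrow> L) \<Longrightarrow> (f \<longlongrightarrow> L) (at_right 0)"
  unfolding tendsto_at_iff_sequentially by (auto simp: comp_def)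

section \<open>Continuity of \<open>G2\<close> along the axis and its limit at infinity\<close>

lemma Cl2_pd1_continuous: "f \<in> Cl2 \<Longrightarrow> continuous_on {0..} (\<lambda>u. pd1 f (u, 0))"
  by (erule Cl2_axis_C2) (rule axis_C2_deriv_continuous)

lemma Cl2_right_derivative:
  assumes f: "f \<in> Cl2"
  shows "((\<lambda>r. (1 / r) *\<^sub>R (f (r, 0) - f (0, 0))) \<longlongrightarrow> pd1 f (0, 0)) (at_right 0)"
    and "((\<lambda>r. (1 / r) *\<^sub>R (f (0, r) - f (0, 0))) \<longlongrightarrow> pd2 f (0, 0)) (at_right 0)"
proof -
  obtain s1 s2 C where A: "axis_C2 (\<lambda>u. f (u, 0)) (\<lambda>u. pd1 f (u, 0)) s1 C" "axis_C2 (\<lambda>v. f (0, v)) (\<lambda>v. pd2 f (0, v)) s2 C"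
    using Cl2_axis_C2[OF f] .
  note c = axis_continuous[OF Cl2_continuous[OF f]]
  show "((\<lambda>r. (1 / r) *\<^sub>R (f (r, 0) - f (0, 0))) \<longlongrightarrow> pd1 f (0, 0)) (at_right 0)"
    using axis_C2_right_derivative[OF A(1) c(1)] .
  show "((\<lambda>r. (1 / r) *\<^sub>R (f (0, r) - f (0, 0))) \<longlongrightarrow> pd2 f (0, 0)) (at_right 0)"
    using axis_C2_right_derivative[OF A(2) c(2)] .
qed

lemma Jf_scale:
  "(LINT u:{0<..}|lborel. nk1 0 u *\<^sub>R ((1 / a) *\<^sub>R \<Delta>1 f a u)) + (LINT v:{0<..}|lborel. nk2 0 v *\<^sub>R ((1 / a) *\<^sub>R \<Delta>2 f a v)) = Jf f a 0"
  by (simp only: Jf_def scaleR_left_commute[of _ "1 / a"] set_integral_scaleR_right scaleR_add_right)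

lemma Jf_tendsto_pos:
  assumes f: "f \<in> Cl2" and X: "X \<longlonglongrightarrow> a" and a: "0 < a" and h: "eventually (\<lambda>n. 0 \<le> h n) sequentially" "h \<longlonglongrightarrow> 0"
  shows "(\<lambda>n. Jf f (X n) (h n)) \<longlonglongrightarrow> Jf f a 0"
proof -
  have ev: "eventually (\<lambda>n. 0 < X n) sequentially" by (rule order_tendstoD(1)[OF X a])
  have fl: "(\<lambda>n. f (X n * u, 0)) \<longlonglongrightarrow> f (a * u, 0)" "(\<lambda>n. f (0, X n * u)) \<longlonglongrightarrow> f (0, a * u)" if "0 \<le> u" for u
    by (rule continuous_on_tendsto_compose[OF Cl2_continuous[OF f]], intro tendsto_intros X,
        use a that in \<open>simp add: E_iff\<close>, use ev in eventually_elim, use that in \<open>simp add: E_iff\<close>)+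
  have pl: "(\<lambda>n. pd1 f (X n, 0)) \<longlonglongrightarrow> pd1 f (a, 0)"
    by (rule continuous_on_tendsto_compose[OF Cl2_pd1_continuous[OF f] X])
      (use a ev in \<open>auto elim: eventually_mono\<close>)
  have "(\<lambda>n. (1 / X n) *\<^sub>R \<Delta>1 f (X n) u) \<longlonglongrightarrow> (1 / a) *\<^sub>R \<Delta>1 f a u" if "0 < u" for u
    unfolding \<Delta>1_def using a that fl[of u] fl[of 1] by (intro tendsto_intros X pl) auto
  moreover have "(\<lambda>n. (1 / X n) *\<^sub>R \<Delta>2 f (X n) u) \<longlonglongrightarrow> (1 / a) *\<^sub>R \<Delta>2 f a u" if "0 < u" for u
    unfolding \<Delta>2_def using a that fl[of u] fl[of 1] by (intro tendsto_intros X pl) auto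
  ultimately show ?thesis
    using Jf_limit_eventually[OF f ev h, of "\<lambda>u. (1 / a) *\<^sub>R \<Delta>1 f a u" "\<lambda>u. (1 / a) *\<^sub>R \<Delta>2 f a u"]
    by (simp only: Jf_scale)
qed

text \<open>The first moment of \<open>kern h 1\<close> is \<open>h\<close>, so that of
  \<open>nk2 h\<close> is 1 for every positive \<open>h\<close>; dominated convergence carries this
  over to \<open>h = 0\<close>.\<close>

lemma nk2_moment:
  shows "set_integrable lborel {0<..} (\<lambda>v. nk2 0 v * v)" and "(LINT v:{0<..}|lborel. nk2 0 v * v) = 1"
proof -
  have b: "norm (nk2 h v * v) \<le> 24 / pi / (1 + v\<^sup>2)" if "0 < v" "0 \<le> h" "h \<le> 1" for h v
  proof -
    have "nk2 h v * v \<le> nk2 h v * (1 + v)" using that nk_nonneg(2)[of v h] by (intro mult_left_mono) auto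
    then show ?thesis using nk2_bound[OF that] nk_nonneg(2)[of v h] that by simp
  qed
  have w: "integrable lborel (\<lambda>v::real. 24 / pi * (1 / (1 + v\<^sup>2)))"
    by (rule integrable_mult_right[OF integrable_inverse_one_plus_sq])
  have b': "norm (indicator {0<..} v *\<^sub>R (nk2 h v * v)) \<le> 24 / pi * (1 / (1 + v\<^sup>2))" if "0 \<le> h" "h \<le> 1" for h v
    using b[of v h] that by (cases "0 < v") auto
  show "set_integrable lborel {0<..} (\<lambda>v. nk2 0 v * v)"
    unfolding set_integrable_def
    by (rule Bochner_Integration.integrable_bound[OF w]) (use b'[of 0] in \<open>auto intro: order_trans[OF _ abs_ge_self]\<close>)
  define h where "h = (\<lambda>n. 1 / real (Suc n))"
  have h: "0 < h n" "h n \<le> 1" for n by (auto simp: h_def)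
  have h0: "h \<longlonglongrightarrow> 0" unfolding h_def using LIMSEQ_inverse_real_of_nat by (simp add: inverse_eq_divide)
  have "(\<lambda>n. LINT v:{0<..}|lborel. nk2 (h n) v * v) \<longlonglongrightarrow> (LINT v:{0<..}|lborel. nk2 0 v * v)"
    unfolding set_lebesgue_integral_def
  proof (rule integral_dominated_convergence[OF _ _ w])
    have ne: "x * x + 1 \<noteq> 0" for x :: real using zero_le_square[of x] by linarith
    have "(\<lambda>n. nk2 (h n) v) \<longlonglongrightarrow> nk2 0 v" for v
      unfolding nk2_def by (intro tendsto_intros h0) (auto simp: power2_eq_square ne)
    then show "AE v in lborel. (\<lambda>n. indicator {0<..} v *\<^sub>R (nk2 (h n) v * v)) \<longlonglongrightarrow> indicator {0<..} v *\<^sub>R (nk2 0 v * v)"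
      by (intro AE_I2 tendsto_intros)
    show "AE v in lborel. norm (indicator {0<..} v *\<^sub>R (nk2 (h n) v * v)) \<le> 24 / pi * (1 / (1 + v\<^sup>2))" for n
      using b'[OF less_imp_le[OF h(1)] h(2)] by (intro AE_I2) blast
  qed auto
  moreover have "(LINT v:{0<..}|lborel. nk2 (h n) v * v) = 1" for n
  proof -
    have "h n * (LINT v:{0<..}|lborel. nk2 (h n) v * v) = h n"
      using kern_facts(4)[OF h(1)[of n] zero_less_one] unfolding nk_kern by (simp add: mult.assoc)
    then show ?thesis using h(1)[of n] by simp
  qed
  ultimately show "(LINT v:{0<..}|lborel. nk2 0 v * v) = 1" by (simp add: LIMSEQ_const_iff)
qed

text \<open>Rescaled at the origin, \<open>f\<close> becomes linear on each axis:
  \<open>\<Delta>1\<close> contributes nothing in the limit, and \<open>\<Delta>2\<close> gives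
  \<open>v *\<^sub>R pd2 f (0, 0)\<close>, whose integral is given by the unit first moment of
  \<open>nk2 0\<close>. This is why \<open>G2\<close> is continuous at the origin, where it is
  defined as a derivative.\<close>

lemma Jf_tendsto_zero:
  assumes f: "f \<in> Cl2"
  shows "((\<lambda>a. Jf f a 0) \<longlongrightarrow> pd2 f (0, 0)) (at_right 0)"
proof (rule tendsto_at_right_sequentially_iff)
  fix X :: "nat \<Rightarrow> real" assume X: "\<And>n. 0 < X n" "X \<longlonglongrightarrow> 0"
  have Xr: "filterlim (\<lambda>n. X n * u) (at_right 0) sequentially" if "0 < u" for u
  proof (rule tendsto_imp_filterlim_at_right)
    show "(\<lambda>n. X n * u) \<longlonglongrightarrow> 0" using tendsto_mult_right[OF X(2), of u] by simp
    show "eventually (\<lambda>n. 0 < X n * u) sequentially" using X(1) that by (intro always_eventually allI mult_pos_pos)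
  qed
  have q1: "(\<lambda>n. (1 / (X n * u)) *\<^sub>R (f (X n * u, 0) - f (0, 0))) \<longlonglongrightarrow> pd1 f (0, 0)" if "0 < u" for u
    by (rule filterlim_compose[OF Cl2_right_derivative(1)[OF f] Xr[OF that]])
  have q2: "(\<lambda>n. (1 / (X n * u)) *\<^sub>R (f (0, X n * u) - f (0, 0))) \<longlonglongrightarrow> pd2 f (0, 0)" if "0 < u" for u
    by (rule filterlim_compose[OF Cl2_right_derivative(2)[OF f] Xr[OF that]])
  have pl: "(\<lambda>n. pd1 f (X n, 0)) \<longlonglongrightarrow> pd1 f (0, 0)"
    by (rule continuous_on_tendsto_compose[OF Cl2_pd1_continuous[OF f] X(2)]) (use X(1) in \<open>auto intro!: always_eventually less_imp_le\<close>)
  have q: "(\<lambda>n. (1 / X n) *\<^sub>R (f (X n, 0) - f (0, 0))) \<longlonglongrightarrow> pd1 f (0, 0)" using q1[of 1] by simp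
  have d1: "(1 / X n) *\<^sub>R \<Delta>1 f (X n) u = u *\<^sub>R ((1 / (X n * u)) *\<^sub>R (f (X n * u, 0) - f (0, 0)))
      - (1 / X n) *\<^sub>R (f (X n, 0) - f (0, 0)) - (u - 1) *\<^sub>R pd1 f (X n, 0)" if "0 < u" for u n
    using X(1)[of n] that by (simp add: \<Delta>1_def scaleR_diff_right)
  have d2: "(1 / X n) *\<^sub>R \<Delta>2 f (X n) u = u *\<^sub>R ((1 / (X n * u)) *\<^sub>R (f (0, X n * u) - f (0, 0)))
      - (1 / X n) *\<^sub>R (f (X n, 0) - f (0, 0)) + pd1 f (X n, 0)" if "0 < u" for u n
    using X(1)[of n] that by (simp add: \<Delta>2_def scaleR_diff_right scaleR_add_right)
  have "(\<lambda>n. (1 / X n) *\<^sub>R \<Delta>1 f (X n) u) \<longlonglongrightarrow> u *\<^sub>R pd1 f (0, 0) - pd1 f (0, 0) - (u - 1) *\<^sub>R pd1 f (0, 0)" if "0 < u" for u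
    unfolding d1[OF that] by (intro tendsto_intros q1[OF that] q pl)
  then have l1: "(\<lambda>n. (1 / X n) *\<^sub>R \<Delta>1 f (X n) u) \<longlonglongrightarrow> 0" if "0 < u" for u
    using that by (simp add: scaleR_diff_left)
  have "(\<lambda>n. (1 / X n) *\<^sub>R \<Delta>2 f (X n) u) \<longlonglongrightarrow> u *\<^sub>R pd2 f (0, 0) - pd1 f (0, 0) + pd1 f (0, 0)" if "0 < u" for u
    unfolding d2[OF that] by (intro tendsto_intros q2[OF that] q pl)
  then have l2: "(\<lambda>n. (1 / X n) *\<^sub>R \<Delta>2 f (X n) u) \<longlonglongrightarrow> u *\<^sub>R pd2 f (0, 0)" if "0 < u" for u
    using that by simp
  have "(LINT v:{0<..}|lborel. nk2 0 v *\<^sub>R (v *\<^sub>R pd2 f (0, 0))) = pd2 f (0, 0)"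
    using set_integral_combination[of lborel "{0<..}" "\<lambda>_. 0" "\<lambda>v. nk2 0 v * v" "\<lambda>v. nk2 0 v * v" 0 "pd2 f (0, 0)" 0] nk2_moment
    by (simp add: set_integrable_def)
  then show "(\<lambda>n. Jf f (X n) 0) \<longlonglongrightarrow> pd2 f (0, 0)"
    using Jf_limit_eventually[OF f _ _ tendsto_const l1 l2] X(1)
    by (simp add: set_lebesgue_integral_def)
qed

text \<open>After division by \<open>a\<close> the values of the bounded function \<open>f\<close>
  disappear, and \<open>pd1 f (a, 0)\<close> tends to 0.\<close>

lemma Jf_tendsto_infinity:
  assumes f: "f \<in> Cl2"
  shows "((\<lambda>a. Jf f a 0) \<longlongrightarrow> 0) at_top"
proof (rule tendsto_at_topI_sequentially)
  fix X :: "nat \<Rightarrow> real" assume X: "filterlim X at_top sequentially"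
  have ev: "eventually (\<lambda>n. 1 \<le> X n) sequentially" using X by (simp add: filterlim_at_top)
  obtain K where K: "0 \<le> K" "\<And>x. x \<in> E \<Longrightarrow> norm (f x) \<le> K" using Cl_bounded[OF Cl2_Cl[OF f]] by blast
  have inv: "(\<lambda>n. 1 / X n) \<longlonglongrightarrow> 0"
    using tendsto_inverse_0_at_top[OF X] by (simp add: inverse_eq_divide)
  have fl: "(\<lambda>n. (1 / X n) *\<^sub>R g (X n)) \<longlonglongrightarrow> 0" if g: "\<And>a. 0 \<le> a \<Longrightarrow> norm (g a :: complex) \<le> K" for g
  proof (rule Lim_null_comparison)
    show "(\<lambda>n. 1 / X n * K) \<longlonglongrightarrow> 0" using tendsto_mult_left[OF inv, of K] by (simp add: mult.commute)
    show "eventually (\<lambda>n. norm ((1 / X n) *\<^sub>R g (X n)) \<le> 1 / X n * K) sequentially"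
      using ev by eventually_elim (use g in \<open>auto intro!: divide_right_mono\<close>)
  qed
  obtain s1 s2 C where A: "axis_C2 (\<lambda>u. f (u, 0)) (\<lambda>u. pd1 f (u, 0)) s1 C" "axis_C2 (\<lambda>v. f (0, v)) (\<lambda>v. pd2 f (0, v)) s2 C"
    using Cl2_axis_C2[OF f] .
  have "(\<lambda>n. X n *\<^sub>R pd1 f (X n, 0)) \<longlonglongrightarrow> 0"
    using A(1) X by (auto simp: axis_C2_def intro: filterlim_compose)
  from tendsto_scaleR[OF inv this] have "(\<lambda>n. (1 / X n) *\<^sub>R (X n *\<^sub>R pd1 f (X n, 0))) \<longlonglongrightarrow> 0" by simp
  then have pl: "(\<lambda>n. pd1 f (X n, 0)) \<longlonglongrightarrow> 0"
    by (rule Lim_transform_eventually) (use ev in eventually_elim, simp)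
  have l1: "(\<lambda>n. (1 / X n) *\<^sub>R \<Delta>1 f (X n) u) \<longlonglongrightarrow> 0" if u: "0 < u" for u
  proof (rule Lim_transform_eventually)
    have "(\<lambda>n. (1 / X n) *\<^sub>R f (X n * u, 0) - (1 / X n) *\<^sub>R f (X n, 0) - (u - 1) *\<^sub>R pd1 f (X n, 0)) \<longlonglongrightarrow> 0 - 0 - (u - 1) *\<^sub>R 0"
      using u by (intro tendsto_diff tendsto_scaleR tendsto_const pl fl[of "\<lambda>a. f (a * u, 0)"] fl[of "\<lambda>a. f (a, 0)"] K(2)) (auto simp: E_iff)
    then show "(\<lambda>n. (1 / X n) *\<^sub>R f (X n * u, 0) - (1 / X n) *\<^sub>R f (X n, 0) - (u - 1) *\<^sub>R pd1 f (X n, 0)) \<longlonglongrightarrow> 0" by simp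
    show "eventually (\<lambda>n. (1 / X n) *\<^sub>R f (X n * u, 0) - (1 / X n) *\<^sub>R f (X n, 0) - (u - 1) *\<^sub>R pd1 f (X n, 0) = (1 / X n) *\<^sub>R \<Delta>1 f (X n) u) sequentially"
      using ev by eventually_elim (simp add: \<Delta>1_def scaleR_diff_right)
  qed
  have l2: "(\<lambda>n. (1 / X n) *\<^sub>R \<Delta>2 f (X n) u) \<longlonglongrightarrow> 0" if u: "0 < u" for u
  proof (rule Lim_transform_eventually)
    have "(\<lambda>n. (1 / X n) *\<^sub>R f (0, X n * u) - (1 / X n) *\<^sub>R f (X n, 0) + pd1 f (X n, 0)) \<longlonglongrightarrow> 0 - 0 + 0"
      using u by (intro tendsto_diff tendsto_add pl fl[of "\<lambda>a. f (0, a * u)"] fl[of "\<lambda>a. f (a, 0)"] K(2)) (auto simp: E_iff)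
    then show "(\<lambda>n. (1 / X n) *\<^sub>R f (0, X n * u) - (1 / X n) *\<^sub>R f (X n, 0) + pd1 f (X n, 0)) \<longlonglongrightarrow> 0" by simp
    show "eventually (\<lambda>n. (1 / X n) *\<^sub>R f (0, X n * u) - (1 / X n) *\<^sub>R f (X n, 0) + pd1 f (X n, 0) = (1 / X n) *\<^sub>R \<Delta>2 f (X n) u) sequentially"
      using ev by eventually_elim (simp add: \<Delta>2_def scaleR_diff_right scaleR_add_right)
  qed
  have ev0: "eventually (\<lambda>n. 0 < X n) sequentially" using ev by eventually_elim simp
  show "(\<lambda>n. Jf f (X n) 0) \<longlonglongrightarrow> 0"
    using Jf_limit_eventually[OF f ev0 _ tendsto_const l1 l2]
    by (simp add: set_lebesgue_integral_def)
qed

lemma dagger_apply [simp]: "dagger f (a, b) = f (b, a)"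
  by (simp add: dagger_def)

lemma E_swap: "(a, b) \<in> E \<longleftrightarrow> (b, a) \<in> E"
  by (auto simp: E_iff)

lemma E_continuousI:
  assumes "continuous_on {0..} (\<lambda>u. g (u, 0))" "continuous_on {0..} (\<lambda>v. g (0, v))"
  shows "continuous_on E g"
proof -
  have eq: "E = {0..} \<times> {0} \<union> {0} \<times> {0..}" by (auto simp: E_iff)
  have 1: "continuous_on ({0..} \<times> {0}) g"
  proof (rule continuous_on_eq)
    show "continuous_on ({0..} \<times> {0}) (\<lambda>y. g (fst y, 0))"
      by (rule continuous_on_compose2[OF assms(1)]) (auto intro: continuous_intros)
  qed auto
  have 2: "continuous_on ({0} \<times> {0..}) g"
  proof (rule continuous_on_eq)
    show "continuous_on ({0} \<times> {0..}) (\<lambda>y. g (0, snd y))"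
      by (rule continuous_on_compose2[OF assms(2)]) (auto intro: continuous_intros)
  qed auto
  show ?thesis
    unfolding eq by (rule continuous_on_closed_Un[OF _ _ 1 2]) (intro closed_Times closed_atLeast closed_singleton)+
qed

lemma dagger_Cl: "f \<in> Cl \<Longrightarrow> dagger f \<in> Cl"
  by (auto simp: Cl_def extensional_def dagger_def E_swap intro!: E_continuousI axis_continuous)

lemma dagger_Cl2:
  assumes f: "f \<in> Cl2" shows "dagger f \<in> Cl2"
proof -
  obtain s1 s2 C where A: "axis_C2 (\<lambda>u. f (u, 0)) (\<lambda>u. pd1 f (u, 0)) s1 C" "axis_C2 (\<lambda>v. f (0, v)) (\<lambda>v. pd2 f (0, v)) s2 C"
    using Cl2_axis_C2[OF f] .
  show ?thesis
    by (rule Cl2I[OF dagger_Cl[OF Cl2_Cl[OF f]]]) (use A in simp_all)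
qed

lemma pd_dagger: "pd1 (dagger f) (a, b) = pd2 f (b, a)" "pd2 (dagger f) (a, b) = pd1 f (b, a)"
  by (simp_all add: pd1_def pd2_def)

lemma G_axis: "G2 f (0, b) = pd2 f (0, b)" "G1 f (a, 0) = pd1 f (a, 0)" "G1 f (0, b) = G2 (dagger f) (b, 0)"
  by (simp_all add: G2_def G1_def pd_dagger)

lemma G2_axis1_continuous:
  assumes f: "f \<in> Cl2"
  shows "continuous_on {0..} (\<lambda>u. G2 f (u, 0))" and "((\<lambda>u. G2 f (u, 0)) \<longlongrightarrow> 0) at_top"
proof -
  show "continuous_on {0..} (\<lambda>u. G2 f (u, 0))"
    unfolding continuous_on_def
  proof
    fix a :: real assume "a \<in> {0..}"
    then consider "a = 0" | "0 < a" by fastforce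
    then show "((\<lambda>u. G2 f (u, 0)) \<longlongrightarrow> G2 f (a, 0)) (at a within {0..})"
    proof cases
      case 1
      have "((\<lambda>u. G2 f (u, 0)) \<longlongrightarrow> pd2 f (0, 0)) (at_right 0)"
        by (rule Lim_transform_eventually[OF Jf_tendsto_zero[OF f]])
          (auto simp: eventually_at_right_field G2_eq_Jf[OF f] intro!: exI[of _ 1])
      then show ?thesis using 1 by (simp add: at_within_Ici_at_right G_axis)
    next
      case 2
      have "((\<lambda>u. Jf f u 0) \<longlongrightarrow> Jf f a 0) (at a)"
        unfolding tendsto_at_iff_sequentially comp_def
        using Jf_tendsto_pos[OF f _ 2, where h = "\<lambda>_. 0"] by auto
      then have "((\<lambda>u. G2 f (u, 0)) \<longlongrightarrow> Jf f a 0) (at a)"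
        by (rule Lim_transform_within_open[where s = "{0<..}"]) (use 2 G2_eq_Jf[OF f] in auto)
      then show ?thesis unfolding G2_eq_Jf[OF f 2] by (rule tendsto_within_subset) simp
    qed
  qed
  show "((\<lambda>u. G2 f (u, 0)) \<longlongrightarrow> 0) at_top"
    by (rule Lim_transform_eventually[OF Jf_tendsto_infinity[OF f]])
      (use eventually_gt_at_top[of 0] in eventually_elim, simp add: G2_eq_Jf[OF f])
qed

text \<open>The unbounded drift is harmless because \<open>u *\<^sub>R pd1 f (u, 0)\<close> tends to
  0. The second axis is reduced to the first by \<open>dagger\<close>, with the coordinates of
  \<theta> exchanged.\<close>

lemma G_Cl2:
  assumes f: "f \<in> Cl2"
  shows "G c \<theta> f \<in> Cl" and "((\<lambda>u. G c \<theta> f (u, 0)) \<longlongrightarrow> 0) at_top"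
proof -
  have half: "continuous_on {0..} (\<lambda>u. (c * (p - u)) *\<^sub>R pd1 f (u, 0) + (c * q) *\<^sub>R G2 f (u, 0))"
    "((\<lambda>u. (c * (p - u)) *\<^sub>R pd1 f (u, 0) + (c * q) *\<^sub>R G2 f (u, 0)) \<longlongrightarrow> 0) at_top"
    if f: "f \<in> Cl2" for f p q
  proof -
    show "continuous_on {0..} (\<lambda>u. (c * (p - u)) *\<^sub>R pd1 f (u, 0) + (c * q) *\<^sub>R G2 f (u, 0))"
      by (intro continuous_intros Cl2_pd1_continuous[OF f] G2_axis1_continuous[OF f])
    obtain s1 s2 C where A: "axis_C2 (\<lambda>u. f (u, 0)) (\<lambda>u. pd1 f (u, 0)) s1 C" "axis_C2 (\<lambda>v. f (0, v)) (\<lambda>v. pd2 f (0, v)) s2 C"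
      using Cl2_axis_C2[OF f] .
    have ul: "((\<lambda>u. u *\<^sub>R pd1 f (u, 0)) \<longlongrightarrow> 0) at_top" using A(1) by (simp add: axis_C2_def)
    have "((\<lambda>u. (1 / u) *\<^sub>R (u *\<^sub>R pd1 f (u, 0))) \<longlongrightarrow> 0 *\<^sub>R 0) at_top"
      by (intro tendsto_scaleR ul) real_asymp
    then have "((\<lambda>u. (1 / u) *\<^sub>R (u *\<^sub>R pd1 f (u, 0))) \<longlongrightarrow> 0) at_top" by simp
    then have pl: "((\<lambda>u. pd1 f (u, 0)) \<longlongrightarrow> 0) at_top"
      by (rule Lim_transform_eventually) (use eventually_gt_at_top[of 0] in eventually_elim, simp)
    have "((\<lambda>u. (c * p) *\<^sub>R pd1 f (u, 0) - c *\<^sub>R (u *\<^sub>R pd1 f (u, 0)) + (c * q) *\<^sub>R G2 f (u, 0)) \<longlongrightarrow>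
        (c * p) *\<^sub>R 0 - c *\<^sub>R 0 + (c * q) *\<^sub>R 0) at_top"
      by (intro tendsto_intros pl ul G2_axis1_continuous[OF f])
    then show "((\<lambda>u. (c * (p - u)) *\<^sub>R pd1 f (u, 0) + (c * q) *\<^sub>R G2 f (u, 0)) \<longlongrightarrow> 0) at_top"
      by (simp add: right_diff_distrib scaleR_diff_left)
  qed
  have e1: "G c \<theta> f (u, 0) = (c * (fst \<theta> - u)) *\<^sub>R pd1 f (u, 0) + (c * snd \<theta>) *\<^sub>R G2 f (u, 0)" if "0 \<le> u" for u
    using that by (simp add: G_def E_iff G_axis)
  have e2: "G c \<theta> f (0, u) = (c * (snd \<theta> - u)) *\<^sub>R pd1 (dagger f) (u, 0) + (c * fst \<theta>) *\<^sub>R G2 (dagger f) (u, 0)" if "0 \<le> u" for u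
    using that by (simp add: G_def E_iff G_axis pd_dagger)
  have t: "((\<lambda>u. g u) \<longlongrightarrow> L) at_top" if "(h \<longlongrightarrow> L) at_top" "\<And>u. 0 \<le> u \<Longrightarrow> g u = h u" for g h :: "real \<Rightarrow> complex" and L
    by (rule Lim_transform_eventually[OF that(1)])
      (use eventually_ge_at_top[of 0] in eventually_elim, simp add: that(2))
  note h1 = half[OF f, of "fst \<theta>" "snd \<theta>"] and h2 = half[OF dagger_Cl2[OF f], of "snd \<theta>" "fst \<theta>"]
  show l: "((\<lambda>u. G c \<theta> f (u, 0)) \<longlongrightarrow> 0) at_top" by (rule t[OF h1(2) e1])
  have "((\<lambda>u. G c \<theta> f (0, u)) \<longlongrightarrow> 0) at_top" by (rule t[OF h2(2) e2])
  moreover have "continuous_on E (G c \<theta> f)"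
    by (rule E_continuousI; rule continuous_on_eq[OF h1(1)] continuous_on_eq[OF h2(1)]; simp add: e1 e2)
  moreover have "G c \<theta> f \<in> extensional E" by (simp add: G_def)
  ultimately show "G c \<theta> f \<in> Cl" using l by (auto simp: Cl_def)
qed

section \<open>One-sided derivatives of the exit law\<close>

context exit_kernel
begin

lemma Q_near_axis:
  assumes f: "f \<in> Cl2" and a: "0 < a" and b: "0 \<le> b" "b \<le> a"
  shows "(LINT y:E|Q (a, b). f y) = f (a, 0) + b *\<^sub>R Jf f a (b / a)"
proof (cases "b = 0")
  case True
  then show ?thesis using Q_boundary[OF _ Cl2_Cl[OF f], of "(a, 0)"] a by (simp add: E_iff)
next
  case False
  then have "(LINT y:E|Q (a, b). f y) = poisson f (a, b)"
    using a b by (intro Q_poisson Cl2_Cl f) (auto simp: open_quadrant_def)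
  then show ?thesis using poisson_Jf[OF f a, of "b / a"] a b False by simp
qed

text \<open>The displacement is split into a motion along the axis, which gives \<open>pd1\<close>,
  and a transversal motion from the moved base point, which gives \<open>Jf\<close> at a base point
  tending to \<open>a\<close> and a height ratio tending to 0.\<close>

lemma Q_derivative_axis1:
  assumes f: "f \<in> Cl2" and a: "0 < a" and \<beta>: "0 \<le> \<beta>"
  shows "((\<lambda>e. (1 / e) *\<^sub>R ((LINT y:E|Q (a + e * \<alpha>, e * \<beta>). f y) - f (a, 0))) \<longlongrightarrow>
    \<alpha> *\<^sub>R pd1 f (a, 0) + \<beta> *\<^sub>R G2 f (a, 0)) (at_right 0)"
proof (rule tendsto_at_right_sequentially_iff)
  fix X :: "nat \<Rightarrow> real" assume X: "\<And>n. 0 < X n" "X \<longlonglongrightarrow> 0"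
  obtain s1 s2 C where A: "axis_C2 (\<lambda>u. f (u, 0)) (\<lambda>u. pd1 f (u, 0)) s1 C" "axis_C2 (\<lambda>v. f (0, v)) (\<lambda>v. pd2 f (0, v)) s2 C"
    using Cl2_axis_C2[OF f] .
  have d: "((\<lambda>u. f (u, 0)) has_vector_derivative pd1 f (a, 0)) (at a)" using A(1) a by (simp add: axis_C2_def)
  have pos: "0 < X n" for n by (rule X(1))
  have al: "(\<lambda>n. a + X n * \<alpha>) \<longlonglongrightarrow> a + 0 * \<alpha>" by (intro tendsto_intros X)
  then have al: "(\<lambda>n. a + X n * \<alpha>) \<longlonglongrightarrow> a" by simp
  have hl: "(\<lambda>n. X n * \<beta> / (a + X n * \<alpha>)) \<longlonglongrightarrow> 0 * \<beta> / a" using a by (intro tendsto_intros X al) auto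
  then have hl: "(\<lambda>n. X n * \<beta> / (a + X n * \<alpha>)) \<longlonglongrightarrow> 0" by simp
  have e1: "eventually (\<lambda>n. 0 < a + X n * \<alpha>) sequentially" by (rule order_tendstoD(1)[OF al a])
  have e2: "eventually (\<lambda>n. X n * \<beta> / (a + X n * \<alpha>) < 1) sequentially" by (rule order_tendstoD(2)[OF hl]) simp
  have e3: "eventually (\<lambda>n. 0 \<le> X n * \<beta> / (a + X n * \<alpha>)) sequentially"
    using e1 by eventually_elim (intro divide_nonneg_pos mult_nonneg_nonneg less_imp_le[OF pos] \<beta>)
  have J: "(\<lambda>n. Jf f (a + X n * \<alpha>) (X n * \<beta> / (a + X n * \<alpha>))) \<longlonglongrightarrow> Jf f a 0"
    by (rule Jf_tendsto_pos[OF f al a e3 hl])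
  have D: "(\<lambda>n. (1 / X n) *\<^sub>R (f (a + X n * \<alpha>, 0) - f (a, 0))) \<longlonglongrightarrow> \<alpha> *\<^sub>R pd1 f (a, 0)"
  proof (cases "\<alpha> = 0")
    case False
    have "filterlim (\<lambda>n. X n * \<alpha>) (at 0) sequentially"
      using tendsto_mult_right[OF X(2), of \<alpha>] False pos by (auto simp: filterlim_at intro!: always_eventually) (metis less_irrefl)
    from filterlim_compose[OF has_vector_derivative_quotient[OF d] this]
    have "(\<lambda>n. \<alpha> *\<^sub>R ((1 / (X n * \<alpha>)) *\<^sub>R (f (a + X n * \<alpha>, 0) - f (a, 0)))) \<longlonglongrightarrow> \<alpha> *\<^sub>R pd1 f (a, 0)"
      by (intro tendsto_scaleR tendsto_const)
    then show ?thesis using False by simp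
  qed simp
  have "(\<lambda>n. (1 / X n) *\<^sub>R (f (a + X n * \<alpha>, 0) - f (a, 0)) + \<beta> *\<^sub>R Jf f (a + X n * \<alpha>) (X n * \<beta> / (a + X n * \<alpha>))) \<longlonglongrightarrow>
      \<alpha> *\<^sub>R pd1 f (a, 0) + \<beta> *\<^sub>R G2 f (a, 0)"
    unfolding G2_eq_Jf[OF f a] by (intro tendsto_intros D J)
  then show "(\<lambda>n. (1 / X n) *\<^sub>R ((LINT y:E|Q (a + X n * \<alpha>, X n * \<beta>). f y) - f (a, 0))) \<longlonglongrightarrow>
      \<alpha> *\<^sub>R pd1 f (a, 0) + \<beta> *\<^sub>R G2 f (a, 0)"
  proof (rule Lim_transform_eventually)
    show "eventually (\<lambda>n. (1 / X n) *\<^sub>R (f (a + X n * \<alpha>, 0) - f (a, 0)) + \<beta> *\<^sub>R Jf f (a + X n * \<alpha>) (X n * \<beta> / (a + X n * \<alpha>)) =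
        (1 / X n) *\<^sub>R ((LINT y:E|Q (a + X n * \<alpha>, X n * \<beta>). f y) - f (a, 0))) sequentially"
      using e1 e2
    proof eventually_elim
      case (elim n)
      have "0 \<le> X n * \<beta>" "X n * \<beta> \<le> a + X n * \<alpha>" using pos[of n] \<beta> elim by (auto simp: divide_less_eq)
      from Q_near_axis[OF f elim(1) this] show ?case using pos[of n] by (simp add: algebra_simps)
    qed
  qed
qed

text \<open>The reflection symmetry is read off from the Poisson kernel and need not be proved for
  Brownian motion.\<close>

lemma Q_dagger:
  assumes f: "f \<in> Cl" and "0 \<le> a" "0 \<le> b"
  shows "(LINT y:E|Q (a, b). f y) = (LINT y:E|Q (b, a). dagger f y)"
proof (cases "(a, b) \<in> E")
  case True
  then show ?thesis using Q_boundary[OF True f] Q_boundary[OF _ dagger_Cl[OF f], of "(b, a)"] by (simp add: E_swap)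
next
  case False
  then have o: "(a, b) \<in> open_quadrant" "(b, a) \<in> open_quadrant" using assms by (auto simp: E_iff open_quadrant_def)
  show ?thesis unfolding Q_poisson[OF o(1) f] Q_poisson[OF o(2) dagger_Cl[OF f]] by (simp add: poisson_def add.commute)
qed

text \<open>Scaling moves the starting point back to \<open>(\<alpha>, \<beta>)\<close> and turns
  the integrand into difference quotients of \<open>f\<close> at 0. These converge to linear
  functions on the axes, and the first moments \<alpha> and \<beta> of the two kernels are the
  coefficients.\<close>

lemma Q_derivative_origin:
  assumes f: "f \<in> Cl2" and \<alpha>: "0 \<le> \<alpha>" and \<beta>: "0 \<le> \<beta>"
  shows "((\<lambda>e. (1 / e) *\<^sub>R ((LINT y:E|Q (e * \<alpha>, e * \<beta>). f y) - f (0, 0))) \<longlongrightarrow>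
    \<alpha> *\<^sub>R pd1 f (0, 0) + \<beta> *\<^sub>R pd2 f (0, 0)) (at_right 0)"
proof (rule tendsto_at_right_sequentially_iff)
  fix X :: "nat \<Rightarrow> real" assume X: "\<And>n. 0 < X n" "X \<longlonglongrightarrow> 0"
  have Xr: "filterlim (\<lambda>n. X n * u) (at_right 0) sequentially" if "0 < u" for u
  proof (rule tendsto_imp_filterlim_at_right)
    show "(\<lambda>n. X n * u) \<longlonglongrightarrow> 0" using tendsto_mult_right[OF X(2), of u] by simp
    show "eventually (\<lambda>n. 0 < X n * u) sequentially" using X(1) that by (intro always_eventually allI mult_pos_pos)
  qed
  have ray: "(\<lambda>n. (1 / X n) *\<^sub>R (g (X n * u) - g 0)) \<longlonglongrightarrow> u *\<^sub>R d"
    if g: "((\<lambda>r. (1 / r) *\<^sub>R (g r - g 0)) \<longlongrightarrow> d) (at_right 0)" and u: "0 \<le> u" for u d and g :: "real \<Rightarrow> complex"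
  proof (cases "u = 0")
    case False
    then have u: "0 < u" using u by simp
    from filterlim_compose[OF g Xr[OF u]]
    have "(\<lambda>n. u *\<^sub>R ((1 / (X n * u)) *\<^sub>R (g (X n * u) - g 0))) \<longlonglongrightarrow> u *\<^sub>R d"
      by (intro tendsto_scaleR tendsto_const)
    then show ?thesis using u by simp
  qed simp
  note r1 = ray[OF Cl2_right_derivative(1)[OF f]] and r2 = ray[OF Cl2_right_derivative(2)[OF f]]
  show "(\<lambda>n. (1 / X n) *\<^sub>R ((LINT y:E|Q (X n * \<alpha>, X n * \<beta>). f y) - f (0, 0))) \<longlonglongrightarrow>
      \<alpha> *\<^sub>R pd1 f (0, 0) + \<beta> *\<^sub>R pd2 f (0, 0)"
  \<comment> \<open>With a vanishing coordinate the starting points stay in \<open>E\<close>, where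
    the exit law is a point mass and has no Poisson density.\<close>
  proof (cases "\<alpha> = 0 \<or> \<beta> = 0")
    case True
    have "(X n * \<alpha>, X n * \<beta>) \<in> E" for n using True \<alpha> \<beta> X(1)[of n] by (auto simp: E_iff)
    then have q: "(LINT y:E|Q (X n * \<alpha>, X n * \<beta>). f y) = f (X n * \<alpha>, X n * \<beta>)" for n
      using Q_boundary[OF _ Cl2_Cl[OF f]] by blast
    show ?thesis unfolding q using True r1[OF \<alpha>] r2[OF \<beta>] by auto
  next
    case False
    then have p: "0 < \<alpha>" "0 < \<beta>" using \<alpha> \<beta> by auto
    obtain s1 s2 C where A: "axis_C2 (\<lambda>u. f (u, 0)) (\<lambda>u. pd1 f (u, 0)) s1 C" "axis_C2 (\<lambda>v. f (0, v)) (\<lambda>v. pd2 f (0, v)) s2 C"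
      using Cl2_axis_C2[OF f] .
    note c = axis_continuous[OF Cl2_continuous[OF f]]
    have half: "(\<lambda>n. LINT u:{0<..}|lborel. kern a b u *\<^sub>R ((1 / X n) *\<^sub>R (g (X n * u) - g 0))) \<longlonglongrightarrow> a *\<^sub>R d 0"
      "set_integrable lborel {0<..} (\<lambda>u. kern a b u *\<^sub>R ((1 / X n) *\<^sub>R (g (X n * u) - g 0)))"
      if ab: "0 < a" "0 < b" and A: "axis_C2 g d s C" and g: "continuous_on {0..} g" for a b g d s n
    proof -
      obtain M where M: "0 \<le> M" "\<And>u. 0 \<le> u \<Longrightarrow> norm (d u) \<le> M" "\<And>u v. 0 \<le> u \<Longrightarrow> 0 \<le> v \<Longrightarrow> norm (g u - g v) \<le> M * \<bar>u - v\<bar>"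
        using axis_C2_lipschitz[OF A g] by blast
      have b: "norm ((1 / X n) *\<^sub>R (g (X n * u) - g 0)) \<le> M * u" if "0 \<le> u" for u n
      proof -
        have "norm (g (X n * u) - g 0) \<le> M * (X n * u)" using M(3)[of "X n * u" 0] X(1)[of n] that by simp
        then show ?thesis using X(1)[of n] by (simp add: divide_le_eq mult_ac)
      qed
      have gc: "continuous_on {0..} (\<lambda>u. (1 / X n) *\<^sub>R (g (X n * u) - g 0))" for n
        using X(1)[of n] by (intro continuous_intros continuous_on_compose2[OF g]) auto
      have km: "kern a b \<in> borel_measurable borel" unfolding kern_def by measurable
      have meas: "(\<lambda>u. indicator {0<..} u *\<^sub>R kern a b u *\<^sub>R ((1 / X n) *\<^sub>R (g (X n * u) - g 0))) \<in> borel_measurable lborel" for n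
        by (rule half_line_measurable[OF gc km])
      have "M * u \<le> M * (1 + u)" for u using M(1) by (simp add: distrib_left)
      then show "set_integrable lborel {0<..} (\<lambda>u. kern a b u *\<^sub>R ((1 / X n) *\<^sub>R (g (X n * u) - g 0)))"
        by (intro kern_scaleR_integrable[OF ab gc, of _ M] order_trans[OF b])
      have lim: "(\<lambda>n. indicator {0<..} u *\<^sub>R kern a b u *\<^sub>R ((1 / X n) *\<^sub>R (g (X n * u) - g 0))) \<longlonglongrightarrow>
          indicator {0<..} u *\<^sub>R kern a b u *\<^sub>R (u *\<^sub>R d 0)" for u
      proof (cases "0 < u")
        case True
        show ?thesis
          by (intro tendsto_scaleR[OF tendsto_const] ray[OF axis_C2_right_derivative[OF A g] less_imp_le[OF True]])
      qed simp
      have "(\<lambda>n. LINT u:{0<..}|lborel. kern a b u *\<^sub>R ((1 / X n) *\<^sub>R (g (X n * u) - g 0))) \<longlonglongrightarrow>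
          (LINT u:{0<..}|lborel. kern a b u *\<^sub>R (u *\<^sub>R d 0))"
        unfolding set_lebesgue_integral_def
      proof (rule integral_dominated_convergence[OF borel_measurable_LIMSEQ_metric[OF meas lim] meas])
        show "integrable lborel (\<lambda>u. M * (indicator {0<..} u *\<^sub>R (kern a b u * u)))"
          using kern_facts(2)[OF ab] by (intro integrable_mult_right) (simp add: set_integrable_def)
        show "AE u in lborel. (\<lambda>n. indicator {0<..} u *\<^sub>R kern a b u *\<^sub>R ((1 / X n) *\<^sub>R (g (X n * u) - g 0))) \<longlonglongrightarrow>
          indicator {0<..} u *\<^sub>R kern a b u *\<^sub>R (u *\<^sub>R d 0)" using lim by simp
        show "AE u in lborel. norm (indicator {0<..} u *\<^sub>R kern a b u *\<^sub>R ((1 / X n) *\<^sub>R (g (X n * u) - g 0))) \<le>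
          M * (indicator {0<..} u *\<^sub>R (kern a b u * u))" for n
        proof (rule AE_I2)
          fix u :: real
          show "norm (indicator {0<..} u *\<^sub>R kern a b u *\<^sub>R ((1 / X n) *\<^sub>R (g (X n * u) - g 0))) \<le>
            M * (indicator {0<..} u *\<^sub>R (kern a b u * u))"
          proof (cases "0 < u")
            case True
            have k: "0 \<le> kern a b u" using ab True by (intro kern_nonneg) auto
            have "norm (kern a b u *\<^sub>R ((1 / X n) *\<^sub>R (g (X n * u) - g 0))) = kern a b u * norm ((1 / X n) *\<^sub>R (g (X n * u) - g 0))"
              by (simp only: norm_scaleR[of "kern a b u"] abs_of_nonneg[OF k])
            also have "\<dots> \<le> kern a b u * (M * u)" using True by (intro mult_left_mono b k) auto
            finally show ?thesis using True by (simp add: mult_ac)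
          qed simp
        qed
      qed
      moreover have "(LINT u:{0<..}|lborel. kern a b u *\<^sub>R (u *\<^sub>R d 0)) = a *\<^sub>R d 0"
        using set_integral_combination[of lborel "{0<..}" "\<lambda>_. 0" "\<lambda>u. kern a b u * u" "\<lambda>u. kern a b u * u" 0 "d 0" 0] kern_facts(2,4)[OF ab]
        by (simp add: set_integrable_def)
      ultimately show "(\<lambda>n. LINT u:{0<..}|lborel. kern a b u *\<^sub>R ((1 / X n) *\<^sub>R (g (X n * u) - g 0))) \<longlonglongrightarrow> a *\<^sub>R d 0"
        by simp
    qed
    note h1 = half[OF p A(1) c(1)] and h2 = half[OF p(2,1) A(2) c(2)]
    have "(LINT y:E|Q (X n * \<alpha>, X n * \<beta>). f y) - f (0, 0) = X n *\<^sub>R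
        ((LINT u:{0<..}|lborel. kern \<alpha> \<beta> u *\<^sub>R ((1 / X n) *\<^sub>R (f (X n * u, 0) - f (0, 0)))) +
         (LINT u:{0<..}|lborel. kern \<beta> \<alpha> u *\<^sub>R ((1 / X n) *\<^sub>R (f (0, X n * u) - f (0, 0)))))" for n
    proof -
      have xo: "(X n * \<alpha>, X n * \<beta>) \<in> open_quadrant" using X(1)[of n] p by (auto simp: open_quadrant_def)
      \<comment> \<open>The zero summand only brings the integrand into the shape of
        \<open>set_integral_combination\<close>.\<close>
      have s: "kern a b u *\<^sub>R y = X n *\<^sub>R (kern a b u *\<^sub>R ((1 / X n) *\<^sub>R (y - f (0, 0)))) + (kern a b u *\<^sub>R f (0, 0) + kern a b u *\<^sub>R 0)" for a b u y
        using X(1)[of n] by (simp add: scaleR_diff_right)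
      have "(LINT y:E|Q (X n * \<alpha>, X n * \<beta>). f y) = poisson f (X n *\<^sub>R (\<alpha>, \<beta>))"
        using Q_poisson[OF xo Cl2_Cl[OF f]] by simp
      also have "\<dots> = poisson (\<lambda>y. f (X n *\<^sub>R y)) (\<alpha>, \<beta>)" by (rule poisson_scale[OF X(1)])
      also have "\<dots> = (LINT u:{0<..}|lborel. kern \<alpha> \<beta> u *\<^sub>R f (X n * u, 0)) + (LINT u:{0<..}|lborel. kern \<beta> \<alpha> u *\<^sub>R f (0, X n * u))"
        by (simp add: poisson_def)
      also have "(LINT u:{0<..}|lborel. kern \<alpha> \<beta> u *\<^sub>R f (X n * u, 0)) = X n *\<^sub>R (LINT u:{0<..}|lborel. kern \<alpha> \<beta> u *\<^sub>R ((1 / X n) *\<^sub>R (f (X n * u, 0) - f (0, 0))))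
          + ((LINT u:{0<..}|lborel. kern \<alpha> \<beta> u) *\<^sub>R f (0, 0) + (LINT u:{0<..}|lborel. kern \<alpha> \<beta> u) *\<^sub>R 0)"
        by (subst s) (rule set_integral_combination[OF h1(2) kern_facts(1)[OF p] kern_facts(1)[OF p]])
      also have "(LINT u:{0<..}|lborel. kern \<beta> \<alpha> u *\<^sub>R f (0, X n * u)) = X n *\<^sub>R (LINT u:{0<..}|lborel. kern \<beta> \<alpha> u *\<^sub>R ((1 / X n) *\<^sub>R (f (0, X n * u) - f (0, 0))))
          + ((LINT u:{0<..}|lborel. kern \<beta> \<alpha> u) *\<^sub>R f (0, 0) + (LINT u:{0<..}|lborel. kern \<beta> \<alpha> u) *\<^sub>R 0)"
        by (subst s) (rule set_integral_combination[OF h2(2) kern_facts(1)[OF p(2,1)] kern_facts(1)[OF p(2,1)]])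
      finally have "(LINT y:E|Q (X n * \<alpha>, X n * \<beta>). f y) =
        X n *\<^sub>R ((LINT u:{0<..}|lborel. kern \<alpha> \<beta> u *\<^sub>R ((1 / X n) *\<^sub>R (f (X n * u, 0) - f (0, 0)))) +
         (LINT u:{0<..}|lborel. kern \<beta> \<alpha> u *\<^sub>R ((1 / X n) *\<^sub>R (f (0, X n * u) - f (0, 0))))) +
         ((LINT u:{0<..}|lborel. kern \<alpha> \<beta> u) + (LINT u:{0<..}|lborel. kern \<beta> \<alpha> u)) *\<^sub>R f (0, 0)"
        by (simp only: scaleR_add_right scaleR_add_left scaleR_zero_right add_0_right add_0_left add_ac)
      then show ?thesis unfolding kern_facts(3)[OF p] by simp
    qed
    then have "(\<lambda>n. (1 / X n) *\<^sub>R ((LINT y:E|Q (X n * \<alpha>, X n * \<beta>). f y) - f (0, 0))) =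
       (\<lambda>n. (LINT u:{0<..}|lborel. kern \<alpha> \<beta> u *\<^sub>R ((1 / X n) *\<^sub>R (f (X n * u, 0) - f (0, 0)))) +
         (LINT u:{0<..}|lborel. kern \<beta> \<alpha> u *\<^sub>R ((1 / X n) *\<^sub>R (f (0, X n * u) - f (0, 0)))))"
      using X(1) by (simp only: scaleR_scaleR) (simp add: less_imp_neq[symmetric])
    then show ?thesis using tendsto_add[OF h1(1) h2(1)] by (simp only:)
  qed
qed

lemma Q_derivative:
  assumes f: "f \<in> Cl2" and x: "x \<in> E" and \<theta>: "\<theta> \<in> quadrant"
  shows "((\<lambda>e. (1 / e) *\<^sub>R ((LINT y:E|Q (x + e *\<^sub>R (\<theta> - x)). f y) - f x)) \<longlongrightarrow>
    (fst \<theta> - fst x) *\<^sub>R G1 f x + (snd \<theta> - snd x) *\<^sub>R G2 f x) (at_right 0)"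
proof -
  obtain p q where \<theta>pq: "\<theta> = (p, q)" "0 \<le> p" "0 \<le> q" using \<theta> by (auto simp: quadrant_def)
  obtain a b where xab: "x = (a, b)" by (cases x)
  have ab: "0 \<le> a" "0 \<le> b" "a = 0 \<or> b = 0" using x by (simp_all add: xab E_iff)
  then consider "a = 0" "b = 0" | "0 < a" "b = 0" | "a = 0" "0 < b" by linarith
  then show ?thesis
  proof cases
    case 1
    then show ?thesis using Q_derivative_origin[OF f \<theta>pq(2,3)] by (simp add: \<theta>pq xab G_axis)
  next
    case 2
    then show ?thesis using Q_derivative_axis1[OF f _ \<theta>pq(3), of a "p - a"] by (simp add: \<theta>pq xab G_axis)
  next
    case 3
    have lim: "((\<lambda>e. (1 / e) *\<^sub>R ((LINT y:E|Q (b + e * (q - b), e * p). dagger f y) - dagger f (b, 0))) \<longlongrightarrow>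
        (q - b) *\<^sub>R pd1 (dagger f) (b, 0) + p *\<^sub>R G2 (dagger f) (b, 0)) (at_right 0)"
      by (rule Q_derivative_axis1[OF dagger_Cl2[OF f] 3(2) \<theta>pq(2)])
    have "((\<lambda>e. (1 / e) *\<^sub>R ((LINT y:E|Q (e * p, b + e * (q - b)). f y) - f (0, b))) \<longlongrightarrow>
        (q - b) *\<^sub>R pd1 (dagger f) (b, 0) + p *\<^sub>R G2 (dagger f) (b, 0)) (at_right 0)"
    proof (rule Lim_transform_eventually[OF lim])
      have "((\<lambda>e. b + e * (q - b)) \<longlongrightarrow> b + 0 * (q - b)) (at_right 0)" by (intro tendsto_intros)
      then have "eventually (\<lambda>e. 0 < b + e * (q - b)) (at_right 0)" using 3 by (intro order_tendstoD(1)) auto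
      moreover have "eventually (\<lambda>e::real. 0 < e) (at_right 0)" by (simp add: eventually_at_right_less)
      ultimately show "eventually (\<lambda>e. (1 / e) *\<^sub>R ((LINT y:E|Q (b + e * (q - b), e * p). dagger f y) - dagger f (b, 0)) =
          (1 / e) *\<^sub>R ((LINT y:E|Q (e * p, b + e * (q - b)). f y) - f (0, b))) (at_right 0)"
      proof eventually_elim
        case (elim e)
        have "0 \<le> e * p" "0 \<le> b + e * (q - b)" using elim \<theta>pq by auto
        from Q_dagger[OF Cl2_Cl[OF f] this] show ?case by simp
      qed
    qed
    then show ?thesis using 3 by (simp add: \<theta>pq xab G_axis pd_dagger add.commute)
  qed
qed

text \<open>A change of parameter on the segment towards \<theta>. It serves both limits of the
  theorem: speed \<open>\<epsilon> * c\<close> on the one hand, \<open>1 - exp (- c * t)\<close> on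
  the other.\<close>

lemma Q_derivative_path:
  assumes f: "f \<in> Cl2" and x: "x \<in> E" and \<theta>: "\<theta> \<in> quadrant"
    and p: "eventually (\<lambda>t. 0 \<le> p t) (at_right 0)" "(p \<longlongrightarrow> 0) (at_right 0)" "((\<lambda>t. p t / t) \<longlongrightarrow> c) (at_right 0)"
  shows "((\<lambda>t. (1 / t) *\<^sub>R ((LINT y:E|Q (x + p t *\<^sub>R (\<theta> - x)). f y) - f x)) \<longlongrightarrow> G c \<theta> f x) (at_right 0)"
proof -
  define D where "D = (fst \<theta> - fst x) *\<^sub>R G1 f x + (snd \<theta> - snd x) *\<^sub>R G2 f x"
  \<comment> \<open>The quotient is extended by its limit at 0, because \<open>p t\<close> may
    vanish, as it does for \<open>c = 0\<close>. At such a \<open>t\<close> the product with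
    \<open>p t / t\<close> is still correct, the exit law at \<open>x\<close> being a point
    mass.\<close>
  define L where "L = (\<lambda>e. if e = 0 then D else (1 / e) *\<^sub>R ((LINT y:E|Q (x + e *\<^sub>R (\<theta> - x)). f y) - f x))"
  have "(L \<longlongrightarrow> D) (at_right 0)"
    by (rule Lim_transform_eventually[OF Q_derivative[OF f x \<theta>, folded D_def]])
      (auto simp: eventually_at_right_field L_def intro!: exI[of _ 1])
  then have Lc: "continuous (at 0 within {0..}) L"
    by (simp add: continuous_within at_within_Ici_at_right L_def)
  have "((\<lambda>t. L (p t)) \<longlongrightarrow> L 0) (at_right 0)"
    by (rule continuous_within_tendsto_compose[OF Lc _ p(2)]) (use p(1) in \<open>auto elim: eventually_mono\<close>)
  then have "((\<lambda>t. (p t / t) *\<^sub>R L (p t)) \<longlongrightarrow> c *\<^sub>R D) (at_right 0)"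
    by (intro tendsto_scaleR p(3)) (simp add: L_def)
  moreover have "(p t / t) *\<^sub>R L (p t) = (1 / t) *\<^sub>R ((LINT y:E|Q (x + p t *\<^sub>R (\<theta> - x)). f y) - f x)" for t
    using Q_boundary[OF x Cl2_Cl[OF f]] by (simp add: L_def)
  moreover have "c *\<^sub>R D = G c \<theta> f x" using x by (simp add: G_def D_def scaleR_add_right)
  ultimately show ?thesis by simp
qed

end

section \<open>The semigroup\<close>

lemma tendsto_zero_approx:
  fixes f :: "'a \<Rightarrow> complex"
  assumes "\<And>e. 0 < e \<Longrightarrow> \<exists>g. (g \<longlongrightarrow> 0) F \<and> eventually (\<lambda>x. norm (f x - g x) \<le> e) F"
  shows "(f \<longlongrightarrow> 0) F"
proof (rule tendstoI)
  fix e :: real assume "0 < e"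
  then obtain g where g: "(g \<longlongrightarrow> 0) F" "eventually (\<lambda>x. norm (f x - g x) \<le> e / 2) F"
    using assms[of "e / 2"] by auto
  have "eventually (\<lambda>x. dist (g x) 0 < e / 2) F" using g(1) by (rule tendstoD) (use \<open>0 < e\<close> in simp)
  with g(2) show "eventually (\<lambda>x. dist (f x) 0 < e) F"
  proof eventually_elim
    case (elim x)
    then show ?case using norm_triangle_ineq[of "f x - g x" "g x"] by simp
  qed
qed

lemma axis_in_E [simp]: "0 \<le> u \<Longrightarrow> (u, 0) \<in> E" "0 \<le> v \<Longrightarrow> (0, v) \<in> E"
  by (simp_all add: E_iff)

lemma hexp_tendsto_zero:
  fixes x :: "real \<Rightarrow> real \<times> real"
  assumes z: "z \<in> Z" "z \<noteq> 0" and x: "\<And>u. 0 \<le> u \<Longrightarrow> x u \<in> quadrant"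
    and "filterlim (\<lambda>u. fst (x u) + snd (x u)) at_top at_top"
  shows "((\<lambda>u. hexp z (x u)) \<longlongrightarrow> 0) at_top"
proof (rule tendsto_norm_zero_cancel, rule tendsto_sandwich[OF _ _ tendsto_const])
  define m where "m = min (Re z) (- Im z)"
  have m: "0 < m" using z by (auto simp: m_def Z_def)
  show "eventually (\<lambda>u. norm (hexp z (x u)) \<le> exp (- (m * (fst (x u) + snd (x u))))) at_top"
    using eventually_ge_at_top[of 0]
  proof eventually_elim
    case (elim u)
    have "m * fst (x u) \<le> Re z * fst (x u)" "m * snd (x u) \<le> - Im z * snd (x u)"
      using x[OF elim] by (intro mult_right_mono; auto simp: m_def quadrant_def)+
    then show ?case by (simp add: norm_hexp algebra_simps)
  qed
  show "((\<lambda>u. exp (- (m * (fst (x u) + snd (x u))))) \<longlongrightarrow> 0) at_top"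
    by (rule filterlim_compose[OF exp_at_bot filterlim_compose[OF filterlim_uminus_at_bot_at_top
        filterlim_tendsto_pos_mult_at_top[OF tendsto_const m assms(4)]]])
qed simp

text \<open>Curves in the whole quadrant and not only the axes, since the flow towards \<theta>
  carries the axes into the interior.\<close>

definition escaping :: "(real \<Rightarrow> real \<times> real) \<Rightarrow> bool"
  where "escaping x \<longleftrightarrow> (\<forall>u\<ge>0. x u \<in> quadrant) \<and> filterlim (\<lambda>u. fst (x u) + snd (x u)) at_top at_top"

lemma core_limit:
  assumes "h \<in> core"
  shows "\<exists>L. \<forall>x. escaping x \<longrightarrow>
    ((\<lambda>u. h (x u)) \<longlongrightarrow> L) at_top"
  using assms
proof induction
  case (exp z c)
  show ?case
  proof (cases "z = 0")
    case True
    then show ?thesis by (intro exI[of _ c]) (simp add: hexp_def)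
  next
    case False
    have "((\<lambda>u. c * hexp z (x u)) \<longlongrightarrow> c * 0) at_top"
      if "escaping x" for x
      using that unfolding escaping_def by (intro tendsto_intros hexp_tendsto_zero[OF exp False]) auto
    then show ?thesis by (intro exI[of _ 0]) simp
  qed
next
  case (cnj z c)
  show ?case
  proof (cases "z = 0")
    case True
    then show ?thesis by (intro exI[of _ c]) (simp add: hexp_def)
  next
    case False
    have "((\<lambda>u. c * cnj (hexp z (x u))) \<longlongrightarrow> c * cnj 0) at_top"
      if "escaping x" for x
      using that unfolding escaping_def by (intro tendsto_intros hexp_tendsto_zero[OF cnj False]) auto
    then show ?thesis by (intro exI[of _ 0]) simp
  qed
next
  case (add f g)
  from add.IH obtain K where K: "\<forall>x. escaping x \<longrightarrow> ((\<lambda>u. f (x u)) \<longlongrightarrow> K) at_top" by (elim exE)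
  from add.IH obtain L where L: "\<forall>x. escaping x \<longrightarrow> ((\<lambda>u. g (x u)) \<longlongrightarrow> L) at_top" by (elim exE)
  show ?case by (intro exI[of _ "K + L"] allI impI tendsto_add K[rule_format] L[rule_format])
qed

lemma escaping_axis: "escaping (\<lambda>u. (u, 0))" "escaping (\<lambda>v. (0, v))"
  by (simp_all add: escaping_def quadrant_def filterlim_ident)

lemma core_axis_limit:
  assumes "h \<in> core"
  obtains L where "((\<lambda>u. h (u, 0)) \<longlongrightarrow> L) at_top" "((\<lambda>v. h (0, v)) \<longlongrightarrow> L) at_top"
  using core_limit[OF assms] escaping_axis by auto

lemma uniform_limit_inverse_Suc:
  assumes "\<And>n x. x \<in> E \<Longrightarrow> norm (f x - F n x) \<le> inverse (real (Suc n))"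
  shows "uniform_limit E F f sequentially"
proof (rule uniform_limitI)
  fix e :: real assume "0 < e"
  then have "eventually (\<lambda>n. inverse (real (Suc n)) < e) sequentially"
    by (rule order_tendstoD(2)[OF LIMSEQ_inverse_real_of_nat])
  then show "eventually (\<lambda>n. \<forall>x\<in>E. dist (F n x) (f x) < e) sequentially"
  proof eventually_elim
    case (elim n)
    then show ?case using assms[of _ n] by (metis dist_commute dist_norm le_less_trans)
  qed
qed

text \<open>An approximant in \<open>core\<close> has the same limit along both axes. These limits
  form a Cauchy sequence by uniform convergence, and its limit is that of \<open>f\<close> along
  either axis.\<close>

lemma ucl_core_Cl:
  assumes ext: "f \<in> extensional E" and f: "f \<in> ucl core"
  shows "f \<in> Cl"
proof -
  have "\<exists>h\<in>core. \<forall>x\<in>E. norm (f x - h x) \<le> inverse (real (Suc n))" for n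
    using f by (auto simp: ucl_def)
  then obtain h where h: "\<And>n. h n \<in> core" "\<And>n x. x \<in> E \<Longrightarrow> norm (f x - h n x) \<le> inverse (real (Suc n))"
    by metis
  have "\<exists>L. ((\<lambda>u. h n (u, 0)) \<longlongrightarrow> L) at_top \<and> ((\<lambda>v. h n (0, v)) \<longlongrightarrow> L) at_top" for n
    using core_axis_limit[OF h(1)] by metis
  then obtain l where l: "\<And>n. ((\<lambda>u. h n (u, 0)) \<longlongrightarrow> l n) at_top" "\<And>n. ((\<lambda>v. h n (0, v)) \<longlongrightarrow> l n) at_top"
    by metis
  have dl: "norm (l m - l n) \<le> inverse (real (Suc m)) + inverse (real (Suc n))" for m n
  proof (rule tendsto_upperbound)
    show "((\<lambda>u. norm (h m (u, 0) - h n (u, 0))) \<longlongrightarrow> norm (l m - l n)) at_top" by (intro tendsto_intros l)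
    show "eventually (\<lambda>u. norm (h m (u, 0) - h n (u, 0)) \<le> inverse (real (Suc m)) + inverse (real (Suc n))) at_top"
      using eventually_ge_at_top[of 0]
    proof eventually_elim
      case (elim u)
      have "norm (h m (u, 0) - h n (u, 0)) \<le> norm (f (u, 0) - h m (u, 0)) + norm (f (u, 0) - h n (u, 0))"
        using norm_triangle_ineq4[of "f (u, 0) - h n (u, 0)" "f (u, 0) - h m (u, 0)"] by simp
      then show ?case using h(2)[of "(u, 0)" m] h(2)[of "(u, 0)" n] elim by simp
    qed
  qed simp
  have "Cauchy l"
  proof (rule metric_CauchyI)
    fix e :: real assume "0 < e"
    then obtain N where N: "inverse (real (Suc N)) < e / 2" using reals_Archimedean[of "e / 2"] by auto
    have "dist (l m) (l n) < e" if "N \<le> m" "N \<le> n" for m n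
    proof -
      have "inverse (real (Suc m)) \<le> inverse (real (Suc N))" "inverse (real (Suc n)) \<le> inverse (real (Suc N))"
        using that by (auto intro!: le_imp_inverse_le)
      then show ?thesis using dl[of m n] N unfolding dist_norm by linarith
    qed
    then show "\<exists>M. \<forall>m\<ge>M. \<forall>n\<ge>M. dist (l m) (l n) < e" by blast
  qed
  then obtain L where L: "l \<longlonglongrightarrow> L" using Cauchy_convergent convergent_def by blast
  have small: "\<exists>n. inverse (real (Suc n)) \<le> e / 2 \<and> norm (l n - L) \<le> e / 2" if "0 < e" for e :: real
  proof -
    have "eventually (\<lambda>n. inverse (real (Suc n)) < e / 2) sequentially"
      by (rule order_tendstoD(2)[OF LIMSEQ_inverse_real_of_nat]) (use that in simp)
    moreover have "eventually (\<lambda>n. dist (l n) L < e / 2) sequentially"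
      by (rule tendstoD[OF L]) (use that in simp)
    ultimately have "eventually (\<lambda>n. inverse (real (Suc n)) \<le> e / 2 \<and> norm (l n - L) \<le> e / 2) sequentially"
      by eventually_elim (simp add: dist_norm)
    then show ?thesis using eventually_happens trivial_limit_sequentially by blast
  qed
  have ax: "((\<lambda>u. f (x u)) \<longlongrightarrow> L) at_top"
    if x: "\<And>u. 0 \<le> u \<Longrightarrow> x u \<in> E" and lx: "\<And>n. ((\<lambda>u. h n (x u)) \<longlongrightarrow> l n) at_top" for x :: "real \<Rightarrow> real \<times> real"
  proof -
    have "((\<lambda>u. f (x u) - L) \<longlongrightarrow> 0) at_top"
    proof (rule tendsto_zero_approx)
      fix e :: real assume "0 < e"
      then obtain n where n: "inverse (real (Suc n)) \<le> e / 2" "norm (l n - L) \<le> e / 2" using small by blast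
      have "eventually (\<lambda>u. norm (f (x u) - L - (h n (x u) - l n)) \<le> e) at_top"
        using eventually_ge_at_top[of 0]
      proof eventually_elim
        case (elim u)
        then show ?case
          using n h(2)[OF x[OF elim], of n] norm_triangle_ineq[of "f (x u) - h n (x u)" "l n - L"] by (simp add: algebra_simps)
      qed
      moreover have "((\<lambda>u. h n (x u) - l n) \<longlongrightarrow> 0) at_top" using tendsto_diff[OF lx tendsto_const, of n "l n"] by simp
      ultimately show "\<exists>g. (g \<longlongrightarrow> 0) at_top \<and> eventually (\<lambda>u. norm (f (x u) - L - g u) \<le> e) at_top" by blast
    qed
    then show ?thesis by (simp add: LIM_zero_iff)
  qed
  have "continuous_on E f"
  proof (rule uniform_limit_theorem)
    show "eventually (\<lambda>n. continuous_on E (h n)) sequentially" by (simp add: core_continuous h(1))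
    show "uniform_limit E h f sequentially" by (rule uniform_limit_inverse_Suc[OF h(2)])
  qed simp
  then show ?thesis using ext ax[of "\<lambda>u. (u, 0)"] ax[of "\<lambda>v. (0, v)"] l by (auto simp: Cl_def)
qed

text \<open>Closure of \<open>Cl\<close> under combinations, the semigroup and uniform limits is
  reduced to properties of \<open>core\<close> by this description.\<close>

lemma Cl_iff: "f \<in> Cl \<longleftrightarrow> f \<in> extensional E \<and> f \<in> ucl core"
  using ucl_core_Cl core_dense by (auto simp: Cl_def)

lemma ucl_cong: "f \<in> ucl V \<Longrightarrow> (\<And>x. x \<in> E \<Longrightarrow> f x = g x) \<Longrightarrow> g \<in> ucl V"
  by (simp add: ucl_def)

lemma ucl_scale:
  assumes V: "\<And>f. f \<in> V \<Longrightarrow> (\<lambda>x. c * f x) \<in> V" and f: "f \<in> ucl V"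
  shows "(\<lambda>x. c * f x) \<in> ucl V"
proof (rule uclI)
  fix e :: real assume "0 < e"
  then obtain g where g: "g \<in> V" "\<And>x. x \<in> E \<Longrightarrow> norm (f x - g x) \<le> e / (norm c + 1)"
    using uclE[OF f, of "e / (norm c + 1)"] by (auto simp: add_nonneg_pos)
  have "norm (c * f x - c * g x) \<le> e" if "x \<in> E" for x
  proof -
    have "norm (c * f x - c * g x) \<le> norm c * (e / (norm c + 1))"
      using g(2)[OF that] by (simp add: right_diff_distrib[symmetric] norm_mult mult_left_mono del: times_divide_eq_right)
    also have "\<dots> \<le> (norm c + 1) * (e / (norm c + 1))" using \<open>0 < e\<close> by (intro mult_right_mono) auto
    also have "\<dots> = e" by (simp add: add_nonneg_eq_0_iff)
    finally show ?thesis .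
  qed
  then show "\<exists>g\<in>V. \<forall>x\<in>E. norm (c * f x - g x) \<le> e" by (rule bexI[OF ballI V[OF g(1)]])
qed

lemma Cl_combination:
  assumes "f \<in> Cl" "g \<in> Cl"
  shows "(\<lambda>x\<in>E. a * f x + b * g x) \<in> Cl"
proof -
  have "(\<lambda>x. a * f x + b * g x) \<in> ucl core"
    using assms by (intro ucl_core_add ucl_scale core_scale) (auto simp: Cl_iff)
  then have "(\<lambda>x\<in>E. a * f x + b * g x) \<in> ucl core" by (rule ucl_cong) simp
  then show ?thesis by (simp add: Cl_iff)
qed

lemma Cl_diff: "f \<in> Cl \<Longrightarrow> g \<in> Cl \<Longrightarrow> (\<lambda>x\<in>E. f x - g x) \<in> Cl"
  using Cl_combination[of f g 1 "- 1"] by simp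

lemma core_Cl: "h \<in> core \<Longrightarrow> restrict h E \<in> Cl"
  using ucl_subset[of core] by (auto simp: Cl_iff intro: ucl_cong[of h])

lemma Cl_eqI: "f \<in> Cl \<Longrightarrow> g \<in> Cl \<Longrightarrow> (\<And>x. x \<in> E \<Longrightarrow> f x = g x) \<Longrightarrow> f = g"
  by (rule extensionalityI[of _ E]) (auto simp: Cl_iff)

lemma Cl_uniform_limit:
  assumes ext: "f \<in> extensional E" and F: "\<And>n. F n \<in> Cl" and l: "uniform_limit E F f L" and L: "L \<noteq> bot"
  shows "f \<in> Cl"
proof -
  have "f \<in> ucl core"
  proof (rule ucl_ucl)
    fix e :: real assume "0 < e"
    then have "eventually (\<lambda>n. \<forall>x\<in>E. dist (F n x) (f x) < e) L" by (rule uniform_limitD[OF l])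
    then obtain n where "\<forall>x\<in>E. dist (F n x) (f x) < e" using eventually_happens L by blast
    then have "norm (f x - F n x) \<le> e" if "x \<in> E" for x using that by (force simp: dist_norm norm_minus_commute)
    then show "\<exists>g\<in>ucl core. \<forall>x\<in>E. norm (f x - g x) \<le> e" using F[of n] by (intro bexI[of _ "F n"]) (auto simp: Cl_iff)
  qed
  then show ?thesis using ext by (simp add: Cl_iff)
qed

section \<open>The semigroup and the deterministic flow\<close>

locale branching_kernel = exit_kernel Q for Q +
  fixes c :: real and \<theta> :: "real \<times> real"
  assumes c: "0 \<le> c" and \<theta>: "\<theta> \<in> quadrant"
begin

abbreviation "T \<equiv> S Q c \<theta>"

text \<open>The solution at time \<open>t\<close> of the linear equation with velocity
  \<open>c *\<^sub>R (\<theta> - x)\<close>. It maps \<open>E\<close> into the quadrant, generally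
  not into \<open>E\<close>.\<close>

definition pos :: "real \<Rightarrow> real \<times> real \<Rightarrow> real \<times> real"
  where "pos t x = exp (- c * t) *\<^sub>R x + (1 - exp (- c * t)) *\<^sub>R \<theta>"

lemma pos_line: "pos t x = x + (1 - exp (- c * t)) *\<^sub>R (\<theta> - x)"
  by (simp add: pos_def algebra_simps)

lemma pos_quadrant: "0 \<le> t \<Longrightarrow> x \<in> quadrant \<Longrightarrow> pos t x \<in> quadrant"
  using \<theta> c by (auto simp: pos_def quadrant_def)

lemma pos_E: "0 \<le> t \<Longrightarrow> x \<in> E \<Longrightarrow> pos t x \<in> quadrant"
  using pos_quadrant E_subset_quadrant by blast

lemma pos_add: "pos t (pos s x) = pos (s + t) x"
proof -
  have "exp (- c * (s + t)) = exp (- c * t) * exp (- c * s)" by (simp add: exp_add[symmetric] algebra_simps)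
  then show ?thesis by (simp add: pos_def scaleR_add_right scaleR_diff_left algebra_simps)
qed

lemma pos_0 [simp]: "pos 0 x = x"
  by (simp add: pos_def)

lemma cx_pos: "cx (pos t x) = of_real (exp (- c * t)) * cx x + of_real (1 - exp (- c * t)) * cx \<theta>"
  by (simp add: pos_def complex_eq_iff)

lemma hexp_pos: "hexp z (pos t x) = exp (- z * (of_real (1 - exp (- c * t)) * cx \<theta>)) * hexp (of_real (exp (- c * t)) * z) x"
  by (simp add: hexp_def cx_pos exp_add[symmetric] algebra_simps)

text \<open>The flow is affine, so composing with it multiplies an exponential by a constant and
  scales its parameter by a positive number, and \<open>Z\<close> is a cone.\<close>

lemma core_pos: "h \<in> core \<Longrightarrow> (\<lambda>x. h (pos t x)) \<in> core"
proof (induction rule: core.induct)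
  case (exp z d)
  have "(\<lambda>x. d * hexp z (pos t x)) = (\<lambda>x. (d * exp (- z * (of_real (1 - exp (- c * t)) * cx \<theta>))) * hexp (of_real (exp (- c * t)) * z) x)"
    by (simp only: hexp_pos mult.assoc)
  then show ?case using core.exp[OF Z_scale[OF exp, of "exp (- c * t)"]] by simp
next
  case (cnj z d)
  have "(\<lambda>x. d * cnj (hexp z (pos t x))) =
      (\<lambda>x. (d * cnj (exp (- z * (of_real (1 - exp (- c * t)) * cx \<theta>)))) * cnj (hexp (of_real (exp (- c * t)) * z) x))"
    by (simp only: hexp_pos mult.assoc complex_cnj_mult)
  then show ?case using core.cnj[OF Z_scale[OF cnj, of "exp (- c * t)"]] by simp
next
  case (add f g)
  show ?case by (rule core.add[OF add.IH])
qed

lemma T_apply: "x \<in> E \<Longrightarrow> T t f x = (LINT y:E|Q (pos t x). f y)"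
  by (simp add: S_def trans_kernel_def pos_def)

lemma T_approx:
  assumes "0 \<le> t" "x \<in> E" "f \<in> Cl" "h \<in> core" "\<And>y. y \<in> E \<Longrightarrow> norm (f y - h y) \<le> e"
  shows "norm (T t f x - h (pos t x)) \<le> e"
  unfolding T_apply[OF assms(2)] using assms by (intro Q_Cl_approx pos_E) auto

lemma T_core:
  assumes "0 \<le> t" "x \<in> E" "h \<in> core"
  shows "T t (restrict h E) x = h (pos t x)"
  using T_approx[OF assms(1,2) core_Cl[OF assms(3)] assms(3), of 0] by simp

lemma T_Cl:
  assumes t: "0 \<le> t" and f: "f \<in> Cl"
  shows "T t f \<in> Cl"
proof -
  have "T t f \<in> ucl core"
  proof (rule uclI)
    fix e :: real assume "0 < e"
    then obtain h where h: "h \<in> core" "\<And>x. x \<in> E \<Longrightarrow> norm (f x - h x) \<le> e" using uclE[OF core_dense[OF f]] by blast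
    show "\<exists>g\<in>core. \<forall>x\<in>E. norm (T t f x - g x) \<le> e"
      by (rule bexI[OF ballI core_pos[OF h(1)]]) (rule T_approx[OF t _ f h])
  qed
  moreover have "T t f \<in> extensional E" by (simp add: S_def)
  ultimately show ?thesis by (simp add: Cl_iff)
qed

lemma T_bound:
  assumes "0 \<le> t" "x \<in> E" "f \<in> Cl" "\<And>y. y \<in> E \<Longrightarrow> norm (f y) \<le> K"
  shows "norm (T t f x) \<le> K"
  unfolding T_apply[OF assms(2)] using assms by (intro Q_norm_le pos_E) (auto simp: Cl_def)

lemma T_combination:
  assumes t: "0 \<le> t" and x: "x \<in> E" and f: "f \<in> Cl" and g: "g \<in> Cl"
  shows "T t (\<lambda>x\<in>E. a * f x + b * g x) x = a * T t f x + b * T t g x"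
proof -
  obtain K where K: "\<And>x. x \<in> E \<Longrightarrow> norm (f x) \<le> K" using Cl_bounded[OF f] by blast
  obtain L where L: "\<And>x. x \<in> E \<Longrightarrow> norm (g x) \<le> L" using Cl_bounded[OF g] by blast
  have c: "continuous_on E f" "continuous_on E g" using f g by (auto simp: Cl_def)
  have i: "set_integrable (Q (pos t x)) E f" "set_integrable (Q (pos t x)) E g"
    using Q_integrable[OF pos_E[OF t x] c(1) K] Q_integrable[OF pos_E[OF t x] c(2) L] by auto
  have "(LINT y:E|Q (pos t x). (\<lambda>x\<in>E. a * f x + b * g x) y) = (LINT y:E|Q (pos t x). a * f y + b * g y)"
    unfolding set_lebesgue_integral_def by (rule Bochner_Integration.integral_cong) (auto simp: indicator_def)
  also have "\<dots> = a * (LINT y:E|Q (pos t x). f y) + b * (LINT y:E|Q (pos t x). g y)"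
    using i by (simp add: set_integral_add)
  finally show ?thesis by (simp add: T_apply[OF x])
qed

lemma T_diff:
  assumes "0 \<le> t" "x \<in> E" "f \<in> Cl" "g \<in> Cl"
  shows "T t (\<lambda>x\<in>E. f x - g x) x = T t f x - T t g x"
  using T_combination[OF assms, of 1 "- 1"] by simp

lemma T_norm_diff:
  assumes "0 \<le> t" "x \<in> E" "f \<in> Cl" "g \<in> Cl" "\<And>y. y \<in> E \<Longrightarrow> norm (f y - g y) \<le> K"
  shows "norm (T t f x - T t g x) \<le> K"
  using T_bound[OF assms(1,2) Cl_diff[OF assms(3,4)], of K] assms(5) T_diff[OF assms(1-4)] by simp

text \<open>On approximants in \<open>core\<close> both sides are composition with the flow, whose
  group law gives equality; the contraction property controls the errors.\<close>

lemma T_add: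
  assumes s: "0 \<le> s" and t: "0 \<le> t" and f: "f \<in> Cl"
  shows "T (s + t) f = T s (T t f)"
proof (rule Cl_eqI)
  show "T (s + t) f \<in> Cl" "T s (T t f) \<in> Cl" using s t f by (auto intro!: T_Cl)
  fix x assume x: "x \<in> E"
  have "norm (T (s + t) f x - T s (T t f) x) \<le> e" if "0 < e" for e
  proof -
    obtain h where h: "h \<in> core" "\<And>x. x \<in> E \<Longrightarrow> norm (f x - h x) \<le> e / 2" using uclE[OF core_dense[OF f], of "e / 2"] \<open>0 < e\<close> by auto
    have "norm (T (s + t) f x - h (pos (s + t) x)) \<le> e / 2" using s t by (intro T_approx[OF _ x f h]) auto
    moreover have "norm (T s (T t f) x - h (pos t (pos s x))) \<le> e / 2"
      by (rule T_approx[OF s x T_Cl[OF t f] core_pos[OF h(1)]]) (rule T_approx[OF t _ f h])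
    ultimately show ?thesis
      using norm_triangle_ineq4[of "T (s + t) f x - h (pos (s + t) x)" "T s (T t f) x - h (pos (s + t) x)"] by (simp add: pos_add)
  qed
  then have "norm (T (s + t) f x - T s (T t f) x) \<le> 0" by (rule field_le_epsilon[of _ 0, simplified])
  then show "T (s + t) f x = T s (T t f) x" by simp
qed

lemma T_0: "f \<in> Cl \<Longrightarrow> T 0 f = f"
  by (rule Cl_eqI[OF T_Cl]) (simp_all add: T_apply Q_boundary)

text \<open>The flow takes far points of the axis to far points of the quadrant, where an
  approximant in \<open>core\<close> has the same limit as on the axis. The point at infinity is
  thus fixed by the process.\<close>

lemma T_infinity:
  assumes t: "0 \<le> t" and f: "f \<in> Cl"
  shows "((\<lambda>u. T t f (u, 0) - f (u, 0)) \<longlongrightarrow> 0) at_top"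
proof (rule tendsto_zero_approx)
  fix e :: real assume "0 < e"
  then obtain h where h: "h \<in> core" "\<And>x. x \<in> E \<Longrightarrow> norm (f x - h x) \<le> e / 2" using uclE[OF core_dense[OF f], of "e / 2"] by auto
  obtain L where L: "\<forall>x. escaping x \<longrightarrow> ((\<lambda>u. h (x u)) \<longlongrightarrow> L) at_top"
    using core_limit[OF h(1)] by (elim exE)
  have "filterlim (\<lambda>u. ((1 - exp (- c * t)) * (fst \<theta> + snd \<theta>)) + exp (- c * t) * u) at_top at_top"
    by (rule filterlim_tendsto_add_at_top[OF tendsto_const filterlim_tendsto_pos_mult_at_top[OF tendsto_const _ filterlim_ident]]) simp
  then have "filterlim (\<lambda>u. fst (pos t (u, 0)) + snd (pos t (u, 0))) at_top at_top"
    by (simp add: pos_def algebra_simps)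
  then have "escaping (\<lambda>u. pos t (u, 0))" using pos_E[OF t] by (simp add: escaping_def)
  then have 1: "((\<lambda>u. h (pos t (u, 0))) \<longlongrightarrow> L) at_top" using L by simp
  have 2: "((\<lambda>u. h (u, 0)) \<longlongrightarrow> L) at_top" using L escaping_axis(1) by simp
  have "((\<lambda>u. h (pos t (u, 0)) - h (u, 0)) \<longlongrightarrow> 0) at_top" using tendsto_diff[OF 1 2] by simp
  moreover have "eventually (\<lambda>u. norm (T t f (u, 0) - f (u, 0) - (h (pos t (u, 0)) - h (u, 0))) \<le> e) at_top"
    using eventually_ge_at_top[of 0]
  proof eventually_elim
    case (elim u)
    have "norm (T t f (u, 0) - h (pos t (u, 0))) \<le> e / 2" using elim by (intro T_approx[OF t _ f h]) auto
    moreover have "norm (f (u, 0) - h (u, 0)) \<le> e / 2" using elim by (intro h) auto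
    ultimately show ?case
      using norm_triangle_ineq4[of "T t f (u, 0) - h (pos t (u, 0))" "f (u, 0) - h (u, 0)"] by (simp add: algebra_simps)
  qed
  ultimately show "\<exists>g. (g \<longlongrightarrow> 0) at_top \<and> eventually (\<lambda>u. norm (T t f (u, 0) - f (u, 0) - g u) \<le> e) at_top" by blast
qed

end

section \<open>Uniform derivatives of exponentials along the flow\<close>

lemma norm_exp_minus_linear: "norm (exp w - 1 - w) \<le> exp (norm w) * (norm w)\<^sup>2" for w :: complex
proof -
  have "norm (exp w - (\<Sum>k\<le>1. w ^ k / fact k)) \<le> exp \<bar>Re w\<bar> * norm w ^ Suc 1 / fact 1" by (rule Taylor_exp)
  also have "\<dots> \<le> exp (norm w) * norm w ^ Suc 1 / fact 1"
    by (intro divide_right_mono mult_right_mono) (auto simp: abs_Re_le_cmod)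
  finally show ?thesis by (simp add: power2_eq_square diff_diff_eq)
qed

lemma square_exp_bound:
  fixes A B m :: real
  assumes "0 < m"
  obtains K where "\<And>r. 0 \<le> r \<Longrightarrow> (A * r + B)\<^sup>2 * exp (- (m * r)) \<le> K"
proof
  fix r :: real assume r: "0 \<le> r"
  have "(m * r)\<^sup>2 / 2 \<le> exp (m * r)" using exp_lower_Taylor_quadratic[of "m * r"] mult_nonneg_nonneg[of m r] assms r by linarith
  then have "r\<^sup>2 * exp (- (m * r)) \<le> 2 / m\<^sup>2" using assms by (simp add: exp_minus field_simps power_mult_distrib)
  moreover have "exp (- (m * r)) \<le> 1" using assms r by simp
  ultimately have "2 * A\<^sup>2 * (r\<^sup>2 * exp (- (m * r))) + 2 * B\<^sup>2 * exp (- (m * r)) \<le> 2 * A\<^sup>2 * (2 / m\<^sup>2) + 2 * B\<^sup>2 * 1"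
    by (intro add_mono mult_left_mono) auto
  moreover have "(A * r + B)\<^sup>2 \<le> 2 * A\<^sup>2 * r\<^sup>2 + 2 * B\<^sup>2"
    using zero_le_power2[of "A * r - B"] by (simp add: power2_eq_square algebra_simps)
  then have "(A * r + B)\<^sup>2 * exp (- (m * r)) \<le> (2 * A\<^sup>2 * r\<^sup>2 + 2 * B\<^sup>2) * exp (- (m * r))" by (intro mult_right_mono) auto
  ultimately show "(A * r + B)\<^sup>2 * exp (- (m * r)) \<le> 2 * A\<^sup>2 * (2 / m\<^sup>2) + 2 * B\<^sup>2 * 1" by (simp add: algebra_simps)
qed

text \<open>The factor \<open>hexp z\<close> decays exponentially along \<open>E\<close>, which absorbs the unbounded drift.\<close>

lemma hexp_drift_bound:
  assumes z: "z \<in> Z" "z \<noteq> 0"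
  obtains K \<eta> where "0 < \<eta>" "\<And>x d. x \<in> E \<Longrightarrow> 0 \<le> d \<Longrightarrow> d \<le> \<eta> \<Longrightarrow>
    norm (hexp z x) * (norm (z * (cx x - w)))\<^sup>2 * exp (d * norm (z * (cx x - w))) \<le> K"
proof -
  define m where "m = min (Re z) (- Im z)"
  have m: "0 < m" using z by (auto simp: m_def Z_def)
  define \<eta> where "\<eta> = m / (2 * norm z)"
  have \<eta>: "0 < \<eta>" using m z by (simp add: \<eta>_def)
  obtain K where K: "\<And>r. 0 \<le> r \<Longrightarrow> (norm z * r + norm (z * w))\<^sup>2 * exp (- (m / 2 * r)) \<le> K"
    using square_exp_bound[of "m / 2"] m by auto
  have "norm (hexp z x) * (norm (z * (cx x - w)))\<^sup>2 * exp (d * norm (z * (cx x - w))) \<le> K * exp (\<eta> * norm (z * w))"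
    if x: "x \<in> E" and d: "0 \<le> d" "d \<le> \<eta>" for x d
  proof -
    define r where "r = fst x + snd x"
    have x': "0 \<le> fst x" "0 \<le> snd x" using x by (auto simp: E_iff)
    then have r: "0 \<le> r" by (simp add: r_def)
    have "norm (cx x) \<le> r" using cmod_le[of "cx x"] x' by (simp add: r_def)
    then have q: "norm (z * (cx x - w)) \<le> norm z * r + norm (z * w)"
      using norm_triangle_ineq4[of "z * cx x" "z * w"] by (simp add: right_diff_distrib norm_mult) (smt (verit) mult_left_mono norm_ge_zero)
    have "m * fst x \<le> Re z * fst x" "m * snd x \<le> - Im z * snd x"
      using x' by (intro mult_right_mono; simp add: m_def)+
    then have h: "norm (hexp z x) \<le> exp (- (m * r))" by (simp add: norm_hexp r_def algebra_simps)
    have "d * norm (z * (cx x - w)) \<le> \<eta> * (norm z * r + norm (z * w))" using q d by (intro mult_mono) auto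
    also have "\<dots> = m / 2 * r + \<eta> * norm (z * w)" using z by (simp add: \<eta>_def field_simps)
    finally have e: "exp (d * norm (z * (cx x - w))) \<le> exp (m / 2 * r + \<eta> * norm (z * w))" by simp
    have "norm (hexp z x) * (norm (z * (cx x - w)))\<^sup>2 * exp (d * norm (z * (cx x - w)))
        \<le> exp (- (m * r)) * (norm z * r + norm (z * w))\<^sup>2 * exp (m / 2 * r + \<eta> * norm (z * w))"
      by (intro mult_mono h power_mono q e) auto
    also have "\<dots> = (norm z * r + norm (z * w))\<^sup>2 * exp (- (m / 2 * r)) * exp (\<eta> * norm (z * w))"
      by (simp add: exp_add[symmetric] mult.assoc mult.left_commute[of "exp _"])
    also have "\<dots> \<le> K * exp (\<eta> * norm (z * w))" by (intro mult_right_mono K r) auto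
    finally show ?thesis .
  qed
  then show ?thesis using that \<eta> by blast
qed

context branching_kernel
begin

lemma drift_speed: "((\<lambda>t. (1 - exp (- c * t)) / t) \<longlongrightarrow> c) (at_right 0)"
proof -
  have "((\<lambda>t. 1 - exp (- c * t)) has_real_derivative c) (at 0 within {0<..})"
    by (auto intro!: derivative_eq_intros)
  then show ?thesis by (simp add: has_field_derivative_iff)
qed

text \<open>Along the flow \<open>hexp z\<close> is multiplied by
  \<open>exp (of_real (\<delta> t) * q x)\<close> with \<open>q\<close> unbounded on
  \<open>E\<close>. The second-order Taylor remainder, multiplied by \<open>hexp z x\<close>, is
  bounded uniformly by \<open>hexp_drift_bound\<close>, and the limit is
  \<open>hexp z x * (of_real c * q x)\<close>.\<close>

lemma hexp_generator:
  assumes z: "z \<in> Z"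
  shows "\<exists>v. uniform_limit E (\<lambda>t x. (1 / t) *\<^sub>R (hexp z (pos t x) - hexp z x)) v (at_right 0)"
proof (cases "z = 0")
  case True
  then show ?thesis by (intro exI[of _ "\<lambda>x. 0"]) (simp add: hexp_def uniform_limit_const)
next
  case False
  define q where "q = (\<lambda>x. z * (cx x - cx \<theta>))"
  obtain K \<eta> where \<eta>: "0 < \<eta>" and K0: "\<And>x d. x \<in> E \<Longrightarrow> 0 \<le> d \<Longrightarrow> d \<le> \<eta> \<Longrightarrow>
      norm (hexp z x) * (norm (z * (cx x - cx \<theta>)))\<^sup>2 * exp (d * norm (z * (cx x - cx \<theta>))) \<le> K"
    by (rule hexp_drift_bound[OF z False, of "cx \<theta>"]; rule that)
  have K: "norm (hexp z x) * (norm (q x))\<^sup>2 * exp (d * norm (q x)) \<le> K" if "x \<in> E" "0 \<le> d" "d \<le> \<eta>" for x d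
    unfolding q_def by (rule K0[OF that])
  define \<delta> where "\<delta> = (\<lambda>t. 1 - exp (- c * t))"
  have h: "hexp z (pos t x) = hexp z x * exp (of_real (\<delta> t) * q x)" for t x
  proof -
    have "- z * cx (pos t x) = - z * cx x + of_real (\<delta> t) * q x" by (simp add: cx_pos \<delta>_def q_def algebra_simps)
    then show ?thesis by (simp only: hexp_def exp_add)
  qed
  have \<delta>0: "0 \<le> \<delta> t" if "0 < t" for t using c that by (simp add: \<delta>_def)
  have \<delta>t: "((\<lambda>t. \<delta> t / t) \<longlongrightarrow> c) (at_right 0)" unfolding \<delta>_def by (rule drift_speed)
  have "((\<lambda>t. 1 - exp (- c * t)) \<longlongrightarrow> 1 - exp (- c * 0)) (at_right 0)" by (intro tendsto_intros)
  then have \<delta>l: "(\<delta> \<longlongrightarrow> 0) (at_right 0)" by (simp add: \<delta>_def)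
  \<comment> \<open>The first summand majorises the Taylor remainder divided by \<open>t\<close>,
    the second the deviation of the speed \<open>\<delta> t / t\<close> from \<open>c\<close>;
    \<open>1 + K\<close> bounds \<open>hexp z x * q x\<close>.\<close>
  have "((\<lambda>t. \<delta> t * (\<delta> t / t) * K + \<bar>\<delta> t / t - c\<bar> * (1 + K)) \<longlongrightarrow> 0 * c * K + \<bar>c - c\<bar> * (1 + K)) (at_right 0)"
    by (intro tendsto_intros \<delta>t \<delta>l)
  then have lim: "((\<lambda>t. \<delta> t * (\<delta> t / t) * K + \<bar>\<delta> t / t - c\<bar> * (1 + K)) \<longlongrightarrow> 0) (at_right 0)" by simp
  have "uniform_limit E (\<lambda>t x. (1 / t) *\<^sub>R (hexp z (pos t x) - hexp z x)) (\<lambda>x. hexp z x * (of_real c * q x)) (at_right 0)"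
  proof (rule uniform_limitI)
    fix e :: real assume "0 < e"
    have "eventually (\<lambda>t. \<delta> t * (\<delta> t / t) * K + \<bar>\<delta> t / t - c\<bar> * (1 + K) < e) (at_right 0)"
      by (rule order_tendstoD(2)[OF lim \<open>0 < e\<close>])
    moreover have "eventually (\<lambda>t. \<delta> t < \<eta>) (at_right 0)" by (rule order_tendstoD(2)[OF \<delta>l \<eta>])
    moreover have "eventually (\<lambda>t::real. 0 < t) (at_right 0)" by (simp add: eventually_at_right_less)
    ultimately show "eventually (\<lambda>t. \<forall>x\<in>E. dist ((1 / t) *\<^sub>R (hexp z (pos t x) - hexp z x)) (hexp z x * (of_real c * q x)) < e) (at_right 0)"
    proof eventually_elim
      case (elim t)
      show ?case
      proof
        fix x assume x: "x \<in> E"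
        have n1: "norm (hexp z x) \<le> 1" using norm_hexp_le_1[OF z] x E_subset_quadrant by blast
        have K0: "norm (hexp z x) * (norm (q x))\<^sup>2 \<le> K" using K[OF x, of 0] \<eta> by simp
        have "2 * norm (q x) \<le> 1 + (norm (q x))\<^sup>2" using zero_le_power2[of "norm (q x) - 1"] by (simp add: power2_diff)
        then have "norm (q x) \<le> 1 + (norm (q x))\<^sup>2" using norm_ge_zero[of "q x"] by linarith
        then have "norm (hexp z x) * norm (q x) \<le> norm (hexp z x) * (1 + (norm (q x))\<^sup>2)" by (rule mult_left_mono) simp
        then have Kq: "norm (hexp z x * q x) \<le> 1 + K" using n1 K0 by (simp add: norm_mult algebra_simps)
        have "norm (exp (of_real (\<delta> t) * q x) - 1 - of_real (\<delta> t) * q x) \<le> exp (\<delta> t * norm (q x)) * (\<delta> t * norm (q x))\<^sup>2"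
          using norm_exp_minus_linear[of "of_real (\<delta> t) * q x"] \<delta>0[OF elim(3)] by (simp add: norm_mult)
        then have "norm (hexp z x * (exp (of_real (\<delta> t) * q x) - 1 - of_real (\<delta> t) * q x))
            \<le> norm (hexp z x) * (exp (\<delta> t * norm (q x)) * (\<delta> t * norm (q x))\<^sup>2)"
          by (simp add: norm_mult mult_left_mono)
        also have "\<dots> = (\<delta> t)\<^sup>2 * (norm (hexp z x) * (norm (q x))\<^sup>2 * exp (\<delta> t * norm (q x)))"
          by (simp add: power_mult_distrib)
        also have "\<dots> \<le> (\<delta> t)\<^sup>2 * K" using K[OF x \<delta>0[OF elim(3)]] elim(2) by (intro mult_left_mono) auto
        finally have "norm (hexp z x * (exp (of_real (\<delta> t) * q x) - 1 - of_real (\<delta> t) * q x)) / t \<le> (\<delta> t)\<^sup>2 * K / t"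
          using elim(3) by (intro divide_right_mono) auto
        then have 1: "norm ((1 / t) *\<^sub>R (hexp z x * (exp (of_real (\<delta> t) * q x) - 1 - of_real (\<delta> t) * q x))) \<le> \<delta> t * (\<delta> t / t) * K"
          using elim(3) by (simp add: power2_eq_square)
        have 2: "norm ((\<delta> t / t - c) *\<^sub>R (hexp z x * q x)) \<le> \<bar>\<delta> t / t - c\<bar> * (1 + K)"
          using Kq by (simp add: mult_left_mono)
        have "(1 / t) *\<^sub>R (hexp z (pos t x) - hexp z x) - hexp z x * (of_real c * q x) =
            (1 / t) *\<^sub>R (hexp z x * (exp (of_real (\<delta> t) * q x) - 1 - of_real (\<delta> t) * q x)) + (\<delta> t / t - c) *\<^sub>R (hexp z x * q x)"
          unfolding h using elim(3) by (simp add: scaleR_conv_of_real field_simps)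
        then have "norm ((1 / t) *\<^sub>R (hexp z (pos t x) - hexp z x) - hexp z x * (of_real c * q x)) \<le>
            \<delta> t * (\<delta> t / t) * K + \<bar>\<delta> t / t - c\<bar> * (1 + K)"
          using norm_triangle_mono[OF 1 2] by simp
        then show "dist ((1 / t) *\<^sub>R (hexp z (pos t x) - hexp z x)) (hexp z x * (of_real c * q x)) < e"
          using elim(1) by (simp only: dist_norm)
      qed
    qed
  qed
  then show ?thesis by blast
qed

lemma core_uniform_derivative:
  assumes "h \<in> core"
  shows "\<exists>v. uniform_limit E (\<lambda>t x. (1 / t) *\<^sub>R (h (pos t x) - h x)) v (at_right 0)"
  using assms
proof induction
  case (exp z d)
  obtain v where v: "uniform_limit E (\<lambda>t x. (1 / t) *\<^sub>R (hexp z (pos t x) - hexp z x)) v (at_right 0)"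
    using hexp_generator[OF exp] by blast
  have "uniform_limit E (\<lambda>t x. d * ((1 / t) *\<^sub>R (hexp z (pos t x) - hexp z x))) (\<lambda>x. d * v x) (at_right 0)"
    by (rule bounded_linear.uniform_limit[OF bounded_linear_mult_right v])
  then show ?case by (intro exI) (simp add: right_diff_distrib)
next
  case (cnj z d)
  obtain v where v: "uniform_limit E (\<lambda>t x. (1 / t) *\<^sub>R (hexp z (pos t x) - hexp z x)) v (at_right 0)"
    using hexp_generator[OF cnj] by blast
  have "uniform_limit E (\<lambda>t x. d * cnj ((1 / t) *\<^sub>R (hexp z (pos t x) - hexp z x))) (\<lambda>x. d * cnj (v x)) (at_right 0)"
    by (intro bounded_linear.uniform_limit[OF bounded_linear_mult_right] bounded_linear.uniform_limit[OF bounded_linear_cnj] v)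
  then show ?case by (intro exI) (simp add: right_diff_distrib)
next
  case (add f g)
  then obtain v w where v: "uniform_limit E (\<lambda>t x. (1 / t) *\<^sub>R (f (pos t x) - f x)) v (at_right 0)"
    and w: "uniform_limit E (\<lambda>t x. (1 / t) *\<^sub>R (g (pos t x) - g x)) w (at_right 0)" by blast
  have "uniform_limit E (\<lambda>t x. (1 / t) *\<^sub>R (f (pos t x) + g (pos t x) - (f x + g x))) (\<lambda>x. v x + w x) (at_right 0)"
    using uniform_limit_add[OF v w] by (simp add: scaleR_add_right[symmetric] algebra_simps del: scaleR_add_right)
  then show ?case by blast
qed

section \<open>The graph of the generator and strong continuity\<close>

lemma generatorI:
  assumes f: "f \<in> Cl" and g: "g \<in> Cl"
    and lim: "\<And>e. 0 < e \<Longrightarrow> eventually (\<lambda>t. \<forall>x\<in>E. norm ((1 / t) *\<^sub>R (T t f x - f x) - g x) \<le> e) (at_right 0)"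
  shows "(f, g) \<in> generator T"
proof -
  have "uniform_limit E (\<lambda>t x. (1 / t) *\<^sub>R (T t f x - f x)) g (at_right 0)"
  proof (rule uniform_limitI)
    fix e :: real assume "0 < e"
    then have "eventually (\<lambda>t. \<forall>x\<in>E. norm ((1 / t) *\<^sub>R (T t f x - f x) - g x) \<le> e / 2) (at_right 0)" by (intro lim) simp
    then show "eventually (\<lambda>t. \<forall>x\<in>E. dist ((1 / t) *\<^sub>R (T t f x - f x)) (g x) < e) (at_right 0)"
    proof eventually_elim
      case (elim t)
      show ?case
      proof
        fix x assume "x \<in> E"
        then have "norm ((1 / t) *\<^sub>R (T t f x - f x) - g x) \<le> e / 2" using elim by blast
        then show "dist ((1 / t) *\<^sub>R (T t f x - f x)) (g x) < e" using \<open>0 < e\<close> unfolding dist_norm by linarith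
      qed
    qed
  qed
  then show ?thesis using f g by (simp add: generator_def)
qed

lemma generatorD:
  assumes "(f, g) \<in> generator T"
  shows "f \<in> Cl" "g \<in> Cl"
    "0 < e \<Longrightarrow> eventually (\<lambda>t. 0 < t \<and> (\<forall>x\<in>E. norm ((1 / t) *\<^sub>R (T t f x - f x) - g x) \<le> e)) (at_right 0)"
proof -
  show "f \<in> Cl" "g \<in> Cl" using assms by (auto simp: generator_def)
  assume "0 < e"
  then have "eventually (\<lambda>t. \<forall>x\<in>E. dist ((1 / t) *\<^sub>R (T t f x - f x)) (g x) < e) (at_right 0)"
    using assms by (auto simp: generator_def dest!: uniform_limitD)
  moreover have "eventually (\<lambda>t::real. 0 < t) (at_right 0)" by (simp add: eventually_at_right_less)
  ultimately show "eventually (\<lambda>t. 0 < t \<and> (\<forall>x\<in>E. norm ((1 / t) *\<^sub>R (T t f x - f x) - g x) \<le> e)) (at_right 0)"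
    by eventually_elim (metis dist_norm less_imp_le)
qed

text \<open>The difference quotients along the flow are themselves in \<open>core\<close>, so their
  uniform limit is in \<open>Cl\<close>.\<close>

lemma generator_core:
  assumes h: "h \<in> core"
  obtains v where "(restrict h E, v) \<in> generator T"
proof -
  obtain v where v: "uniform_limit E (\<lambda>t x. (1 / t) *\<^sub>R (h (pos t x) - h x)) v (at_right 0)"
    using core_uniform_derivative[OF h] by blast
  define F where "F = (\<lambda>t x. of_real (1 / t) * h (pos t x) + of_real (- 1 / t) * h x)"
  have F: "F t x = (1 / t) *\<^sub>R (h (pos t x) - h x)" for t x
    by (simp add: F_def scaleR_conv_of_real right_diff_distrib)
  have Fc: "F t \<in> core" for t unfolding F_def by (intro core.add core_scale core_pos h)
  have ul: "uniform_limit E (\<lambda>t. restrict (F t) E) (restrict v E) (at_right 0)"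
    by (rule uniform_limit_cong'[THEN iffD1, OF _ _ v]) (simp_all add: F)
  have vCl: "restrict v E \<in> Cl" by (rule Cl_uniform_limit[OF _ core_Cl[OF Fc] ul]) simp_all
  have "(restrict h E, restrict v E) \<in> generator T"
  proof (rule generatorI[OF core_Cl[OF h] vCl])
    fix e :: real assume "0 < e"
    then have "eventually (\<lambda>t. \<forall>x\<in>E. dist ((1 / t) *\<^sub>R (h (pos t x) - h x)) (v x) < e) (at_right 0)" by (rule uniform_limitD[OF v])
    moreover have "eventually (\<lambda>t::real. 0 < t) (at_right 0)" by (simp add: eventually_at_right_less)
    ultimately show "eventually (\<lambda>t. \<forall>x\<in>E. norm ((1 / t) *\<^sub>R (T t (restrict h E) x - restrict h E x) - restrict v E x) \<le> e) (at_right 0)"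
      by eventually_elim (simp add: T_core[OF _ _ h] dist_norm less_imp_le)
  qed
  then show ?thesis by (rule that)
qed

lemma generator_combination:
  assumes 1: "(f, g) \<in> generator T" and 2: "(f', g') \<in> generator T"
  shows "(\<lambda>x\<in>E. a * f x + b * f' x, \<lambda>x\<in>E. a * g x + b * g' x) \<in> generator T"
proof (rule generatorI)
  show "(\<lambda>x\<in>E. a * f x + b * f' x) \<in> Cl" "(\<lambda>x\<in>E. a * g x + b * g' x) \<in> Cl"
    using generatorD(1,2)[OF 1] generatorD(1,2)[OF 2] by (auto intro: Cl_combination)
  fix e :: real assume e: "0 < e"
  define d where "d = e / (norm a + norm b + 1)"
  have n: "0 < norm a + norm b + 1" by (simp add: add_nonneg_pos)
  have d: "0 < d" using e n by (simp add: d_def)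
  have "(norm a + norm b + 1) * d = e" using n by (simp add: d_def)
  then have de: "norm a * d + norm b * d \<le> e" using d by (simp add: algebra_simps)
  show "eventually (\<lambda>t. \<forall>x\<in>E. norm ((1 / t) *\<^sub>R (T t (\<lambda>x\<in>E. a * f x + b * f' x) x - (\<lambda>x\<in>E. a * f x + b * f' x) x)
      - (\<lambda>x\<in>E. a * g x + b * g' x) x) \<le> e) (at_right 0)"
    using generatorD(3)[OF 1 d] generatorD(3)[OF 2 d]
  proof eventually_elim
    case (elim t)
    show ?case
    proof
      fix x assume x: "x \<in> E"
      let ?A = "(1 / t) *\<^sub>R (T t f x - f x) - g x" and ?B = "(1 / t) *\<^sub>R (T t f' x - f' x) - g' x"
      have "norm (a * ?A) \<le> norm a * d" "norm (b * ?B) \<le> norm b * d"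
        using elim x by (auto simp: norm_mult intro!: mult_left_mono)
      then have "norm (a * ?A + b * ?B) \<le> e" using norm_triangle_mono[of "a * ?A" _ "b * ?B"] de by fastforce
      moreover have "(1 / t) *\<^sub>R (T t (\<lambda>x\<in>E. a * f x + b * f' x) x - (\<lambda>x\<in>E. a * f x + b * f' x) x)
          - (\<lambda>x\<in>E. a * g x + b * g' x) x = a * ?A + b * ?B"
        using elim x T_combination[of t x f f' a b] generatorD(1)[OF 1] generatorD(1)[OF 2]
        by (simp add: scaleR_conv_of_real algebra_simps)
      ultimately show "norm ((1 / t) *\<^sub>R (T t (\<lambda>x\<in>E. a * f x + b * f' x) x - (\<lambda>x\<in>E. a * f x + b * f' x) x)
          - (\<lambda>x\<in>E. a * g x + b * g' x) x) \<le> e" by (simp only:)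
    qed
  qed
qed

text \<open>The semigroup commutes with its own difference quotients, and the contraction
  \<open>T s\<close> preserves their uniform convergence.\<close>

lemma generator_T:
  assumes fg: "(f, g) \<in> generator T" and s: "0 \<le> s"
  shows "(T s f, T s g) \<in> generator T"
proof (rule generatorI)
  note f = generatorD(1)[OF fg] and g = generatorD(2)[OF fg]
  show "T s f \<in> Cl" "T s g \<in> Cl" using f g s by (auto intro: T_Cl)
  fix e :: real assume "0 < e"
  from generatorD(3)[OF fg this]
  show "eventually (\<lambda>t. \<forall>x\<in>E. norm ((1 / t) *\<^sub>R (T t (T s f) x - T s f x) - T s g x) \<le> e) (at_right 0)"
  proof eventually_elim
    case (elim t)
    then have t: "0 \<le> t" by simp
    define k where "k = (\<lambda>x\<in>E. of_real (1 / t) * T t f x + of_real (- 1 / t) * f x)"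
    have k: "k \<in> Cl" unfolding k_def by (intro Cl_combination T_Cl t f)
    have "k x = (1 / t) *\<^sub>R (T t f x - f x)" if "x \<in> E" for x
      using that by (simp add: k_def scaleR_conv_of_real right_diff_distrib)
    then have kg: "norm (k x - g x) \<le> e" if "x \<in> E" for x using that elim by simp
    show ?case
    proof
      fix x assume x: "x \<in> E"
      have "T s k x = of_real (1 / t) * T s (T t f) x + of_real (- 1 / t) * T s f x"
        unfolding k_def by (rule T_combination[OF s x T_Cl[OF t f] f])
      also have "T s (T t f) = T t (T s f)" using T_add[OF s t f] T_add[OF t s f] by (simp add: add.commute)
      finally have "T s k x = (1 / t) *\<^sub>R (T t (T s f) x - T s f x)" by (simp add: scaleR_conv_of_real right_diff_distrib)
      then show "norm ((1 / t) *\<^sub>R (T t (T s f) x - T s f x) - T s g x) \<le> e" using T_norm_diff[OF s x k g kg] by simp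
    qed
  qed
qed

text \<open>Integration of the derivative is replaced by a division of \<open>t\<close> into equal
  short steps: each step costs at most its length times \<open>K + e\<close>, and the contraction
  property carries this cost along.\<close>

lemma generator_increment:
  assumes fg: "(f, g) \<in> generator T" and K: "\<And>x. x \<in> E \<Longrightarrow> norm (g x) \<le> K" and t: "0 < t" and x: "x \<in> E"
  shows "norm (T t f x - f x) \<le> t * K"
proof -
  note f = generatorD(1)[OF fg]
  have "norm (T t f x - f x) \<le> t * K + d" if "0 < d" for d
  proof -
    define e where "e = d / t"
    have e: "0 < e" using that t by (simp add: e_def)
    from generatorD(3)[OF fg e] obtain b where b: "0 < b"
      "\<And>s. 0 < s \<Longrightarrow> s < b \<Longrightarrow> (\<forall>x\<in>E. norm ((1 / s) *\<^sub>R (T s f x - f x) - g x) \<le> e)"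
      by (auto simp: eventually_at_right_field)
    \<comment> \<open>So many steps that each is shorter than \<open>b\<close>, the range in which
      the difference quotient is within \<open>e\<close> of \<open>g\<close>.\<close>
    obtain n where n: "t / b < real n" using reals_Archimedean2 by blast
    have n0: "0 < real n" by (rule order.strict_trans[OF _ n]) (use t b in simp)
    define s where "s = t / real n"
    have s: "0 < s" "s < b" using t n n0 b(1) by (simp_all add: s_def field_simps)
    have step: "norm (T s f x - f x) \<le> s * (K + e)" if x: "x \<in> E" for x
    proof -
      have "norm ((1 / s) *\<^sub>R (T s f x - f x)) \<le> K + e"
        using norm_triangle_ineq[of "(1 / s) *\<^sub>R (T s f x - f x) - g x" "g x"] b(2)[OF s] K[OF x] x by fastforce
      then show ?thesis using s(1) by (simp add: divide_le_eq mult.commute)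
    qed
    have "norm (T (real j * s) f x - f x) \<le> real j * (s * (K + e))" for j
    proof (induction j)
      case 0
      then show ?case using T_0[OF f] by simp
    next
      case (Suc j)
      have j: "0 \<le> real j * s" using s by simp
      have "T (real (Suc j) * s) f = T (real j * s) (T s f)" using T_add[OF j less_imp_le[OF s(1)] f] by (simp add: algebra_simps)
      moreover have "norm (T (real j * s) (T s f) x - T (real j * s) f x) \<le> s * (K + e)"
        by (rule T_norm_diff[OF j x T_Cl[OF less_imp_le[OF s(1)] f] f step])
      ultimately show ?case
        using Suc.IH norm_triangle_ineq[of "T (real j * s) (T s f) x - T (real j * s) f x" "T (real j * s) f x - f x"]
        by (simp add: algebra_simps)
    qed
    moreover have "real n * s = t" using n0 by (simp add: s_def)
    moreover have "t * (K + e) = t * K + d" using t by (simp add: e_def algebra_simps)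
    ultimately show ?thesis by (metis mult.assoc)
  qed
  then show ?thesis by (rule field_le_epsilon)
qed

text \<open>The difference quotients of \<open>f\<close> and of an approximant \<open>u\<close>
  differ by at most \<open>e / 2\<close> uniformly in \<open>t\<close>: a finer approximant
  \<open>u'\<close> takes the place of \<open>f\<close>, and \<open>generator_increment\<close> is
  applied to \<open>u' - u\<close>, whose generator value is small. The quotient of the fixed
  \<open>u\<close> then converges.\<close>

lemma generator_closed:
  assumes f: "f \<in> Cl" and g: "g \<in> Cl"
    and approx: "\<And>e. 0 < e \<Longrightarrow> \<exists>u v. (u, v) \<in> generator T \<and> (\<forall>x\<in>E. norm (f x - u x) \<le> e \<and> norm (g x - v x) \<le> e)"
  shows "(f, g) \<in> generator T"
proof (rule generatorI[OF f g])
  fix e :: real assume e: "0 < e"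
  obtain u v where uv: "(u, v) \<in> generator T" "\<And>x. x \<in> E \<Longrightarrow> norm (f x - u x) \<le> e / 4 \<and> norm (g x - v x) \<le> e / 4"
    using approx[of "e / 4"] e by auto
  note u = generatorD(1)[OF uv(1)]
  have key: "norm ((1 / t) *\<^sub>R (T t f x - f x) - (1 / t) *\<^sub>R (T t u x - u x)) \<le> e / 2" if t: "0 < t" and x: "x \<in> E" for t x
  proof -
    have "norm ((T t f x - f x) - (T t u x - u x)) \<le> t * (e / 2) + d" if "0 < d" for d
    proof -
      \<comment> \<open>For fixed \<open>t\<close> the replacement of \<open>f\<close> by
        \<open>u'\<close> costs at most \<open>d\<close>, counted twice as \<open>d / 2\<close>; the
        bound \<open>e / 4\<close> keeps \<open>v' - v\<close> below \<open>e / 2\<close>.\<close>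
      define d' where "d' = min (d / 2) (e / 4)"
      have d': "0 < d'" "d' \<le> d / 2" "d' \<le> e / 4" using that e by (auto simp: d'_def)
      obtain u' v' where uv': "(u', v') \<in> generator T" "\<And>x. x \<in> E \<Longrightarrow> norm (f x - u' x) \<le> d' \<and> norm (g x - v' x) \<le> d'"
        using approx[OF d'(1)] by blast
      note u' = generatorD(1)[OF uv'(1)]
      have vv: "norm (1 * v' x + (- 1) * v x) \<le> e / 2" if "x \<in> E" for x
        using norm_triangle_ineq4[of "g x - v x" "g x - v' x"] uv(2)[OF that] uv'(2)[OF that] d' by simp
      have "norm (T t (\<lambda>x\<in>E. 1 * u' x + (- 1) * u x) x - (\<lambda>x\<in>E. 1 * u' x + (- 1) * u x) x) \<le> t * (e / 2)"
        by (rule generator_increment[OF generator_combination[OF uv'(1) uv(1)] _ t x]) (use vv in simp)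
      moreover have "T t (\<lambda>x\<in>E. 1 * u' x + (- 1) * u x) x - (\<lambda>x\<in>E. 1 * u' x + (- 1) * u x) x = (T t u' x - u' x) - (T t u x - u x)"
        unfolding T_combination[OF less_imp_le[OF t] x u' u] using x by simp
      ultimately have 1: "norm ((T t u' x - u' x) - (T t u x - u x)) \<le> t * (e / 2)" by (simp only:)
      have 2: "norm (T t f x - T t u' x) \<le> d'" using uv'(2) by (intro T_norm_diff less_imp_le[OF t] x f u') auto
      have 3: "norm (f x - u' x) \<le> d'" using uv'(2)[OF x] by simp
      have eq: "(T t f x - f x) - (T t u x - u x) = ((T t u' x - u' x) - (T t u x - u x)) + ((T t f x - T t u' x) - (f x - u' x))" by simp
      have "norm ((T t f x - f x) - (T t u x - u x)) \<le> t * (e / 2) + (d' + d')"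
        unfolding eq by (rule norm_triangle_mono[OF 1 norm_triangle_le_diff[OF add_mono[OF 2 3]]])
      then show ?thesis using d' by simp
    qed
    then have "norm ((T t f x - f x) - (T t u x - u x)) \<le> t * (e / 2)" by (rule field_le_epsilon)
    then have "norm ((1 / t) *\<^sub>R ((T t f x - f x) - (T t u x - u x))) \<le> e / 2" using t by (simp add: divide_le_eq mult.commute)
    then show ?thesis by (simp only: scaleR_diff_right)
  qed
  have "0 < e / 4" using e by simp
  from generatorD(3)[OF uv(1) this]
  show "eventually (\<lambda>t. \<forall>x\<in>E. norm ((1 / t) *\<^sub>R (T t f x - f x) - g x) \<le> e) (at_right 0)"
  proof eventually_elim
    case (elim t)
    show ?case
    proof
      fix x assume x: "x \<in> E"
      have "norm ((1 / t) *\<^sub>R (T t u x - u x) - v x) \<le> e / 4" using elim x by blast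
      moreover have "norm (v x - g x) \<le> e / 4" using uv(2)[OF x] by (simp add: norm_minus_commute)
      moreover have "(1 / t) *\<^sub>R (T t f x - f x) - g x = (((1 / t) *\<^sub>R (T t f x - f x) - (1 / t) *\<^sub>R (T t u x - u x)) +
         ((1 / t) *\<^sub>R (T t u x - u x) - v x)) + (v x - g x)" by simp
      ultimately have "norm ((1 / t) *\<^sub>R (T t f x - f x) - g x) \<le> (e / 2 + e / 4) + e / 4"
        by (metis norm_triangle_mono key elim x)
      then show "norm ((1 / t) *\<^sub>R (T t f x - f x) - g x) \<le> e" by simp
    qed
  qed
qed

text \<open>On \<open>core\<close> the increment is at most a multiple of \<open>t\<close>; density
  and contraction do the rest.\<close>

lemma T_strongly_continuous:
  assumes f: "f \<in> Cl"
  shows "uniform_limit E (\<lambda>t. T t f) f (at_right 0)"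
proof (rule uniform_limitI)
  fix e :: real assume e: "0 < e"
  obtain h where h: "h \<in> core" "\<And>x. x \<in> E \<Longrightarrow> norm (f x - h x) \<le> e / 4" using uclE[OF core_dense[OF f], of "e / 4"] e by auto
  obtain v where v: "(restrict h E, v) \<in> generator T" using generator_core[OF h(1)] .
  obtain K where K: "0 \<le> K" "\<And>x. x \<in> E \<Longrightarrow> norm (v x) \<le> K" using Cl_bounded[OF generatorD(2)[OF v]] by blast
  have "((\<lambda>t. t * K) \<longlongrightarrow> 0 * K) (at_right 0)" by (intro tendsto_intros)
  then have "eventually (\<lambda>t. t * K < e / 4) (at_right 0)" using e by (intro order_tendstoD(2)) auto
  moreover have "eventually (\<lambda>t::real. 0 < t) (at_right 0)" by (simp add: eventually_at_right_less)
  ultimately show "eventually (\<lambda>t. \<forall>x\<in>E. dist (T t f x) (f x) < e) (at_right 0)"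
  proof eventually_elim
    case (elim t)
    show ?case
    proof
      fix x assume x: "x \<in> E"
      have "norm (T t f x - h (pos t x)) \<le> e / 4" using elim by (intro T_approx[OF _ x f h]) auto
      moreover have "norm (h (pos t x) - h x) \<le> e / 4"
        using generator_increment[OF v K(2) elim(2) x] elim x T_core[OF _ x h(1), of t] by simp
      moreover have "norm (h x - f x) \<le> e / 4" using h(2)[OF x] by (simp add: norm_minus_commute)
      moreover have "T t f x - f x = ((T t f x - h (pos t x)) + (h (pos t x) - h x)) + (h x - f x)" by simp
      ultimately have "norm (T t f x - f x) \<le> (e / 4 + e / 4) + e / 4" by (metis norm_triangle_mono)
      then show "dist (T t f x) (f x) < e" using e by (simp add: dist_norm)
    qed
  qed
qed

lemma T_contraction_semigroup: "contraction_semigroup T"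
proof -
  have 1: "sup_norm (T t f) \<le> sup_norm f" if t: "0 \<le> t" and f: "f \<in> Cl" for t f
  proof -
    obtain K where K: "\<And>x. x \<in> E \<Longrightarrow> norm (f x) \<le> K" using Cl_bounded[OF f] by blast
    then have "norm (f x) \<le> sup_norm f" if "x \<in> E" for x
      unfolding sup_norm_def using that by (intro cSUP_upper bdd_aboveI2[of _ _ K])
    then show ?thesis
      unfolding sup_norm_def[of "T t f"] using axis_in_E(1)[OF order_refl] by (intro cSUP_least T_bound t f) blast+
  qed
  have 2: "T t (\<lambda>x\<in>E. a * f x + b * g x) = (\<lambda>x\<in>E. a * T t f x + b * T t g x)"
    if "0 \<le> t" "f \<in> Cl" "g \<in> Cl" for t f g a b
    by (rule Cl_eqI) (use that in \<open>auto simp: T_combination intro!: T_Cl Cl_combination\<close>)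
  show ?thesis
    unfolding contraction_semigroup_def
    by (intro conjI allI impI ballI T_Cl 1 2 T_0 T_add T_strongly_continuous)
qed

end

section \<open>The generator\<close>

lemma axis_C2_add:
  assumes "axis_C2 g d s C" "axis_C2 g' d' s' C'"
  shows "axis_C2 (\<lambda>u. g u + g' u) (\<lambda>u. d u + d' u) (\<lambda>u. s u + s' u) (C + C')"
proof -
  have "u * norm (s u + s' u) \<le> C + C'" if "0 < u" for u
  proof -
    have "u * norm (s u + s' u) \<le> u * (norm (s u) + norm (s' u))" using that by (intro mult_left_mono norm_triangle_ineq) auto
    also have "\<dots> \<le> C + C'" using assms that by (auto simp: axis_C2_def distrib_left intro: add_mono)
    finally show ?thesis .
  qed
  moreover have "((\<lambda>u. u *\<^sub>R (d u + d' u)) \<longlongrightarrow> 0) at_top"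
    using assms tendsto_add[of "\<lambda>u. u *\<^sub>R d u" 0 at_top "\<lambda>u. u *\<^sub>R d' u" 0] by (simp add: axis_C2_def scaleR_add_right)
  ultimately show ?thesis
    using assms unfolding axis_C2_def by (auto intro!: has_vector_derivative_add tendsto_add)
qed

text \<open>Restricted to a half-axis, a member of \<open>core\<close> is a combination of decaying
  exponentials and constants, and all derivatives remain of this kind.\<close>

lemma axis_C2_exp:
  fixes a k :: complex
  assumes a: "0 < Re a \<or> a = 0"
  shows "\<exists>d s C. axis_C2 (\<lambda>u. k * exp (- a * of_real u)) d s C"
proof (cases "a = 0")
  case True
  then have "axis_C2 (\<lambda>u. k * exp (- a * of_real u)) (\<lambda>u. 0) (\<lambda>u. 0) 0" by (simp add: axis_C2_def)
  then show ?thesis by blast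
next
  case False
  then have a: "0 < Re a" using a by blast
  define g where "g = (\<lambda>k u. k * exp (- a * of_real u))"
  have der: "(g k has_vector_derivative g (- a * k) u) (at u)" for k u
    unfolding g_def by (auto intro!: derivative_eq_intros has_vector_derivative_real_field)
  have ng: "norm (g k u) = norm k * exp (- (Re a * u))" for k u by (simp add: g_def norm_mult)
  have bd: "u * norm (g k u) \<le> norm k / Re a" if "0 < u" for k u
  proof -
    have "Re a * u \<le> exp (Re a * u)" using exp_ge_add_one_self[of "Re a * u"] by linarith
    then have "u * exp (- (Re a * u)) \<le> 1 / Re a" using a by (simp add: exp_minus field_simps)
    then have "norm k * (u * exp (- (Re a * u))) \<le> norm k * (1 / Re a)" by (rule mult_left_mono) simp
    then show ?thesis by (simp add: ng mult.left_commute)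
  qed
  have "((\<lambda>u. u * exp (- (Re a * u))) \<longlongrightarrow> 0) at_top" using a by real_asymp
  then have "((\<lambda>u. norm (- a * k) * (u * exp (- (Re a * u)))) \<longlongrightarrow> 0) at_top" by (rule tendsto_mult_right_zero)
  then have "((\<lambda>u. u * norm (g (- a * k) u)) \<longlongrightarrow> 0) at_top" by (simp only: ng mult.left_commute)
  moreover have "eventually (\<lambda>u. u * norm (g (- a * k) u) = norm (u *\<^sub>R g (- a * k) u)) at_top"
    using eventually_ge_at_top[of 0] by eventually_elim simp
  ultimately have "((\<lambda>u. norm (u *\<^sub>R g (- a * k) u)) \<longlongrightarrow> 0) at_top"
    by (rule Lim_transform_eventually)
  then have dec: "((\<lambda>u. u *\<^sub>R g (- a * k) u) \<longlongrightarrow> 0) at_top" by (rule tendsto_norm_zero_cancel)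
  have "isCont (g (- a * k)) 0" by (rule has_vector_derivative_continuous[OF der])
  then have "(g (- a * k) \<longlongrightarrow> g (- a * k) 0) (at_right 0)"
    unfolding isCont_def by (rule tendsto_within_subset) simp
  then have "axis_C2 (g k) (g (- a * k)) (g (- a * (- a * k))) (norm (- a * (- a * k)) / Re a)"
    unfolding axis_C2_def by (intro conjI allI impI der dec bd)
  then show ?thesis unfolding g_def by blast
qed

lemma axis_C2_cong:
  assumes "axis_C2 g d s C" "\<And>u. 0 < u \<Longrightarrow> g u = g' u"
  shows "axis_C2 g' d s C"
proof -
  have "(g' has_vector_derivative d u) (at u)" if "0 < u" for u
    by (rule has_vector_derivative_transform_within_open[of g _ u "{0<..}"]) (use assms that in \<open>auto simp: axis_C2_def\<close>)
  then show ?thesis using assms(1) by (simp add: axis_C2_def)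
qed

lemma core_axis_C2:
  assumes "h \<in> core"
  shows "(\<exists>d s C. axis_C2 (\<lambda>u. h (u, 0)) d s C) \<and> (\<exists>d s C. axis_C2 (\<lambda>v. h (0, v)) d s C)"
  using assms
proof induction
  case (exp z k)
  have eq: "hexp z (u, 0) = exp (- z * of_real u)" "hexp z (0, u) = exp (- (\<i> * z) * of_real u)" for u
    by (simp_all add: hexp_def cx_def Complex_eq mult_ac)
  have "0 < Re z \<or> z = 0" "0 < Re (\<i> * z) \<or> \<i> * z = 0" using exp by (auto simp: Z_def)
  then show ?case unfolding eq by (intro conjI axis_C2_exp)
next
  case (cnj z k)
  have eq: "cnj (hexp z (u, 0)) = exp (- cnj z * of_real u)" "cnj (hexp z (0, u)) = exp (- cnj (\<i> * z) * of_real u)" for u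
    by (simp_all add: hexp_def cx_def Complex_eq exp_cnj mult_ac)
  have "0 < Re (cnj z) \<or> cnj z = 0" "0 < Re (cnj (\<i> * z)) \<or> cnj (\<i> * z) = 0" using cnj by (auto simp: Z_def)
  then show ?case unfolding eq by (intro conjI axis_C2_exp)
next
  case (add f g)
  then show ?case using axis_C2_add by fast
qed

lemma core_Cl2:
  assumes h: "h \<in> core"
  shows "restrict h E \<in> Cl2"
proof -
  obtain d s C d' s' C' where A: "axis_C2 (\<lambda>u. h (u, 0)) d s C" "axis_C2 (\<lambda>v. h (0, v)) d' s' C'"
    using core_axis_C2[OF h] by blast
  have "axis_C2 (\<lambda>u. restrict h E (u, 0)) d s C" by (rule axis_C2_cong[OF A(1)]) simp
  moreover have "axis_C2 (\<lambda>v. restrict h E (0, v)) d' s' C'" by (rule axis_C2_cong[OF A(2)]) simp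
  ultimately show ?thesis by (rule Cl2I[OF core_Cl[OF h]])
qed

section \<open>The maximum principle and the closure of \<open>G\<close>\<close>

context branching_kernel
begin

text \<open>The pointwise generator. It satisfies a maximum principle on the compactification of \<open>E\<close> by one
  point at infinity, which is absorbing: hence the condition on \<open>g\<close> there.\<close>

definition pointwise_generator :: "(real \<times> real \<Rightarrow> complex) \<Rightarrow> (real \<times> real \<Rightarrow> complex) \<Rightarrow> bool"
  where "pointwise_generator f g \<longleftrightarrow> f \<in> Cl \<and> g \<in> Cl \<and> ((\<lambda>u. g (u, 0)) \<longlongrightarrow> 0) at_top \<and>
    (\<forall>x\<in>E. ((\<lambda>t. (1 / t) *\<^sub>R (T t f x - f x)) \<longlongrightarrow> g x) (at_right 0))"

lemma pointwise_generator_diff: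
  assumes 1: "pointwise_generator f g" and 2: "pointwise_generator f' g'"
  shows "pointwise_generator (\<lambda>x\<in>E. f x - f' x) (\<lambda>x\<in>E. g x - g' x)"
proof -
  have "((\<lambda>t. (1 / t) *\<^sub>R (T t (\<lambda>x\<in>E. f x - f' x) x - (\<lambda>x\<in>E. f x - f' x) x)) \<longlongrightarrow> (\<lambda>x\<in>E. g x - g' x) x) (at_right 0)"
    if x: "x \<in> E" for x
  proof (rule Lim_transform_eventually)
    show "((\<lambda>t. (1 / t) *\<^sub>R (T t f x - f x) - (1 / t) *\<^sub>R (T t f' x - f' x)) \<longlongrightarrow> (\<lambda>x\<in>E. g x - g' x) x) (at_right 0)"
      using 1 2 x by (auto simp: pointwise_generator_def intro!: tendsto_diff)
    have "eventually (\<lambda>t::real. 0 < t) (at_right 0)" by (simp add: eventually_at_right_less)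
    then show "eventually (\<lambda>t. (1 / t) *\<^sub>R (T t f x - f x) - (1 / t) *\<^sub>R (T t f' x - f' x) =
        (1 / t) *\<^sub>R (T t (\<lambda>x\<in>E. f x - f' x) x - (\<lambda>x\<in>E. f x - f' x) x)) (at_right 0)"
    proof eventually_elim
      case (elim t)
      have "T t (\<lambda>x\<in>E. f x - f' x) x = T t f x - T t f' x"
        using 1 2 elim x by (intro T_diff) (auto simp: pointwise_generator_def)
      then show ?case using x by (simp add: scaleR_diff_right)
    qed
  qed
  moreover have "((\<lambda>u. (\<lambda>x\<in>E. g x - g' x) (u, 0)) \<longlongrightarrow> 0) at_top"
  proof (rule Lim_transform_eventually)
    show "((\<lambda>u. g (u, 0) - g' (u, 0)) \<longlongrightarrow> 0) at_top"
      using 1 2 tendsto_diff[of "\<lambda>u. g (u, 0)" 0 at_top "\<lambda>u. g' (u, 0)" 0] by (simp add: pointwise_generator_def)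
    show "eventually (\<lambda>u. g (u, 0) - g' (u, 0) = (\<lambda>x\<in>E. g x - g' x) (u, 0)) at_top"
      using eventually_ge_at_top[of 0] by eventually_elim simp
  qed
  ultimately show ?thesis using 1 2 by (auto simp: pointwise_generator_def intro: Cl_diff)
qed

text \<open>If the modulus of \<open>f\<close> exceeded \<open>K\<close> somewhere, its maximum
  would be attained, because the limit of \<open>f\<close> at infinity is also that of
  \<open>f - g\<close> and hence at most \<open>K\<close> in modulus. At a maximum point
  \<open>x1\<close> the contraction property gives \<open>norm (f x1) \<le> norm (f x1 - (1 / t)
  *\<^sub>R (T t f x1 - f x1))\<close>, and the pointwise limit contradicts the bound on
  \<open>f - g\<close>.\<close>

lemma pointwise_generator_dissipative:
  assumes fg: "pointwise_generator f g" and K: "\<And>x. x \<in> E \<Longrightarrow> norm (f x - g x) \<le> K" and x: "x \<in> E"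
  shows "norm (f x) \<le> K"
proof (rule ccontr)
  assume "\<not> norm (f x) \<le> K"
  then have big: "K < norm (f x)" by simp
  have f: "f \<in> Cl" and fc: "continuous_on E f" using fg by (auto simp: pointwise_generator_def Cl_def)
  obtain L where L: "((\<lambda>u. f (u, 0)) \<longlongrightarrow> L) at_top" "((\<lambda>v. f (0, v)) \<longlongrightarrow> L) at_top"
    using f by (auto simp: Cl_def)
  have "((\<lambda>u. norm (f (u, 0) - g (u, 0))) \<longlongrightarrow> norm (L - 0)) at_top"
    using fg by (intro tendsto_intros L) (simp add: pointwise_generator_def)
  moreover have "eventually (\<lambda>u. norm (f (u, 0) - g (u, 0)) \<le> K) at_top"
    using eventually_ge_at_top[of 0] by eventually_elim (simp add: K)
  ultimately have "norm (L - 0) \<le> K" by (rule tendsto_upperbound) simp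
  then have LK: "norm L < norm (f x)" using big by simp
  obtain R1 where R1: "\<And>u. R1 \<le> u \<Longrightarrow> norm (f (u, 0)) < norm (f x)"
    using order_tendstoD(2)[OF tendsto_norm[OF L(1)] LK] by (auto simp: eventually_at_top_linorder)
  obtain R2 where R2: "\<And>v. R2 \<le> v \<Longrightarrow> norm (f (0, v)) < norm (f x)"
    using order_tendstoD(2)[OF tendsto_norm[OF L(2)] LK] by (auto simp: eventually_at_top_linorder)
  define R where "R = max R1 R2"
  define A where "A = {0..R} \<times> {0} \<union> {0} \<times> {0..R}"
  have AE: "A \<subseteq> E" by (auto simp: A_def E_iff)
  have out: "norm (f y) < norm (f x)" if y: "y \<in> E" "y \<notin> A" for y
  proof -
    obtain p q where pq: "y = (p, q)" by (cases y)
    have "0 \<le> p" "0 \<le> q" "p = 0 \<or> q = 0" using y by (simp_all add: pq E_iff)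
    then have "(q = 0 \<and> R < p) \<or> (p = 0 \<and> R < q)" using y by (auto simp: pq A_def)
    then show ?thesis using R1[of p] R2[of q] by (auto simp: pq R_def)
  qed
  have xA: "x \<in> A" using out[OF x] by auto
  have "compact A" unfolding A_def by (intro compact_Un compact_Times) auto
  moreover have "continuous_on A (\<lambda>y. norm (f y))" by (intro continuous_on_norm continuous_on_subset[OF fc AE])
  ultimately obtain x1 where x1: "x1 \<in> A" "\<forall>y\<in>A. norm (f y) \<le> norm (f x1)"
    using continuous_attains_sup[of A "\<lambda>y. norm (f y)"] xA by blast
  have x1E: "x1 \<in> E" using x1 AE by blast
  have max: "norm (f y) \<le> norm (f x1)" if "y \<in> E" for y
    using out[OF that] x1(2) xA by (cases "y \<in> A") force+
  have "((\<lambda>t. norm (f x1 - (1 / t) *\<^sub>R (T t f x1 - f x1))) \<longlongrightarrow> norm (f x1 - g x1)) (at_right 0)"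
    using fg x1E by (intro tendsto_intros) (auto simp: pointwise_generator_def)
  moreover have "eventually (\<lambda>t. norm (f x1) \<le> norm (f x1 - (1 / t) *\<^sub>R (T t f x1 - f x1))) (at_right 0)"
  proof -
    have "eventually (\<lambda>t::real. 0 < t) (at_right 0)" by (simp add: eventually_at_right_less)
    then show ?thesis
    proof eventually_elim
      case (elim t)
      have "norm ((1 / t) *\<^sub>R T t f x1) \<le> (1 / t) * norm (f x1)"
        using T_bound[OF less_imp_le[OF elim] x1E f max] elim by (simp add: divide_right_mono)
      moreover have "norm ((1 + 1 / t) *\<^sub>R f x1) = norm (f x1) + (1 / t) * norm (f x1)"
        using elim by (simp add: distrib_right)
      moreover have "f x1 - (1 / t) *\<^sub>R (T t f x1 - f x1) = (1 + 1 / t) *\<^sub>R f x1 - (1 / t) *\<^sub>R T t f x1"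
        by (simp add: algebra_simps)
      ultimately show ?case
        using norm_triangle_ineq2[of "(1 + 1 / t) *\<^sub>R f x1" "(1 / t) *\<^sub>R T t f x1"] by simp
    qed
  qed
  ultimately have "norm (f x1) \<le> norm (f x1 - g x1)" by (rule tendsto_lowerbound) simp
  then show False using K[OF x1E] big x1(2) xA by force
qed

text \<open>The decay of \<open>g\<close> at infinity is inherited from the difference quotients,
  which vanish there by \<open>T_infinity\<close> and converge uniformly.\<close>

lemma generator_pointwise:
  assumes fg: "(f, g) \<in> generator T"
  shows "pointwise_generator f g"
proof -
  have "((\<lambda>t. (1 / t) *\<^sub>R (T t f x - f x)) \<longlongrightarrow> g x) (at_right 0)" if "x \<in> E" for x
    using fg that by (auto simp: generator_def dest: tendsto_uniform_limitI)
  moreover have "((\<lambda>u. g (u, 0)) \<longlongrightarrow> 0) at_top"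
  proof (rule tendsto_zero_approx)
    fix e :: real assume "0 < e"
    from generatorD(3)[OF fg this] have "eventually (\<lambda>t. 0 < t \<and> (\<forall>x\<in>E. norm ((1 / t) *\<^sub>R (T t f x - f x) - g x) \<le> e)) (at_right 0)" .
    from eventually_happens[OF this] obtain t where t: "0 < t" "\<And>x. x \<in> E \<Longrightarrow> norm ((1 / t) *\<^sub>R (T t f x - f x) - g x) \<le> e"
      by auto
    have "((\<lambda>u. (1 / t) *\<^sub>R (T t f (u, 0) - f (u, 0))) \<longlongrightarrow> (1 / t) *\<^sub>R 0) at_top"
      by (intro tendsto_intros T_infinity less_imp_le[OF t(1)] generatorD(1)[OF fg])
    moreover have "eventually (\<lambda>u. norm (g (u, 0) - (1 / t) *\<^sub>R (T t f (u, 0) - f (u, 0))) \<le> e) at_top"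
      using eventually_ge_at_top[of 0]
    proof eventually_elim
      case (elim u)
      then show ?case using t(2)[of "(u, 0)"] by (simp only: norm_minus_commute axis_in_E)
    qed
    ultimately show "\<exists>h. (h \<longlongrightarrow> 0) at_top \<and> eventually (\<lambda>u. norm (g (u, 0) - h u) \<le> e) at_top"
      by (intro exI[of _ "\<lambda>u. (1 / t) *\<^sub>R (T t f (u, 0) - f (u, 0))"]) simp
  qed
  ultimately show ?thesis using generatorD(1,2)[OF fg] by (simp add: pointwise_generator_def)
qed

text \<open>The flow runs along the segment from \<open>x\<close> to \<theta> with parameter
  \<open>1 - exp (- c * t)\<close>, whose initial speed is \<open>c\<close>.\<close>

lemma Cl2_pointwise:
  assumes f: "f \<in> Cl2"
  shows "pointwise_generator f (G c \<theta> f)"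
proof -
  have "((\<lambda>t. (1 / t) *\<^sub>R (T t f x - f x)) \<longlongrightarrow> G c \<theta> f x) (at_right 0)" if x: "x \<in> E" for x
  proof -
    have "((\<lambda>t. 1 - exp (- c * t)) \<longlongrightarrow> 1 - exp (- c * 0)) (at_right 0)" by (intro tendsto_intros)
    then have p0: "((\<lambda>t. 1 - exp (- c * t)) \<longlongrightarrow> 0) (at_right 0)" by simp
    have "eventually (\<lambda>t::real. 0 < t) (at_right 0)" by (simp add: eventually_at_right_less)
    then have pp: "eventually (\<lambda>t. 0 \<le> 1 - exp (- c * t)) (at_right 0)"
      by eventually_elim (use c in simp)
    show ?thesis
      using Q_derivative_path[OF f x \<theta> pp p0 drift_speed] by (simp add: T_apply[OF x] pos_line)
  qed
  then show ?thesis using G_Cl2[OF f] Cl2_Cl[OF f] by (simp add: pointwise_generator_def)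
qed

lemma pointwise_generator_unique:
  assumes "pointwise_generator f g" "pointwise_generator f g'"
  shows "g = g'"
proof (rule Cl_eqI)
  show "g \<in> Cl" "g' \<in> Cl" using assms by (auto simp: pointwise_generator_def)
  fix x assume "x \<in> E"
  then show "g x = g' x" using assms by (auto simp: pointwise_generator_def intro: tendsto_unique[OF trivial_limit_at_right_real])
qed

text \<open>An approximate solution of \<open>u - G u = h\<close>: the Euler scheme for the resolvent integral
  \<open>\<integral> exp (- t) T\<^sub>t h dt\<close>, which stays inside \<open>core\<close>.\<close>

lemma core_resolvent:
  assumes h: "h \<in> core" and e: "0 < e"
  obtains u v where "u \<in> core" "(restrict u E, v) \<in> generator T" "\<And>x. x \<in> E \<Longrightarrow> norm (u x - v x - h x) \<le> e"
proof -
  obtain g where g: "(restrict h E, g) \<in> generator T" using generator_core[OF h] .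
  note gCl = generatorD(2)[OF g]
  have "0 < e / 2" using e by simp
  from eventually_happens[OF generatorD(3)[OF g this]]
  obtain \<tau> where \<tau>: "0 < \<tau>" "\<forall>x\<in>E. norm ((1 / \<tau>) *\<^sub>R (T \<tau> (restrict h E) x - restrict h E x) - g x) \<le> e / 2" by auto
  have step: "norm ((1 / \<tau>) *\<^sub>R (h (pos \<tau> x) - h x) - g x) \<le> e / 2" if "x \<in> E" for x
    using \<tau>(2)[rule_format, OF that] T_core[OF less_imp_le[OF \<tau>(1)] that h] that by simp
  \<comment> \<open>The implicit Euler factor replacing \<open>exp (- \<tau>)\<close>. The weights
    \<open>\<tau> * q ^ Suc k\<close> are chosen such that \<open>qs\<close> lets the resolvent
    equation telescope.\<close>
  define q where "q = 1 / (1 + \<tau>)"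
  have q: "0 < q" "q < 1" using \<tau> by (simp_all add: q_def)
  have qs: "q ^ k = q ^ Suc k + \<tau> * q ^ Suc k" for k
  proof -
    have "(1 + \<tau>) * q = 1" using \<tau> by (simp add: q_def)
    then have "((1 + \<tau>) * q) * q ^ k = q ^ k" by simp
    then show ?thesis by (simp add: algebra_simps)
  qed
  define s where "s = (\<lambda>k. real k * \<tau>)"
  have s: "0 \<le> s k" for k using \<tau> by (simp add: s_def)
  define H where "H = (\<lambda>k x. h (pos (s k) x))"
  have Hc: "H k \<in> core" for k unfolding H_def by (rule core_pos[OF h])
  have Hg: "(restrict (H k) E, T (s k) g) \<in> generator T" for k
  proof -
    have "T (s k) (restrict h E) = restrict (H k) E"
      by (rule Cl_eqI[OF T_Cl[OF s core_Cl[OF h]] core_Cl[OF Hc]]) (simp add: T_core[OF s _ h] H_def)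
    then show ?thesis using generator_T[OF g s, of k] by simp
  qed
  have Hs: "norm ((1 / \<tau>) *\<^sub>R (H (Suc k) x - H k x) - T (s k) g x) \<le> e / 2" if x: "x \<in> E" for k x
  proof -
    define F where "F = (\<lambda>x. of_real (1 / \<tau>) * h (pos \<tau> x) + of_real (- 1 / \<tau>) * h x)"
    have Fc: "F \<in> core" unfolding F_def by (intro core.add core_scale core_pos h)
    have F: "F x = (1 / \<tau>) *\<^sub>R (h (pos \<tau> x) - h x)" for x by (simp add: F_def scaleR_conv_of_real right_diff_distrib)
    have "norm (T (s k) (restrict F E) x - T (s k) g x) \<le> e / 2"
      by (rule T_norm_diff[OF s x core_Cl[OF Fc] gCl]) (simp only: restrict_apply' F step)
    moreover have "s (Suc k) = s k + \<tau>" by (simp add: s_def algebra_simps)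
    ultimately show ?thesis by (simp add: T_core[OF s x Fc] F H_def pos_add)
  qed
  \<comment> \<open>The partial sums \<open>u\<close> of \<open>\<tau> * q ^ Suc k\<close> times
    \<open>H k\<close> over \<open>k < N\<close>. With the exact difference quotients of step \<tau>
    as generator values, the telescoping sum would leave \<open>h - q ^ N * H N\<close>; replacing
    them by the true values costs \<open>e / 2\<close> times the sum of the weights, which is
    \<open>1 - q ^ N\<close>.\<close>
  have "\<exists>u v. u \<in> core \<and> (restrict u E, v) \<in> generator T \<and>
      (\<forall>x\<in>E. norm (u x - v x - (h x - of_real (q ^ N) * H N x)) \<le> e / 2 * (1 - q ^ N))" for N
  proof (induction N)
    case 0
    have z: "(\<lambda>x. 0 * h x) \<in> core" by (rule core_scale[OF h])
    \<comment> \<open>The zero function enters the graph as the trivial combination of a known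
      pair.\<close>
    have "(\<lambda>x\<in>E. 0 * restrict h E x + 0 * restrict h E x, \<lambda>x\<in>E. 0 * g x + 0 * g x) \<in> generator T"
      by (rule generator_combination[OF g g])
    then have g0: "(restrict (\<lambda>x. 0 * h x) E, \<lambda>x\<in>E. 0) \<in> generator T" by (simp cong: restrict_cong)
    show ?case
      by (intro exI[of _ "\<lambda>x. 0 * h x"] exI[of _ "\<lambda>x\<in>E. 0"] conjI z g0) (simp add: H_def s_def)
  next
    case (Suc N)
    then obtain u v where u: "u \<in> core" "(restrict u E, v) \<in> generator T"
      and uv: "\<And>x. x \<in> E \<Longrightarrow> norm (u x - v x - (h x - of_real (q ^ N) * H N x)) \<le> e / 2 * (1 - q ^ N)" by blast
    define a where "a = \<tau> * q ^ Suc N"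
    have a: "0 \<le> a" using \<tau> q by (simp add: a_def)
    define u' where "u' = (\<lambda>x. u x + of_real a * H N x)"
    define v' where "v' = (\<lambda>x\<in>E. v x + of_real a * T (s N) g x)"
    have u': "u' \<in> core" unfolding u'_def by (intro core.add core_scale u Hc)
    have "(\<lambda>x\<in>E. 1 * restrict u E x + of_real a * restrict (H N) E x, \<lambda>x\<in>E. 1 * v x + of_real a * T (s N) g x) \<in> generator T"
      by (rule generator_combination[OF u(2) Hg])
    then have "(restrict u' E, v') \<in> generator T" by (simp add: u'_def v'_def cong: restrict_cong)
    moreover have "norm (u' x - v' x - (h x - of_real (q ^ Suc N) * H (Suc N) x)) \<le> e / 2 * (1 - q ^ Suc N)" if x: "x \<in> E" for x
    proof -
      have qN: "q ^ N = q ^ Suc N + a" unfolding a_def by (rule qs)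
      have at: "a * (1 / \<tau>) = q ^ Suc N" using \<tau> by (simp add: a_def)
      have "norm (a *\<^sub>R ((1 / \<tau>) *\<^sub>R (H (Suc N) x - H N x) - T (s N) g x)) \<le> a * (e / 2)"
        unfolding norm_scaleR using Hs[OF x, of N] a by (simp only: abs_of_nonneg mult_left_mono)
      also have "a *\<^sub>R ((1 / \<tau>) *\<^sub>R (H (Suc N) x - H N x) - T (s N) g x) = (q ^ Suc N) *\<^sub>R (H (Suc N) x - H N x) - a *\<^sub>R T (s N) g x"
        by (simp only: scaleR_diff_right[of a] scaleR_scaleR at)
      finally have 1: "norm ((q ^ Suc N) *\<^sub>R (H (Suc N) x - H N x) - a *\<^sub>R T (s N) g x) \<le> a * (e / 2)" .
      have "u' x - v' x - (h x - of_real (q ^ Suc N) * H (Suc N) x) =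
          (u x - v x - (h x - of_real (q ^ N) * H N x)) + ((q ^ Suc N) *\<^sub>R (H (Suc N) x - H N x) - a *\<^sub>R T (s N) g x)"
        unfolding qN u'_def v'_def restrict_apply'[OF x] by (simp add: scaleR_conv_of_real algebra_simps del: power_Suc)
      then have "norm (u' x - v' x - (h x - of_real (q ^ Suc N) * H (Suc N) x)) \<le> e / 2 * (1 - q ^ N) + a * (e / 2)"
        using norm_triangle_mono[OF uv[OF x] 1] by (simp only:)
      also have "\<dots> = e / 2 * (1 - q ^ Suc N)" unfolding qN by (simp add: algebra_simps del: power_Suc)
      finally show ?thesis .
    qed
    ultimately show ?case using u' by blast
  qed
  note ex = this
  obtain K where K: "\<And>x. x \<in> quadrant \<Longrightarrow> norm (h x) \<le> K" using core_bounded[OF h] by blast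
  have "(\<lambda>N. q ^ N * K) \<longlonglongrightarrow> 0 * K" using q by (intro tendsto_intros LIMSEQ_realpow_zero) auto
  then have "eventually (\<lambda>N. q ^ N * K < e / 2) sequentially" using e by (intro order_tendstoD(2)) auto
  then obtain N where N: "q ^ N * K < e / 2" by (auto simp: eventually_sequentially)
  obtain u v where u: "u \<in> core" "(restrict u E, v) \<in> generator T"
    and uv: "\<And>x. x \<in> E \<Longrightarrow> norm (u x - v x - (h x - of_real (q ^ N) * H N x)) \<le> e / 2 * (1 - q ^ N)" using ex[of N] by blast
  have "norm (u x - v x - h x) \<le> e" if x: "x \<in> E" for x
  proof -
    have "norm (of_real (q ^ N) * H N x) \<le> q ^ N * K"
      unfolding norm_mult norm_of_real using q K[OF pos_E[OF s x]] by (simp add: H_def mult_left_mono)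
    moreover have "e / 2 * (1 - q ^ N) \<le> e / 2" using e q by (simp add: algebra_simps)
    moreover have eq: "u x - v x - h x = (u x - v x - (h x - of_real (q ^ N) * H N x)) - of_real (q ^ N) * H N x" by simp
    ultimately show ?thesis
      unfolding eq using norm_triangle_ineq4[of "u x - v x - (h x - of_real (q ^ N) * H N x)" "of_real (q ^ N) * H N x"] uv[OF x] N
      by linarith
  qed
  with u show ?thesis by (rule that)
qed

text \<open>An approximate solution in \<open>core\<close> of the resolvent equation for
  \<open>f - g\<close> has \<open>u - v\<close> close to \<open>f - g\<close>. Dissipativity makes
  \<open>u\<close> close to \<open>f\<close>, and then \<open>v\<close> is close to \<open>g\<close>
  as well.\<close>

lemma pointwise_generator_approx:
  assumes fg: "pointwise_generator f g" and e: "0 < e"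
  obtains u v where "(u, v) \<in> G_graph c \<theta>" "(u, v) \<in> generator T"
    "\<And>x. x \<in> E \<Longrightarrow> norm (f x - u x) \<le> e" "\<And>x. x \<in> E \<Longrightarrow> norm (g x - v x) \<le> e"
proof -
  have fgCl: "f \<in> Cl" "g \<in> Cl" using fg by (auto simp: pointwise_generator_def)
  obtain h where h: "h \<in> core" "\<And>x. x \<in> E \<Longrightarrow> norm ((\<lambda>x\<in>E. f x - g x) x - h x) \<le> e / 4"
    using uclE[OF core_dense[OF Cl_diff[OF fgCl]], of "e / 4"] e by auto
  obtain u v where u: "u \<in> core" "(restrict u E, v) \<in> generator T" "\<And>x. x \<in> E \<Longrightarrow> norm (u x - v x - h x) \<le> e / 4"
    using core_resolvent[OF h(1), of "e / 4"] e by auto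
  note uv = generator_pointwise[OF u(2)]
  \<comment> \<open>The strong derivative is also the pointwise one, which on \<open>Cl2\<close> is
    \<open>G\<close>; the pair therefore lies in both graphs.\<close>
  have v: "v = G c \<theta> (restrict u E)" by (rule pointwise_generator_unique[OF uv Cl2_pointwise[OF core_Cl2[OF u(1)]]])
  have d: "norm ((f x - g x) - (u x - v x)) \<le> e / 2" if x: "x \<in> E" for x
  proof -
    have eq: "(f x - g x) - (u x - v x) = (f x - g x - h x) - (u x - v x - h x)" by simp
    have "norm (f x - g x - h x) \<le> e / 4" using h(2)[OF x] x by simp
    then show ?thesis unfolding eq using norm_triangle_ineq4[of "f x - g x - h x" "u x - v x - h x"] u(3)[OF x] by linarith
  qed
  have fu: "norm (f x - restrict u E x) \<le> e / 2" if x: "x \<in> E" for x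
  proof -
    have "norm ((\<lambda>x\<in>E. f x - restrict u E x) x) \<le> e / 2"
      by (rule pointwise_generator_dissipative[OF pointwise_generator_diff[OF fg uv] _ x]) (use d in \<open>simp add: algebra_simps\<close>)
    then show ?thesis using x by simp
  qed
  have "norm (g x - v x) \<le> e" if x: "x \<in> E" for x
    using norm_triangle_ineq4[of "f x - u x" "(f x - g x) - (u x - v x)"] d[OF x] fu[OF x] x by simp
  moreover have "norm (f x - restrict u E x) \<le> e" if "x \<in> E" for x using fu[OF that] e by simp
  moreover have "(restrict u E, v) \<in> G_graph c \<theta>" unfolding v G_graph_def using core_Cl2[OF u(1)] by blast
  ultimately show ?thesis using u(2) that by blast
qed

text \<open>Pointwise differentiability with a limit in \<open>Cl\<close> vanishing at infinity
  already implies uniform differentiability: the approximating pairs are in the generator, which is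
  closed.\<close>

lemma generator_iff: "(f, g) \<in> generator T \<longleftrightarrow> pointwise_generator f g"
proof
  assume fg: "pointwise_generator f g"
  show "(f, g) \<in> generator T"
  proof (rule generator_closed)
    show "f \<in> Cl" "g \<in> Cl" using fg by (auto simp: pointwise_generator_def)
    fix e :: real assume "0 < e"
    then obtain u v where "(u, v) \<in> generator T" "\<And>x. x \<in> E \<Longrightarrow> norm (f x - u x) \<le> e" "\<And>x. x \<in> E \<Longrightarrow> norm (g x - v x) \<le> e"
      using pointwise_generator_approx[OF fg] by metis
    then show "\<exists>u v. (u, v) \<in> generator T \<and> (\<forall>x\<in>E. norm (f x - u x) \<le> e \<and> norm (g x - v x) \<le> e)" by blast
  qed
qed (rule generator_pointwise)

text \<open>The generator is closed and contains \<open>G\<close> on \<open>Cl2\<close> by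
  \<open>generator_iff\<close>; conversely each of its pairs is approximated by pairs from the graph
  of \<open>G\<close>, already with first component in \<open>core\<close>.\<close>

theorem graph_closure_G: "graph_closure (G_graph c \<theta>) = generator T"
proof (intro equalityI subrelI)
  fix f g assume fg: "(f, g) \<in> generator T"
  have "\<exists>u v. (u, v) \<in> G_graph c \<theta> \<and> (\<forall>x\<in>E. norm (f x - u x) \<le> inverse (real (Suc n)) \<and> norm (g x - v x) \<le> inverse (real (Suc n)))" for n
    using pointwise_generator_approx[OF generator_pointwise[OF fg], of "inverse (real (Suc n))"] by (metis inverse_positive_iff_positive of_nat_0_less_iff zero_less_Suc)
  then obtain F H where FH: "\<And>n. (F n, H n) \<in> G_graph c \<theta>"
    "\<And>n. \<forall>x\<in>E. norm (f x - F n x) \<le> inverse (real (Suc n)) \<and> norm (g x - H n x) \<le> inverse (real (Suc n))"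
    by metis
  then have "uniform_limit E F f sequentially" "uniform_limit E H g sequentially"
    by (auto intro!: uniform_limit_inverse_Suc)
  then show "(f, g) \<in> graph_closure (G_graph c \<theta>)"
    using FH(1) generatorD(1,2)[OF fg] by (auto simp: graph_closure_def)
next
  fix f g assume "(f, g) \<in> graph_closure (G_graph c \<theta>)"
  then obtain F H where fg: "f \<in> Cl" "g \<in> Cl" and FH: "\<And>n. (F n, H n) \<in> G_graph c \<theta>"
    and lim: "uniform_limit E F f sequentially" "uniform_limit E H g sequentially"
    by (auto simp: graph_closure_def)
  show "(f, g) \<in> generator T"
  proof (rule generator_closed[OF fg])
    fix e :: real assume "0 < e"
    from eventually_happens'[OF sequentially_bot eventually_conj[OF uniform_limitD[OF lim(1) this] uniform_limitD[OF lim(2) this]]]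
    obtain n where "\<forall>x\<in>E. dist (F n x) (f x) < e" "\<forall>x\<in>E. dist (H n x) (g x) < e" by blast
    then have "\<forall>x\<in>E. norm (f x - F n x) \<le> e \<and> norm (g x - H n x) \<le> e"
      by (metis dist_commute dist_norm less_imp_le)
    moreover have "(F n, H n) \<in> generator T"
      using FH[of n] Cl2_pointwise by (auto simp: G_graph_def generator_iff)
    ultimately show "\<exists>u v. (u, v) \<in> generator T \<and> (\<forall>x\<in>E. norm (f x - u x) \<le> e \<and> norm (g x - v x) \<le> e)" by blast
  qed
qed

text \<open>A pair in the closure is a pair of pointwise derivatives, and such limits are
  unique.\<close>

lemma closable_G: "closable (G_graph c \<theta>)"
  unfolding closable_def graph_closure_G single_valued_def
  using generator_pointwise pointwise_generator_unique by blast

end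

theorem theorem5p3:
  fixes M :: "real \<times> real \<Rightarrow> 'w measure"
    and B :: "real \<times> real \<Rightarrow> real \<Rightarrow> 'w \<Rightarrow> real \<times> real"
    and Q :: "real \<times> real \<Rightarrow> (real \<times> real) measure"
    and c :: real and \<theta> :: "real \<times> real"
  assumes B: "\<And>x. x \<in> quadrant \<Longrightarrow> planar_brownian_motion (M x) x (B x)"
    and Q: "\<And>x. x \<in> quadrant \<Longrightarrow> Q x = exit_law (M x) (B x)"
    and c: "0 \<le> c" and \<theta>: "\<theta> \<in> quadrant"
  shows "(\<forall>f\<in>Cl2. \<forall>x\<in>E.
      ((\<lambda>\<epsilon>. (1 / \<epsilon>) *\<^sub>R ((LINT y:E|Q (x + (\<epsilon> * c) *\<^sub>R (\<theta> - x)). f y) - f x))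
        \<longlongrightarrow> G c \<theta> f x) (at_right 0) \<and>
      ((\<lambda>t. (1 / t) *\<^sub>R (S Q c \<theta> t f x - f x)) \<longlongrightarrow> G c \<theta> f x) (at_right 0))
    \<and> (G_graph c \<theta> \<subseteq> Cl \<times> Cl
      \<and> closable (G_graph c \<theta>)
      \<and> contraction_semigroup (S Q c \<theta>)
      \<and> graph_closure (G_graph c \<theta>) = generator (S Q c \<theta>))"
proof -
  have "exit_kernel Q"
  proof (rule exit_kernel.intro)
    fix x assume x: "x \<in> quadrant"
    note exit = exit_law_props[OF B[OF x] x, folded Q[OF x]]
    show "prob_space (Q x)" "AE y in Q x. y \<in> E" by (rule exit)+
    show "sets (Q x) = sets borel" by (simp add: Q[OF x] exit_law_def)
    show "(LINT y|Q x. hexp z y) = hexp z x" if "z \<in> Z" for z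
      \<comment> \<open>The exit law is known on the closed fourth quadrant of parameters, which
        contains \<open>Z\<close> together with its point 0.\<close>
      unfolding hexp_def cx_def by (rule exit(3)) (use that in \<open>auto simp: Z_def\<close>)
  qed
  then interpret branching_kernel Q c \<theta>
    by (intro branching_kernel.intro branching_kernel_axioms.intro c \<theta>)
  have "((\<lambda>\<epsilon>. (1 / \<epsilon>) *\<^sub>R ((LINT y:E|Q (x + (\<epsilon> * c) *\<^sub>R (\<theta> - x)). f y) - f x)) \<longlongrightarrow> G c \<theta> f x) (at_right 0)"
    if "f \<in> Cl2" "x \<in> E" for f x
  proof (rule Q_derivative_path[OF that \<theta>])
    have pos: "eventually (\<lambda>\<epsilon>::real. 0 < \<epsilon>) (at_right 0)" by (simp add: eventually_at_right_less)
    then show "eventually (\<lambda>\<epsilon>. 0 \<le> \<epsilon> * c) (at_right 0)" by eventually_elim (use c in simp)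
    have "((\<lambda>\<epsilon>. \<epsilon> * c) \<longlongrightarrow> 0 * c) (at_right 0)" by (intro tendsto_intros)
    then show "((\<lambda>\<epsilon>. \<epsilon> * c) \<longlongrightarrow> 0) (at_right 0)" by simp
    show "((\<lambda>\<epsilon>. \<epsilon> * c / \<epsilon>) \<longlongrightarrow> c) (at_right 0)"
      by (rule Lim_transform_eventually[OF tendsto_const]) (use pos in \<open>eventually_elim, simp\<close>)
  qed
  moreover have "G_graph c \<theta> \<subseteq> Cl \<times> Cl" using Cl2_Cl G_Cl2(1)[of _ c \<theta>] by (auto simp: G_graph_def)
  ultimately show ?thesis
    using Cl2_pointwise closable_G T_contraction_semigroup graph_closure_G by (auto simp: pointwise_generator_def)
qed

end
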